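(* Let $\mathcal I=[0,b)$, $X=\{x_n\}_{n=1}^\infty$, $d_n=x_n-x_{n-1}$ with $\sup_nd_n<\infty$, and $\beta=\{\beta_n\}_{n=1}^\infty\subset\mathbb R\setminus\{0\}$ be as in the context. Assume $\beta_n+d_n\ge0$ for all $n\in\mathbb N$. (i) Let $\mathcal I=[0,b)$ be a bounded interval ($b<\infty$) and let $X$ and $\beta$ be such that the Hamiltonian $\mathrm H_{X,\beta}$ is self-adjoint. Then $\mathrm H_{X,\beta}$ has discrete spectrum if and only if $$\lim_{n\to\infty}(b-x_n)\sum_{j=1}^n(\beta_j+d_j)=0.$$ (ii) Let $\mathcal I=\mathbb R_+$ ($b=+\infty$). Then the Hamiltonian $\mathrm H_{X,\beta}$ $(=\mathrm H_{X,\beta}^* )$ has discrete spectrum if and only if $$\lim_{n\to\infty}x_n\sum_{j=n}^\infty d_j^3=0\qquad\text{and}\qquad\lim_{n\to\infty}x_n\sum_{j=n}^\infty(\beta_j+d_j)=0 .$$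
   Context: Let $\mathcal I=[0,b)$, $0<b\le+\infty$, and $X=\{x_n\}_{n=1}^\infty$, $x_0=0$, with $0=x_0<x_1<x_2<\dots<b$ and $\lim_nx_n=b$; $d_n=x_n-x_{n-1}$; it is assumed that $d^*=\sup_nd_n<\infty$ and $\beta_n\ne0$ for all $n$. $W^{2,2}(\mathcal I\setminus X)=\{f\in L^2(\mathcal I): f,f'\in AC_{loc}(\mathcal I\setminus X),\ f''\in L^2(\mathcal I)\}$, and $W^{2,2}_{\mathrm{comp}}(\mathcal I\setminus X)$ is the set of its elements whose support is compact in $\mathcal I=[0,b)$. $\mathrm H_{X,\beta}$ is the closure in $L^2(\mathcal I)$ of the symmetric operator $-\mathrm d^2/\mathrm dx^2$ with domain $$\{f\in W^{2,2}_{\mathrm{comp}}(\mathcal I\setminus X): f'(0+)=0,\ f'(x_n+)=f'(x_n-),\ f(x_n+)-f(x_n-)=\beta_nf'(x_n),\ n\in\mathbb N\};$$ it is self-adjoint when $\mathcal I=\mathbb R_+$. A self-adjoint operator has discrete spectrum if its spectrum consists only of isolated eigenvalues of finite multiplicity. The limit conditions in (ii) include convergence of the series involved. *)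

theory Defs
  imports "HOL-Analysis.Analysis"
begin

section \<open>The Hilbert space $L^2$ and unbounded operators in it\<close>

text \<open>
  Elements of $L^2(M)$ are represented by complex-valued square-integrable functions; equality in
  $L^2(M)$ is equality almost everywhere. A linear operator in $L^2(M)$ is represented by its graph,
  a set of pairs of functions. Closures and adjoints are saturated under almost everywhere equality,
  so for them equality of graphs as sets of pairs is equality of operators.
\<close>

definition L2 :: "'a measure \<Rightarrow> ('a \<Rightarrow> complex) set" where
  "L2 M = {f \<in> borel_measurable M. integrable M (\<lambda>t. (cmod (f t))\<^sup>2)}"

definition L2_eq :: "'a measure \<Rightarrow> ('a \<Rightarrow> complex) \<Rightarrow> ('a \<Rightarrow> complex) \<Rightarrow> bool" where
  "L2_eq M f g \<longleftrightarrow> (AE t in M. f t = g t)"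

definition L2_inner :: "'a measure \<Rightarrow> ('a \<Rightarrow> complex) \<Rightarrow> ('a \<Rightarrow> complex) \<Rightarrow> complex" where
  "L2_inner M f g = (LINT t|M. f t * cnj (g t))"

definition L2_norm :: "'a measure \<Rightarrow> ('a \<Rightarrow> complex) \<Rightarrow> real" where
  "L2_norm M f = sqrt (LINT t|M. (cmod (f t))\<^sup>2)"

type_synonym 'a graph = "(('a \<Rightarrow> complex) \<times> ('a \<Rightarrow> complex)) set"

definition graph_closure :: "'a measure \<Rightarrow> 'a graph \<Rightarrow> 'a graph" where
  "graph_closure M T = {(f, g). f \<in> L2 M \<and> g \<in> L2 M \<and>
     (\<exists>F G. (\<forall>n::nat. (F n, G n) \<in> T) \<and>
        (\<lambda>n. L2_norm M (\<lambda>t. F n t - f t)) \<longlonglongrightarrow> 0 \<and>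
        (\<lambda>n. L2_norm M (\<lambda>t. G n t - g t)) \<longlonglongrightarrow> 0)}"

definition densely_defined :: "'a measure \<Rightarrow> 'a graph \<Rightarrow> bool" where
  "densely_defined M T \<longleftrightarrow>
     (\<forall>h\<in>L2 M. \<forall>\<epsilon>>0. \<exists>f\<in>Domain T. L2_norm M (\<lambda>t. f t - h t) < \<epsilon>)"

definition adjoint_graph :: "'a measure \<Rightarrow> 'a graph \<Rightarrow> 'a graph" where
  "adjoint_graph M T = {(f, g). f \<in> L2 M \<and> g \<in> L2 M \<and>
     (\<forall>(u, v)\<in>T. L2_inner M v f = L2_inner M u g)}"

definition self_adjoint :: "'a measure \<Rightarrow> 'a graph \<Rightarrow> bool" where
  "self_adjoint M T \<longleftrightarrow> densely_defined M T \<and> T = adjoint_graph M T"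

text \<open>
  \<open>T - z\<close> maps the domain of \<open>T\<close> onto the whole space and has a bounded inverse; the estimate
  contains injectivity.
\<close>

definition resolvent_set :: "'a measure \<Rightarrow> 'a graph \<Rightarrow> complex set" where
  "resolvent_set M T = {z.
     (\<forall>h\<in>L2 M. \<exists>(f, g)\<in>T. L2_eq M (\<lambda>t. g t - z * f t) h) \<and>
     (\<exists>C. \<forall>(f, g)\<in>T. L2_norm M f \<le> C * L2_norm M (\<lambda>t. g t - z * f t))}"

definition op_spectrum :: "'a measure \<Rightarrow> 'a graph \<Rightarrow> complex set" where
  "op_spectrum M T = - resolvent_set M T"

definition eigenspace :: "'a measure \<Rightarrow> 'a graph \<Rightarrow> complex \<Rightarrow> ('a \<Rightarrow> complex) set" where
  "eigenspace M T z = {f. \<exists>g. (f, g) \<in> T \<and> L2_eq M g (\<lambda>t. z * f t)}"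

definition is_eigenvalue :: "'a measure \<Rightarrow> 'a graph \<Rightarrow> complex \<Rightarrow> bool" where
  "is_eigenvalue M T z \<longleftrightarrow> (\<exists>f\<in>eigenspace M T z. \<not> L2_eq M f (\<lambda>_. 0))"

definition finite_multiplicity :: "'a measure \<Rightarrow> 'a graph \<Rightarrow> complex \<Rightarrow> bool" where
  "finite_multiplicity M T z \<longleftrightarrow>
     (\<exists>B. finite B \<and> B \<subseteq> L2 M \<and>
        (\<forall>f\<in>eigenspace M T z. \<exists>c. L2_eq M f (\<lambda>t. \<Sum>u\<in>B. c u * u t)))"

definition has_discrete_spectrum :: "'a measure \<Rightarrow> 'a graph \<Rightarrow> bool" where
  "has_discrete_spectrum M T \<longleftrightarrow>
     (\<forall>z\<in>op_spectrum M T. z isolated_in op_spectrum M T \<and>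
        is_eigenvalue M T z \<and> finite_multiplicity M T z)"

section \<open>Absolute continuity and the space $W^{2,2}$\<close>

text \<open>
  The usual \<open>\<epsilon>\<close>-\<open>\<delta>\<close> definition; the finite families of nonoverlapping compact intervals are the
  divisions of subsets of \<open>S\<close>.
\<close>

definition abs_continuous_on :: "real set \<Rightarrow> (real \<Rightarrow> complex) \<Rightarrow> bool" where
  "abs_continuous_on S f \<longleftrightarrow>
     (\<forall>\<epsilon>>0. \<exists>\<delta>>0. \<forall>D S'. D division_of S' \<and> S' \<subseteq> S \<and> (\<Sum>K\<in>D. measure lborel K) < \<delta> \<longrightarrow>
        (\<Sum>K\<in>D. cmod (f (interval_upperbound K) - f (interval_lowerbound K))) < \<epsilon>)"

definition AC_loc :: "real set \<Rightarrow> (real \<Rightarrow> complex) \<Rightarrow> bool" where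
  "AC_loc S f \<longleftrightarrow> (\<forall>a c. {a..c} \<subseteq> S \<longrightarrow> abs_continuous_on {a..c} f)"

text \<open>The interval $[0,b)$, where \<open>b = \<infinity>\<close> is allowed.\<close>

definition Ivl :: "ereal \<Rightarrow> real set" where
  "Ivl b = {t. 0 \<le> t \<and> ereal t < b}"

abbreviation Ivl_measure :: "ereal \<Rightarrow> real measure" where
  "Ivl_measure b \<equiv> lebesgue_on (Ivl b)"

text \<open>
  \<open>W22_jet b X f f1 f2\<close> says that \<open>f\<close> belongs to $W^{2,2}([0,b)\setminus X)$, with \<open>f1\<close> its
  derivative and \<open>f2\<close> a representative of its second derivative. As \<open>f1\<close> is required to be locally
  absolutely continuous, \<open>f\<close> is continuously differentiable off \<open>X\<close> (one-sidedly at 0), whereas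
  the second derivative exists only almost everywhere.
\<close>

definition W22_jet ::
  "ereal \<Rightarrow> real set \<Rightarrow> (real \<Rightarrow> complex) \<Rightarrow> (real \<Rightarrow> complex) \<Rightarrow> (real \<Rightarrow> complex) \<Rightarrow> bool" where
  "W22_jet b X f f1 f2 \<longleftrightarrow>
     f \<in> L2 (Ivl_measure b) \<and> f2 \<in> L2 (Ivl_measure b) \<and>
     AC_loc (Ivl b - X) f \<and> AC_loc (Ivl b - X) f1 \<and>
     (\<forall>t\<in>Ivl b - X. (f has_vector_derivative f1 t) (at t within Ivl b - X)) \<and>
     (AE t in Ivl_measure b. (f1 has_vector_derivative f2 t) (at t within Ivl b - X))"

text \<open>
  The support lies in $[0,b)$ and stays away from \<open>b\<close>. The values of \<open>f\<close> on the null set \<open>X\<close> are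
  immaterial and are ignored.
\<close>

definition compact_support_in_Ivl :: "ereal \<Rightarrow> real set \<Rightarrow> (real \<Rightarrow> complex) \<Rightarrow> bool" where
  "compact_support_in_Ivl b X f \<longleftrightarrow>
     compact (closure {t \<in> Ivl b - X. f t \<noteq> 0}) \<and> closure {t \<in> Ivl b - X. f t \<noteq> 0} \<subseteq> Ivl b"

section \<open>The Hamiltonian\<close>

definition gap :: "(nat \<Rightarrow> real) \<Rightarrow> nat \<Rightarrow> real" where
  "gap x n = x n - x (n - 1)"

definition delta'_conditions ::
  "(nat \<Rightarrow> real) \<Rightarrow> (nat \<Rightarrow> real) \<Rightarrow> (real \<Rightarrow> complex) \<Rightarrow> (real \<Rightarrow> complex) \<Rightarrow> bool" where
  "delta'_conditions x \<beta> f f1 \<longleftrightarrow>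
     (f1 \<longlongrightarrow> 0) (at_right 0) \<and>
     (\<forall>n\<ge>1. \<exists>f_right f_left f1_x.
        (f \<longlongrightarrow> f_right) (at_right (x n)) \<and> (f \<longlongrightarrow> f_left) (at_left (x n)) \<and>
        (f1 \<longlongrightarrow> f1_x) (at_right (x n)) \<and> (f1 \<longlongrightarrow> f1_x) (at_left (x n)) \<and>
        f_right - f_left = of_real (\<beta> n) * f1_x)"

definition H0 :: "ereal \<Rightarrow> (nat \<Rightarrow> real) \<Rightarrow> (nat \<Rightarrow> real) \<Rightarrow> real graph" where
  "H0 b x \<beta> = {(f, \<lambda>t. - f2 t) | f f1 f2.
     W22_jet b (x ` {1..}) f f1 f2 \<and> compact_support_in_Ivl b (x ` {1..}) f \<and>
     delta'_conditions x \<beta> f f1}"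

definition Hamiltonian :: "ereal \<Rightarrow> (nat \<Rightarrow> real) \<Rightarrow> (nat \<Rightarrow> real) \<Rightarrow> real graph" where
  "Hamiltonian b x \<beta> = graph_closure (Ivl_measure b) (H0 b x \<beta>)"

end

theory Submission
 imports Defs "HOL-Complex_Analysis.Great_Picard"
begin

text \<open>Let \<open>P\<close> be the distribution function of \<open>dt + \<Sum>\<beta>\<^sub>n \<delta>\<^bsub>x\<^sub>n\<^esub>\<close>. The conditions at \<open>x\<^sub>n\<close> say that \<open>df = f' dP\<close>, so
 \<open>- f'' = g\<close> means \<open>f(t) = c - \<integral>\<^sub>0\<^sup>t g(s) (P(t) - P(s)) ds\<close>. The spectrum is discrete if and only if the
 resolvent is compact. On compact subintervals there is no obstruction, and near \<open>b\<close> the function \<open>f\<close> is,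
 up to a constant controlled by finitely many functionals, a Hardy operator plus its dual applied to \<open>g\<close>, with the weight
 \<open>P\<close> if \<open>b < \<infinity>\<close> and \<open>P(\<infinity>) - P\<close> if \<open>b = \<infinity>\<close>. These are small near \<open>b\<close> if \<open>(b - t) \<bar>P(t)\<bar> \<rightarrow> 0\<close>,
 respectively \<open>t \<integral>\<^sub>t\<^sup>\<infinity> (P(\<infinity>) - P)\<^sup>2 \<rightarrow> 0\<close>. On \<open>[x\<^sub>n, x\<^sub>n\<^sub>+\<^sub>1)\<close> the integrand is
 \<open>(\<Sum>\<^sub>j\<^sub>>\<^sub>n (\<beta>\<^sub>j + d\<^sub>j) - (t - x\<^sub>n))\<^sup>2\<close>, which is where the two conditions of (ii) come from. Conversely,
 the resolvent maps normalised windows, which converge weakly to zero, to functions whose norm bounds these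
 quantities from below.\<close>

section \<open>The space $L^2$\<close>

text \<open>Compactness is used as an inequality: the norm of \<open>f\<close> is at most
  \<open>\<epsilon>\<close> times the graph norm plus finitely many functionals of
  \<open>(f, g)\<close>. Such bounds add up, so \<open>f\<close> may be cut at a point and its
  pieces treated separately. The kernel decides the weight. For \<open>b < \<infinity>\<close>
  constants lie in the kernel, so \<open>g\<close> has mean zero, its primitive is minus an integral
  over \<open>[t,b)\<close>, and \<open>P\<close> itself is the weight. For
  \<open>b = \<infinity>\<close> constants are not square integrable, and \<open>P\<close> has to be
  normalised at infinity. The obstacle is that \<open>P\<close> grows with slope 1 between nodes and
  may jump down at them; only its values at the nodes are monotone, by
  \<open>\<beta>\<^sub>n + d\<^sub>n \<ge> 0\<close>. On a cell of length \<open>d\<close> no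
  constant is close to \<open>P\<close>: the square integral of
  \<open>\<kappa> - (t - x\<^sub>n)\<close> is
  \<open>d (\<kappa> - d/2)\<^sup>2 + d\<^sup>3/12\<close>. The second term is the origin of the
  cubes, and the whole also dominates \<open>d \<kappa>\<^sup>2 / 4\<close>, which controls the
  remainders of the series. Bounded gaps allow neighbouring nodes to be exchanged in these
  estimates.\<close>

lemma L2_measurable [measurable_dest]: "f \<in> L2 M ==> f \<in> borel_measurable M"
 by (simp add: L2_def)

lemma borel_measurable_cnj [measurable (raw)]:
 "f \<in> borel_measurable M ==> (%t. cnj (f t)) \<in> borel_measurable M"
 by (rule borel_measurable_continuous_on[where f=cnj]) (auto intro: continuous_intros)

lemma L2_integrable_sq: "f \<in> L2 M ==> integrable M (%t. (cmod (f t))^2)"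
 by (simp add: L2_def)

lemma L2_bound:
 assumes "f \<in> borel_measurable M" "integrable M h" "\<And>t. t \<in> space M ==> (cmod (f t))^2 \<le> h t"
 shows "f \<in> L2 M"
proof -
 have "integrable M (%t. (cmod (f t))^2)"
  by (rule Bochner_Integration.integrable_bound[OF assms(2)]) (use assms in "auto intro!: AE_I2 order_trans[OF _ abs_ge_self]")
 then show ?thesis using assms(1) by (simp add: L2_def)
qed

lemma norm_add_sq_le: "(norm (a + b :: 'a :: real_normed_vector))^2 \<le> 2 * (norm a)^2 + 2 * (norm b)^2"
proof -
 have "(norm (a + b))^2 \<le> (norm a + norm b)^2"
  by (intro power_mono norm_triangle_ineq) auto
 also have "... \<le> 2 * (norm a)^2 + 2 * (norm b)^2"
  using sum_squares_bound[of "norm a" "norm b"] by (simp add: power2_sum)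
 finally show ?thesis .
qed

lemma L2_add:
 assumes "f \<in> L2 M" "g \<in> L2 M"
 shows "(%t. f t + g t) \<in> L2 M"
proof (rule L2_bound)
 show "(%t. f t + g t) \<in> borel_measurable M"
  using assms[THEN L2_measurable] by simp
 show "integrable M (%t. 2 * (cmod (f t))^2 + 2 * (cmod (g t))^2)"
  using assms[THEN L2_integrable_sq] by simp
qed (rule norm_add_sq_le)

lemma L2_cmult:
 assumes "f \<in> L2 M"
 shows "(%t. c * f t) \<in> L2 M"
 using L2_measurable[OF assms] L2_integrable_sq[OF assms]
 by (auto simp: L2_def norm_mult power_mult_distrib)

lemma L2_diff:
 assumes "f \<in> L2 M" "g \<in> L2 M"
 shows "(%t. f t - g t) \<in> L2 M"
 using L2_add[OF assms(1) L2_cmult[OF assms(2), of "-1"]] by simp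

lemma L2_uminus: "f \<in> L2 M ==> (%t. - f t) \<in> L2 M"
 using L2_cmult[of f M "-1"] by simp

lemma L2_zero [simp]: "(%_. 0) \<in> L2 M"
 by (simp add: L2_def)

lemma L2_sum: "(\<And>i. i \<in> I ==> f i \<in> L2 M) ==> (%t. \<Sum>i\<in>I. f i t) \<in> L2 M"
 by (induction I rule: infinite_finite_induct) (auto intro: L2_add)

lemmas L2_intros = L2_add L2_cmult L2_diff L2_uminus L2_zero L2_sum

lemma L2_mult_integrable:
 assumes "f \<in> L2 M" "g \<in> L2 M"
 shows "integrable M (%t. f t * cnj (g t))"
proof (rule Bochner_Integration.integrable_bound)
 show "integrable M (%t. (cmod (f t))^2 + (cmod (g t))^2)"
  using assms[THEN L2_integrable_sq] by simp
 show "(%t. f t * cnj (g t)) \<in> borel_measurable M"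
  using assms[THEN L2_measurable] by simp
 have "cmod (f t) * cmod (g t) \<le> \<bar>(cmod (f t))^2 + (cmod (g t))^2\<bar>" for t
  using sum_squares_bound[of "cmod (f t)" "cmod (g t)"] mult_nonneg_nonneg[OF norm_ge_zero[of "f t"] norm_ge_zero[of "g t"]] by linarith
 then show "AE t in M. norm (f t * cnj (g t)) \<le> norm ((cmod (f t))^2 + (cmod (g t))^2)"
  by (simp add: norm_mult)
qed

lemma L2_inner_add_left:
 "f \<in> L2 M ==> g \<in> L2 M ==> h \<in> L2 M ==> L2_inner M (%t. f t + g t) h = L2_inner M f h + L2_inner M g h"
 using L2_mult_integrable[of f M h] L2_mult_integrable[of g M h]
 by (simp add: L2_inner_def algebra_simps)

lemma L2_inner_diff_left:
 "f \<in> L2 M ==> g \<in> L2 M ==> h \<in> L2 M ==> L2_inner M (%t. f t - g t) h = L2_inner M f h - L2_inner M g h"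
 using L2_mult_integrable[of f M h] L2_mult_integrable[of g M h]
 by (simp add: L2_inner_def algebra_simps)

lemma L2_inner_cmult_left: "L2_inner M (%t. c * f t) h = c * L2_inner M f h"
 by (simp add: L2_inner_def mult.assoc)

lemma L2_inner_cnj: "cnj (L2_inner M f g) = L2_inner M g f"
 unfolding L2_inner_def by (subst Bochner_Integration.integral_cnj[symmetric]) (simp add: mult.commute)

lemma L2_inner_add_right:
 assumes "f \<in> L2 M" "g \<in> L2 M" "h \<in> L2 M"
 shows "L2_inner M h (%t. f t + g t) = L2_inner M h f + L2_inner M h g"
 using arg_cong[OF L2_inner_add_left[OF assms], where f=cnj] by (simp add: L2_inner_cnj)

lemma L2_inner_diff_right:
 assumes "f \<in> L2 M" "g \<in> L2 M" "h \<in> L2 M"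
 shows "L2_inner M h (%t. f t - g t) = L2_inner M h f - L2_inner M h g"
 using arg_cong[OF L2_inner_diff_left[OF assms], where f=cnj] by (simp add: L2_inner_cnj)

lemma L2_inner_cmult_right: "L2_inner M h (%t. c * f t) = cnj c * L2_inner M h f"
 using arg_cong[OF L2_inner_cmult_left[of M c f h], where f=cnj] by (simp add: L2_inner_cnj)

lemma L2_inner_zero [simp]: "L2_inner M (%_. 0) f = 0" "L2_inner M f (%_. 0) = 0"
 by (simp_all add: L2_inner_def)

lemma L2_inner_sum_left:
 "(\<And>i. i \<in> I ==> f i \<in> L2 M) ==> h \<in> L2 M ==>
   L2_inner M (%t. \<Sum>i\<in>I. f i t) h = (\<Sum>i\<in>I. L2_inner M (f i) h)"
 by (induction I rule: infinite_finite_induct) (auto simp: L2_inner_add_left L2_sum)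

lemma L2_inner_sum_right:
 assumes "\<And>i. i \<in> I ==> f i \<in> L2 M" "h \<in> L2 M"
 shows "L2_inner M h (%t. \<Sum>i\<in>I. f i t) = (\<Sum>i\<in>I. L2_inner M h (f i))"
 using arg_cong[OF L2_inner_sum_left[OF assms], where f=cnj] by (simp add: L2_inner_cnj)

lemma L2_norm_nonneg [simp]: "0 \<le> L2_norm M f"
 by (simp add: L2_norm_def)

lemma L2_norm_zero [simp]: "L2_norm M (%_. 0) = 0"
 by (simp add: L2_norm_def)

lemma L2_norm_sq: "(L2_norm M f)^2 = (LINT t|M. (cmod (f t))^2)"
 by (simp add: L2_norm_def)

lemma L2_inner_self: "L2_inner M f f = of_real ((L2_norm M f)^2)"
 by (simp add: L2_inner_def L2_norm_sq complex_norm_square[symmetric] flip: of_real_power)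

lemma L2_norm_cmult: "L2_norm M (%t. c * f t) = cmod c * L2_norm M f"
 by (simp add: L2_norm_def norm_mult power_mult_distrib real_sqrt_mult)

lemma L2_norm_uminus: "L2_norm M (%t. - f t) = L2_norm M f"
 by (simp add: L2_norm_def)

lemma L2_norm_minus_commute: "L2_norm M (%t. f t - g t) = L2_norm M (%t. g t - f t)"
 by (simp add: L2_norm_def norm_minus_commute)

lemma L2_norm_cong_AE:
 assumes "f \<in> borel_measurable M" "g \<in> borel_measurable M" "AE t in M. f t = g t"
 shows "L2_norm M f = L2_norm M g"
 unfolding L2_norm_def by (rule arg_cong[where f=sqrt], rule integral_cong_AE) (use assms in auto)

lemma L2_inner_cong_AE:
 assumes "f \<in> borel_measurable M" "g \<in> borel_measurable M" "h \<in> borel_measurable M" "AE t in M. f t = g t"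
 shows "L2_inner M f h = L2_inner M g h" "L2_inner M h f = L2_inner M h g"
 unfolding L2_inner_def using assms by (auto intro!: integral_cong_AE)

lemma L2_cong_AE:
 assumes "f \<in> L2 M" "g \<in> borel_measurable M" "AE t in M. f t = g t"
 shows "g \<in> L2 M"
proof -
 have "integrable M (%t. (cmod (g t))^2)"
  by (rule iffD1[OF integrable_cong_AE L2_integrable_sq[OF assms(1)]])
   (use assms in "auto dest: L2_measurable")
 then show ?thesis using assms by (simp add: L2_def)
qed

lemma L2_norm_add_sq:
 assumes "f \<in> L2 M" "g \<in> L2 M"
 shows "(L2_norm M (%t. f t + g t))^2 = (L2_norm M f)^2 + 2 * Re (L2_inner M f g) + (L2_norm M g)^2"
proof -
 have "complex_of_real ((L2_norm M (%t. f t + g t))^2) = L2_inner M f f + (L2_inner M f g + cnj (L2_inner M f g)) + L2_inner M g g"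
  unfolding L2_inner_self[symmetric]
  by (simp add: L2_inner_add_left L2_inner_add_right assms L2_add L2_inner_cnj)
 also have "... = of_real ((L2_norm M f)^2 + 2 * Re (L2_inner M f g) + (L2_norm M g)^2)"
  by (simp add: L2_inner_self complex_add_cnj)
 finally show ?thesis by (simp only: of_real_eq_iff)
qed

lemma L2_norm_diff_sq:
 assumes "f \<in> L2 M" "g \<in> L2 M"
 shows "(L2_norm M (%t. f t - g t))^2 = (L2_norm M f)^2 - 2 * Re (L2_inner M f g) + (L2_norm M g)^2"
 using L2_norm_add_sq[OF assms(1) L2_cmult[OF assms(2), of "-1"]]
  L2_inner_cmult_right[of M f "-1" g] L2_norm_cmult[of M "-1" g] by simp

lemma L2_norm_eq_0_iff:
 assumes "f \<in> L2 M"
 shows "L2_norm M f = 0 \<longleftrightarrow> L2_eq M f (%_. 0)"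
 using integral_nonneg_eq_0_iff_AE[OF L2_integrable_sq[OF assms]]
 by (simp add: L2_norm_def L2_eq_def)

lemma L2_Cauchy_Schwarz:
 assumes "f \<in> L2 M" "g \<in> L2 M"
 shows "cmod (L2_inner M f g) \<le> L2_norm M f * L2_norm M g"
proof (cases "L2_norm M g = 0")
 case True
 then have "AE t in M. g t = 0" using L2_norm_eq_0_iff[OF assms(2)] by (simp add: L2_eq_def)
 then have "L2_inner M f g = L2_inner M f (%_. 0)"
  by (intro L2_inner_cong_AE) (use assms in "auto dest: L2_measurable")
 then show ?thesis by simp
next
 case False
 let ?n = "L2_norm M g" and ?z = "L2_inner M f g"
 have n: "?n > 0" using False by (simp add: order_less_le)
 \<comment> \<open>The coefficient of the projection of \<open>f\<close> onto \<open>g\<close>; it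
   minimises the norm of \<open>f - c g\<close>, and that this norm is nonnegative is the
   inequality.\<close>
 define c where "c = ?z / of_real (?n^2)"
 have "cnj c * ?z = of_real ((cmod ?z)^2 / ?n^2)"
  unfolding c_def by (simp add: complex_norm_square[symmetric] mult.commute[of "cnj ?z"] flip: of_real_power)
 then have r: "Re (cnj c * ?z) = (cmod ?z)^2 / ?n^2" by (simp only: Re_complex_of_real)
 have "cmod c = cmod ?z / ?n^2" unfolding c_def by (simp add: norm_divide norm_power)
 then have s: "(cmod c * ?n)^2 = (cmod ?z)^2 / ?n^2"
  using n by (simp add: power2_eq_square field_simps)
 have "0 \<le> (L2_norm M f)^2 - 2 * Re (cnj c * ?z) + (cmod c * ?n)^2"
  using L2_norm_diff_sq[OF assms(1) L2_cmult[OF assms(2), of c]] zero_le_power2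
  by (metis L2_inner_cmult_right L2_norm_cmult)
 then have "(cmod ?z)^2 / ?n^2 \<le> (L2_norm M f)^2" using r s by simp
 then have "(cmod ?z)^2 \<le> (L2_norm M f * ?n)^2" using n by (simp add: field_simps power_mult_distrib)
 then show ?thesis by (rule power2_le_imp_le) simp
qed

lemma L2_norm_triangle:
 assumes "f \<in> L2 M" "g \<in> L2 M"
 shows "L2_norm M (%t. f t + g t) \<le> L2_norm M f + L2_norm M g"
proof (rule power2_le_imp_le)
 show "(L2_norm M (%t. f t + g t))^2 \<le> (L2_norm M f + L2_norm M g)^2"
  using L2_norm_add_sq[OF assms] L2_Cauchy_Schwarz[OF assms] complex_Re_le_cmod[of "L2_inner M f g"]
  by (simp add: power2_sum)
qed simp

lemma L2_norm_triangle_diff: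
 assumes "f \<in> L2 M" "g \<in> L2 M"
 shows "L2_norm M (%t. f t - g t) \<le> L2_norm M f + L2_norm M g"
 using L2_norm_triangle[OF assms(1) L2_uminus[OF assms(2)]] by (simp add: L2_norm_uminus)

lemma L2_norm_triangle_sub:
 assumes "f \<in> L2 M" "g \<in> L2 M"
 shows "L2_norm M f \<le> L2_norm M g + L2_norm M (%t. f t - g t)"
 using L2_norm_triangle[OF assms(2) L2_diff[OF assms]] by simp

lemma L2_norm_triangle3:
 assumes "f \<in> L2 M" "g \<in> L2 M" "h \<in> L2 M"
 shows "L2_norm M (%t. f t - h t) \<le> L2_norm M (%t. f t - g t) + L2_norm M (%t. g t - h t)"
 using L2_norm_triangle[OF L2_diff[OF assms(1,2)] L2_diff[OF assms(2,3)]] by simp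

lemma L2_norm_abs_diff:
 assumes "f \<in> L2 M" "g \<in> L2 M"
 shows "\<bar>L2_norm M f - L2_norm M g\<bar> \<le> L2_norm M (%t. f t - g t)"
 using L2_norm_triangle_sub[OF assms] L2_norm_triangle_sub[OF assms(2,1)] L2_norm_minus_commute[of M f g] by linarith

lemma L2_norm_sum_le:
 "(\<And>i. i \<in> I ==> f i \<in> L2 M) ==> L2_norm M (%t. \<Sum>i\<in>I. f i t) \<le> (\<Sum>i\<in>I. L2_norm M (f i))"
proof (induction I rule: infinite_finite_induct)
 case (insert i I)
 then show ?case using L2_norm_triangle[of "f i" M "%t. \<Sum>i\<in>I. f i t"] L2_sum[of I f M] by force
qed auto

lemma nn_integral_L2_norm:
 assumes "f \<in> L2 M"
 shows "(\<integral>\<^sup>+ t. ennreal ((cmod (f t))^2) \<partial>M) = ennreal ((L2_norm M f)^2)"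
 by (simp add: L2_norm_sq nn_integral_eq_integral[OF L2_integrable_sq[OF assms]])

lemma L2_nnI:
 assumes "f \<in> borel_measurable M" "(\<integral>\<^sup>+ t. ennreal ((cmod (f t))^2) \<partial>M) \<le> ennreal c"
 shows "f \<in> L2 M" and "0 \<le> c ==> (L2_norm M f)^2 \<le> c"
proof -
 have "(\<integral>\<^sup>+ t. ennreal ((cmod (f t))^2) \<partial>M) < \<infinity>" using assms(2) by (simp add: le_less_trans)
 then have "integrable M (%t. (cmod (f t))^2)"
  using assms(1) by (auto simp: integrable_iff_bounded)
 then show f: "f \<in> L2 M" using assms(1) by (simp add: L2_def)
 show "(L2_norm M f)^2 \<le> c" if "0 \<le> c"
  using assms(2) that by (simp add: nn_integral_L2_norm[OF f])
qed

lemma L2_inner_tendsto_left: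
 assumes F: "\<And>n. F n \<in> L2 M" and f: "f \<in> L2 M" and h: "h \<in> L2 M"
  and lim: "(%n::nat. L2_norm M (%t. F n t - f t)) \<longlonglongrightarrow> 0"
 shows "(%n. L2_inner M (F n) h) \<longlonglongrightarrow> L2_inner M f h"
proof (rule LIM_zero_cancel, rule Lim_null_comparison)
 show "\<forall>\<^sub>F n in sequentially. norm (L2_inner M (F n) h - L2_inner M f h) \<le> L2_norm M (%t. F n t - f t) * L2_norm M h"
  using L2_Cauchy_Schwarz[OF L2_diff[OF F f] h] by (simp add: L2_inner_diff_left F f h)
 show "(%n. L2_norm M (%t. F n t - f t) * L2_norm M h) \<longlonglongrightarrow> 0"
  using tendsto_mult_right[OF lim, of "L2_norm M h"] by simp
qed

lemma L2_inner_tendsto_right: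
 assumes F: "\<And>n. F n \<in> L2 M" and f: "f \<in> L2 M" and h: "h \<in> L2 M"
  and lim: "(%n::nat. L2_norm M (%t. F n t - f t)) \<longlonglongrightarrow> 0"
 shows "(%n. L2_inner M h (F n)) \<longlonglongrightarrow> L2_inner M h f"
 using tendsto_cnj[OF L2_inner_tendsto_left[OF assms]] by (simp add: L2_inner_cnj)

lemma L2_norm_tendsto:
 assumes F: "\<And>n. F n \<in> L2 M" and f: "f \<in> L2 M"
  and lim: "(%n::nat. L2_norm M (%t. F n t - f t)) \<longlonglongrightarrow> 0"
 shows "(%n. L2_norm M (F n)) \<longlonglongrightarrow> L2_norm M f"
proof (rule LIM_zero_cancel, rule Lim_null_comparison[OF _ lim])
 show "\<forall>\<^sub>F n in sequentially. norm (L2_norm M (F n) - L2_norm M f) \<le> L2_norm M (%t. F n t - f t)"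
  using L2_norm_abs_diff[OF F f] by simp
qed

definition L2_Cauchy :: "'a measure \<Rightarrow> (nat \<Rightarrow> 'a \<Rightarrow> complex) \<Rightarrow> bool" where
 "L2_Cauchy M F \<longleftrightarrow> (\<forall>e>0. \<exists>N. \<forall>m\<ge>N. \<forall>n\<ge>N. L2_norm M (%t. F m t - F n t) < e)"

text \<open>Along a subsequence with \<open>\<parallel>F k\<^sub>i\<^sub>+\<^sub>1 - F k\<^sub>i\<parallel> \<le> 2\<^sup>-\<^sup>i\<close> the sum of
 \<open>2\<^sup>i \<bar>F k\<^sub>i\<^sub>+\<^sub>1 - F k\<^sub>i\<bar>\<^sup>2\<close> has a finite integral, which forces pointwise convergence a.e.\<close>

lemma L2_complete:
 assumes F: "\<And>n. F n \<in> L2 M" and C: "L2_Cauchy M F"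
 shows "\<exists>f\<in>L2 M. (%n. L2_norm M (%t. F n t - f t)) \<longlonglongrightarrow> 0"
proof -
 have "\<exists>N. \<forall>m\<ge>N. \<forall>n\<ge>N. L2_norm M (%t. F m t - F n t) < (1/2)^i" for i :: nat
  using C unfolding L2_Cauchy_def by (metis half_gt_zero_iff zero_less_one zero_less_power)
 then obtain N where N: "\<And>i m n. m \<ge> N i ==> n \<ge> N i ==> L2_norm M (%t. F m t - F n t) < (1/2)^i"
  by metis
 define k where "k i = (\<Sum>j\<le>i. N j) + i" for i
 have k_N: "k i \<ge> N i" for i unfolding k_def by (simp add: atMost_Suc member_le_sum trans_le_add1)
 have k_Suc: "k i < k (Suc i)" for i unfolding k_def by simp
 then have km: "strict_mono k" by (simp add: strict_mono_Suc_iff)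
 define D where "D i t = F (k (Suc i)) t - F (k i) t" for i t
 have meas: "\<And>n. F n \<in> borel_measurable M" using F by (auto dest: L2_measurable)
 have D: "L2_norm M (D i) \<le> (1/2)^i" for i
  unfolding D_def using N[of i "k (Suc i)" "k i"] k_N[of i] k_Suc[of i] by (simp add: less_imp_le)
 have D2: "D i \<in> L2 M" for i unfolding D_def by (intro L2_diff F)
 have "(\<integral>\<^sup>+t. (\<Sum>i. ennreal (2^i * (cmod (D i t))^2)) \<partial>M) = (\<Sum>i. (\<integral>\<^sup>+t. ennreal (2^i * (cmod (D i t))^2) \<partial>M))"
  by (intro nn_integral_suminf) (use meas in "auto simp: D_def")
 also have "... = (\<Sum>i. ennreal (2^i * (L2_norm M (D i))^2))"
  using D2[THEN nn_integral_L2_norm] D2[THEN L2_measurable]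
  by (simp add: ennreal_mult nn_integral_cmult del: ennreal_power)
 also have "... \<le> (\<Sum>i. ennreal ((1/2)^i))"
 proof (intro suminf_le)
  fix i :: nat
  have "2^i * (L2_norm M (D i))^2 \<le> 2^i * ((1/2)^i)^2"
   using D by (intro mult_left_mono power_mono) auto
  also have "... = (1/2)^i" by (simp add: power2_eq_square power_divide)
  finally show "ennreal (2^i * (L2_norm M (D i))^2) \<le> ennreal ((1/2)^i)" by (rule ennreal_leI)
 qed auto
 also have "... = ennreal (\<Sum>i. (1/2)^i)" by (intro suminf_ennreal2) auto
 also have "... < \<infinity>" by simp
 finally have "AE t in M. (\<Sum>i. ennreal (2^i * (cmod (D i t))^2)) \<noteq> \<infinity>"
  by (intro nn_integral_PInf_AE) (use meas in "auto simp: D_def")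
 then have conv: "AE t in M. convergent (%i. F (k i) t)"
 proof (rule AE_mp, intro AE_I2 impI)
  fix t assume *: "(\<Sum>i. ennreal (2^i * (cmod (D i t))^2)) \<noteq> \<infinity>"
  have sm: "summable (%i. 2^i * (cmod (D i t))^2)"
   by (rule summable_suminf_not_top) (use * in auto)
  have sm2: "summable (%i. (1/2::real)^i)" by (rule summable_geometric) auto
  have "summable (%i. norm (D i t))"
  proof (rule summable_comparison_test'[OF summable_add[OF sm sm2]])
   fix i :: nat
   define p :: real where "p = 2^i"
   have p: "p > 0" by (simp add: p_def)
   have "0 \<le> (sqrt p * cmod (D i t) - 1 / sqrt p)^2" by simp
   also have "... = p * (cmod (D i t))^2 - 2 * cmod (D i t) + 1/p"
    using p by (simp add: power2_diff power_mult_distrib power_divide real_sqrt_pow2)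
   finally have "2 * cmod (D i t) \<le> p * (cmod (D i t))^2 + 1/p" by linarith
   then have "cmod (D i t) \<le> p * (cmod (D i t))^2 + 1/p" using norm_ge_zero[of "D i t"] by linarith
   then show "norm (norm (D i t)) \<le> 2^i * (cmod (D i t))^2 + (1/2)^i"
    unfolding p_def by (simp add: power_one_over)
  qed
  then have "summable (%i. D i t)" by (rule summable_norm_cancel)
  then have "convergent (%n. \<Sum>i<n. D i t)" by (simp add: summable_iff_convergent)
  moreover have "(\<Sum>i<n. D i t) = F (k n) t - F (k 0) t" for n
   unfolding D_def by (rule sum_lessThan_telescope)
  ultimately have "convergent (%n. (F (k n) t - F (k 0) t) + F (k 0) t)"
   by (intro convergent_add convergent_const) simp
  then show "convergent (%i. F (k i) t)" by simp
 qed
 define f where "f t = lim (%i. F (k i) t)" for t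
 have fm: "f \<in> borel_measurable M" unfolding f_def using meas by measurable
 have lim: "AE t in M. (%i. F (k i) t) \<longlonglongrightarrow> f t"
  using conv unfolding f_def by (auto simp: convergent_LIMSEQ_iff)
 have key: "(%t. F n t - f t) \<in> L2 M \<and> L2_norm M (%t. F n t - f t) \<le> (1/2)^i" if n: "n \<ge> N i" for n i
 proof -
  have "(\<integral>\<^sup>+t. ennreal ((cmod (F n t - f t))^2) \<partial>M) = (\<integral>\<^sup>+t. liminf (%j. ennreal ((cmod (F n t - F (k j) t))^2)) \<partial>M)"
  proof (rule nn_integral_cong_AE, rule AE_mp[OF lim], intro AE_I2 impI)
   fix t assume "(%i. F (k i) t) \<longlonglongrightarrow> f t"
   then have "(%j. ennreal ((cmod (F n t - F (k j) t))^2)) \<longlonglongrightarrow> ennreal ((cmod (F n t - f t))^2)"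
    by (intro tendsto_ennrealI tendsto_intros)
   then show "ennreal ((cmod (F n t - f t))^2) = liminf (%j. ennreal ((cmod (F n t - F (k j) t))^2))"
    by (rule lim_imp_Liminf[OF sequentially_bot, symmetric])
  qed
  also have "... \<le> liminf (%j. \<integral>\<^sup>+t. ennreal ((cmod (F n t - F (k j) t))^2) \<partial>M)"
   by (rule nn_integral_liminf) (use meas in auto)
  also have "... \<le> limsup (%j. \<integral>\<^sup>+t. ennreal ((cmod (F n t - F (k j) t))^2) \<partial>M)"
   by (rule Liminf_le_Limsup) simp
  also have "... \<le> ennreal (((1/2)^i)^2)"
  proof (rule Limsup_bounded, rule eventually_sequentiallyI[of "N i"])
   fix j assume "j \<ge> N i"
   then have "k j \<ge> N i" using seq_suble[OF km, of j] by linarith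
   then have "L2_norm M (%t. F n t - F (k j) t) \<le> (1/2)^i" using N[OF n] by (simp add: less_imp_le)
   then have "(L2_norm M (%t. F n t - F (k j) t))^2 \<le> ((1/2)^i)^2" by (intro power_mono) auto
   then show "(\<integral>\<^sup>+t. ennreal ((cmod (F n t - F (k j) t))^2) \<partial>M) \<le> ennreal (((1/2)^i)^2)"
    using nn_integral_L2_norm[OF L2_diff[OF F F], of n "k j"] ennreal_leI by metis
  qed
  finally have *: "(\<integral>\<^sup>+t. ennreal ((cmod (F n t - f t))^2) \<partial>M) \<le> ennreal (((1/2)^i)^2)" .
  have m: "(%t. F n t - f t) \<in> borel_measurable M" using meas fm by simp
  show ?thesis using L2_nnI[OF m *] by (auto intro: power2_le_imp_le)
 qed
 have "(%t. F (N 0) t - (F (N 0) t - f t)) \<in> L2 M" by (rule L2_diff[OF F]) (use key[of 0 "N 0"] in simp)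
 then have fL: "f \<in> L2 M" by simp
 moreover have "(%n. L2_norm M (%t. F n t - f t)) \<longlonglongrightarrow> 0"
 proof (rule LIMSEQ_I)
  fix r :: real assume "r > 0"
  then obtain i where i: "(1/2)^i < r" using real_arch_pow_inv[of r "1/2"] by auto
  then show "\<exists>n0. \<forall>n\<ge>n0. norm (L2_norm M (%t. F n t - f t) - 0) < r"
   using key[of i] by (intro exI[of _ "N i"]) force
 qed
 ultimately show ?thesis by blast
qed

definition L2_subspace :: "'a measure \<Rightarrow> ('a \<Rightarrow> complex) set \<Rightarrow> bool" where
 "L2_subspace M S \<longleftrightarrow> S \<subseteq> L2 M \<and> (%_. 0) \<in> S \<and>
   (\<forall>f\<in>S. \<forall>g\<in>S. (%t. f t + g t) \<in> S) \<and> (\<forall>f\<in>S. \<forall>c. (%t. c * f t) \<in> S)"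

lemma L2_parallelogram:
 assumes "f \<in> L2 M" "g \<in> L2 M"
 shows "(L2_norm M (%t. f t + g t))^2 + (L2_norm M (%t. f t - g t))^2 = 2 * (L2_norm M f)^2 + 2 * (L2_norm M g)^2"
 by (simp add: L2_norm_add_sq L2_norm_diff_sq assms)

lemma L2_subspace_lincomb:
 assumes "L2_subspace M S" "f \<in> S" "g \<in> S"
 shows "(%t. a * f t + c * g t) \<in> S"
proof -
 have "(%t. a * f t) \<in> S" "(%t. c * g t) \<in> S"
  using assms by (simp_all add: L2_subspace_def)
 then show ?thesis using assms(1) by (simp add: L2_subspace_def)
qed

text \<open>The projection argument: a minimising sequence in \<open>S\<close> is Cauchy by the
  parallelogram law, and \<open>w = h - p\<close>, with \<open>p\<close> its limit, is orthogonal to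
  \<open>S\<close>. By \<open>orth\<close> it is orthogonal to \<open>h\<close>, and to
  \<open>p\<close> as a limit from \<open>S\<close>, hence to itself. Ranges and domains are shown
  to be dense in this form, by computing an orthogonal complement.\<close>

lemma L2_biorthogonal_in_closure:
 assumes S: "L2_subspace M S" and h: "h \<in> L2 M"
  and orth: "\<And>w. w \<in> L2 M ==> (\<And>s. s \<in> S ==> L2_inner M s w = 0) ==> L2_inner M h w = 0"
  and e: "0 < e"
 shows "\<exists>s\<in>S. L2_norm M (%t. h t - s t) < e"
proof -
 have SL: "s \<in> S ==> s \<in> L2 M" for s using S by (auto simp: L2_subspace_def)
 define d where "d = (INF s\<in>S. L2_norm M (%t. h t - s t))"
 have S0: "S \<noteq> {}" using S by (auto simp: L2_subspace_def)
 have bd: "bdd_below ((%s. L2_norm M (%t. h t - s t)) ` S)" by (rule bdd_belowI2[of _ 0]) simp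
 have dle: "s \<in> S ==> d \<le> L2_norm M (%t. h t - s t)" for s unfolding d_def by (rule cINF_lower[OF bd])
 have d0: "0 \<le> d" unfolding d_def by (rule cINF_greatest[OF S0]) simp
 have "\<exists>s\<in>S. L2_norm M (%t. h t - s t) < d + 1 / Suc n" for n
  using cINF_less_iff[OF S0 bd, of "d + 1 / Suc n"] unfolding d_def[symmetric] by auto
 then obtain s where s: "\<And>n. s n \<in> S" "\<And>n. L2_norm M (%t. h t - s n t) < d + 1 / Suc n" by metis
 \<comment> \<open>The midpoint of two elements of \<open>S\<close> is again in \<open>S\<close>, so
   its distance from \<open>h\<close> is at least \<open>d\<close>; the parallelogram law turns this
   into an upper bound for the distance of the two.\<close>
 have par: "(L2_norm M (%t. s m t - s n t))^2 \<le> 2 * (d + 1 / Suc m)^2 + 2 * (d + 1 / Suc n)^2 - 4 * d^2" for m n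
 proof -
  have mid: "(%t. (1/2) * s m t + (1/2) * s n t) \<in> S" by (rule L2_subspace_lincomb[OF S s(1) s(1)])
  have "(%t. (h t - s m t) + (h t - s n t)) = (%t. 2 * (h t - ((1/2) * s m t + (1/2) * s n t)))"
   by (rule ext) (simp add: algebra_simps)
  then have "L2_norm M (%t. (h t - s m t) + (h t - s n t)) = 2 * L2_norm M (%t. h t - ((1/2) * s m t + (1/2) * s n t))"
   by (simp only: L2_norm_cmult) simp
  then have "2 * d \<le> L2_norm M (%t. (h t - s m t) + (h t - s n t))" using dle[OF mid] by simp
  then have "(2 * d)^2 \<le> (L2_norm M (%t. (h t - s m t) + (h t - s n t)))^2" using d0 by (intro power_mono) auto
  moreover have "(L2_norm M (%t. (h t - s m t) - (h t - s n t)))^2 = (L2_norm M (%t. s m t - s n t))^2"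
   by (subst L2_norm_minus_commute) (simp add: algebra_simps)
  moreover have b: "(L2_norm M (%t. h t - s i t))^2 \<le> (d + 1 / Suc i)^2" for i
   using s(2)[of i] by (intro power_mono) auto
  moreover have "(2 * d)^2 = 4 * d^2" by (simp add: power_mult_distrib)
  ultimately show ?thesis
   using L2_parallelogram[OF L2_diff[OF h SL[OF s(1)]] L2_diff[OF h SL[OF s(1)]], of m n] b[of m] b[of n]
   by linarith
 qed
 have "L2_Cauchy M s"
  unfolding L2_Cauchy_def
 proof (intro allI impI)
  fix r :: real assume r: "r > 0"
  have "(%n. (d + 1 / real (Suc n))^2) \<longlonglongrightarrow> (d + 0)^2"
   by (intro tendsto_intros LIMSEQ_Suc[OF lim_1_over_n])
  then have "\<forall>\<^sub>F n in sequentially. (d + 1 / real (Suc n))^2 < d^2 + r^2 / 4"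
   using r by (intro order_tendstoD(2)[where y="d^2"]) auto
  then obtain n0 where n0: "\<And>n. n \<ge> n0 ==> (d + 1 / real (Suc n))^2 < d^2 + r^2 / 4"
   by (auto simp: eventually_sequentially)
  have "L2_norm M (%t. s m t - s n t) < r" if "m \<ge> n0" "n \<ge> n0" for m n
  proof (rule power2_less_imp_less)
   show "(L2_norm M (%t. s m t - s n t))^2 < r^2"
    using par[of m n] n0[OF that(1)] n0[OF that(2)] by linarith
  qed (use r in simp)
  then show "\<exists>N. \<forall>m\<ge>N. \<forall>n\<ge>N. L2_norm M (%t. s m t - s n t) < r" by blast
 qed
 from L2_complete[OF SL[OF s(1)] this] obtain p where p: "p \<in> L2 M"
  and lim: "(%n. L2_norm M (%t. s n t - p t)) \<longlonglongrightarrow> 0" by auto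
 define w where "w = (%t. h t - p t)"
 have w: "w \<in> L2 M" unfolding w_def by (rule L2_diff[OF h p])
 have dist: "d \<le> L2_norm M (%t. w t - c * v t)" if v: "v \<in> S" for v c
 proof (rule LIMSEQ_le_const)
  have eq: "(%t. (h t - (1 * s n t + c * v t)) - (w t - c * v t)) = (%t. p t - s n t)" for n
   by (rule ext) (simp add: w_def algebra_simps)
  show "(%n. L2_norm M (%t. h t - (1 * s n t + c * v t))) \<longlonglongrightarrow> L2_norm M (%t. w t - c * v t)"
   by (rule L2_norm_tendsto)
    (use lim eq in "auto simp: L2_norm_minus_commute[of M p] intro!: L2_intros h w SL[OF s(1)] SL[OF v]")
  show "\<exists>N. \<forall>n\<ge>N. d \<le> L2_norm M (%t. h t - (1 * s n t + c * v t))"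
   using dle[OF L2_subspace_lincomb[OF S s(1) v]] by blast
 qed
 have wd: "L2_norm M w \<le> d"
 proof (rule LIMSEQ_le)
  show "(%n. L2_norm M (%t. h t - s n t)) \<longlonglongrightarrow> L2_norm M w"
   by (rule L2_norm_tendsto)
    (use lim in "auto simp: w_def L2_norm_minus_commute[of M p] intro!: L2_intros h p SL[OF s(1)]")
  show "(%n. d + 1 / real (Suc n)) \<longlonglongrightarrow> d"
   using tendsto_add[OF tendsto_const LIMSEQ_Suc[OF lim_1_over_n], of d] by simp
  show "\<exists>N. \<forall>n\<ge>N. L2_norm M (%t. h t - s n t) \<le> d + 1 / real (Suc n)"
   using s(2) less_imp_le by blast
 qed
 have "L2_inner M v w = 0" if v: "v \<in> S" for v
 proof (cases "L2_norm M v = 0")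
  case True
  then show ?thesis using L2_Cauchy_Schwarz[OF SL[OF v] w] by simp
 next
  case False
  then have n: "L2_norm M v > 0" by (simp add: order_less_le)
  let ?z = "L2_inner M w v" and ?n = "L2_norm M v"
  \<comment> \<open>The optimal coefficient along \<open>v\<close>. Since \<open>w\<close> has
    minimal norm modulo \<open>S\<close>, subtracting \<open>c v\<close> cannot shorten it, which
    forces the coefficient to vanish.\<close>
  define c where "c = ?z / of_real (?n^2)"
  have "cnj c * ?z = of_real ((cmod ?z)^2 / ?n^2)"
   unfolding c_def by (simp add: complex_norm_square[symmetric] mult.commute[of "cnj ?z"] flip: of_real_power)
  then have r: "Re (cnj c * ?z) = (cmod ?z)^2 / ?n^2" by (simp only: Re_complex_of_real)
  have "cmod c = cmod ?z / ?n^2" unfolding c_def by (simp add: norm_divide norm_power)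
  then have q: "(cmod c * ?n)^2 = (cmod ?z)^2 / ?n^2"
   using n by (simp add: power2_eq_square field_simps)
  have "(L2_norm M w)^2 \<le> d^2" using wd by (intro power_mono) auto
  also have "... \<le> (L2_norm M (%t. w t - c * v t))^2" using dist[OF v] d0 by (intro power_mono) auto
  also have "... = (L2_norm M w)^2 - 2 * Re (cnj c * ?z) + (cmod c * ?n)^2"
   by (simp only: L2_norm_diff_sq[OF w L2_cmult[OF SL[OF v]]] L2_inner_cmult_right L2_norm_cmult)
  finally have "(cmod ?z)^2 / ?n^2 \<le> 0" using r q by simp
  then have "?z = 0" using n by (simp add: divide_le_0_iff)
  then show ?thesis using L2_inner_cnj[of M w v] by simp
 qed
 then have orthw: "L2_inner M h w = 0" using orth[OF w] by blast
 have "L2_inner M p w = 0"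
 proof (rule LIMSEQ_unique)
  show "(%n. L2_inner M (s n) w) \<longlonglongrightarrow> L2_inner M p w"
   by (rule L2_inner_tendsto_left[OF SL[OF s(1)] p w lim])
  show "(%n. L2_inner M (s n) w) \<longlonglongrightarrow> 0"
   using \<open>\<And>v. v \<in> S ==> L2_inner M v w = 0\<close>[OF s(1)] by simp
 qed
 then have "L2_inner M w w = 0" using orthw L2_inner_diff_left[OF h p w] by (simp add: w_def)
 then have "L2_norm M w = 0" by (simp add: L2_inner_self)
 moreover have "(%n. L2_norm M (%t. h t - s n t)) \<longlonglongrightarrow> L2_norm M w"
  by (rule L2_norm_tendsto)
   (use lim in "auto simp: w_def L2_norm_minus_commute[of M p] intro!: L2_intros h p SL[OF s(1)]")
 ultimately have "\<forall>\<^sub>F n in sequentially. L2_norm M (%t. h t - s n t) < e"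
  using e by (intro order_tendstoD(2)[where y=0]) auto
 then obtain n where "L2_norm M (%t. h t - s n t) < e" by (auto simp: eventually_sequentially)
 then show ?thesis using s(1) by blast
qed

section \<open>Orthonormal systems\<close>

definition L2_orthonormal :: "'a measure \<Rightarrow> ('a \<Rightarrow> complex) set \<Rightarrow> bool" where
 "L2_orthonormal M B \<longleftrightarrow> finite B \<and> B \<subseteq> L2 M \<and> (\<forall>u\<in>B. \<forall>v\<in>B. L2_inner M u v = (if u = v then 1 else 0))"

definition L2_proj :: "'a measure \<Rightarrow> ('a \<Rightarrow> complex) set \<Rightarrow> ('a \<Rightarrow> complex) \<Rightarrow> 'a \<Rightarrow> complex" where
 "L2_proj M B f = (%t. \<Sum>u\<in>B. L2_inner M f u * u t)"

lemma L2_proj_in [simp]: "L2_orthonormal M B ==> L2_proj M B f \<in> L2 M"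
 unfolding L2_proj_def L2_orthonormal_def by (intro L2_sum L2_cmult) auto

lemma L2_proj_inner:
 assumes B: "L2_orthonormal M B" and v: "v \<in> B"
 shows "L2_inner M (L2_proj M B f) v = L2_inner M f v"
proof -
 have "L2_inner M (L2_proj M B f) v = (\<Sum>u\<in>B. L2_inner M f u * L2_inner M u v)"
  unfolding L2_proj_def
  by (subst L2_inner_sum_left) (use B v in "auto simp: L2_orthonormal_def L2_inner_cmult_left intro!: L2_cmult")
 also have "... = (\<Sum>u\<in>B. if u = v then L2_inner M f v else 0)"
  using B v by (intro sum.cong) (auto simp: L2_orthonormal_def)
 also have "... = L2_inner M f v" using B v by (simp add: L2_orthonormal_def)
 finally show ?thesis .
qed

lemma L2_proj_residual_orthogonal:
 assumes B: "L2_orthonormal M B" and v: "v \<in> B" and f: "f \<in> L2 M"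
 shows "L2_inner M (%t. f t - L2_proj M B f t) v = 0"
 using L2_inner_diff_left[OF f L2_proj_in[OF B], of v f] B v L2_proj_inner[OF B v]
 by (auto simp: L2_orthonormal_def)

lemma L2_Bessel:
 assumes B: "L2_orthonormal M B" and f: "f \<in> L2 M"
 shows "L2_norm M (%t. f t - L2_proj M B f t) \<le> L2_norm M f"
proof (rule power2_le_imp_le)
 let ?r = "%t. f t - L2_proj M B f t"
 have r: "?r \<in> L2 M" by (rule L2_diff[OF f L2_proj_in[OF B]])
 have "L2_inner M (L2_proj M B f) ?r = (\<Sum>u\<in>B. L2_inner M f u * L2_inner M u ?r)"
  unfolding L2_proj_def[of M B f]
  by (subst L2_inner_sum_left) (use B r in "auto simp: L2_orthonormal_def L2_inner_cmult_left L2_proj_def intro!: L2_cmult")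
 also have "... = 0"
 proof (rule sum.neutral, rule ballI)
  fix u assume "u \<in> B"
  then have "L2_inner M u ?r = 0"
   using L2_proj_residual_orthogonal[OF B _ f] L2_inner_cnj[of M ?r u] by simp
  then show "L2_inner M f u * L2_inner M u ?r = 0" by simp
 qed
 finally have "(L2_norm M (%t. L2_proj M B f t + ?r t))^2 = (L2_norm M (L2_proj M B f))^2 + (L2_norm M ?r)^2"
  using L2_norm_add_sq[OF L2_proj_in[OF B] r, of f] by simp
 then show "(L2_norm M ?r)^2 \<le> (L2_norm M f)^2" by simp
qed simp

text \<open>Induction on \<open>E\<close>: the subspace of \<open>V\<close> annihilated by
  \<open>e\<close> is separated by the remaining functionals, so it has a basis \<open>B\<close>.
  Its codimension is at most one, and a vector of \<open>V\<close> not annihilated by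
  \<open>e\<close>, made orthogonal to \<open>B\<close> and normalised, completes \<open>B\<close>.
  Finite dimension enters through separating functionals because this is what a compactness estimate
  provides for an eigenspace.\<close>

lemma finite_dimensional_orthonormal_basis:
 assumes "finite E" "E \<subseteq> L2 M" "L2_subspace M V"
  and "\<And>f. f \<in> V ==> (\<And>e. e \<in> E ==> L2_inner M f e = 0) ==> L2_norm M f = 0"
 shows "\<exists>B. L2_orthonormal M B \<and> B \<subseteq> V \<and> (\<forall>f\<in>V. L2_eq M f (L2_proj M B f))"
 using assms
proof (induction E arbitrary: V rule: finite_induct)
 case empty
 have "L2_orthonormal M {} \<and> {} \<subseteq> V \<and> (\<forall>f\<in>V. L2_eq M f (L2_proj M {} f))"
 proof (intro conjI ballI)
  fix f assume f: "f \<in> V"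
  then have "f \<in> L2 M" "L2_norm M f = 0" using empty by (auto simp: L2_subspace_def)
  then show "L2_eq M f (L2_proj M {} f)" by (simp add: L2_norm_eq_0_iff L2_proj_def)
 qed (auto simp: L2_orthonormal_def)
 then show ?case by blast
next
 case (insert e E)
 have VL: "f \<in> V ==> f \<in> L2 M" for f using insert.prems by (auto simp: L2_subspace_def)
 have e: "e \<in> L2 M" using insert.prems by auto
 define V' where "V' = {f\<in>V. L2_inner M f e = 0}"
 have V': "L2_subspace M V'"
  using insert.prems(2) VL e unfolding L2_subspace_def V'_def
  by (auto simp: L2_inner_add_left L2_inner_cmult_left)
 have "\<exists>B. L2_orthonormal M B \<and> B \<subseteq> V' \<and> (\<forall>f\<in>V'. L2_eq M f (L2_proj M B f))"
  by (rule insert.IH[OF _ V']) (use insert.prems in "auto simp: V'_def")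
 then obtain B where B: "L2_orthonormal M B" "B \<subseteq> V'" "\<And>f. f \<in> V' ==> L2_eq M f (L2_proj M B f)" by blast
 have BL: "u \<in> B ==> u \<in> L2 M" for u using B(1) by (auto simp: L2_orthonormal_def)
 show ?case
 proof (cases "V \<subseteq> V'")
  case True
  then show ?thesis using B by (intro exI[of _ B]) (auto simp: V'_def)
 next
  case False
  then obtain v where v: "v \<in> V" "L2_inner M v e \<noteq> 0" by (auto simp: V'_def)
  have pV: "L2_proj M B f \<in> V" for f
  proof -
   have "finite B" using B by (simp add: L2_orthonormal_def)
   then show ?thesis using B(2) unfolding L2_proj_def
   proof (induction B rule: finite_induct)
    case (insert u B')
    then show ?case using insert.prems insert.IH \<open>L2_subspace M V\<close> by (auto simp: L2_subspace_def V'_def)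
   qed (use insert.prems in "simp add: L2_subspace_def")
  qed
  have pe: "L2_inner M (L2_proj M B f) e = 0" for f
   unfolding L2_proj_def
   by (subst L2_inner_sum_left) (use B(2) BL e in "auto simp: L2_inner_cmult_left V'_def intro!: L2_cmult sum.neutral")
  define v1 where "v1 = (%t. 1 * v t + (-1) * L2_proj M B v t)"
  have v1V: "v1 \<in> V" unfolding v1_def by (rule L2_subspace_lincomb[OF insert.prems(2) v(1) pV])
  have v1eq: "v1 = (%t. v t - L2_proj M B v t)" by (simp add: v1_def)
  have v1e: "L2_inner M v1 e \<noteq> 0"
   using L2_inner_diff_left[OF VL[OF v(1)] VL[OF pV] e] pe v by (simp add: v1eq)
  have n1: "L2_norm M v1 > 0"
   using L2_Cauchy_Schwarz[OF VL[OF v1V] e] v1e L2_norm_nonneg[of M v1] by (cases "L2_norm M v1 = 0") (auto simp: order_less_le)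
  define w where "w = (%t. of_real (1 / L2_norm M v1) * v1 t)"
  have wV: "w \<in> V" unfolding w_def using insert.prems(2) v1V unfolding L2_subspace_def by blast
  have wn: "L2_norm M w = 1" unfolding w_def L2_norm_cmult using n1 by (simp add: norm_divide)
  then have ww: "L2_inner M w w = 1" by (simp add: L2_inner_self)
  have we: "L2_inner M w e \<noteq> 0" unfolding w_def L2_inner_cmult_left using n1 v1e by simp
  have wu: "L2_inner M w u = 0" if "u \<in> B" for u
   unfolding w_def L2_inner_cmult_left v1eq L2_proj_residual_orthogonal[OF B(1) that VL[OF v(1)]] by simp
  have uw: "L2_inner M u w = 0" if "u \<in> B" for u
   using wu[OF that] L2_inner_cnj[of M w u] by simp
  have wB: "w \<notin> B" using wu ww by force
  have fin: "finite B" using B by (simp add: L2_orthonormal_def)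
  have ON: "L2_orthonormal M (insert w B)"
   using B(1) wB ww wu uw VL[OF wV] by (auto simp: L2_orthonormal_def)
  have "L2_eq M f (L2_proj M (insert w B) f)" if f: "f \<in> V" for f
  proof -
   define a where "a = L2_inner M f e / L2_inner M w e"
   define f' where "f' = (%t. 1 * f t + (-a) * w t)"
   have f'V: "f' \<in> V" unfolding f'_def by (rule L2_subspace_lincomb[OF insert.prems(2) f wV])
   have f'i: "L2_inner M f' h = L2_inner M f h - a * L2_inner M w h" if "h \<in> L2 M" for h
    unfolding f'_def using L2_inner_diff_left[OF VL[OF f] L2_cmult[OF VL[OF wV]] that, of a]
    by (simp add: L2_inner_cmult_left)
   have "f' \<in> V'" using f'V f'i[OF e] we by (simp add: V'_def a_def)
   then have "L2_eq M f' (L2_proj M B f')" by (rule B(3))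
   moreover have "L2_proj M B f' = L2_proj M B f"
    unfolding L2_proj_def by (rule ext, rule sum.cong) (use f'i[OF BL] wu in auto)
   ultimately have ae: "AE t in M. f t = a * w t + L2_proj M B f t"
    by (auto simp: L2_eq_def f'_def algebra_simps elim!: AE_mp intro!: AE_I2)
   have "L2_inner M f w = L2_inner M (%t. a * w t + L2_proj M B f t) w"
    by (rule L2_inner_cong_AE(1)[OF _ _ _ ae])
     (use VL[OF f] VL[OF wV] L2_proj_in[OF B(1), of f] in "auto dest!: L2_measurable")
   also have "... = a * 1 + L2_inner M (L2_proj M B f) w"
    by (simp add: L2_inner_add_left L2_cmult VL[OF wV] B(1) L2_inner_cmult_left ww)
   also have "L2_inner M (L2_proj M B f) w = 0"
    unfolding L2_proj_def
    by (subst L2_inner_sum_left) (use BL VL[OF wV] uw in "auto simp: L2_inner_cmult_left intro!: L2_cmult sum.neutral")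
   finally have "L2_inner M f w = a" by simp
   then show ?thesis using ae by (simp add: L2_eq_def L2_proj_def fin wB)
  qed
  then show ?thesis using ON wV B(2) by (intro exI[of _ "insert w B"]) (auto simp: V'_def)
 qed
qed

section \<open>Self-adjoint operators\<close>

text \<open>Being an adjoint makes the graph linear, closed and saturated under almost everywhere
  equality, so these properties are derived from the one identity.\<close>

locale selfadjoint_graph =
 fixes M :: "'a measure" and T :: "'a graph"
 assumes T_eq: "T = adjoint_graph M T"
begin

abbreviation nm where "nm \<equiv> L2_norm M"
abbreviation inn where "inn \<equiv> L2_inner M"

lemma T_iff: "(f, g) \<in> T \<longleftrightarrow> f \<in> L2 M \<and> g \<in> L2 M \<and> (\<forall>u v. (u, v) \<in> T --> inn v f = inn u g)"
 by (subst T_eq) (auto simp: adjoint_graph_def)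

lemma T_L2: "(f, g) \<in> T ==> f \<in> L2 M" "(f, g) \<in> T ==> g \<in> L2 M"
 using T_iff by blast+

lemma T_symmetric: "(f, g) \<in> T ==> (u, v) \<in> T ==> inn v f = inn u g"
 using T_iff by blast

lemma T_lincomb:
 assumes "(f, g) \<in> T" "(f', g') \<in> T"
 shows "(%t. a * f t + c * f' t, %t. a * g t + c * g' t) \<in> T"
 using assms T_L2
 by (subst T_iff) (auto simp: L2_intros L2_inner_add_right L2_inner_cmult_right T_symmetric[of f g] T_symmetric[of f' g'])

lemma T_cmult: "(f, g) \<in> T ==> (%t. a * f t, %t. a * g t) \<in> T"
 using T_lincomb[of f g f g a 0] by simp

lemma T_add: "(f, g) \<in> T ==> (f', g') \<in> T ==> (%t. f t + f' t, %t. g t + g' t) \<in> T"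
 using T_lincomb[of f g f' g' 1 1] by simp

lemma T_diff: "(f, g) \<in> T ==> (f', g') \<in> T ==> (%t. f t - f' t, %t. g t - g' t) \<in> T"
 using T_lincomb[of f g f' g' 1 "-1"] by simp

lemma T_zero [simp]: "(%_. 0, %_. 0) \<in> T"
 by (subst T_iff) simp

lemma T_sum: "(\<And>i. i \<in> I ==> (f i, g i) \<in> T) ==> (%t. \<Sum>i\<in>I. f i t, %t. \<Sum>i\<in>I. g i t) \<in> T"
proof (induction I rule: infinite_finite_induct)
 case (insert i I)
 then show ?case using T_add[of "f i" "g i"] by simp
qed auto

lemma T_cong:
 assumes "(f, g) \<in> T" "f' \<in> borel_measurable M" "g' \<in> borel_measurable M"
  and "AE t in M. f t = f' t" "AE t in M. g t = g' t"
 shows "(f', g') \<in> T"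
proof -
 have L: "f' \<in> L2 M" "g' \<in> L2 M"
  by (rule L2_cong_AE[OF T_L2(1)[OF assms(1)] assms(2,4)], rule L2_cong_AE[OF T_L2(2)[OF assms(1)] assms(3,5)])
 have "inn v f' = inn u g'" if uv: "(u, v) \<in> T" for u v
 proof -
  have m: "f \<in> borel_measurable M" "g \<in> borel_measurable M" "u \<in> borel_measurable M" "v \<in> borel_measurable M"
   using T_L2[OF uv] T_L2[OF assms(1)] by (blast dest: L2_measurable)+
  show ?thesis
   using T_symmetric[OF assms(1) uv] L2_inner_cong_AE(2)[OF m(1) assms(2) m(4) assms(4)]
    L2_inner_cong_AE(2)[OF m(2) assms(3) m(3) assms(5)] by simp
 qed
 then show ?thesis using L by (subst T_iff) auto
qed

lemma T_closed:
 assumes FG: "\<And>n::nat. (F n, G n) \<in> T" and f: "f \<in> L2 M" and g: "g \<in> L2 M"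
  and lim: "(%n. nm (%t. F n t - f t)) \<longlonglongrightarrow> 0" "(%n. nm (%t. G n t - g t)) \<longlonglongrightarrow> 0"
 shows "(f, g) \<in> T"
proof -
 have "inn v f = inn u g" if uv: "(u, v) \<in> T" for u v
 proof (rule LIMSEQ_unique)
  show "(%n. inn v (F n)) \<longlonglongrightarrow> inn v f"
   by (rule L2_inner_tendsto_right[OF T_L2(1)[OF FG] f T_L2(2)[OF uv] lim(1)])
  show "(%n. inn v (F n)) \<longlonglongrightarrow> inn u g"
   unfolding T_symmetric[OF FG uv]
   by (rule L2_inner_tendsto_right[OF T_L2(2)[OF FG] g T_L2(1)[OF uv] lim(2)])
 qed
 then show ?thesis using f g by (subst T_iff) auto
qed

lemma eigenspace_iff: "f \<in> eigenspace M T z \<longleftrightarrow> (f, %t. z * f t) \<in> T"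
proof
 assume "f \<in> eigenspace M T z"
 then obtain g where g: "(f, g) \<in> T" "L2_eq M g (%t. z * f t)" by (auto simp: eigenspace_def)
 show "(f, %t. z * f t) \<in> T"
  by (rule T_cong[OF g(1)]) (use g T_L2[OF g(1)] in "auto simp: L2_eq_def dest: L2_measurable")
qed (auto simp: eigenspace_def L2_eq_def)

lemma L2_subspace_eigenspace: "L2_subspace M (eigenspace M T z)"
 using T_L2 T_add[of _ "%t. z * _ t" _ "%t. z * _ t"] T_cmult[of _ "%t. z * _ t"]
 by (auto simp: L2_subspace_def eigenspace_iff algebra_simps)

lemma eigenvalue_obtain:
 assumes "is_eigenvalue M T z"
 obtains f where "(f, %t. z * f t) \<in> T" "nm f = 1"
proof -
 obtain f where f: "(f, %t. z * f t) \<in> T" "nm f \<noteq> 0"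
  using assms T_L2(1) by (auto simp: is_eigenvalue_def eigenspace_iff L2_norm_eq_0_iff)
 let ?c = "of_real (1 / nm f) :: complex"
 have "(%t. ?c * f t, %t. z * (?c * f t)) \<in> T"
  using T_cmult[OF f(1), of ?c] by (simp add: algebra_simps)
 moreover have "nm (%t. ?c * f t) = 1" unfolding L2_norm_cmult using f(2) by (simp add: norm_divide)
 ultimately show ?thesis using that by blast
qed

lemma eigenvalueI: "(f, %t. z * f t) \<in> T ==> nm f \<noteq> 0 ==> is_eigenvalue M T z"
 using T_L2(1) by (auto simp: is_eigenvalue_def eigenspace_iff L2_norm_eq_0_iff)

lemma eigenvectors_orthogonal:
 assumes "(f, %t. z * f t) \<in> T" "(h, %t. w * h t) \<in> T" "z \<noteq> cnj w"
 shows "inn f h = 0"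
 using T_symmetric[OF assms(2,1)] assms(3) by (simp add: L2_inner_cmult_left L2_inner_cmult_right)

lemma eigenvalue_real:
 assumes "is_eigenvalue M T z"
 shows "cnj z = z"
proof -
 obtain f where f: "(f, %t. z * f t) \<in> T" "nm f = 1" using eigenvalue_obtain[OF assms] .
 then show ?thesis using eigenvectors_orthogonal[OF f(1) f(1)] by (cases "z = cnj z") (auto simp: L2_inner_self)
qed

lemma resolvent_solve:
 assumes "z \<in> resolvent_set M T" "h \<in> L2 M"
 shows "\<exists>f. (f, %t. h t + z * f t) \<in> T"
proof -
 obtain f g where fg: "(f, g) \<in> T" "L2_eq M (%t. g t - z * f t) h"
  using assms unfolding resolvent_set_def by blast
 have "(f, %t. h t + z * f t) \<in> T"
 proof (rule T_cong[OF fg(1) _ _ AE_I2])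
  show "AE t in M. g t = h t + z * f t"
   using fg(2) unfolding L2_eq_def by eventually_elim (simp add: algebra_simps)
 qed (use L2_measurable[OF T_L2(1)[OF fg(1)]] L2_measurable[OF assms(2)] in simp_all)
 then show ?thesis by blast
qed

lemma resolvent_bound:
 assumes "z \<in> resolvent_set M T"
 obtains C where "C \<ge> 0" "\<And>f g. (f, g) \<in> T ==> nm f \<le> C * nm (%t. g t - z * f t)"
proof -
 obtain C where C: "\<And>f g. (f, g) \<in> T ==> nm f \<le> C * nm (%t. g t - z * f t)"
  using assms unfolding resolvent_set_def by blast
 have "nm f \<le> \<bar>C\<bar> * nm (%t. g t - z * f t)" if "(f, g) \<in> T" for f g
  using C[OF that] by (rule order_trans) (auto intro: mult_right_mono)
 then show ?thesis using that[of "\<bar>C\<bar>"] by simp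
qed

text \<open>The complement of the range of \<open>T - z\<close> is the kernel of the adjoint minus
  \<open>cnj z\<close>, and the adjoint is \<open>T\<close>.\<close>

lemma orthogonal_to_range:
 assumes w: "w \<in> L2 M" and orth: "\<And>f g. (f, g) \<in> T ==> inn (%t. g t - z * f t) w = 0"
 shows "(w, %t. cnj z * w t) \<in> T"
proof -
 have "inn v w = inn u (%t. cnj z * w t)" if "(u, v) \<in> T" for u v
  using orth[OF that] T_L2[OF that] w
  by (simp add: L2_inner_diff_left L2_cmult L2_inner_cmult_left L2_inner_cmult_right)
 then show ?thesis using w by (subst T_iff) (auto intro: L2_cmult)
qed

lemma L2_subspace_range: "L2_subspace M {%t. g t - z * f t | f g. (f, g) \<in> T}"
proof -
 have "\<exists>f g. (%t. (a t - z * b t) + (c t - z * d t)) = (%t. g t - z * f t) \<and> (f, g) \<in> T"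
  if "(b, a) \<in> T" "(d, c) \<in> T" for a b c d
  using T_add[OF that] by (force simp: algebra_simps)
 moreover have "\<exists>f g. (%t. k * (a t - z * b t)) = (%t. g t - z * f t) \<and> (f, g) \<in> T"
  if "(b, a) \<in> T" for a b k
  using T_cmult[OF that, of k] by (force simp: algebra_simps)
 moreover have "\<exists>f g. (%t. 0) = (%t. g t - z * f t) \<and> (f, g) \<in> T"
  by (rule exI[of _ "%_. 0"], rule exI[of _ "%_. 0"]) simp
 ultimately show ?thesis
  unfolding L2_subspace_def by (auto intro!: L2_diff L2_cmult dest: T_L2)
qed

text \<open>Two halves of surjectivity: without an eigenvalue at \<open>cnj z\<close> nothing is
  orthogonal to the range, so the range is dense; the lower bound makes approximate preimages a
  Cauchy sequence, and the closed graph contains their limit, so the range is closed.\<close>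

lemma in_resolvent_setI:
 assumes C: "\<And>f g. (f, g) \<in> T ==> nm f \<le> C * nm (%t. g t - z * f t)"
  and noeig: "\<not> is_eigenvalue M T (cnj z)"
 shows "z \<in> resolvent_set M T"
proof -
 have "\<exists>(f, g)\<in>T. L2_eq M (%t. g t - z * f t) h" if h: "h \<in> L2 M" for h
 proof -
  let ?S = "{%t. g t - z * f t | f g. (f, g) \<in> T}"
  have orth: "inn h w = 0" if w: "w \<in> L2 M" "\<And>s. s \<in> ?S ==> inn s w = 0" for w
  proof -
   have "(w, %t. cnj z * w t) \<in> T"
    by (rule orthogonal_to_range[OF w(1)], rule w(2)) auto
   then have "nm w = 0" using noeig eigenvalueI by blast
   then show "inn h w = 0" using L2_Cauchy_Schwarz[OF h w(1)] by simp
  qed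
  have "\<exists>f g. (f, g) \<in> T \<and> nm (%t. h t - (g t - z * f t)) < 1 / Suc n" for n
  proof -
   have "\<exists>s\<in>?S. nm (%t. h t - s t) < 1 / Suc n"
    by (rule L2_biorthogonal_in_closure[OF L2_subspace_range h orth]) auto
   then obtain s where s: "s \<in> ?S" "nm (%t. h t - s t) < 1 / Suc n" by (elim bexE)
   from s(1) obtain f g where fg: "s = (%t. g t - z * f t)" "(f, g) \<in> T" by auto
   show ?thesis by (rule exI[of _ f], rule exI[of _ g]) (use fg s(2) in simp)
  qed
  then obtain F G where FG: "\<And>n. (F n, G n) \<in> T"
   and d: "\<And>n. nm (%t. h t - (G n t - z * F n t)) < 1 / Suc n" by metis
  define s where "s n = (%t. G n t - z * F n t)" for n
  have sL: "s n \<in> L2 M" for n unfolding s_def using T_L2[OF FG] by (intro L2_diff L2_cmult)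
  have sh: "(%n. nm (%t. s n t - h t)) \<longlonglongrightarrow> 0"
   unfolding L2_norm_minus_commute[of M _ h]
   by (rule Lim_null_comparison[OF _ LIMSEQ_Suc[OF lim_1_over_n]])
    (use d in "auto simp: s_def less_imp_le")
  have FF: "nm (%t. F m t - F n t) \<le> \<bar>C\<bar> * (nm (%t. s m t - h t) + nm (%t. s n t - h t))" for m n
  proof -
   have "nm (%t. F m t - F n t) \<le> C * nm (%t. (G m t - G n t) - z * (F m t - F n t))"
    by (rule C[OF T_diff[OF FG FG]])
   also have "(%t. (G m t - G n t) - z * (F m t - F n t)) = (%t. s m t - s n t)"
    by (rule ext) (simp add: s_def algebra_simps)
   also have "C * nm (%t. s m t - s n t) \<le> \<bar>C\<bar> * nm (%t. s m t - s n t)"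
    by (intro mult_right_mono) auto
   also have "... \<le> \<bar>C\<bar> * (nm (%t. s m t - h t) + nm (%t. s n t - h t))"
    using L2_norm_triangle3[OF sL h sL, of m n] L2_norm_minus_commute[of M h "s n"]
    by (intro mult_left_mono) auto
   finally show ?thesis .
  qed
  have "L2_Cauchy M F"
   unfolding L2_Cauchy_def
  proof (intro allI impI)
   fix e :: real assume e: "e > 0"
   obtain K where K: "K > 0" "\<bar>C\<bar> \<le> K" by (rule that[of "\<bar>C\<bar> + 1"]) auto
   define r where "r = e / (2 * K)"
   have r: "r > 0" "2 * r * K = e" using e K(1) by (simp_all add: r_def)
   have "\<forall>\<^sub>F n in sequentially. nm (%t. s n t - h t) < r"
    by (rule order_tendstoD(2)[OF sh r(1)])
   then obtain N where N: "\<And>n. n \<ge> N ==> nm (%t. s n t - h t) < r"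
    unfolding eventually_sequentially by blast
   have "nm (%t. F m t - F n t) < e" if "m \<ge> N" "n \<ge> N" for m n
   proof -
    let ?d = "nm (%t. s m t - h t) + nm (%t. s n t - h t)"
    have "?d < 2 * r" using N[OF that(1)] N[OF that(2)] by linarith
    then have "?d * K < 2 * r * K" by (rule mult_strict_right_mono[OF _ K(1)])
    then have "?d * K < e" using r(2) by simp
    moreover have "\<bar>C\<bar> * ?d \<le> K * ?d" using K(2) by (intro mult_right_mono) auto
    then have "\<bar>C\<bar> * ?d \<le> ?d * K" by (subst (2) mult.commute)
    ultimately have "\<bar>C\<bar> * ?d < e" by (rule le_less_trans[rotated])
    then show ?thesis by (rule le_less_trans[OF FF])
   qed
   then show "\<exists>N. \<forall>m\<ge>N. \<forall>n\<ge>N. nm (%t. F m t - F n t) < e" by blast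
  qed
  from L2_complete[OF T_L2(1)[OF FG] this] obtain f where f: "f \<in> L2 M"
   and lim: "(%n. nm (%t. F n t - f t)) \<longlonglongrightarrow> 0" by (elim bexE)
  have "(f, %t. h t + z * f t) \<in> T"
  proof (rule T_closed[OF FG f _ lim])
   show "(%t. h t + z * f t) \<in> L2 M" by (intro L2_intros h f)
   show "(%n. nm (%t. G n t - (h t + z * f t))) \<longlonglongrightarrow> 0"
   proof (rule Lim_null_comparison)
    have "nm (%t. G n t - (h t + z * f t)) \<le> nm (%t. s n t - h t) + cmod z * nm (%t. F n t - f t)" for n
    proof -
     have "(%t. G n t - (h t + z * f t)) = (%t. (s n t - h t) + z * (F n t - f t))"
      by (rule ext) (simp add: s_def algebra_simps)
     then show ?thesis
      using L2_norm_triangle[OF L2_diff[OF sL h] L2_cmult[OF L2_diff[OF T_L2(1)[OF FG] f]], of n z n]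
      by (simp only: L2_norm_cmult)
    qed
    then show "\<forall>\<^sub>F n in sequentially. norm (nm (%t. G n t - (h t + z * f t)))
      \<le> nm (%t. s n t - h t) + cmod z * nm (%t. F n t - f t)" by simp
    show "(%n. nm (%t. s n t - h t) + cmod z * nm (%t. F n t - f t)) \<longlonglongrightarrow> 0"
     using tendsto_add[OF sh tendsto_mult_left[OF lim, of "cmod z"]] by simp
   qed
  qed
  then show ?thesis by (intro bexI[of _ "(f, %t. h t + z * f t)"]) (auto simp: L2_eq_def)
 qed
 then show ?thesis using C unfolding resolvent_set_def by blast
qed

end

section \<open>From the compactness estimate to discrete spectrum\<close>

context selfadjoint_graph
begin

text \<open>For a self-adjoint operator this is compactness of the resolvent.\<close>

definition finite_rank_approximable :: bool where
 "finite_rank_approximable \<longleftrightarrow> (\<forall>\<epsilon>>0. \<exists>E K. finite E \<and> E \<subseteq> L2 M \<and>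
   (\<forall>f g. (f, g) \<in> T --> nm f \<le> \<epsilon> * (nm f + nm g) +
    K * (\<Sum>e\<in>E. cmod (inn f e) + cmod (inn g e))))"

lemma finite_rank_approximableE:
 assumes "finite_rank_approximable" "\<epsilon> > 0"
 obtains E K where "finite E" "E \<subseteq> L2 M"
  "\<forall>f g. (f, g) \<in> T --> nm f \<le> \<epsilon> * (nm f + nm g) +
    K * (\<Sum>e\<in>E. cmod (inn f e) + cmod (inn g e))"
proof -
 obtain E K where EK: "finite E \<and> E \<subseteq> L2 M \<and>
   (\<forall>f g. (f, g) \<in> T --> nm f \<le> \<epsilon> * (nm f + nm g) +
    K * (\<Sum>e\<in>E. cmod (inn f e) + cmod (inn g e)))"
  using assms(1)[unfolded finite_rank_approximable_def, rule_format, OF assms(2)] by (elim exE)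
 show ?thesis
  by (rule that[OF EK[THEN conjunct1] EK[THEN conjunct2, THEN conjunct1] EK[THEN conjunct2, THEN conjunct2]])
qed

text \<open>The finite sets belonging to \<open>\<epsilon> = 1 / Suc i\<close> have a countable
  union, so a diagonal subsequence makes all the inner products with it converge. On differences of
  members of this subsequence the functionals in the estimate become small, and the remaining term
  is small by the choice of \<open>i\<close>.\<close>

lemma Cauchy_subsequence:
 assumes comp: "finite_rank_approximable"
  and FG: "\<And>n::nat. (F n, G n) \<in> T" and bd: "\<And>n. nm (F n) \<le> B" "\<And>n. nm (G n) \<le> B"
 obtains k where "strict_mono (k :: nat \<Rightarrow> nat)" "L2_Cauchy M (F \<circ> k)"
proof -
 have B0: "B \<ge> 0" using bd(1)[of 0] L2_norm_nonneg[of M "F 0"] by linarith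
 define Q where "Q i E K \<longleftrightarrow> finite E \<and> E \<subseteq> L2 M \<and>
   (\<forall>f g. (f, g) \<in> T --> nm f \<le> (1 / Suc i) * (nm f + nm g) +
    K * (\<Sum>e\<in>E. cmod (inn f e) + cmod (inn g e)))" for i E K
 have "\<exists>E K. Q i E K" for i
  using comp unfolding finite_rank_approximable_def Q_def by (elim allE[of _ "1 / Suc i"]) simp
 then obtain E K where Q: "\<And>i. Q i (E i) (K i)" by metis
 have E: "\<And>i::nat. finite (E i)" "\<And>i. E i \<subseteq> L2 M"
  and EK: "\<And>i f g. (f, g) \<in> T ==> nm f \<le> (1 / Suc i) * (nm f + nm g) +
    K i * (\<Sum>e\<in>E i. cmod (inn f e) + cmod (inn g e))"
  using Q unfolding Q_def by blast+
 define S' where "S' = (\<Union>i. E i)"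
 have cS: "countable S'" unfolding S'_def using E(1) by (intro countable_UN) (auto intro: countable_finite)
 have SL: "e \<in> S' ==> e \<in> L2 M" for e using E(2) by (auto simp: S'_def)
 \<comment> \<open>Dividing by \<open>1 + nm e\<close> gives a bound that is uniform in
   \<open>e\<close>, as the diagonal extraction requires; the two components carry the functionals
   of \<open>F n\<close> and of \<open>G n\<close> along the same subsequence.\<close>
 define \<phi> where "\<phi> n e = (inn (F n) e / of_real (1 + nm e), inn (G n) e / of_real (1 + nm e))" for n e
 have phib: "norm (\<phi> n e) \<le> 2 * B" if e: "e \<in> S'" for n e
 proof -
  have *: "cmod (inn h e / of_real (1 + nm e)) \<le> B" if h: "h \<in> L2 M" "nm h \<le> B" for h
  proof -
   have p: "0 < 1 + nm e" by (rule add_pos_nonneg) simp_all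
   have "cmod (inn h e) \<le> nm h * nm e" by (rule L2_Cauchy_Schwarz[OF h(1) SL[OF e]])
   also have "... \<le> B * (1 + nm e)" using h(2) B0 by (intro mult_mono) auto
   finally have "cmod (inn h e) / (1 + nm e) \<le> B" using p by (simp add: pos_divide_le_eq)
   moreover have "cmod (of_real (1 + nm e)) = 1 + nm e" using p by (simp only: norm_of_real)
   ultimately show ?thesis by (simp only: norm_divide)
  qed
  have "norm (\<phi> n e) \<le> norm (fst (\<phi> n e)) + norm (snd (\<phi> n e))"
   using norm_Pair_le[of "fst (\<phi> n e)" "snd (\<phi> n e)"] by simp
  also have "... \<le> B + B"
   unfolding \<phi>_def fst_conv snd_conv
   by (intro add_mono *[OF T_L2(1)[OF FG] bd(1)] *[OF T_L2(2)[OF FG] bd(2)])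
  finally show ?thesis by simp
 qed
 obtain k :: "nat \<Rightarrow> nat" where k: "strict_mono k" and kl: "\<And>e. e \<in> S' ==> \<exists>l. (%n. \<phi> (k n) e) \<longlonglongrightarrow> l"
  using function_convergent_subsequence[where f=\<phi>, OF cS phib] by blast
 have conv: "convergent (%n. inn (F (k n)) e)" "convergent (%n. inn (G (k n)) e)" if e: "e \<in> S'" for e
 proof -
  obtain l where l: "(%n. \<phi> (k n) e) \<longlonglongrightarrow> l" using kl[OF e] by blast
  have p: "1 + nm e \<noteq> 0" using L2_norm_nonneg[of M e] by linarith
  then have p: "complex_of_real (1 + nm e) \<noteq> 0" by (simp only: of_real_eq_0_iff) simp
  have "(%n. of_real (1 + nm e) * fst (\<phi> (k n) e)) \<longlonglongrightarrow> of_real (1 + nm e) * fst l"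
   "(%n. of_real (1 + nm e) * snd (\<phi> (k n) e)) \<longlonglongrightarrow> of_real (1 + nm e) * snd l"
   by (intro tendsto_intros l)+
  then show "convergent (%n. inn (F (k n)) e)" "convergent (%n. inn (G (k n)) e)"
   using p unfolding \<phi>_def convergent_def by (auto simp del: of_real_add)
 qed
 have "L2_Cauchy M (F \<circ> k)"
  unfolding L2_Cauchy_def
 proof (intro allI impI)
  fix r :: real assume r: "r > 0"
  \<comment> \<open>The graph norm of a difference is at most \<open>4 * B\<close>, so this
    \<open>i\<close> reduces the first term of the estimate below \<open>r / 2\<close>;
    \<open>\<eta>\<close> does the same for the functionals.\<close>
  obtain i :: nat where i: "8 * B / r < real i" using reals_Archimedean2 by blast
  have ib: "1 / Suc i * (4 * B) < r / 2"
  proof -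
   have "8 * B < real i * r" using i r by (simp add: field_simps)
   also have "... \<le> real (Suc i) * r" using r by (intro mult_right_mono) auto
   finally show ?thesis by (simp add: field_simps)
  qed
  let ?D = "%m n. \<Sum>e\<in>E i. cmod (inn (F (k m)) e - inn (F (k n)) e) + cmod (inn (G (k m)) e - inn (G (k n)) e)"
  obtain K' where K': "K' > 0" "\<bar>K i\<bar> \<le> K'" by (rule that[of "\<bar>K i\<bar> + 1"]) auto
  define c where "c = real (card (E i)) + 1"
  have c: "c > 0" "card (E i) < c" unfolding c_def by auto
  define \<eta> where "\<eta> = r / (4 * K' * c)"
  have \<eta>: "\<eta> > 0" using r K'(1) c(1) unfolding \<eta>_def by simp
  define S where "S m n e \<longleftrightarrow> cmod (inn (F (k m)) e - inn (F (k n)) e) < \<eta> \<and>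
    cmod (inn (G (k m)) e - inn (G (k n)) e) < \<eta>" for m n e
  have "\<exists>N. \<forall>m\<ge>N. \<forall>n\<ge>N. S m n e" if e: "e \<in> E i" for e
  proof -
   have eS: "e \<in> (\<Union>i. E i)" using e by auto
   obtain N1 where N1: "\<forall>m\<ge>N1. \<forall>n\<ge>N1. cmod (inn (F (k m)) e - inn (F (k n)) e) < \<eta>"
    using convergent_Cauchy[OF conv(1)[OF eS[folded S'_def]]] \<eta> unfolding Cauchy_iff by blast
   obtain N2 where N2: "\<forall>m\<ge>N2. \<forall>n\<ge>N2. cmod (inn (G (k m)) e - inn (G (k n)) e) < \<eta>"
    using convergent_Cauchy[OF conv(2)[OF eS[folded S'_def]]] \<eta> unfolding Cauchy_iff by blast
   show ?thesis unfolding S_def using N1 N2 by (intro exI[of _ "max N1 N2"]) auto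
  qed
  then obtain N where N: "\<And>e m n. e \<in> E i ==> m \<ge> N e ==> n \<ge> N e ==> S m n e" by metis
  define N0 where "N0 = (\<Sum>e\<in>E i. N e)"
  have N0: "e \<in> E i ==> N e \<le> N0" for e unfolding N0_def using E(1) by (intro member_le_sum) auto
  have "nm (%t. (F \<circ> k) m t - (F \<circ> k) n t) < r" if mn: "m \<ge> N0" "n \<ge> N0" for m n
  proof -
   have Fd: "inn (%t. F (k m) t - F (k n) t) e = inn (F (k m)) e - inn (F (k n)) e"
    and Gd: "inn (%t. G (k m) t - G (k n) t) e = inn (G (k m)) e - inn (G (k n)) e"
    if "e \<in> E i" for e
    by (rule L2_inner_diff_left; use that E(2) T_L2[OF FG] in blast)+
   have "?D m n \<le> (\<Sum>e\<in>E i. 2 * \<eta>)"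
   proof (rule sum_mono)
    fix e assume e: "e \<in> E i"
    show "cmod (inn (F (k m)) e - inn (F (k n)) e) + cmod (inn (G (k m)) e - inn (G (k n)) e) \<le> 2 * \<eta>"
     using N[OF e order_trans[OF N0[OF e] mn(1)] order_trans[OF N0[OF e] mn(2)]] unfolding S_def by linarith
   qed
   also have "... = card (E i) * (2 * \<eta>)" by simp
   also have "... < c * (2 * \<eta>)" using c \<eta> by (intro mult_strict_right_mono) auto
   finally have D: "?D m n < c * (2 * \<eta>)" .
   have D0: "?D m n \<ge> 0" by (intro sum_nonneg add_nonneg_nonneg) auto
   have "K i * ?D m n \<le> K' * ?D m n" using K' D0 by (intro mult_right_mono) auto
   also have "... < K' * (c * (2 * \<eta>))" by (rule mult_strict_left_mono[OF D K'(1)])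
   also have "... = r / 2" using K'(1) c(1) by (simp add: \<eta>_def)
   finally have KD: "K i * ?D m n < r / 2" .
   have b: "nm (%t. F (k m) t - F (k n) t) + nm (%t. G (k m) t - G (k n) t) \<le> 4 * B"
    using L2_norm_triangle_diff[OF T_L2(1)[OF FG] T_L2(1)[OF FG], of "k m" "k n"]
     L2_norm_triangle_diff[OF T_L2(2)[OF FG] T_L2(2)[OF FG], of "k m" "k n"]
     bd(1)[of "k m"] bd(1)[of "k n"] bd(2)[of "k m"] bd(2)[of "k n"] by linarith
   have "nm (%t. F (k m) t - F (k n) t) \<le> (1 / Suc i) * (nm (%t. F (k m) t - F (k n) t) + nm (%t. G (k m) t - G (k n) t)) + K i * ?D m n"
    using EK[OF T_diff[OF FG FG], of "k m" "k n" i] by (simp add: Fd Gd)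
   also have "... < (1 / Suc i) * (4 * B) + r / 2"
    using mult_left_mono[OF b, of "1 / Suc i"] KD by (intro add_le_less_mono) auto
   finally show ?thesis using ib by simp
  qed
  then show "\<exists>N. \<forall>m\<ge>N. \<forall>n\<ge>N. nm (%t. (F \<circ> k) m t - (F \<circ> k) n t) < r" by blast
 qed
 then show ?thesis using that k by blast
qed

text \<open>If no bound held, there would be unit vectors with \<open>(T - z) f\<close> tending to
  zero. Their graph norms are bounded, so a subsequence converges, and its limit is a unit
  eigenvector.\<close>

lemma not_eigenvalue_bounded_below:
 assumes comp: "finite_rank_approximable" and ne: "\<not> is_eigenvalue M T z"
 shows "\<exists>C. \<forall>f g. (f, g) \<in> T --> nm f \<le> C * nm (%t. g t - z * f t)"
proof (rule ccontr)
 assume "\<not> ?thesis"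
 then have ex: "\<exists>f g. (f, g) \<in> T \<and> nm f > C * nm (%t. g t - z * f t)" for C
  by (meson not_le)
 define Q where "Q n f g \<longleftrightarrow> (f, g) \<in> T \<and> nm f = 1 \<and> nm (%t. g t - z * f t) < 1 / Suc n" for n f g
 have "\<exists>f g. Q n f g" for n
 proof -
  obtain f g where fg: "(f, g) \<in> T" "nm f > real (Suc n) * nm (%t. g t - z * f t)" using ex by blast
  have n: "nm f > 0" by (rule le_less_trans[OF _ fg(2)]) (intro mult_nonneg_nonneg, auto)
  let ?c = "of_real (1 / nm f) :: complex"
  have cn: "cmod ?c = 1 / nm f" using n by (simp add: norm_divide)
  have "nm (%t. ?c * f t) = 1" unfolding L2_norm_cmult cn using n by simp
  moreover have "(%t. ?c * g t - z * (?c * f t)) = (%t. ?c * (g t - z * f t))"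
   by (rule ext) (simp add: algebra_simps)
  then have "nm (%t. ?c * g t - z * (?c * f t)) = nm (%t. g t - z * f t) / nm f"
   by (simp only: L2_norm_cmult cn) simp
  moreover have "nm (%t. g t - z * f t) / nm f < 1 / Suc n"
   using fg(2) n by (simp add: field_simps)
  ultimately have "Q n (%t. ?c * f t) (%t. ?c * g t)" using T_cmult[OF fg(1), of ?c] unfolding Q_def by simp
  then show ?thesis by blast
 qed
 then obtain F G where "\<And>n. Q n (F n) (G n)" by metis
 then have FG: "\<And>n. (F n, G n) \<in> T" and F1: "\<And>n. nm (F n) = 1"
  and r: "\<And>n. nm (%t. G n t - z * F n t) < 1 / Suc n" unfolding Q_def by blast+
 have FL: "\<And>n. F n \<in> L2 M" and GL: "\<And>n. G n \<in> L2 M" using T_L2[OF FG] by auto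
 have rz: "(%n. nm (%t. G n t - z * F n t)) \<longlonglongrightarrow> 0"
  by (rule Lim_null_comparison[OF _ LIMSEQ_Suc[OF lim_1_over_n]]) (use r in "auto simp: less_imp_le")
 have Gb: "nm (G n) \<le> 1 + cmod z" for n
 proof -
  have "nm (G n) \<le> nm (%t. z * F n t) + nm (%t. G n t - z * F n t)"
   by (rule L2_norm_triangle_sub[OF GL L2_cmult[OF FL]])
  moreover have "1 / real (Suc n) \<le> 1" by simp
  ultimately show ?thesis using r[of n] F1[of n] by (simp only: L2_norm_cmult)
 qed
 have Fb: "nm (F n) \<le> 1 + cmod z" for n using F1[of n] by simp
 obtain k :: "nat \<Rightarrow> nat" where k: "strict_mono k" "L2_Cauchy M (F \<circ> k)"
  by (rule Cauchy_subsequence[OF comp FG Fb Gb])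
 obtain f where f: "f \<in> L2 M" "(%n. nm (%t. (F \<circ> k) n t - f t)) \<longlonglongrightarrow> 0"
  using L2_complete[OF _ k(2)] FL by auto
 have lim: "(%n. nm (%t. F (k n) t - f t)) \<longlonglongrightarrow> 0" using f(2) by (simp only: o_def)
 have "(f, %t. z * f t) \<in> T"
 proof (rule T_closed[OF FG f(1) L2_cmult[OF f(1)] lim])
  show "(%n. nm (%t. G (k n) t - z * f t)) \<longlonglongrightarrow> 0"
  proof (rule Lim_null_comparison)
   have "nm (%t. G (k n) t - z * f t) \<le> nm (%t. G (k n) t - z * F (k n) t) + cmod z * nm (%t. F (k n) t - f t)" for n
   proof -
    have "(%t. G (k n) t - z * f t) = (%t. (G (k n) t - z * F (k n) t) + z * (F (k n) t - f t))"
     by (rule ext) (simp add: algebra_simps)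
    then show ?thesis
     using L2_norm_triangle[OF L2_diff[OF GL L2_cmult[OF FL]] L2_cmult[OF L2_diff[OF FL f(1)]], of "k n" z "k n" z "k n"]
     by (simp only: L2_norm_cmult)
   qed
   then show "\<forall>\<^sub>F n in sequentially. norm (nm (%t. G (k n) t - z * f t))
     \<le> nm (%t. G (k n) t - z * F (k n) t) + cmod z * nm (%t. F (k n) t - f t)" by simp
   show "(%n. nm (%t. G (k n) t - z * F (k n) t) + cmod z * nm (%t. F (k n) t - f t)) \<longlonglongrightarrow> 0"
    using tendsto_add[OF LIMSEQ_subseq_LIMSEQ[OF rz k(1)] tendsto_mult_left[OF lim, of "cmod z"]]
    by (simp add: o_def)
  qed
 qed
 moreover have "nm f = 1"
  using LIMSEQ_unique[OF L2_norm_tendsto[OF FL f(1) lim]] F1 by simp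
 ultimately show False using ne eigenvalueI by force
qed

lemma spectrum_eq_eigenvalues:
 assumes comp: "finite_rank_approximable" and z: "z \<in> op_spectrum M T"
 shows "is_eigenvalue M T z"
proof (rule ccontr)
 assume ne: "\<not> is_eigenvalue M T z"
 then have ne': "\<not> is_eigenvalue M T (cnj z)"
  using eigenvalue_real[of "cnj z"] by auto
 obtain C where "\<And>f g. (f, g) \<in> T ==> nm f \<le> C * nm (%t. g t - z * f t)"
  using not_eigenvalue_bounded_below[OF comp ne] by blast
 then have "z \<in> resolvent_set M T" by (rule in_resolvent_setI[OF _ ne'])
 then show False using z by (simp add: op_spectrum_def)
qed

text \<open>On the eigenspace both families of functionals are multiples of \<open>inn f e\<close>,
  and \<open>\<epsilon>\<close> is chosen with \<open>\<epsilon> * (1 + cmod z) = 1/2\<close>. An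
  eigenvector orthogonal to \<open>E\<close> then has norm at most half of its norm, so
  \<open>E\<close> separates the eigenspace.\<close>

lemma finite_multiplicity:
 assumes comp: "finite_rank_approximable"
 shows "finite_multiplicity M T z"
proof -
 define \<epsilon> where "\<epsilon> = 1 / (2 * (1 + cmod z))"
 have z1: "1 + cmod z > 0" by (rule add_pos_nonneg) auto
 have "\<epsilon> > 0" unfolding \<epsilon>_def using z1 by simp
 then obtain E K where E: "finite E" "E \<subseteq> L2 M"
  and EK0: "\<forall>f g. (f, g) \<in> T --> nm f \<le> \<epsilon> * (nm f + nm g) +
    K * (\<Sum>e\<in>E. cmod (inn f e) + cmod (inn g e))"
  by (rule finite_rank_approximableE[OF comp])
 note EK = EK0[rule_format]
 have "\<exists>B. L2_orthonormal M B \<and> B \<subseteq> eigenspace M T z \<and> (\<forall>f\<in>eigenspace M T z. L2_eq M f (L2_proj M B f))"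
 proof (rule finite_dimensional_orthonormal_basis[OF E L2_subspace_eigenspace])
  fix f assume f: "f \<in> eigenspace M T z" and 0: "\<And>e. e \<in> E ==> inn f e = 0"
  have "nm f \<le> \<epsilon> * (nm f + cmod z * nm f)"
   using EK[of f "%t. z * f t"] f 0 by (simp add: eigenspace_iff L2_norm_cmult L2_inner_cmult_left)
  also have "... = nm f / 2" using z1 unfolding \<epsilon>_def by (simp add: field_simps)
  finally show "nm f = 0" using L2_norm_nonneg[of M f] by linarith
 qed
 then obtain B where B: "L2_orthonormal M B" "\<And>f. f \<in> eigenspace M T z ==> L2_eq M f (L2_proj M B f)" by blast
 show ?thesis
  unfolding finite_multiplicity_def
  using B by (intro exI[of _ B]) (auto simp: L2_orthonormal_def L2_proj_def)
qed

text \<open>Infinitely many spectral points in a disc would be real eigenvalues with orthonormal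
  eigenvectors of bounded graph norm. These have mutual distance \<open>sqrt 2\<close>, so no
  subsequence is Cauchy.\<close>

lemma spectrum_isolated:
 assumes comp: "finite_rank_approximable" and z: "z \<in> op_spectrum M T"
 shows "z isolated_in op_spectrum M T"
proof -
 have "\<not> z islimpt op_spectrum M T"
 proof
  assume "z islimpt op_spectrum M T"
  then have "infinite (op_spectrum M T \<inter> cball z 1)"
   unfolding islimpt_eq_infinite_cball by simp
  then obtain s :: "nat \<Rightarrow> complex" where s: "inj s" "range s \<subseteq> op_spectrum M T \<inter> cball z 1"
   using infinite_countable_subset by blast
  have ev: "is_eigenvalue M T (s n)" for n
   by (rule spectrum_eq_eigenvalues[OF comp]) (use s(2) in blast)
  have "\<exists>f. (f, %t. s n * f t) \<in> T \<and> nm f = 1" for n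
   using eigenvalue_obtain[OF ev] by metis
  then obtain F where F: "\<And>n. (F n, %t. s n * F n t) \<in> T" "\<And>n. nm (F n) = 1" by metis
  define B where "B = cmod z + 1"
  have B: "cmod (s n) \<le> B" for n
  proof -
   have "s n \<in> cball z 1" using s(2) by blast
   then have "dist z (s n) \<le> 1" by simp
   then show ?thesis using norm_triangle_ineq2[of "s n" z] by (simp add: B_def dist_norm norm_minus_commute)
  qed
  have b1: "nm (F n) \<le> 1 + B" and b2: "nm (%t. s n * F n t) \<le> 1 + B" for n
   using B[of n] F(2)[of n] norm_ge_zero[of "s n"] unfolding L2_norm_cmult by (linarith, simp)
  obtain k :: "nat \<Rightarrow> nat" where k: "strict_mono k" "L2_Cauchy M (F \<circ> k)"
   by (rule Cauchy_subsequence[OF comp F(1) b1 b2])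
  obtain N where N: "\<And>m n. m \<ge> N ==> n \<ge> N ==> nm (%t. F (k m) t - F (k n) t) < 1"
   using k(2) unfolding L2_Cauchy_def o_def by (metis zero_less_one)
  have FL: "F n \<in> L2 M" for n using T_L2(1)[OF F(1)] .
  have "k N \<noteq> k (Suc N)" using strict_monoD[OF k(1), of N "Suc N"] by simp
  then have "s (k N) \<noteq> s (k (Suc N))" using s(1) by (auto dest: injD)
  then have "s (k N) \<noteq> cnj (s (k (Suc N)))" using eigenvalue_real[OF ev] by simp
  then have "inn (F (k N)) (F (k (Suc N))) = 0"
   by (rule eigenvectors_orthogonal[OF F(1) F(1)])
  then have "(nm (%t. F (k N) t - F (k (Suc N)) t))^2 = 2"
   using L2_norm_diff_sq[OF FL FL, of "k N" "k (Suc N)"] F(2) by simp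
  moreover have "(nm (%t. F (k N) t - F (k (Suc N)) t))^2 \<le> 1^2"
   using N[of N "Suc N"] by (intro power_mono) auto
  ultimately show False by simp
 qed
 then show ?thesis using z by (simp add: isolated_in_islimpt_iff)
qed

theorem discrete_spectrumI: "finite_rank_approximable ==> has_discrete_spectrum M T"
 unfolding has_discrete_spectrum_def
 using spectrum_isolated spectrum_eq_eigenvalues finite_multiplicity by blast

text \<open>With \<open>R = (T - c)\<^sup>-\<^sup>1\<close> and \<open>m\<close> its norm on the orthogonal complement of \<open>W\<close>, nearly
 maximizing vectors \<open>a\<close> make \<open>(R\<^sup>2 - m\<^sup>2) a = (R - m) (R + m) a\<close> small, so that one of
 \<open>c \<plusminus> 1/m\<close> is an approximate eigenvalue.\<close>

lemma resolvent_gap: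
 fixes c d :: real
 assumes c: "of_real c \<in> resolvent_set M T" and d: "d > 0"
  and W: "\<And>e. e \<in> W ==> \<exists>y::real. (e, %t. of_real y * e t) \<in> T"
  and bb: "\<And>y::real. \<bar>y - c\<bar> < d ==> \<exists>C. \<forall>f g. (f, g) \<in> T --> (\<forall>e\<in>W. inn f e = 0) -->
    nm f \<le> C * nm (%t. g t - of_real y * f t)"
  and fg: "(f, g) \<in> T" and fW: "\<And>e. e \<in> W ==> inn f e = 0"
 shows "d * nm f \<le> nm (%t. g t - of_real c * f t)"
proof -
 define V where "V = {f. \<forall>e\<in>W. inn f e = 0}"
 have WL: "e \<in> W ==> e \<in> L2 M" for e using W T_L2(1) by blast
 obtain C where C: "C \<ge> 0" "\<And>f g. (f, g) \<in> T ==> nm f \<le> C * nm (%t. g t - of_real c * f t)"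
  by (rule resolvent_bound[OF c]) blast
 \<comment> \<open>The resolvent at \<open>c\<close> as a relation, restricted to the complement
   \<open>V\<close> of the exceptional eigenvectors. \<open>V\<close> is invariant because each
   vector of \<open>W\<close> is an eigenvector for a real eigenvalue.\<close>
 define R where "R a f \<longleftrightarrow> a \<in> L2 M \<and> a \<in> V \<and> f \<in> V \<and> (f, %t. a t + of_real c * f t) \<in> T" for a f
 have R_L2: "a \<in> L2 M" "f \<in> L2 M" if "R a f" for a f using that T_L2(1) unfolding R_def by blast+
 have V_lin: "(%t. p * a t + q * b t) \<in> V" if "a \<in> V" "b \<in> V" "a \<in> L2 M" "b \<in> L2 M" for a b p q
  using that WL by (simp add: V_def L2_inner_add_left L2_inner_cmult_left L2_cmult)
 have R_solve: "\<exists>f. R a f" if a: "a \<in> L2 M" "a \<in> V" for a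
 proof -
  obtain f where f: "(f, %t. a t + of_real c * f t) \<in> T" using resolvent_solve[OF c a(1)] by blast
  have "inn f e = 0" if e: "e \<in> W" for e
  proof -
   obtain y :: real where y: "(e, %t. of_real y * e t) \<in> T" using W[OF e] by blast
   have "inn (%t. a t + of_real c * f t) e = of_real y * inn f e"
    using T_symmetric[OF y f] by (simp add: L2_inner_cmult_right)
   then have *: "of_real c * inn f e = of_real y * inn f e"
    using a e WL[OF e] T_L2(1)[OF f] by (simp add: L2_inner_add_left L2_cmult L2_inner_cmult_left V_def)
   show ?thesis
   proof (cases "y = c")
    case True
    have "nm e \<le> C * nm (%t. of_real y * e t - of_real c * e t)" by (rule C(2)[OF y])
    then have "nm e = 0" using True L2_norm_nonneg[of M e] by simp
    then show ?thesis using L2_Cauchy_Schwarz[OF T_L2(1)[OF f] WL[OF e]] by simp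
   qed (use * in simp)
  qed
  then show ?thesis using f a by (auto simp: R_def V_def)
 qed
 have R_lin: "R (%t. p * a t + q * b t) (%t. p * f t + q * h t)" if "R a f" "R b h" for a b f h p q
 proof -
  have eq: "(%t. (p * a t + q * b t) + of_real c * (p * f t + q * h t)) = (%t. p * (a t + of_real c * f t) + q * (b t + of_real c * h t))"
   by (rule ext) (simp add: algebra_simps)
  have "(%t. p * f t + q * h t, %t. (p * a t + q * b t) + of_real c * (p * f t + q * h t)) \<in> T"
   unfolding eq using that by (intro T_lincomb) (simp_all add: R_def)
  then show ?thesis using V_lin[of a b p q] V_lin[of f h p q] that R_L2[OF that(1)] R_L2[OF that(2)]
   unfolding R_def by (simp add: L2_add L2_cmult)
 qed
 have R_C: "nm f \<le> C * nm a" if "R a f" for a f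
  using C(2)[of f "%t. a t + of_real c * f t"] that by (simp add: R_def)
 define X where "X = {nm f | a f. R a f \<and> nm a \<le> 1}"
 have "R (%_. 0) (%_. 0)" by (simp add: R_def V_def)
 then have X0: "0 \<in> X" unfolding X_def using L2_norm_zero[of M] by (force intro!: exI[of _ "%_. 0"])
 have Xb: "x \<le> C" if x: "x \<in> X" for x
 proof -
  obtain a f where af: "x = nm f" "R a f" "nm a \<le> 1" using x by (auto simp: X_def)
  show ?thesis using R_C[OF af(2)] mult_left_le[OF af(3) C(1)] af(1) by linarith
 qed
 have bX: "bdd_above X" using Xb by (rule bdd_aboveI)
 define m where "m = Sup X"
 have Xm: "x \<in> X ==> x \<le> m" for x unfolding m_def by (rule cSup_upper[OF _ bX])
 have m0: "m \<ge> 0" using Xm[OF X0] .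
 have R_m: "nm f \<le> m * nm a" if af: "R a f" for a f
 proof (cases "nm a = 0")
  case True
  then show ?thesis using R_C[OF af] by simp
 next
  case False
  then have n: "nm a > 0" by (simp add: order_less_le)
  let ?c = "of_real (1 / nm a) :: complex"
  have cn: "cmod ?c = 1 / nm a" using n by (simp add: norm_divide)
  have "R (%t. ?c * a t + 0 * a t) (%t. ?c * f t + 0 * f t)" by (rule R_lin[OF af af])
  then have "R (%t. ?c * a t) (%t. ?c * f t)" by (simp only: mult_zero_left add_0_right)
  moreover have "nm (%t. ?c * a t) \<le> 1" unfolding L2_norm_cmult cn using n by simp
  ultimately have "nm (%t. ?c * f t) \<in> X" unfolding X_def by blast
  then have "nm f / nm a \<le> m" using Xm unfolding L2_norm_cmult cn by fastforce
  then show ?thesis using n by (simp add: field_simps)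
 qed
 have md: "m \<le> 1 / d"
 proof (rule ccontr)
  assume "\<not> m \<le> 1 / d"
  then have md: "m > 1 / d" by simp
  have "1 / d > 0" using d by simp
  then have mp: "m > 0" using md by linarith
  have im: "1 / m < d" "\<bar>1 / m\<bar> < d" "\<bar>- (1 / m)\<bar> < d" using md mp d by (auto simp: field_simps)
  obtain C1 where C1: "\<And>f g. (f, g) \<in> T ==> f \<in> V ==> nm f \<le> C1 * nm (%t. g t - of_real (c + 1 / m) * f t)"
   using bb[of "c + 1 / m"] im unfolding V_def by auto
  obtain C2 where C2: "\<And>f g. (f, g) \<in> T ==> f \<in> V ==> nm f \<le> C2 * nm (%t. g t - of_real (c - 1 / m) * f t)"
   using bb[of "c - 1 / m"] im unfolding V_def by auto
  \<comment> \<open>\<open>C1\<close>, belonging to \<open>c + 1/m\<close>, bounds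
    \<open>b = (R + m) a\<close> by a multiple of the norm of \<open>(R^2 - m^2) a\<close>;
    \<open>C2\<close>, belonging to \<open>c - 1/m\<close>, bounds \<open>f = R a\<close> by a
    multiple of the norm of \<open>b\<close>. \<open>K\<close> is the product of the two
    constants.\<close>
  define K where "K = \<bar>C2\<bar> / m * ((\<bar>C1\<bar> / m + 1) / m)"
  have K0: "K \<ge> 0" unfolding K_def using mp by simp
  have est: "(nm f)^2 * (1 + (K * m)^2) \<le> (K * m)^2 * m^2" if af: "R a f" and a1: "nm a \<le> 1" for a f
  proof -
   have aL: "a \<in> L2 M" and fL: "f \<in> L2 M" using R_L2[OF af] .
   obtain p where p: "R f p" using R_solve[of f] af fL unfolding R_def by blast
   have pL: "p \<in> L2 M" using R_L2[OF p] by blast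
   have fT: "(f, %t. a t + of_real c * f t) \<in> T" and pT: "(p, %t. f t + of_real c * p t) \<in> T"
    using af p by (auto simp: R_def)
   \<comment> \<open>The resolvent at the real point \<open>c\<close> is symmetric, so the inner
     product of \<open>R^2 a\<close> with \<open>a\<close> is the squared norm of
     \<open>R a\<close>. Hence the norm of \<open>(R^2 - m^2) a\<close> is small when
     \<open>a\<close> is nearly maximizing.\<close>
   have pa: "inn p a = of_real ((nm f)^2)"
    using T_symmetric[OF fT pT] aL fL pL
    by (simp add: L2_inner_add_left L2_inner_add_right L2_cmult L2_inner_cmult_left L2_inner_cmult_right L2_inner_self)
   define \<delta> where "\<delta> = nm (%t. p t - of_real (m^2) * a t)"
   have "\<delta>^2 = (nm p)^2 - 2 * (m^2 * (nm f)^2) + (m^2 * nm a)^2"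
    unfolding \<delta>_def L2_norm_diff_sq[OF pL L2_cmult[OF aL]] L2_inner_cmult_right L2_norm_cmult pa
    by (simp add: power_mult_distrib norm_power flip: of_real_power of_real_mult)
   also have "(nm p)^2 \<le> (m * nm f)^2" using R_m[OF p] by (intro power_mono) auto
   also have "(m^2 * nm a)^2 \<le> (m^2 * 1)^2" using a1 by (intro power_mono mult_left_mono) auto
   finally have d2: "\<delta>^2 \<le> m^2 * (m^2 - (nm f)^2)" by (simp add: power_mult_distrib power2_eq_square algebra_simps)
   define b where "b = (%t. 1 * f t + of_real m * a t)"
   define q where "q = (%t. 1 * p t + of_real m * f t)"
   have bq: "R b q" unfolding b_def q_def by (rule R_lin[OF p af])
   have bL: "b \<in> L2 M" and qL: "q \<in> L2 M" using R_L2[OF bq] .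
   have mi: "cmod (of_real (1 / m)) = 1 / m" using mp by (simp add: norm_divide)
   have e1: "(%t. (b t + of_real c * q t) - of_real (c + 1 / m) * q t) = (%t. of_real (1 / m) * (of_real (m^2) * a t - p t))"
   proof
    fix t
    have "of_real m * ((b t + of_real c * q t) - of_real (c + 1 / m) * q t) = of_real (m^2) * a t - p t"
     using mp by (simp add: b_def q_def field_simps power2_eq_square)
    then have "of_real (1 / m) * (of_real m * ((b t + of_real c * q t) - of_real (c + 1 / m) * q t)) = of_real (1 / m) * (of_real (m^2) * a t - p t)"
     by (rule arg_cong)
    moreover have "of_real (1 / m) * (of_real m * w) = w" for w :: complex using mp by simp
    ultimately show "(b t + of_real c * q t) - of_real (c + 1 / m) * q t = of_real (1 / m) * (of_real (m^2) * a t - p t)"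
     by (simp only:)
   qed
   have "nm q \<le> C1 * nm (%t. (b t + of_real c * q t) - of_real (c + 1 / m) * q t)"
    using C1 bq by (simp add: R_def)
   also have "... = C1 * (1 / m * \<delta>)" unfolding e1 L2_norm_cmult mi \<delta>_def by (simp only: L2_norm_minus_commute[of M p])
   also have "... \<le> \<bar>C1\<bar> * (1 / m * \<delta>)" using mp by (intro mult_right_mono) (auto simp: \<delta>_def)
   finally have q1: "nm q \<le> \<bar>C1\<bar> / m * \<delta>" by simp
   have e2: "b = (%t. of_real (1 / m) * (q t + (of_real (m^2) * a t - p t)))"
    by (rule ext) (use mp in "simp add: b_def q_def field_simps power2_eq_square")
   have "nm b = 1 / m * nm (%t. q t + (of_real (m^2) * a t - p t))"
    by (subst e2) (simp only: L2_norm_cmult mi)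
   also have "... \<le> 1 / m * (nm q + \<delta>)"
    using L2_norm_triangle[OF qL L2_diff[OF L2_cmult[OF aL] pL], of "of_real (m^2)"] mp
    unfolding \<delta>_def L2_norm_minus_commute[of M p] by (intro mult_left_mono) auto
   also have "... \<le> 1 / m * (\<bar>C1\<bar> / m * \<delta> + \<delta>)" using q1 mp by (intro mult_left_mono) auto
   also have "... = (\<bar>C1\<bar> / m + 1) / m * \<delta>" using mp by (simp add: field_simps)
   finally have b1: "nm b \<le> (\<bar>C1\<bar> / m + 1) / m * \<delta>" .
   have e3: "(%t. (a t + of_real c * f t) - of_real (c - 1 / m) * f t) = (%t. of_real (1 / m) * b t)"
    by (rule ext) (use mp in "simp add: b_def field_simps")
   have "nm f \<le> C2 * nm (%t. (a t + of_real c * f t) - of_real (c - 1 / m) * f t)"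
    using C2 af by (simp add: R_def)
   also have "... = C2 * (1 / m * nm b)" unfolding e3 L2_norm_cmult mi ..
   also have "... \<le> \<bar>C2\<bar> * (1 / m * nm b)" using mp by (intro mult_right_mono) auto
   also have "... \<le> \<bar>C2\<bar> * (1 / m * ((\<bar>C1\<bar> / m + 1) / m * \<delta>))" using mp b1 by (intro mult_left_mono) auto
   also have "... = K * \<delta>" unfolding K_def by simp
   finally have "(nm f)^2 \<le> (K * \<delta>)^2" by (intro power_mono) auto
   also have "... \<le> K^2 * (m^2 * (m^2 - (nm f)^2))" unfolding power_mult_distrib by (intro mult_left_mono d2) auto
   finally show ?thesis by (simp add: algebra_simps power_mult_distrib)
  qed
  \<comment> \<open>Solving \<open>est\<close> for the norm of \<open>f\<close> gives the bound
    \<open>sqrt \<theta> * m\<close> for all unit vectors, with \<open>\<theta> < 1\<close>; this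
    contradicts that \<open>m\<close> is the supremum.\<close>
  define \<theta> where "\<theta> = (K * m)^2 / (1 + (K * m)^2)"
  have k1: "1 + (K * m)^2 > 0" by (rule add_pos_nonneg) auto
  have th: "0 \<le> \<theta>" "\<theta> < 1" unfolding \<theta>_def using k1 by (simp_all add: divide_less_eq)
  have "x \<le> sqrt \<theta> * m" if x: "x \<in> X" for x
  proof -
   obtain a f where af: "x = nm f" "R a f" "nm a \<le> 1" using x by (auto simp: X_def)
   have "x^2 \<le> \<theta> * m^2" using est[OF af(2,3)] k1 unfolding \<theta>_def af(1) by (simp add: pos_le_divide_eq)
   also have "... = (sqrt \<theta> * m)^2" using th by (simp add: power_mult_distrib)
   finally show ?thesis by (rule power2_le_imp_le) (use th m0 in simp)
  qed
  then have "m \<le> sqrt \<theta> * m" unfolding m_def using X0 by (intro cSup_least) auto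
  moreover have "sqrt \<theta> < 1" using th by simp
  ultimately show False using mp by simp
 qed
 have fV: "f \<in> V" using fW by (simp add: V_def)
 have aV: "(%t. g t - of_real c * f t) \<in> V"
 proof -
  have "inn (%t. g t - of_real c * f t) e = 0" if e: "e \<in> W" for e
  proof -
   obtain y :: real where y: "(e, %t. of_real y * e t) \<in> T" using W[OF e] by blast
   have "inn g e = of_real y * inn f e"
    using T_symmetric[OF y fg] by (simp add: L2_inner_cmult_right)
   then show ?thesis using fW[OF e] T_L2[OF fg] WL[OF e]
    by (simp add: L2_inner_diff_left L2_cmult L2_inner_cmult_left)
  qed
  then show ?thesis by (simp add: V_def)
 qed
 have "R (%t. g t - of_real c * f t) f"
  using fV aV fg T_L2[OF fg] by (simp add: R_def L2_diff L2_cmult)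
 from R_m[OF this] have "nm f \<le> 1 / d * nm (%t. g t - of_real c * f t)"
  using mult_right_mono[OF md L2_norm_nonneg] by (rule order_trans)
 then show ?thesis using d by (simp add: field_simps)
qed

end

section \<open>From discrete spectrum to the compactness estimate\<close>

context selfadjoint_graph
begin

text \<open>Since \<open>z \<plusminus> \<delta>\<close> have distance at least \<open>\<delta>\<close> from the spectrum, \<open>A = T - z\<close> satisfies
 \<open>2 \<delta> \<bar>\<langle>A u, u\<rangle>\<bar> \<le> \<parallel>A u\<parallel>\<^sup>2\<close>; polarizing, \<open>\<langle>A u, f\<rangle>\<close> is controlled by \<open>\<parallel>A u\<parallel> \<parallel>A f\<parallel>\<close>, and
 \<open>A u\<close> can be chosen close to \<open>f\<close>.\<close>

lemma isolated_point_bounded_below: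
 fixes z \<delta> :: real
 assumes \<delta>: "\<delta> > 0" and iso: "\<And>y::real. y \<noteq> z ==> \<bar>y - z\<bar> < 2 * \<delta> ==> of_real y \<in> resolvent_set M T"
  and fg: "(f, g) \<in> T" and orth: "\<And>e. (e, %t. of_real z * e t) \<in> T ==> inn f e = 0"
 shows "2 * \<delta> * nm f \<le> nm (%t. g t - of_real z * f t)"
proof -
 define A where "A v u = (%t. v t - of_real z * u t)" for v u :: "'a \<Rightarrow> complex"
 have AL: "A v u \<in> L2 M" if "(u, v) \<in> T" for u v
  unfolding A_def using T_L2[OF that] by (intro L2_diff L2_cmult)
 \<comment> \<open>For \<open>c = z + \<delta>\<close> and \<open>c = z - \<delta>\<close> every
   real point at distance less than \<open>\<delta>\<close> from \<open>c\<close> differs from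
   \<open>z\<close> and lies within \<open>2 * \<delta>\<close> of it. No spectrum is there, so the
   gap estimate applies without exceptional vectors.\<close>
 have gap: "\<delta> * nm u \<le> nm (%t. v t - of_real c * u t)"
  if uv: "(u, v) \<in> T" and c: "\<bar>c - z\<bar> = \<delta>" for u v c
 proof (rule resolvent_gap[where W = "{}", OF _ \<delta> _ _ uv])
  show "of_real c \<in> resolvent_set M T" using iso[of c] c \<delta> by auto
  fix y :: real assume y: "\<bar>y - c\<bar> < \<delta>"
  have "y \<noteq> z" "\<bar>y - z\<bar> < 2 * \<delta>" using y c by linarith+
  then have "of_real y \<in> resolvent_set M T" by (rule iso)
  then obtain C where "\<And>f g. (f, g) \<in> T ==> nm f \<le> C * nm (%t. g t - of_real y * f t)"
   by (rule resolvent_bound) blast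
  then show "\<exists>C. \<forall>f g. (f, g) \<in> T --> (\<forall>e\<in>{}. inn f e = 0) --> nm f \<le> C * nm (%t. g t - of_real y * f t)"
   by (intro exI[of _ C] allI impI)
 qed auto
 have quad: "2 * \<delta> * \<bar>Re (inn (A v u) u)\<bar> \<le> (nm (A v u))^2" if uv: "(u, v) \<in> T" for u v
 proof -
  have sq: "0 \<le> (nm (A v u))^2 - 2 * (s * Re (inn (A v u) u))" if s: "\<bar>s\<bar> = \<delta>" for s
  proof -
   have "\<delta> * nm u \<le> nm (%t. v t - of_real (z + s) * u t)"
    by (rule gap[OF uv]) (use s in simp)
   also have "(%t. v t - of_real (z + s) * u t) = (%t. A v u t - of_real s * u t)"
    by (rule ext) (simp add: A_def algebra_simps)
   finally have "(\<delta> * nm u)^2 \<le> (nm (%t. A v u t - of_real s * u t))^2"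
    using \<delta> by (intro power_mono) auto
   also have "... = (nm (A v u))^2 - 2 * (s * Re (inn (A v u) u)) + (\<delta> * nm u)^2"
    unfolding L2_norm_diff_sq[OF AL[OF uv] L2_cmult[OF T_L2(1)[OF uv]]] L2_inner_cmult_right L2_norm_cmult
    by (simp add: s)
   finally show ?thesis by simp
  qed
  show ?thesis using sq[of \<delta>] sq[of "- \<delta>"] \<delta> by (simp add: abs_if)
 qed
 have polar: "4 * \<delta> * Re (inn (A v u) f) \<le> (nm (A v u))^2 + (nm (A g f))^2"
  if uv: "(u, v) \<in> T" for u v
 proof -
  have L: "A v u \<in> L2 M" "A g f \<in> L2 M" "u \<in> L2 M" "f \<in> L2 M" using AL uv fg T_L2(1) by blast+
  have ap: "A (%t. v t + g t) (%t. u t + f t) = (%t. A v u t + A g f t)"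
   and am: "A (%t. v t - g t) (%t. u t - f t) = (%t. A v u t - A g f t)"
   by (auto simp: A_def algebra_simps)
  have "inn (A g f) u = inn f (A v u)"
   using T_symmetric[OF uv fg] T_L2[OF uv] T_L2[OF fg]
   by (simp add: A_def L2_inner_diff_left L2_inner_diff_right L2_cmult L2_inner_cmult_left L2_inner_cmult_right)
  then have "inn (A g f) u = cnj (inn (A v u) f)" by (simp add: L2_inner_cnj)
  then have sym: "Re (inn (A g f) u) = Re (inn (A v u) f)" by simp
  have p: "2 * \<delta> * \<bar>Re (inn (%t. A v u t + A g f t) (%t. u t + f t))\<bar> \<le> (nm (%t. A v u t + A g f t))^2"
   using quad[OF T_add[OF uv fg]] by (simp only: ap)
  have m: "2 * \<delta> * \<bar>Re (inn (%t. A v u t - A g f t) (%t. u t - f t))\<bar> \<le> (nm (%t. A v u t - A g f t))^2"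
   using quad[OF T_diff[OF uv fg]] by (simp only: am)
  define P where "P = Re (inn (%t. A v u t + A g f t) (%t. u t + f t))"
  define Q where "Q = Re (inn (%t. A v u t - A g f t) (%t. u t - f t))"
  have PQ: "P - Q = 4 * Re (inn (A v u) f)"
   unfolding P_def Q_def
   by (simp add: L L2_inner_add_left L2_inner_add_right L2_inner_diff_left L2_inner_diff_right L2_add L2_diff sym)
  have "2 * \<delta> * (P - Q) \<le> 2 * \<delta> * \<bar>P\<bar> + 2 * \<delta> * \<bar>Q\<bar>"
   using \<delta> by (simp only: distrib_left[symmetric]) (intro mult_left_mono, auto)
  also have "... \<le> 2 * (nm (A v u))^2 + 2 * (nm (A g f))^2"
   using p m L2_parallelogram[OF L(1,2)] unfolding P_def Q_def by linarith
  finally show ?thesis unfolding PQ by (simp add: algebra_simps)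
 qed
 have fL: "f \<in> L2 M" using T_L2(1)[OF fg] .
 have ex: "\<exists>s. s \<in> {%t. v t - of_real z * u t | u v. (u, v) \<in> T} \<and> nm (%t. f t - s t) < 1 / Suc n" for n
 proof -
  have "\<exists>s\<in>{%t. v t - of_real z * u t | u v. (u, v) \<in> T}. nm (%t. f t - s t) < 1 / Suc n"
  proof (rule L2_biorthogonal_in_closure[OF L2_subspace_range fL])
   fix w assume w: "w \<in> L2 M" "\<And>s. s \<in> {%t. v t - of_real z * u t | u v. (u, v) \<in> T} ==> inn s w = 0"
   have "(w, %t. cnj (of_real z) * w t) \<in> T"
    by (rule orthogonal_to_range[OF w(1)], rule w(2)) auto
   then show "inn f w = 0" using orth by simp
  qed simp
  then show ?thesis by (simp only: Bex_def)
 qed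
 define Q where "Q n s \<longleftrightarrow> s \<in> {%t. v t - of_real z * u t | u v. (u, v) \<in> T} \<and> nm (%t. f t - s t) < 1 / Suc n" for n s
 have "\<exists>s. Q n s" for n using ex[of n] unfolding Q_def .
 then obtain s where "\<And>n. Q n (s n)" by metis
 then have s: "\<And>n. s n \<in> {%t. v t - of_real z * u t | u v. (u, v) \<in> T}"
  "\<And>n. nm (%t. f t - s n t) < 1 / Suc n" unfolding Q_def by blast+
 have sL: "s n \<in> L2 M" for n using s(1)[of n] AL by (auto simp: A_def)
 \<comment> \<open>The polarized inequality is not homogeneous in \<open>u\<close>. When
   \<open>s n\<close> tends to \<open>f\<close>, the scaling of \<open>u\<close> by
   \<open>2 * \<delta>\<close> is the one that maximises the resulting lower bound for
   \<open>T - z\<close>.\<close>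
 have sp: "8 * \<delta>^2 * Re (inn (s n) f) \<le> 4 * \<delta>^2 * (nm (s n))^2 + (nm (A g f))^2" for n
 proof -
  obtain u v where uv: "(u, v) \<in> T" "s n = A v u" using s(1)[of n] by (auto simp: A_def)
  have e: "A (%t. of_real (2 * \<delta>) * v t) (%t. of_real (2 * \<delta>) * u t) = (%t. of_real (2 * \<delta>) * s n t)"
   by (rule ext) (simp add: uv(2) A_def algebra_simps)
  have cn: "cmod (of_real (2 * \<delta>)) = 2 * \<delta>" using \<delta> by (simp add: norm_mult)
  have re: "Re (of_real (2 * \<delta>) * w) = 2 * \<delta> * Re w" for w by simp
  have "4 * \<delta> * (2 * \<delta> * Re (inn (s n) f)) \<le> (2 * \<delta> * nm (s n))^2 + (nm (A g f))^2"
   using polar[OF T_cmult[OF uv(1), of "of_real (2 * \<delta>)"]] unfolding e L2_inner_cmult_left L2_norm_cmult cn re .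
  then show ?thesis by (simp add: power2_eq_square algebra_simps)
 qed
 have sf: "(%n. nm (%t. s n t - f t)) \<longlonglongrightarrow> 0"
 proof (rule Lim_null_comparison[OF _ LIMSEQ_Suc[OF lim_1_over_n]])
  show "\<forall>\<^sub>F n in sequentially. norm (nm (%t. s n t - f t)) \<le> 1 / real (Suc n)"
   using s(2) by (auto simp: L2_norm_minus_commute[of M _ f] less_imp_le)
 qed
 have "8 * \<delta>^2 * Re (inn f f) \<le> 4 * \<delta>^2 * (nm f)^2 + (nm (A g f))^2"
 proof (rule LIMSEQ_le)
  show "(%n. 8 * \<delta>^2 * Re (inn (s n) f)) \<longlonglongrightarrow> 8 * \<delta>^2 * Re (inn f f)"
   by (intro tendsto_intros L2_inner_tendsto_left[OF sL fL fL sf])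
  show "(%n. 4 * \<delta>^2 * (nm (s n))^2 + (nm (A g f))^2) \<longlonglongrightarrow> 4 * \<delta>^2 * (nm f)^2 + (nm (A g f))^2"
   by (intro tendsto_intros L2_norm_tendsto[OF sL fL sf])
 qed (use sp in blast)
 then have "(2 * \<delta> * nm f)^2 \<le> (nm (A g f))^2"
  by (simp add: L2_inner_self power_mult_distrib)
 then show ?thesis unfolding A_def by (rule power2_le_imp_le) simp
qed

text \<open>The definition only isolates the points of the spectrum. A limit point outside would lie
  in the resolvent set, but the bound there fails for unit eigenvectors to nearby eigenvalues. This
  makes the spectrum finite in every disc.\<close>

lemma discrete_spectrum_no_limpt:
 assumes disc: "has_discrete_spectrum M T"
 shows "\<not> z islimpt op_spectrum M T"
proof
 assume z: "z islimpt op_spectrum M T"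
 have "z \<notin> op_spectrum M T"
  using disc z unfolding has_discrete_spectrum_def isolated_in_islimpt_iff by blast
 then have "z \<in> resolvent_set M T" by (simp add: op_spectrum_def)
 then obtain C where C: "C \<ge> 0" "\<And>f g. (f, g) \<in> T ==> nm f \<le> C * nm (%t. g t - z * f t)"
  by (rule resolvent_bound) blast
 have "1 / (C + 1) > 0" using C(1) by simp
 then obtain y where y: "y \<in> op_spectrum M T" "dist y z < 1 / (C + 1)"
  using z unfolding islimpt_approachable by blast
 then have "is_eigenvalue M T y" using disc unfolding has_discrete_spectrum_def by blast
 then obtain e where e: "(e, %t. y * e t) \<in> T" "nm e = 1" by (rule eigenvalue_obtain)
 have eq: "(%t. y * e t - z * e t) = (%t. (y - z) * e t)" by (rule ext) (simp add: algebra_simps)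
 have "1 \<le> C * dist y z"
  using C(2)[OF e(1)] unfolding eq L2_norm_cmult by (simp add: e(2) dist_norm)
 also have "... \<le> C * (1 / (C + 1))" using y(2) C(1) by (intro mult_left_mono) auto
 also have "... < 1" using C(1) by (simp add: divide_less_eq)
 finally show False by simp
qed

text \<open>A finite set spanning the eigenspace also separates it: an eigenvector orthogonal to the
  set is orthogonal to itself. The members of the set need not be eigenvectors, hence the passage to
  an orthonormal basis inside the eigenspace.\<close>

lemma discrete_spectrum_eigenvalue:
 assumes disc: "has_discrete_spectrum M T" and z: "z \<in> op_spectrum M T"
 shows "is_eigenvalue M T z" "\<exists>y::real. z = of_real y"
  and "\<exists>B. L2_orthonormal M B \<and> B \<subseteq> eigenspace M T z \<and> (\<forall>f\<in>eigenspace M T z. L2_eq M f (L2_proj M B f))"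
proof -
 show ev: "is_eigenvalue M T z" using disc z unfolding has_discrete_spectrum_def by blast
 show "\<exists>y::real. z = of_real y"
  using eigenvalue_real[OF ev] by (auto simp: complex_eq_iff intro: exI[of _ "Re z"])
 have "finite_multiplicity M T z" using disc z unfolding has_discrete_spectrum_def by blast
 then obtain E where E: "finite E" "E \<subseteq> L2 M"
  and Ec: "\<And>f. f \<in> eigenspace M T z ==> \<exists>c. L2_eq M f (%t. \<Sum>u\<in>E. c u * u t)"
  unfolding finite_multiplicity_def by blast
 show "\<exists>B. L2_orthonormal M B \<and> B \<subseteq> eigenspace M T z \<and> (\<forall>f\<in>eigenspace M T z. L2_eq M f (L2_proj M B f))"
 proof (rule finite_dimensional_orthonormal_basis[OF E L2_subspace_eigenspace])
  fix f assume f: "f \<in> eigenspace M T z" and 0: "\<And>e. e \<in> E ==> inn f e = 0"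
  obtain c where c: "L2_eq M f (%t. \<Sum>u\<in>E. c u * u t)" using Ec[OF f] by blast
  have fL: "f \<in> L2 M" using f T_L2(1) unfolding eigenspace_iff by blast
  have sL: "(%t. \<Sum>u\<in>E. c u * u t) \<in> L2 M" by (intro L2_sum L2_cmult) (use E(2) in blast)
  have "inn f f = inn f (%t. \<Sum>u\<in>E. c u * u t)"
   by (rule L2_inner_cong_AE(2)[OF fL[THEN L2_measurable] sL[THEN L2_measurable] fL[THEN L2_measurable] c[unfolded L2_eq_def]])
  also have "... = (\<Sum>u\<in>E. inn f (%t. c u * u t))"
   by (rule L2_inner_sum_right[OF L2_cmult fL]) (use E(2) in blast)
  also have "... = 0" by (simp add: L2_inner_cmult_right 0)
  finally show "nm f = 0" by (simp add: L2_inner_self)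
 qed
qed

text \<open>Eigenvectors to the finitely many spectral points within \<open>N\<close> of
  \<open>c\<close> form an orthonormal set \<open>W\<close>. Orthogonally to \<open>W\<close> the
  operator \<open>T - c\<close> is bounded below by \<open>N\<close>; along \<open>e\<close> in
  \<open>W\<close> the coefficient of \<open>f\<close> is that of \<open>g\<close> divided by the
  eigenvalue. Only functionals of \<open>g\<close> occur, because in the applications
  \<open>g\<close> is prescribed and \<open>f\<close> is not explicit; the price is that
  \<open>f\<close> must be orthogonal to the kernel.\<close>

theorem discrete_spectrum_bound:
 assumes disc: "has_discrete_spectrum M T" and \<epsilon>: "\<epsilon> > 0"
 shows "\<exists>E K. finite E \<and> E \<subseteq> L2 M \<and>
   (\<forall>f g. (f, g) \<in> T --> (\<forall>e. (e, %_. 0) \<in> T --> inn f e = 0) -->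
    nm f \<le> \<epsilon> * nm g + K * (\<Sum>e\<in>E. cmod (inn g e)))"
proof -
 let ?\<sigma> = "op_spectrum M T"
 have fin: "finite (?\<sigma> \<inter> cball a r)" for a r
  using finite_not_islimpt_in_compact[OF compact_cball discrete_spectrum_no_limpt[OF disc], of a r]
  by (simp only: Int_commute)
 \<comment> \<open>The spectrum meets every disc in a finite set, so it cannot contain all of
   \<open>(0,1)\<close>.\<close>
 obtain c :: real where c: "0 < c" "c < 1" "of_real c \<in> resolvent_set M T"
 proof -
  have "\<not> complex_of_real ` {0<..<1} \<subseteq> ?\<sigma> \<inter> cball 0 1"
  proof
   assume "complex_of_real ` {0<..<1} \<subseteq> ?\<sigma> \<inter> cball 0 1"
   then have "finite (complex_of_real ` {0<..<1})" using fin by (rule finite_subset)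
   then have "finite {0<..<1::real}" by (rule finite_imageD) (simp add: inj_on_def)
   then show False using infinite_Ioo[of "0::real" 1] by simp
  qed
  then show ?thesis using that by (auto simp: op_spectrum_def)
 qed
 \<comment> \<open>As \<open>c < 1\<close>, the bound \<open>N * nm f \<le> nm g + c * nm f\<close>
   gives \<open>nm f \<le> nm g / (N - 1)\<close>, and \<open>N\<close> makes
   \<open>1 / (N - 1)\<close> at most \<open>\<epsilon>\<close>.\<close>
 define N where "N = 2 + 1 / \<epsilon>"
 have N: "N > 2" "N - 1 > 0" "1 / (N - 1) \<le> \<epsilon>" using \<epsilon> by (auto simp: N_def field_simps)
 define Z where "Z = ?\<sigma> \<inter> cball (of_real c) N"
 have finZ: "finite Z" unfolding Z_def by (rule fin)
 define Q where "Q z B \<longleftrightarrow> L2_orthonormal M B \<and> B \<subseteq> eigenspace M T z \<and> (\<forall>f\<in>eigenspace M T z. L2_eq M f (L2_proj M B f))" for z B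
 have "\<exists>B. Q z B" if "z \<in> Z" for z
  using discrete_spectrum_eigenvalue(3)[OF disc] that unfolding Z_def Q_def by blast
 then obtain B where Q: "\<And>z. z \<in> Z ==> Q z (B z)" by metis
 have B1: "L2_orthonormal M (B z)" and B2: "B z \<subseteq> eigenspace M T z"
  and B3: "\<And>f. f \<in> eigenspace M T z ==> L2_eq M f (L2_proj M (B z) f)" if "z \<in> Z" for z
  using Q[OF that] unfolding Q_def by blast+
 define W where "W = (\<Union>z\<in>Z. B z)"
 have "\<exists>z. z \<in> Z \<and> e \<in> B z" if "e \<in> W" for e using that unfolding W_def by blast
 then obtain ev where ev: "\<And>e. e \<in> W ==> ev e \<in> Z \<and> e \<in> B (ev e)" by metis
 have WT: "(e, %t. ev e * e t) \<in> T" if "e \<in> W" for e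
  using ev[OF that] B2 unfolding eigenspace_iff[symmetric] by blast
 have WL: "e \<in> L2 M" if "e \<in> W" for e using T_L2(1)[OF WT[OF that]] .
 have Zreal: "\<exists>y::real. z = of_real y" if "z \<in> Z" for z
  using discrete_spectrum_eigenvalue(2)[OF disc] that unfolding Z_def by blast
 have W1: "L2_orthonormal M W"
  unfolding L2_orthonormal_def
 proof (intro conjI ballI)
  show "finite W" unfolding W_def using finZ B1 by (auto simp: L2_orthonormal_def)
  show "W \<subseteq> L2 M" using WL by blast
  fix u v assume uv: "u \<in> W" "v \<in> W"
  show "inn u v = (if u = v then 1 else 0)"
  proof (cases "ev u = ev v")
   case True
   then have "u \<in> B (ev u)" "v \<in> B (ev u)" using ev[OF uv(1)] ev[OF uv(2)] by auto
   then show ?thesis using B1 ev[OF uv(1)] by (auto simp: L2_orthonormal_def)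
  next
   case False
   then have "ev u \<noteq> cnj (ev v)" using Zreal[of "ev v"] ev[OF uv(2)] by auto
   then have "inn u v = 0" by (rule eigenvectors_orthogonal[OF WT[OF uv(1)] WT[OF uv(2)]])
   then show ?thesis using False by auto
  qed
 qed
 have finW: "finite W" using W1 by (simp add: L2_orthonormal_def)
 have gap: "(N - 1) * nm f \<le> nm g" if fg: "(f, g) \<in> T" and fW: "\<And>e. e \<in> W ==> inn f e = 0" for f g
 proof -
  have "N * nm f \<le> nm (%t. g t - of_real c * f t)"
  proof (rule resolvent_gap[OF c(3) _ _ _ fg fW])
   show "N > 0" using N by simp
   show "\<exists>y::real. (e, %t. of_real y * e t) \<in> T" if "e \<in> W" for e
    using WT[OF that] Zreal[of "ev e"] ev[OF that] by auto
   fix y :: real assume y: "\<bar>y - c\<bar> < N"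
   show "\<exists>C. \<forall>f g. (f, g) \<in> T --> (\<forall>e\<in>W. inn f e = 0) --> nm f \<le> C * nm (%t. g t - of_real y * f t)"
   proof (cases "of_real y \<in> ?\<sigma>")
    case False
    then have "of_real y \<in> resolvent_set M T" by (simp add: op_spectrum_def)
    then obtain C where "\<And>f g. (f, g) \<in> T ==> nm f \<le> C * nm (%t. g t - of_real y * f t)"
     by (rule resolvent_bound) blast
    then show ?thesis by (intro exI[of _ C] allI impI)
   next
    case True
    have yZ: "of_real y \<in> Z"
    proof -
     have "dist (complex_of_real c) (of_real y) = \<bar>c - y\<bar>" by (simp add: dist_norm flip: of_real_diff)
     then show ?thesis using True y by (simp add: Z_def abs_minus_commute)
    qed
    have "of_real y isolated_in ?\<sigma>" using disc True unfolding has_discrete_spectrum_def by blast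
    then obtain r where r: "r > 0" "\<And>w. w \<in> ?\<sigma> ==> dist (of_real y) w < r ==> w = of_real y"
     by (rule isolated_inE_dist) blast
    have iso: "of_real x \<in> resolvent_set M T" if x: "x \<noteq> y" "\<bar>x - y\<bar> < 2 * (r / 2)" for x :: real
    proof -
     have "dist (complex_of_real y) (of_real x) = \<bar>y - x\<bar>" by (simp add: dist_norm flip: of_real_diff)
     then have "dist (complex_of_real y) (of_real x) < r" using x by (simp add: abs_minus_commute)
     then have "of_real x \<notin> ?\<sigma>" using r(2)[of "of_real x"] x(1) by auto
     then show ?thesis by (simp add: op_spectrum_def)
    qed
    have "nm f \<le> (1 / r) * nm (%t. g t - of_real y * f t)"
     if fg: "(f, g) \<in> T" and f0: "\<forall>e\<in>W. inn f e = 0" for f g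
    proof -
     have "2 * (r / 2) * nm f \<le> nm (%t. g t - of_real y * f t)"
     proof (rule isolated_point_bounded_below[OF _ iso fg])
      fix e assume e: "(e, %t. of_real y * e t) \<in> T"
      then have "e \<in> eigenspace M T (of_real y)" unfolding eigenspace_iff .
      then have ae: "L2_eq M e (L2_proj M (B (of_real y)) e)" by (rule B3[OF yZ])
      have fL: "f \<in> L2 M" and eL: "e \<in> L2 M" using T_L2(1) fg e by blast+
      have BW: "u \<in> B (of_real y) ==> u \<in> W" for u using yZ unfolding W_def by blast
      have "inn f e = inn f (L2_proj M (B (of_real y)) e)"
       by (rule L2_inner_cong_AE(2)[OF eL[THEN L2_measurable] _ fL[THEN L2_measurable] ae[unfolded L2_eq_def]])
        (rule L2_proj_in[OF B1[OF yZ], THEN L2_measurable])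
      also have "... = (\<Sum>u\<in>B (of_real y). inn f (%t. inn e u * u t))"
       unfolding L2_proj_def by (rule L2_inner_sum_right[OF L2_cmult fL]) (use BW WL in blast)
      also have "... = 0" unfolding L2_inner_cmult_right using f0 BW by (intro sum.neutral) auto
      finally show "inn f e = 0" .
     qed (use r(1) in simp)
     then show ?thesis using r(1) by (simp add: field_simps)
    qed
    then show ?thesis by (intro exI[of _ "1 / r"] allI impI)
   qed
  qed
  also have "... \<le> nm g + nm (%t. of_real c * f t)"
   using T_L2[OF fg] by (intro L2_norm_triangle_diff L2_cmult)
  also have "... = nm g + c * nm f" unfolding L2_norm_cmult using c by simp
  also have "... \<le> nm g + 1 * nm f" using c by (intro add_mono mult_right_mono) auto
  finally show ?thesis by (simp add: algebra_simps)
 qed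
 \<comment> \<open>A zero eigenvalue contributes \<open>1 / 0 = 0\<close> here; its eigenvectors lie
   in the kernel, to which \<open>f\<close> is orthogonal, so they do not need a coefficient
   bound.\<close>
 define K where "K = (\<Sum>e\<in>W. 1 / cmod (ev e))"
 have K0: "K \<ge> 0" unfolding K_def by (intro sum_nonneg) auto
 have main: "nm f \<le> \<epsilon> * nm g + K * (\<Sum>e\<in>W. cmod (inn g e))"
  if fg: "(f, g) \<in> T" and ker: "\<forall>e. (e, %_. 0) \<in> T --> inn f e = 0" for f g
 proof -
  have fL: "f \<in> L2 M" and gL: "g \<in> L2 M" using T_L2[OF fg] by auto
  have ge: "inn g e = ev e * inn f e" if e: "e \<in> W" for e
  proof -
   have "inn g e = cnj (ev e) * inn f e"
    using T_symmetric[OF WT[OF e] fg] by (simp add: L2_inner_cmult_right)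
   then show ?thesis using Zreal[of "ev e"] ev[OF e] by auto
  qed
  have "(%t. \<Sum>e\<in>W. inn f e * e t, %t. \<Sum>e\<in>W. inn f e * (ev e * e t)) \<in> T"
   by (intro T_sum T_cmult WT)
  have pT: "(L2_proj M W f, L2_proj M W g) \<in> T"
  proof -
   have "(\<Sum>e\<in>W. inn f e * (ev e * e t)) = L2_proj M W g t" for t
    unfolding L2_proj_def by (rule sum.cong[OF refl]) (simp only: ge mult.assoc mult.left_commute)
   then show "(L2_proj M W f, L2_proj M W g) \<in> T"
    using \<open>(%t. \<Sum>e\<in>W. inn f e * e t, %t. \<Sum>e\<in>W. inn f e * (ev e * e t)) \<in> T\<close>
    by (simp only: L2_proj_def[of M W f])
  qed
  have "(N - 1) * nm (%t. f t - L2_proj M W f t) \<le> nm (%t. g t - L2_proj M W g t)"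
   by (rule gap[OF T_diff[OF fg pT] L2_proj_residual_orthogonal[OF W1 _ fL]])
  also have "... \<le> nm g" by (rule L2_Bessel[OF W1 gL])
  finally have "nm (%t. f t - L2_proj M W f t) \<le> 1 / (N - 1) * nm g"
   using N(2) by (simp add: field_simps)
  also have "... \<le> \<epsilon> * nm g" using N(3) by (intro mult_right_mono) auto
  finally have r: "nm (%t. f t - L2_proj M W f t) \<le> \<epsilon> * nm g" .
  have "nm (L2_proj M W f) \<le> (\<Sum>e\<in>W. nm (%t. inn f e * e t))"
   unfolding L2_proj_def by (intro L2_norm_sum_le L2_cmult WL)
  also have "... \<le> (\<Sum>e\<in>W. K * cmod (inn g e))"
  proof (rule sum_mono)
   fix e assume e: "e \<in> W"
   have "complex_of_real ((nm e)^2) = 1" using W1 e unfolding L2_inner_self[symmetric] by (simp add: L2_orthonormal_def)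
   then have "(nm e)^2 = 1" by (simp only: of_real_eq_1_iff)
   then have e1: "nm e = 1" using L2_norm_nonneg[of M e] by (simp add: power2_eq_1_iff)
   show "nm (%t. inn f e * e t) \<le> K * cmod (inn g e)"
   proof (cases "ev e = 0")
    case True
    then have "(e, %_. 0) \<in> T" using WT[OF e] by simp
    then have "inn f e = 0" using ker by blast
    then show ?thesis using K0 by (simp add: L2_norm_cmult)
   next
    case False
    have "1 / cmod (ev e) \<le> K" unfolding K_def using finW e by (intro member_le_sum) auto
    then have "1 / cmod (ev e) * cmod (inn g e) \<le> K * cmod (inn g e)" by (intro mult_right_mono) auto
    moreover have "1 / cmod (ev e) * cmod (inn g e) = cmod (inn f e)"
     using False ge[OF e] by (simp add: norm_mult)
    ultimately show ?thesis by (simp add: L2_norm_cmult e1)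
   qed
  qed
  finally have p: "nm (L2_proj M W f) \<le> K * (\<Sum>e\<in>W. cmod (inn g e))" by (simp add: sum_distrib_left)
  show ?thesis using L2_norm_triangle_sub[OF fL L2_proj_in[OF W1, of f]] p r by linarith
 qed
 show ?thesis
  by (rule exI[of _ W], rule exI[of _ K], intro conjI, rule finW, rule subsetI, erule WL, intro allI impI, erule (1) main)
qed

end

section \<open>Absolutely continuous functions\<close>

lemma sum_content_division_le:
 fixes D :: "real set set"
 assumes D: "D division_of S" and ST: "S \<subseteq> T" and T: "T \<in> lmeasurable"
 shows "(\<Sum>K\<in>D. measure lborel K) \<le> measure lebesgue T"
proof -
 have eq: "integral K (%_. 1::real) = measure lborel K" if K: "K \<in> D" for K
 proof -
  obtain u v where "K = cbox u v" using division_ofD(4)[OF D K] by blast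
  then show ?thesis by simp
 qed
 have Sm: "S \<in> lmeasurable" using D by (rule lmeasurable_division)
 have "(\<Sum>K\<in>D. measure lborel K) = integral S (%_. 1::real)"
 proof -
  have "integral S (%_. 1::real) = (\<Sum>K\<in>D. integral K (%_. 1))"
   by (rule integral_combine_division_topdown[OF _ D])
    (use Sm in "simp add: lmeasurable_iff_integrable_on")
  also have "... = (\<Sum>K\<in>D. measure lborel K)" by (rule sum.cong[OF refl eq])
  finally show ?thesis by simp
 qed
 also have "... = measure lebesgue S" using Sm by (simp add: lmeasure_integral)
 also have "... \<le> measure lebesgue T"
  by (rule measure_mono_fmeasurable[OF ST _ T]) (use Sm in auto)
 finally show ?thesis .
qed

text \<open>Tags in the exceptional null set are confined to an open set of small measure, where absolute
 continuity takes over from differentiability.\<close>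

lemma fundamental_theorem_of_calculus_abs_continuous:
 fixes F f :: "real \<Rightarrow> complex"
 assumes ac: "a \<le> c" and F: "abs_continuous_on {a..c} F" and N: "negligible N"
  and der: "\<And>t. t \<in> {a..c} - N ==> (F has_vector_derivative f t) (at t within {a..c})"
 shows "(f has_integral (F c - F a)) {a..c}"
proof -
 define f' where "f' t = (if t \<in> N then 0 else f t)" for t
 have "(f' has_integral (F c - F a)) (cbox a c)"
  unfolding has_integral
 proof (intro allI impI)
  fix e :: real assume e: "e > 0"
  define e1 where "e1 = e / (2 * (c - a + 1))"
  have e1: "e1 > 0" "e1 * (c - a) < e / 2" using e ac by (auto simp: e1_def field_simps)
  have "e / 2 > 0" using e by simp
  from F[unfolded abs_continuous_on_def, THEN spec, THEN mp, OF this] obtain \<delta> where \<delta>: "\<delta> > 0"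
   and AC0: "\<forall>D S'. D division_of S' \<and> S' \<subseteq> {a..c} \<and> (\<Sum>K\<in>D. measure lborel K) < \<delta> -->
    (\<Sum>K\<in>D. cmod (F (interval_upperbound K) - F (interval_lowerbound K))) < e / 2"
   by (elim exE conjE)
  note AC = AC0[rule_format, OF conjI[OF _ conjI]]
  have Nn: "N \<in> null_sets lebesgue" using N by (simp add: negligible_iff_null_sets)
  obtain T where T: "open T" "N \<subseteq> T" "T - N \<in> lmeasurable" "emeasure lebesgue (T - N) < ennreal \<delta>"
   using sets_lebesgue_outer_open[OF _ \<delta>, of N] Nn by auto
  have TmN: "emeasure lebesgue T = emeasure lebesgue (T - N)"
   using Nn T(1) by (intro emeasure_Diff_null_set[symmetric]) auto
  have Tm: "T \<in> lmeasurable"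
   using T(1) T(4) TmN by (intro fmeasurableI) (auto simp: less_top[symmetric] top_unique dest: order.strict_trans2)
  have Tl: "measure lebesgue T < \<delta>"
   using T(4) TmN \<delta> Tm by (metis emeasure_eq_measure2 ennreal_less_iff measure_nonneg)
  have "\<exists>d>0. \<forall>y\<in>{a..c}. norm (y - t) < d --> norm (F y - F t - (y - t) *\<^sub>R f t) \<le> e1 * norm (y - t)"
   if "t \<in> {a..c} - N" for t
   using der[OF that] e1(1) unfolding has_vector_derivative_def has_derivative_within_alt by blast
  then obtain d where d: "\<And>t. t \<in> {a..c} - N ==> d t > 0"
   "\<And>t y. t \<in> {a..c} - N ==> y \<in> {a..c} ==> norm (y - t) < d t ==> norm (F y - F t - (y - t) *\<^sub>R f t) \<le> e1 * norm (y - t)"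
   by metis
  define \<gamma> where "\<gamma> t = (if t \<in> N then T else if t \<in> {a..c} then ball t (d t) else ball t 1)" for t
  have g: "gauge \<gamma>" unfolding gauge_def \<gamma>_def using T d(1) by auto
  have "norm ((\<Sum>(x, K)\<in>p. measure lborel K *\<^sub>R f' x) - (F c - F a)) < e"
   if p: "p tagged_division_of cbox a c" "\<gamma> fine p" for p
  proof -
   have finp: "finite p" using p(1) by blast
   define p1 where "p1 = {(x, K) \<in> p. x \<in> N}"
   have p1p: "p1 \<subseteq> p" by (auto simp: p1_def)
   have tpd: "p1 tagged_partial_division_of cbox a c"
    using p(1) p1p by (metis tagged_division_of_def tagged_partial_division_subset)
   have tp1: "p1 tagged_division_of \<Union>(snd ` p1)" by (rule tagged_partial_division_of_Union_self[OF tpd])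
   have D1: "snd ` p1 division_of \<Union>(snd ` p1)" by (rule division_of_tagged_division[OF tp1])
   let ?d = "%x K. measure lborel K *\<^sub>R f' x - (F (Sup K) - F (Inf K))"
   \<comment> \<open>To rewrite a sum over tags as a sum over intervals, degenerate intervals must
     contribute zero. For the empty set this needs an explicit default, as its bounds carry no
     meaning.\<close>
   let ?D = "%K. if K = {} then 0 else cmod (F (interval_upperbound K) - F (interval_lowerbound K))"
   have Kform: "\<exists>u v. K = {u..v} \<and> u \<le> v \<and> x \<in> {u..v} \<and> {u..v} \<subseteq> {a..c}" if "(x, K) \<in> p" for x K
   proof -
    have "x \<in> K" "K \<subseteq> cbox a c" "\<exists>u v. K = cbox u v" using tagged_division_ofD(2,3,4)[OF p(1) that] by blast+
    then show ?thesis by fastforce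
   qed
   have ba: "c - a = (\<Sum>(x,K)\<in>p. Sup K - Inf K)" "F c - F a = (\<Sum>(x,K)\<in>p. F (Sup K) - F (Inf K))"
    using additive_tagged_division_1[OF ac, of p "%x. x"] additive_tagged_division_1[OF ac, of p F] p(1) by auto
   have b2: "norm (?d x K) \<le> e1 * (Sup K - Inf K)" if xK: "(x, K) \<in> p - p1" for x K
   proof -
    obtain u v where uv: "K = {u..v}" "u \<le> v" "x \<in> {u..v}" "{u..v} \<subseteq> {a..c}" using Kform xK by blast
    have xN: "x \<notin> N" using xK by (auto simp: p1_def)
    have x: "x \<in> {a..c} - N" using uv xN by blast
    have "K \<subseteq> ball x (d x)" using p(2) xK x unfolding fine_def \<gamma>_def by fastforce
    moreover have "u \<in> K" "v \<in> K" using uv by auto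
    ultimately have "u \<in> ball x (d x)" "v \<in> ball x (d x)" by blast+
    then have dx: "norm (u - x) < d x" "norm (v - x) < d x" by (simp_all add: dist_norm abs_minus_commute)
    have uvi: "u \<in> {a..c}" "v \<in> {a..c}" using uv \<open>u \<in> K\<close> \<open>v \<in> K\<close> by blast+
    have fu: "norm (F u - F x - (u - x) *\<^sub>R f x) \<le> e1 * norm (u - x)"
     and fv: "norm (F v - F x - (v - x) *\<^sub>R f x) \<le> e1 * norm (v - x)"
     using d(2)[OF x uvi(1) dx(1)] d(2)[OF x uvi(2) dx(2)] .
    have "norm (?d x K) = norm ((F u - F x - (u - x) *\<^sub>R f x) - (F v - F x - (v - x) *\<^sub>R f x))"
     using uv xN by (simp add: f'_def algebra_simps)
    also have "... \<le> e1 * norm (u - x) + e1 * norm (v - x)"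
     by (rule order_trans[OF norm_triangle_ineq4 add_mono[OF fu fv]])
    also have "... = e1 * (Sup K - Inf K)" using uv by (simp add: algebra_simps)
    finally show ?thesis .
   qed
   have b1: "norm (?d x K) = cmod (F (Sup K) - F (Inf K))" if "(x, K) \<in> p1" for x K
    using that by (simp add: p1_def f'_def norm_minus_commute)
   have "(\<Sum>(x,K)\<in>p. measure lborel K *\<^sub>R f' x) - (F c - F a) = (\<Sum>(x,K)\<in>p. ?d x K)"
    unfolding ba(2) by (simp add: sum_subtractf split_def)
   also have "norm ... \<le> (\<Sum>(x,K)\<in>p. norm (?d x K))"
    by (rule sum_norm_le) auto
   also have "... = (\<Sum>(x,K)\<in>p - p1. norm (?d x K)) + (\<Sum>(x,K)\<in>p1. norm (?d x K))"
    by (rule sum.subset_diff[OF p1p finp])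
   also have "(\<Sum>(x,K)\<in>p - p1. norm (?d x K)) \<le> (\<Sum>(x,K)\<in>p - p1. e1 * (Sup K - Inf K))"
    by (rule sum_mono) (use b2 in auto)
   also have "... \<le> (\<Sum>(x,K)\<in>p. e1 * (Sup K - Inf K))"
   proof (rule sum_mono2[OF finp])
    fix z assume "z \<in> p - (p - p1)"
    then obtain x K where z: "z = (x, K)" "(x, K) \<in> p" by (cases z) auto
    obtain u v where "K = {u..v}" "u \<le> v" using Kform[OF z(2)] by blast
    then show "0 \<le> (case z of (x, K) \<Rightarrow> e1 * (Sup K - Inf K))" using e1 z by simp
   qed auto
   also have "... = e1 * (c - a)" unfolding ba(1) by (simp add: sum_distrib_left split_def)
   also have "(\<Sum>(x,K)\<in>p1. norm (?d x K)) = (\<Sum>(x,K)\<in>p1. ?D K)"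
   proof (rule sum.cong[OF refl])
    fix z assume "z \<in> p1"
    then obtain x K where z: "z = (x, K)" "(x, K) \<in> p1" by (cases z) auto
    obtain u v where "K = {u..v}" "u \<le> v" using Kform[of x K] z(2) p1p by blast
    then show "(case z of (x, K) \<Rightarrow> norm (?d x K)) = (case z of (x, K) \<Rightarrow> ?D K)"
     using z b1[OF z(2)] by simp
   qed
   also have "... = (\<Sum>K\<in>snd ` p1. ?D K)"
    by (rule sum.over_tagged_division_lemma[OF tp1]) (auto simp: box_eq_empty)
   also have "... = (\<Sum>K\<in>snd ` p1. cmod (F (interval_upperbound K) - F (interval_lowerbound K)))"
    by (rule sum.cong[OF refl]) (use division_ofD(3)[OF D1] in auto)
   also have "... < e / 2"
   proof (rule AC[OF D1])
    show "\<Union>(snd ` p1) \<subseteq> {a..c}"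
    proof
     fix y assume "y \<in> \<Union>(snd ` p1)"
     then obtain x K where "(x, K) \<in> p1" "y \<in> K" by auto
     then have "(x, K) \<in> p" using p1p by blast
     then obtain u v where "K = {u..v}" "{u..v} \<subseteq> {a..c}" using Kform by blast
     then show "y \<in> {a..c}" using \<open>y \<in> K\<close> by blast
    qed
    have sT: "\<Union>(snd ` p1) \<subseteq> T"
    proof
     fix y assume "y \<in> \<Union>(snd ` p1)"
     then obtain x K where xK: "(x, K) \<in> p1" "y \<in> K" by auto
     then have "x \<in> N" "(x, K) \<in> p" by (auto simp: p1_def)
     then have "K \<subseteq> T" using p(2) unfolding fine_def \<gamma>_def by fastforce
     then show "y \<in> T" using xK by blast
    qed
    show "(\<Sum>K\<in>snd ` p1. measure lborel K) < \<delta>"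
     using sum_content_division_le[OF D1 sT Tm] Tl by linarith
   qed
   finally show ?thesis using e1(2) by simp
  qed
  then show "\<exists>\<gamma>. gauge \<gamma> \<and> (\<forall>\<D>. \<D> tagged_division_of cbox a c \<and> \<gamma> fine \<D> -->
    norm ((\<Sum>(x, K)\<in>\<D>. measure lborel K *\<^sub>R f' x) - (F c - F a)) < e)"
   using g by (intro exI[of _ \<gamma>]) auto
 qed
 then show ?thesis
  by (intro has_integral_spike[OF N, of "{a..c}" f f']) (auto simp: f'_def)
qed

text \<open>The differentiation theorem at hand controls averages over \<open>[t, t + h]\<close>
  only. Applied to the reflected function as well, it controls those over \<open>[t - h, t]\<close>,
  and the union of the two null sets, one of them reflected, serves for the two-sided derivative and
  for every base point \<open>a\<close>.\<close>

lemma indefinite_integral_vector_derivative_AE: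
 fixes w :: "real \<Rightarrow> complex"
 assumes w: "\<And>a c. w integrable_on {a..c}"
 obtains N where "negligible N"
  "\<And>a t. a < t ==> t \<notin> N ==> ((%t. integral {a..t} w) has_vector_derivative w t) (at t)"
proof -
 have w': "w integrable_on cbox a c" for a c using w by simp
 have wr: "(%t. w (- t)) integrable_on cbox a c" for a c using w[of "- c" "- a"] Henstock_Kurzweil_Integration.integrable_reflect_real[of w "- a" "- c"] by simp
 obtain N1 where N1: "negligible N1" "\<And>x e. [|x \<notin> N1; 0 < e|] ==>
   \<exists>d>0. \<forall>h. 0 < h \<and> h < d --> norm (integral (cbox x (x + h *\<^sub>R One)) w /\<^sub>R h ^ DIM(real) - w x) < e"
  using integrable_ccontinuous_explicit[OF w'] by metis
 obtain N2 where N2: "negligible N2" "\<And>x e. [|x \<notin> N2; 0 < e|] ==>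
   \<exists>d>0. \<forall>h. 0 < h \<and> h < d --> norm (integral (cbox x (x + h *\<^sub>R One)) (%t. w (- t)) /\<^sub>R h ^ DIM(real) - w (- x)) < e"
  using integrable_ccontinuous_explicit[OF wr] by metis
 define N where "N = N1 \<union> uminus ` N2"
 have "negligible N" unfolding N_def using N1(1) negligible_differentiable_image_negligible[OF order_refl N2(1), of uminus]
  by (intro negligible_Un) (auto intro!: derivative_intros simp: differentiable_on_def)
 moreover have "((%t. integral {a..t} w) has_vector_derivative w t) (at t)" if at: "a < t" and tN: "t \<notin> N" for a t
  unfolding has_vector_derivative_def has_derivative_within_alt
 proof (intro conjI allI impI)
  show "bounded_linear (%x. x *\<^sub>R w t)" by (rule bounded_linear_scaleR_left)
  fix e :: real assume e: "e > 0"
  obtain d1 where d1: "d1 > 0" "\<And>h. 0 < h ==> h < d1 ==> norm (integral {t..t + h} w /\<^sub>R h - w t) < e"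
   using N1(2)[of t e] tN e by (auto simp: N_def box_real)
  have "- t \<notin> N2" using tN by (force simp: N_def)
  then obtain d2 where d2: "d2 > 0" "\<And>h. 0 < h ==> h < d2 ==> norm (integral {- t..- t + h} (%t. w (- t)) /\<^sub>R h - w t) < e"
   using N2(2)[of "- t" e] e by (auto simp: box_real)
  have key: "norm (i - h *\<^sub>R w t) \<le> e * h" if "norm (i /\<^sub>R h - w t) < e" "h > 0" for i h
  proof -
   have "i - h *\<^sub>R w t = h *\<^sub>R (i /\<^sub>R h - w t)" using that(2) by (simp add: algebra_simps)
   then have "norm (i - h *\<^sub>R w t) = h * norm (i /\<^sub>R h - w t)" using that(2) by (simp only: norm_scaleR abs_of_pos)
   also have "... \<le> h * e" using that by (intro mult_left_mono) auto
   finally show ?thesis by (simp add: mult.commute)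
  qed
  have "norm (integral {a..y} w - integral {a..t} w - (y - t) *\<^sub>R w t) \<le> e * norm (y - t)"
   if y: "norm (y - t) < min (min d1 d2) (t - a)" for y
  proof -
   consider "y = t" | "y > t" | "y < t" by linarith
   then show ?thesis
   proof cases
    case 2
    have "integral {a..t} w + integral {t..y} w = integral {a..y} w"
     using 2 at by (intro Henstock_Kurzweil_Integration.integral_combine w) auto
    then have "integral {a..y} w - integral {a..t} w = integral {t..t + (y - t)} w" by (simp add: algebra_simps)
    then show ?thesis using key[OF d1(2)[of "y - t"]] 2 y by simp
   next
    case 3
    have ay: "a \<le> y" using y 3 by simp
    have "integral {a..y} w + integral {y..t} w = integral {a..t} w"
     using 3 ay by (intro Henstock_Kurzweil_Integration.integral_combine w) auto
    then have i: "integral {a..y} w - integral {a..t} w = - integral {y..t} w" by (simp add: algebra_simps)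
    have "integral {- t..- t + (t - y)} (%t. w (- t)) = integral {y..t} w"
     using Henstock_Kurzweil_Integration.integral_reflect_real[of t y w] by simp
    then have "norm (integral {y..t} w - (t - y) *\<^sub>R w t) \<le> e * (t - y)"
     using key[OF d2(2)[of "t - y"]] 3 y by simp
    moreover have "integral {a..y} w - integral {a..t} w - (y - t) *\<^sub>R w t = - (integral {y..t} w - (t - y) *\<^sub>R w t)"
     unfolding i by (simp add: algebra_simps)
    ultimately show ?thesis using 3 by (simp only: norm_minus_cancel) simp
   qed simp
  qed
  then show "\<exists>d>0. \<forall>y\<in>UNIV. norm (y - t) < d --> norm (integral {a..y} w - integral {a..t} w - (y - t) *\<^sub>R w t) \<le> e * norm (y - t)"
   using d1(1) d2(1) at by (intro exI[of _ "min (min d1 d2) (t - a)"]) auto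
 qed
 ultimately show ?thesis using that by blast
qed

text \<open>Square integrability makes the integral of \<open>w\<close> over short sets small by
  \<open>w \<le> 1 / (2 * \<tau>) + \<tau> / 2 * w^2\<close>: the quadratic part is below
  \<open>e / 2\<close> by the choice of \<open>\<tau>\<close>, and the rest is at most a constant
  times the total length, for which \<open>\<delta>\<close> is then chosen.\<close>

lemma abs_continuous_onI:
 fixes F :: "real \<Rightarrow> complex" and w :: "real \<Rightarrow> real"
 assumes C: "C \<ge> 0" and w: "w integrable_on {a..c}" "(%t. (w t)^2) integrable_on {a..c}"
  and F: "\<And>u v. a \<le> u ==> u \<le> v ==> v \<le> c ==> cmod (F v - F u) \<le> C * (v - u) + integral {u..v} w"
 shows "abs_continuous_on {a..c} F"
 unfolding abs_continuous_on_def
proof (intro allI impI)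
 fix e :: real assume e: "e > 0"
 define I where "I = integral {a..c} (%t. (w t)^2)"
 have I0: "I \<ge> 0" unfolding I_def by (intro integral_nonneg w) auto
 define \<tau> where "\<tau> = e / (I + 1)"
 have tau: "\<tau> > 0" "\<tau> * I < e" using e I0 by (auto simp: \<tau>_def field_simps)
 define \<delta> where "\<delta> = e / 2 / (C + 1 / (2 * \<tau>))"
 have pos: "C + 1 / (2 * \<tau>) > 0" using C tau by (intro add_nonneg_pos) auto
 have "q * (e / 2 / q) = e / 2" if "q > 0" for q using that by simp
 then have \<delta>: "\<delta> > 0" "(C + 1 / (2 * \<tau>)) * \<delta> = e / 2" using e pos unfolding \<delta>_def by (simp_all only: divide_pos_pos half_gt_zero)
 show "\<exists>\<delta>>0. \<forall>D S'. D division_of S' \<and> S' \<subseteq> {a..c} \<and> (\<Sum>K\<in>D. measure lborel K) < \<delta> -->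
    (\<Sum>K\<in>D. cmod (F (interval_upperbound K) - F (interval_lowerbound K))) < e"
 proof (intro exI[of _ \<delta>] conjI allI impI \<delta>(1))
  fix D S assume "D division_of S \<and> S \<subseteq> {a..c} \<and> (\<Sum>K\<in>D. measure lborel K) < \<delta>"
  then have D: "D division_of S" and S: "S \<subseteq> {a..c}" and m: "(\<Sum>K\<in>D. measure lborel K) < \<delta>" by auto
  let ?q = "%t. (w t)^2"
  have b: "cmod (F (interval_upperbound K) - F (interval_lowerbound K)) \<le> (C + 1 / (2 * \<tau>)) * measure lborel K + \<tau> / 2 * integral K ?q"
   and qK: "?q integrable_on K" if K: "K \<in> D" for K
  proof -
   obtain u v where uv: "K = cbox u v" using division_ofD(4)[OF D K] by blast
   have "K \<noteq> {}" "K \<subseteq> S" using division_ofD(2,3)[OF D K] by auto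
   then have u0: "K = {u..v}" "u \<le> v" using uv by auto
   then have "u \<in> S" "v \<in> S" using \<open>K \<subseteq> S\<close> by auto
   then have "u \<in> {a..c}" "v \<in> {a..c}" using S by blast+
   then have uv: "K = {u..v}" "u \<le> v" "a \<le> u" "v \<le> c" using u0 by auto
   have wi: "w integrable_on {u..v}" "?q integrable_on {u..v}"
    using w uv by (auto intro: integrable_on_subinterval)
   show "?q integrable_on K" using wi uv by simp
   have "integral {u..v} w \<le> integral {u..v} (%t. 1 / (2 * \<tau>) + \<tau> / 2 * (w t)^2)"
   proof (rule integral_le[OF wi(1)])
    show "(%t. 1 / (2 * \<tau>) + \<tau> / 2 * (w t)^2) integrable_on {u..v}"
     by (intro integrable_add integrable_const_ivl integrable_on_mult_right wi(2))
    fix t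
    have "0 \<le> (1 - \<tau> * w t)^2" by simp
    then have "2 * \<tau> * w t \<le> 1 + \<tau> * \<tau> * (w t)^2" by (simp add: power2_eq_square algebra_simps)
    then show "w t \<le> 1 / (2 * \<tau>) + \<tau> / 2 * (w t)^2" using tau(1) by (simp add: field_simps)
   qed
   also have "... = 1 / (2 * \<tau>) * (v - u) + \<tau> / 2 * integral {u..v} ?q"
    using uv by (subst Henstock_Kurzweil_Integration.integral_add) (auto intro: integrable_on_mult_right wi(2))
   finally show "cmod (F (interval_upperbound K) - F (interval_lowerbound K)) \<le> (C + 1 / (2 * \<tau>)) * measure lborel K + \<tau> / 2 * integral K ?q"
    using F[OF uv(3,2,4)] uv by (simp add: algebra_simps)
  qed
  have "(\<Sum>K\<in>D. cmod (F (interval_upperbound K) - F (interval_lowerbound K)))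
    \<le> (\<Sum>K\<in>D. (C + 1 / (2 * \<tau>)) * measure lborel K + \<tau> / 2 * integral K ?q)"
   by (rule sum_mono) (rule b)
  also have "... = (C + 1 / (2 * \<tau>)) * (\<Sum>K\<in>D. measure lborel K) + \<tau> / 2 * (\<Sum>K\<in>D. integral K ?q)"
   by (simp add: sum.distrib sum_distrib_left)
  also have "(\<Sum>K\<in>D. integral K ?q) = integral S ?q"
   by (rule integral_combine_division_bottomup[OF D qK, symmetric])
  also have "(C + 1 / (2 * \<tau>)) * (\<Sum>K\<in>D. measure lborel K) + \<tau> / 2 * integral S ?q < e / 2 + \<tau> / 2 * I"
  proof (rule add_less_le_mono)
   show "(C + 1 / (2 * \<tau>)) * (\<Sum>K\<in>D. measure lborel K) < e / 2"
    using mult_strict_left_mono[OF m pos] \<delta>(2) by simp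
   have "?q integrable_on S" using integrable_combine_division[OF D qK] .
   then have "integral S ?q \<le> I" unfolding I_def by (intro integral_subset_le[OF S] w) auto
   then show "\<tau> / 2 * integral S ?q \<le> \<tau> / 2 * I" using tau by (intro mult_left_mono) auto
  qed
  also have "... \<le> e" using tau by simp
  finally show "(\<Sum>K\<in>D. cmod (F (interval_upperbound K) - F (interval_lowerbound K))) < e" .
 qed
qed

section \<open>The maximal operator\<close>

lemma sigma_finite_lebesgue_on:
 assumes S: "S \<in> sets lebesgue"
 shows "sigma_finite_measure (lebesgue_on (S :: real set))"
proof (rule sigma_finite_measure_restrict_space[OF _ S])
 show "sigma_finite_measure (lebesgue :: real measure)"
 proof (standard, intro exI[of _ "range (%n::nat. {- real n..real n})"] conjI ballI)
  have "t \<in> (\<Union>n::nat. {- real n..real n})" for t :: real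
   using real_arch_simple[of "\<bar>t\<bar>"] by (auto simp: abs_le_iff minus_le_iff)
  then show "\<Union> (range (%n::nat. {- real n..real n})) = space lebesgue" by auto
 qed auto
qed

lemma Ivl_borel [measurable]: "Ivl b \<in> sets borel"
proof -
 have "Ivl b = {0..} \<inter> {t. ereal t < b}" by (auto simp: Ivl_def)
 then show ?thesis by simp
qed

lemma Ivl_lebesgue [measurable]: "Ivl b \<in> sets lebesgue"
 using Ivl_borel[of b] by simp

lemma space_Ivl_measure [simp]: "space (Ivl_measure b) = Ivl b"
 by simp

lemma id_borel_measurable_Ivl [measurable]: "(%t. t) \<in> borel_measurable (Ivl_measure b)"
 by (intro measurable_restrict_space1 measurable_completion) simp

lemma Ivl_downward: "t \<in> Ivl b ==> 0 \<le> s ==> s \<le> t ==> s \<in> Ivl b"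
 by (auto simp: Ivl_def intro: le_less_trans[of "ereal s" "ereal t"])

lemma Ivl_nonneg: "t \<in> Ivl b ==> 0 \<le> t"
 by (simp add: Ivl_def)

lemma lint_window:
 fixes c :: "'a :: {banach, second_countable_topology}"
 assumes "0 \<le> s" "s \<le> t" "t \<in> Ivl b"
 shows "integrable (Ivl_measure b) (%r. if s \<le> r \<and> r < t then c else 0)"
  and "(LINT r|Ivl_measure b. (if s \<le> r \<and> r < t then c else 0)) = (t - s) *\<^sub>R c"
proof -
 have sub: "{s..<t} \<subseteq> Ivl b" using assms by (auto intro: Ivl_downward)
 have m: "{s..<t} \<in> sets (Ivl_measure b)" using sub by (auto simp: sets_restrict_space_iff)
 have e: "emeasure (Ivl_measure b) {s..<t} = ennreal (t - s)"
  using sub assms(2) by (subst emeasure_restrict_space) auto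
 have "has_bochner_integral (Ivl_measure b) (%r. indicator {s..<t} r *\<^sub>R c) (measure (Ivl_measure b) {s..<t} *\<^sub>R c)"
  by (rule has_bochner_integral_scaleR_left[OF has_bochner_integral_real_indicator[OF m]]) (simp add: e)
 moreover have "(%r. indicator {s..<t} r *\<^sub>R c) = (%r. if s \<le> r \<and> r < t then c else 0)"
  by (auto simp: indicator_def)
 moreover have "measure (Ivl_measure b) {s..<t} = t - s"
  using e assms(2) by (simp add: measure_def)
 ultimately show "integrable (Ivl_measure b) (%r. if s \<le> r \<and> r < t then c else 0)"
  "(LINT r|Ivl_measure b. (if s \<le> r \<and> r < t then c else 0)) = (t - s) *\<^sub>R c"
  by (simp_all add: has_bochner_integral_iff)
qed

section \<open>Truncations and primitives\<close>

definition cut :: "real \<Rightarrow> real \<Rightarrow> (real \<Rightarrow> complex) \<Rightarrow> real \<Rightarrow> complex" where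
 "cut s t g = (%r. if s \<le> r \<and> r < t then g r else 0)"

definition prim :: "ereal \<Rightarrow> (real \<Rightarrow> complex) \<Rightarrow> real \<Rightarrow> complex" where
 "prim b g t = (LINT s|Ivl_measure b. cut 0 t g s)"

lemma cut_in: "s \<le> r ==> r < t ==> cut s t g r = g r"
 and cut_out: "\<not> (s \<le> r \<and> r < t) ==> cut s t g r = 0"
 by (auto simp: cut_def)

lemma sets_Ivl_measure_conv:
 "{t \<in> Ivl b. t < s} \<in> sets (Ivl_measure b)" "{t \<in> Ivl b. s < t} \<in> sets (Ivl_measure b)"
 "{t \<in> Ivl b. s \<le> t \<and> t < r} \<in> sets (Ivl_measure b)"
proof -
 have *: "A \<inter> Ivl b \<in> sets (Ivl_measure b)" if "A \<in> sets borel" for A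
  unfolding sets_restrict_space by (rule image_eqI[of _ _ A]) (use that in auto)
 have "{t \<in> Ivl b. t < s} = {..<s} \<inter> Ivl b" by auto
 then show "{t \<in> Ivl b. t < s} \<in> sets (Ivl_measure b)" using *[of "{..<s}"] by (metis lessThan_borel)
 have "{t \<in> Ivl b. s < t} = {s<..} \<inter> Ivl b" by auto
 then show "{t \<in> Ivl b. s < t} \<in> sets (Ivl_measure b)" using *[of "{s<..}"] by (metis greaterThan_borel)
 have "{t \<in> Ivl b. s \<le> t \<and> t < r} = {s..<r} \<inter> Ivl b" by auto
 then show "{t \<in> Ivl b. s \<le> t \<and> t < r} \<in> sets (Ivl_measure b)" using *[of "{s..<r}"] by (metis atLeastLessThan_borel)
qed

lemma cut_measurable [measurable]:
 "g \<in> borel_measurable (Ivl_measure b) ==> cut s t g \<in> borel_measurable (Ivl_measure b)"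
 unfolding cut_def by (rule measurable_If) (simp_all add: sets_Ivl_measure_conv)

lemma cut_L2: "g \<in> L2 (Ivl_measure b) ==> cut s t g \<in> L2 (Ivl_measure b)"
 by (rule L2_bound[OF _ L2_integrable_sq]) (auto simp: cut_def dest: L2_measurable[THEN cut_measurable, of _ _ s t, unfolded cut_def])

lemma cut_bounded_L2:
 assumes "0 \<le> s" "s \<le> t" "t \<in> Ivl b" "g \<in> borel_measurable (Ivl_measure b)" "\<And>r. s \<le> r ==> r < t ==> cmod (g r) \<le> C" "C \<ge> 0"
 shows "cut s t g \<in> L2 (Ivl_measure b)" "L2_norm (Ivl_measure b) (cut s t g) \<le> C * sqrt (t - s)"
proof -
 let ?h = "%r. if s \<le> r \<and> r < t then C^2 else 0"
 have le: "(cmod (cut s t g r))^2 \<le> ?h r" for r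
  using assms(5)[of r] by (auto simp: cut_def intro: power_mono)
 show L: "cut s t g \<in> L2 (Ivl_measure b)"
  by (rule L2_bound[OF cut_measurable[OF assms(4)] lint_window(1)[OF assms(1-3)] le])
 have "(L2_norm (Ivl_measure b) (cut s t g))^2 \<le> (LINT r|Ivl_measure b. ?h r)"
  unfolding L2_norm_sq by (rule integral_mono[OF L2_integrable_sq[OF L] lint_window(1)[OF assms(1-3)] le])
 also have "... = (C * sqrt (t - s))^2" unfolding lint_window(2)[OF assms(1-3)] using assms(2) by (simp add: power_mult_distrib)
 finally show "L2_norm (Ivl_measure b) (cut s t g) \<le> C * sqrt (t - s)"
  by (rule power2_le_imp_le) (use assms in simp)
qed

lemma window_L2:
 assumes "0 \<le> s" "s \<le> t" "t \<in> Ivl b"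
 shows "cut s t (%_. 1) \<in> L2 (Ivl_measure b)" "L2_norm (Ivl_measure b) (cut s t (%_. 1)) = sqrt (t - s)"
proof -
 show "cut s t (%_. 1) \<in> L2 (Ivl_measure b)" by (rule cut_bounded_L2(1)[OF assms, of _ 1]) auto
 have "(%r. (cmod (cut s t (%_. 1) r))^2) = (%r. if s \<le> r \<and> r < t then 1 else 0)" by (auto simp: cut_def)
 then show "L2_norm (Ivl_measure b) (cut s t (%_. 1)) = sqrt (t - s)"
  unfolding L2_norm_def using lint_window(2)[OF assms, of "1::real"] by simp
qed

lemma inner_window:
 "L2_inner M g (cut s t (%_. 1)) = (LINT r|M. cut s t g r)"
 unfolding L2_inner_def by (rule Bochner_Integration.integral_cong) (auto simp: cut_def)

lemma inner_cut: "L2_inner M (cut s t g) h = L2_inner M g (cut s t h)"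
 unfolding L2_inner_def by (rule Bochner_Integration.integral_cong) (auto simp: cut_def)

lemma cut_integrable:
 assumes "g \<in> L2 (Ivl_measure b)" "0 \<le> s" "s \<le> t" "t \<in> Ivl b"
 shows "integrable (Ivl_measure b) (cut s t g)"
proof -
 have "(%r. g r * cnj (cut s t (%_. 1) r)) = cut s t g" by (auto simp: cut_def)
 then show ?thesis using L2_mult_integrable[OF assms(1) window_L2(1)[OF assms(2-4)]] by simp
qed

text \<open>Values of the primitive are thereby square integrable functionals of \<open>g\<close>,
  which admits them among the finitely many functionals of a compactness estimate.\<close>

lemma prim_inner: "prim b g t = L2_inner (Ivl_measure b) g (cut 0 t (%_. 1))"
 by (simp add: prim_def inner_window)

lemma prim_diff:
 assumes "g \<in> L2 (Ivl_measure b)" "0 \<le> s" "s \<le> t" "t \<in> Ivl b"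
 shows "prim b g t - prim b g s = (LINT r|Ivl_measure b. cut s t g r)"
proof -
 have s: "s \<in> Ivl b" and t: "0 \<le> t" using assms Ivl_downward by auto
 have "cut s t g = (%r. cut 0 t g r - cut 0 s g r)" using assms by (auto simp: cut_def)
 then show ?thesis unfolding prim_def
  using cut_integrable[OF assms(1) _ t assms(4)] cut_integrable[OF assms(1) _ assms(2) s] by simp
qed

lemma prim_Holder:
 assumes "g \<in> L2 (Ivl_measure b)" "0 \<le> s" "s \<le> t" "t \<in> Ivl b"
 shows "cmod (prim b g t - prim b g s) \<le> sqrt (t - s) * L2_norm (Ivl_measure b) (cut s t g)"
proof -
 have "cut s t (cut s t g) = cut s t g" by (auto simp: cut_def)
 then have "prim b g t - prim b g s = L2_inner (Ivl_measure b) (cut s t g) (cut s t (%_. 1))"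
  unfolding prim_diff[OF assms] inner_window by simp
 then show ?thesis
  using L2_Cauchy_Schwarz[OF cut_L2[OF assms(1)] window_L2(1)[OF assms(2-4)], of s t] window_L2(2)[OF assms(2-4)]
  by (simp add: mult.commute)
qed

lemma L2_norm_cut_le: "g \<in> L2 (Ivl_measure b) ==> L2_norm (Ivl_measure b) (cut s t g) \<le> L2_norm (Ivl_measure b) g"
 unfolding L2_norm_def
 by (intro real_sqrt_le_mono integral_mono L2_integrable_sq cut_L2) (auto simp: cut_def)

lemma prim_0 [simp]: "prim b g 0 = 0"
proof -
 have "cut 0 0 g = (%_. 0)" by (auto simp: cut_def fun_eq_iff)
 then show ?thesis by (simp add: prim_def)
qed

lemma prim_bound:
 assumes "g \<in> L2 (Ivl_measure b)" "t \<in> Ivl b"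
 shows "cmod (prim b g t) \<le> sqrt t * L2_norm (Ivl_measure b) g"
 using prim_Holder[OF assms(1) order_refl Ivl_nonneg[OF assms(2)] assms(2)] L2_norm_cut_le[OF assms(1), of 0 t] Ivl_nonneg[OF assms(2)]
 by (simp add: mult_left_mono order_trans)

lemma prim_continuous_on:
 assumes g: "g \<in> L2 (Ivl_measure b)"
 shows "continuous_on (Ivl b) (prim b g)"
 unfolding continuous_on_iff
proof (intro ballI allI impI)
 fix t e :: real assume t: "t \<in> Ivl b" and e: "e > 0"
 define N where "N = L2_norm (Ivl_measure b) g + 1"
 have N: "N > 0" "L2_norm (Ivl_measure b) g \<le> N" unfolding N_def by (auto intro: add_nonneg_pos)
 have H: "cmod (prim b g v - prim b g u) \<le> sqrt (v - u) * N" if "u \<le> v" "u \<in> Ivl b" "v \<in> Ivl b" for u v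
  using prim_Holder[OF g Ivl_nonneg[OF that(2)] that(1,3)] L2_norm_cut_le[OF g, of u v] N(2) that(1)
  by (meson mult_left_mono order_trans real_sqrt_ge_zero diff_ge_0_iff_ge)
 have "dist (prim b g s) (prim b g t) < e" if s: "s \<in> Ivl b" "dist s t < (e / N)^2" for s
 proof -
  have "sqrt \<bar>s - t\<bar> < e / N"
   using s(2) e N(1) by (intro real_less_lsqrt) (auto simp: dist_real_def)
  then have "sqrt \<bar>s - t\<bar> * N < e" using N(1) by (simp add: field_simps)
  moreover have "dist (prim b g s) (prim b g t) \<le> sqrt \<bar>s - t\<bar> * N"
   using H[of s t] H[of t s] s(1) t by (cases "s \<le> t") (auto simp: dist_norm norm_minus_commute abs_if)
  ultimately show ?thesis by linarith
 qed
 then show "\<exists>d>0. \<forall>s\<in>Ivl b. dist s t < d --> dist (prim b g s) (prim b g t) < e"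
  using e N(1) by (intro exI[of _ "(e / N)^2"]) auto
qed

lemma continuous_on_Ivl_measurable:
 fixes f :: "real \<Rightarrow> 'a :: real_normed_vector"
 shows "continuous_on (Ivl b) f ==> f \<in> borel_measurable (Ivl_measure b)"
 by (rule continuous_imp_measurable_on_sets_lebesgue) auto

lemma prim_measurable: "g \<in> L2 (Ivl_measure b) ==> prim b g \<in> borel_measurable (Ivl_measure b)"
 by (intro continuous_on_Ivl_measurable prim_continuous_on)

lemma prim_cut:
 assumes "t \<le> R" shows "prim b (cut 0 R g) t = prim b g t"
proof -
 have "cut 0 t (cut 0 R g) = cut 0 t g" using assms by (auto simp: cut_def)
 then show ?thesis by (simp add: prim_def)
qed

lemma prim_cut_ge:
 assumes "R \<le> t" shows "prim b (cut 0 R g) t = prim b g R"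
proof -
 have "cut 0 t (cut 0 R g) = cut 0 R g" using assms by (auto simp: cut_def)
 then show ?thesis by (simp add: prim_def)
qed

lemma prim_lincomb:
 assumes "g \<in> L2 (Ivl_measure b)" "h \<in> L2 (Ivl_measure b)" "t \<in> Ivl b"
 shows "prim b (%s. p * g s + q * h s) t = p * prim b g t + q * prim b h t"
 unfolding prim_inner using assms
 by (simp add: L2_inner_add_left L2_inner_cmult_left L2_cmult window_L2 Ivl_nonneg)

lemma prim_cnj: "prim b (%s. cnj (g s)) t = cnj (prim b g t)"
proof -
 have "cut 0 t (%s. cnj (g s)) = (%s. cnj (cut 0 t g s))" by (auto simp: cut_def)
 then show ?thesis by (simp add: prim_def)
qed

text \<open>Fubini on the square, the diagonal being a null set.\<close>

lemma prim_by_parts: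
 fixes p q :: "real \<Rightarrow> complex"
 assumes p: "integrable (Ivl_measure b) p" and q: "integrable (Ivl_measure b) q"
 shows "integrable (Ivl_measure b) (%t. p t * prim b q t)"
  and "(LINT t|Ivl_measure b. p t * prim b q t) + (LINT t|Ivl_measure b. q t * prim b p t)
   = (LINT t|Ivl_measure b. p t) * (LINT t|Ivl_measure b. q t)"
proof -
 let ?M = "Ivl_measure b"
 interpret sigma_finite_measure ?M by (rule sigma_finite_lebesgue_on) simp
 interpret MM: pair_sigma_finite ?M ?M ..
 note [measurable] = borel_measurable_integrable[OF p] borel_measurable_integrable[OF q]
 have id1: "(%z. fst z) \<in> borel_measurable (?M \<Otimes>\<^sub>M ?M)"
  by (rule measurable_compose[OF measurable_fst id_borel_measurable_Ivl])
 have id2: "(%z. snd z) \<in> borel_measurable (?M \<Otimes>\<^sub>M ?M)"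
  by (rule measurable_compose[OF measurable_snd id_borel_measurable_Ivl])
 have tri: "Measurable.pred (?M \<Otimes>\<^sub>M ?M) (%z. snd z < fst z)" "Measurable.pred (?M \<Otimes>\<^sub>M ?M) (%z. fst z < snd z)"
  by (rule borel_measurable_pred_less[OF id2 id1], rule borel_measurable_pred_less[OF id1 id2])
 have prod: "integrable (?M \<Otimes>\<^sub>M ?M) (%z. f (fst z) * g (snd z))"
  if f: "integrable ?M f" and g: "integrable ?M g" for f g :: "real \<Rightarrow> complex"
 proof (rule MM.Fubini_integrable)
  note [measurable] = borel_measurable_integrable[OF f] borel_measurable_integrable[OF g]
  show "(%z. f (fst z) * g (snd z)) \<in> borel_measurable (?M \<Otimes>\<^sub>M ?M)" by measurable
  show "integrable ?M (%x. \<integral>y. norm (f (fst (x, y)) * g (snd (x, y))) \<partial>?M)"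
   using f g by (simp add: norm_mult)
  show "AE x in ?M. integrable ?M (%y. f (fst (x, y)) * g (snd (x, y)))" using g by simp
 qed
 have low: "integrable (?M \<Otimes>\<^sub>M ?M) (%(t, s). if s < t then f t * g s else 0)"
  if f: "integrable ?M f" and g: "integrable ?M g" for f g :: "real \<Rightarrow> complex"
 proof -
  note [measurable] = borel_measurable_integrable[OF f] borel_measurable_integrable[OF g]
  have "integrable (?M \<Otimes>\<^sub>M ?M) (%z. if snd z < fst z then f (fst z) * g (snd z) else 0)"
  proof (rule Bochner_Integration.integrable_bound[OF prod[OF f g]])
   show "(%z. if snd z < fst z then f (fst z) * g (snd z) else 0) \<in> borel_measurable (?M \<Otimes>\<^sub>M ?M)"
    by (rule measurable_If[OF borel_measurable_integrable[OF prod[OF f g]] _ tri(1)[unfolded pred_def]]) simp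
  qed auto
  then show ?thesis by (simp add: split_def)
 qed
 have up: "integrable (?M \<Otimes>\<^sub>M ?M) (%(t, s). if t < s then p t * q s else 0)"
 proof -
  have "integrable (?M \<Otimes>\<^sub>M ?M) (%z. if fst z < snd z then p (fst z) * q (snd z) else 0)"
  proof (rule Bochner_Integration.integrable_bound[OF prod[OF p q]])
   show "(%z. if fst z < snd z then p (fst z) * q (snd z) else 0) \<in> borel_measurable (?M \<Otimes>\<^sub>M ?M)"
    by (rule measurable_If[OF borel_measurable_integrable[OF prod[OF p q]] _ tri(2)[unfolded pred_def]]) simp
  qed auto
  then show ?thesis by (simp add: split_def)
 qed
 have inner: "(LINT s|?M. (if s < t then f t * g s else 0)) = f t * prim b g t" for f g :: "real \<Rightarrow> complex" and t
 proof -
  have "(LINT s|?M. (if s < t then f t * g s else 0)) = (LINT s|?M. f t * cut 0 t g s)"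
   by (rule Bochner_Integration.integral_cong) (auto simp: cut_def Ivl_def)
  then show ?thesis by (simp add: prim_def)
 qed
 show i1: "integrable ?M (%t. p t * prim b q t)"
  using MM.integrable_fst[OF low[OF p q]] by (simp add: inner)
 have i2: "integrable ?M (%t. q t * prim b p t)"
  using MM.integrable_fst[OF low[OF q p]] by (simp add: inner)
 have "(LINT t|?M. q t * prim b p t) = (LINT t|?M. (LINT s|?M. (if s < t then q t * p s else 0)))"
  by (simp add: inner)
 also have "... = (LINT s|?M. (LINT t|?M. (if s < t then q t * p s else 0)))"
  by (rule MM.Fubini_integral[OF low[OF q p], symmetric])
 also have "... = (LINT t|?M. (LINT s|?M. (if t < s then p t * q s else 0)))"
  by (intro Bochner_Integration.integral_cong refl) (rule if_cong[OF refl mult.commute refl])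
 finally have sw: "(LINT t|?M. q t * prim b p t) = (LINT t|?M. (LINT s|?M. (if t < s then p t * q s else 0)))" .
 have null: "AE s in ?M. s \<noteq> t" for t
 proof -
  have "{t} \<in> null_sets lebesgue" by simp
  then have "AE s in lebesgue. s \<notin> {t}" by (rule AE_not_in)
  then show ?thesis by (auto simp: AE_restrict_space_iff)
 qed
 have "(LINT t|?M. p t * prim b q t) + (LINT t|?M. q t * prim b p t)
   = (LINT t|?M. (LINT s|?M. (if s < t then p t * q s else 0)) + (LINT s|?M. (if t < s then p t * q s else 0)))"
  unfolding sw using i1 MM.integrable_fst[OF up] by (simp add: inner)
 also have "... = (LINT t|?M. p t * (LINT s|?M. q s))"
 proof (rule Bochner_Integration.integral_cong[OF refl])
  fix t
  have q': "integrable ?M (%s. p t * q s)" using q by simp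
  have m1: "integrable ?M (%s. if s < t then p t * q s else 0)"
  proof (rule Bochner_Integration.integrable_bound[OF q'])
   show "(%s. if s < t then p t * q s else 0) \<in> borel_measurable ?M" by (rule measurable_If[OF borel_measurable_integrable[OF q']]) (simp_all add: sets_Ivl_measure_conv)
  qed simp
  have m2: "integrable ?M (%s. if t < s then p t * q s else 0)"
  proof (rule Bochner_Integration.integrable_bound[OF q'])
   show "(%s. if t < s then p t * q s else 0) \<in> borel_measurable ?M" by (rule measurable_If[OF borel_measurable_integrable[OF q']]) (simp_all add: sets_Ivl_measure_conv)
  qed simp
  have "(LINT s|?M. (if s < t then p t * q s else 0)) + (LINT s|?M. (if t < s then p t * q s else 0))
    = (LINT s|?M. (if s < t then p t * q s else 0) + (if t < s then p t * q s else 0))"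
   using m1 m2 by simp
  also have "... = (LINT s|?M. p t * q s)"
  proof (rule integral_cong_AE)
   show "AE s in ?M. (if s < t then p t * q s else 0) + (if t < s then p t * q s else 0) = p t * q s"
    using null[of t] by eventually_elim auto
  qed (use borel_measurable_integrable[OF m1] borel_measurable_integrable[OF m2] in auto)
  finally show "(LINT s|?M. (if s < t then p t * q s else 0)) + (LINT s|?M. (if t < s then p t * q s else 0)) = p t * (LINT s|?M. q s)"
   by simp
 qed
 also have "... = (LINT t|?M. p t) * (LINT t|?M. q t)" by simp
 finally show "(LINT t|?M. p t * prim b q t) + (LINT t|?M. q t * prim b p t) = (LINT t|?M. p t) * (LINT t|?M. q t)" .
qed

section \<open>The Volterra representation and Green's formula\<close>

locale delta_chain =
 fixes b :: ereal and x \<beta> :: "nat \<Rightarrow> real"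
 assumes x0: "x 0 = 0" and x_mono: "strict_mono x" and x_less: "\<And>n. ereal (x n) < b"
  and x_lim: "(%n. ereal (x n)) \<longlonglongrightarrow> b"
begin

abbreviation I :: "real set" where "I \<equiv> Ivl b"
abbreviation M :: "real measure" where "M \<equiv> Ivl_measure b"
abbreviation nrm where "nrm \<equiv> L2_norm M"
abbreviation ip where "ip \<equiv> L2_inner M"

text \<open>The distribution function of \<open>dt + \<Sum>\<beta>\<^sub>n \<delta>\<^bsub>x\<^sub>n\<^esub>\<close>. An element \<open>f\<close> of the domain satisfies
 \<open>df = f' dP\<close>.\<close>

definition P :: "real \<Rightarrow> real" where
 "P t = t + (\<Sum>j | 1 \<le> j \<and> x j \<le> t. \<beta> j)"

definition Pbound :: "real \<Rightarrow> real" where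
 "Pbound t = t + (\<Sum>j | 1 \<le> j \<and> x j \<le> t. \<bar>\<beta> j\<bar>)"

definition weighted :: "(real \<Rightarrow> complex) \<Rightarrow> real \<Rightarrow> complex" where
 "weighted g = (%t. of_real (P t) * g t)"

text \<open>The integral of \<open>g(s) (P(t) - P(s))\<close> over \<open>0 \<le> s < t\<close>.\<close>

definition volterra :: "(real \<Rightarrow> complex) \<Rightarrow> real \<Rightarrow> complex" where
 "volterra g t = of_real (P t) * prim b g t - prim b (weighted g) t"

lemma x_less_iff [simp]: "x m < x n \<longleftrightarrow> m < n" and x_le_iff [simp]: "x m \<le> x n \<longleftrightarrow> m \<le> n"
 using strict_mono_less[OF x_mono] strict_mono_less_eq[OF x_mono] by auto

lemma x_nonneg: "0 \<le> x n"
 using x_le_iff[of 0 n] x0 by simp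

lemma x_in_I: "x n \<in> I"
 using x_nonneg x_less by (simp add: Ivl_def)

lemma zero_in_I: "0 \<in> I"
 using x_in_I[of 0] x0 by simp

lemma ex_x_gt:
 assumes "t \<in> I" shows "\<exists>n. t < x n"
proof -
 have "ereal t < b" using assms by (simp add: Ivl_def)
 then have "\<forall>\<^sub>F n in sequentially. ereal t < ereal (x n)" by (rule order_tendstoD(1)[OF x_lim])
 then show ?thesis by (auto simp: eventually_sequentially)
qed

lemma finite_x_le:
 assumes "t \<in> I" shows "finite {j. 1 \<le> j \<and> x j \<le> t}"
proof -
 obtain n where n: "t < x n" using ex_x_gt[OF assms] by blast
 have "{j. 1 \<le> j \<and> x j \<le> t} \<subseteq> {..<n}"
 proof
  fix j assume "j \<in> {j. 1 \<le> j \<and> x j \<le> t}"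
  then have "x j < x n" using n by (simp del: x_less_iff)
  then show "j \<in> {..<n}" by simp
 qed
 then show ?thesis by (rule finite_subset) simp
qed

lemma x_le_set:
 assumes "x n \<le> t" "t < x (Suc n)" shows "{j. 1 \<le> j \<and> x j \<le> t} = {1..n}"
proof -
 have "x j \<le> t \<longleftrightarrow> j \<le> n" for j
 proof
  assume "x j \<le> t"
  then have "x j < x (Suc n)" using assms by linarith
  then show "j \<le> n" by simp
 next
  assume "j \<le> n"
  then have "x j \<le> x n" by simp
  then show "x j \<le> t" using assms by linarith
 qed
 then show ?thesis by (intro set_eqI) (simp only: mem_Collect_eq atLeastAtMost_iff)
qed

lemma P_eq: "x n \<le> t ==> t < x (Suc n) ==> P t = t + (\<Sum>j=1..n. \<beta> j)"
 by (simp only: P_def x_le_set)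

lemma interval_obtain:
 assumes "t \<in> I"
 obtains n where "x n \<le> t" "t < x (Suc n)"
proof -
 define n where "n = (LEAST n. t < x n)"
 have n: "t < x n" unfolding n_def by (rule LeastI_ex[OF ex_x_gt[OF assms]])
 have "n \<noteq> 0" using n assms x0 Ivl_nonneg[OF assms] by (intro notI) simp
 then obtain m where m: "n = Suc m" by (cases n) auto
 have "\<not> t < x m" using not_less_Least[of m "%n. t < x n"] m by (simp add: n_def)
 then show ?thesis using that[of m] n m by simp
qed

lemma P_0 [simp]: "P 0 = 0"
 using P_eq[of 0 0] x0 x_less_iff[of 0 1] by simp

lemma P_bound:
 assumes "0 \<le> t" "t \<le> r" "r \<in> I"
 shows "\<bar>P t\<bar> \<le> Pbound r"
proof -
 have "\<bar>P t\<bar> \<le> \<bar>t\<bar> + \<bar>\<Sum>j | 1 \<le> j \<and> x j \<le> t. \<beta> j\<bar>" unfolding P_def by (rule abs_triangle_ineq)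
 also have "... \<le> r + (\<Sum>j | 1 \<le> j \<and> x j \<le> t. \<bar>\<beta> j\<bar>)" using assms by (intro add_mono sum_abs) auto
 also have "... \<le> Pbound r" unfolding Pbound_def
  using assms by (intro add_left_mono sum_mono2 finite_x_le) auto
 finally show ?thesis .
qed

lemma Pbound_nonneg: "r \<in> I ==> 0 \<le> Pbound r"
 using P_bound[of 0 r] Ivl_nonneg[of r b] by simp

lemma P_measurable: "P \<in> borel_measurable M"
proof (rule borel_measurable_LIMSEQ_real)
 fix t assume "t \<in> space M"
 then have t: "t \<in> I" by simp
 obtain n where n: "x n \<le> t" "t < x (Suc n)" using interval_obtain[OF t] .
 show "(%N. t + (\<Sum>j=1..N. if x j \<le> t then \<beta> j else 0)) \<longlonglongrightarrow> P t"
 proof (rule tendsto_eventually, rule eventually_sequentiallyI[of n])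
  fix N assume N: "n \<le> N"
  have "(\<Sum>j=1..N. if x j \<le> t then \<beta> j else 0) = (\<Sum>j\<in>{j\<in>{1..N}. x j \<le> t}. \<beta> j)"
   by (rule sum.inter_filter[symmetric]) simp
  also have "{j\<in>{1..N}. x j \<le> t} = {j. 1 \<le> j \<and> x j \<le> t}" using N x_le_set[OF n] by auto
  finally show "t + (\<Sum>j=1..N. if x j \<le> t then \<beta> j else 0) = P t" by (simp add: P_def)
 qed
next
 fix N
 have *: "{t \<in> I. x j \<le> t} \<in> sets M" for j
 proof -
  have "{t \<in> I. x j \<le> t} = space M - {t \<in> I. t < x j}" by auto
  then show ?thesis using sets.compl_sets[OF sets_Ivl_measure_conv(1)] by metis
 qed
 have "(%t. if x j \<le> t then \<beta> j else 0) \<in> borel_measurable M" for j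
  by (rule measurable_If) (simp_all add: *)
 then show "(%t. t + (\<Sum>j=1..N. if x j \<le> t then \<beta> j else 0)) \<in> borel_measurable M"
  by (intro borel_measurable_add borel_measurable_sum id_borel_measurable_Ivl)
qed

lemma weighted_measurable: "g \<in> borel_measurable M ==> weighted g \<in> borel_measurable M"
 unfolding weighted_def using P_measurable by simp

lemma cut_weighted_L2:
 assumes g: "g \<in> L2 M" and R: "R \<in> I"
 shows "cut 0 R (weighted g) \<in> L2 M"
proof (rule L2_bound)
 show "cut 0 R (weighted g) \<in> borel_measurable M" using g by (intro cut_measurable weighted_measurable L2_measurable)
 show "integrable M (%t. (Pbound R)^2 * (cmod (g t))^2)" using L2_integrable_sq[OF g] by simp
 fix t
 have "(\<bar>P t\<bar> * cmod (g t))^2 \<le> (Pbound R)^2 * (cmod (g t))^2" if "0 \<le> t" "t < R"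
  using P_bound[of t R] that R unfolding power_mult_distrib by (intro mult_right_mono power_mono) auto
 then show "(cmod (cut 0 R (weighted g) t))^2 \<le> (Pbound R)^2 * (cmod (g t))^2"
  by (auto simp: cut_def weighted_def norm_mult)
qed

lemma weighted_window_L2:
 assumes R: "R \<in> I"
 shows "cut 0 R (%t. of_real (P t)) \<in> L2 M"
 by (rule cut_bounded_L2(1)[OF order_refl Ivl_nonneg[OF R] R _ _ Pbound_nonneg[OF R]])
  (use P_measurable P_bound[OF _ _ R] in auto)

lemma prim_weighted_inner: "prim b (weighted g) t = ip g (cut 0 t (%s. of_real (P s)))"
 unfolding prim_def L2_inner_def
 by (rule Bochner_Integration.integral_cong) (auto simp: cut_def weighted_def)

lemma prim_weighted_continuous_on:
 assumes g: "g \<in> L2 M" and R: "R \<in> I"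
 shows "continuous_on {0..R} (prim b (weighted g))"
proof -
 have "continuous_on {0..R} (prim b (cut 0 R (weighted g)))"
  by (rule continuous_on_subset[OF prim_continuous_on[OF cut_weighted_L2[OF g R]]]) (use R in "auto intro: Ivl_downward")
 then show ?thesis by (rule continuous_on_eq) (simp add: prim_cut)
qed

lemma prim_weighted_measurable:
 assumes g: "g \<in> L2 M"
 shows "prim b (weighted g) \<in> borel_measurable M"
proof (rule borel_measurable_LIMSEQ_metric)
 show "prim b (cut 0 (x n) (weighted g)) \<in> borel_measurable M" for n
  by (rule prim_measurable[OF cut_weighted_L2[OF g x_in_I]])
 fix t assume "t \<in> space M"
 then obtain n where n: "t < x n" using ex_x_gt by auto
 show "(%n. prim b (cut 0 (x n) (weighted g)) t) \<longlonglongrightarrow> prim b (weighted g) t"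
 proof (rule tendsto_eventually, rule eventually_sequentiallyI[of n])
  fix m assume "n \<le> m"
  then have "x n \<le> x m" by simp
  then show "prim b (cut 0 (x m) (weighted g)) t = prim b (weighted g) t" using n by (intro prim_cut) linarith
 qed
qed

lemma volterra_measurable: "g \<in> L2 M ==> volterra g \<in> borel_measurable M"
 unfolding volterra_def using P_measurable prim_measurable[of g b] prim_weighted_measurable[of g] by simp

lemma volterra_0 [simp]: "volterra g 0 = 0"
 by (simp add: volterra_def)

lemma volterra_bounded:
 assumes g: "g \<in> L2 M" and R: "R \<in> I"
 obtains C where "C \<ge> 0" "\<And>t. 0 \<le> t ==> t \<le> R ==> cmod (volterra g t) \<le> C"
proof -
 have "continuous_on {0..R} (prim b g)"
  by (rule continuous_on_subset[OF prim_continuous_on[OF g]]) (use R in "auto intro: Ivl_downward")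
 then have "bounded (prim b g ` {0..R})" by (intro compact_imp_bounded compact_continuous_image) auto
 then obtain C1 where C1: "\<And>t. t \<in> {0..R} ==> cmod (prim b g t) \<le> C1" unfolding bounded_iff by blast
 have "bounded (prim b (weighted g) ` {0..R})"
  by (intro compact_imp_bounded compact_continuous_image prim_weighted_continuous_on[OF g R]) auto
 then obtain C2 where C2: "\<And>t. t \<in> {0..R} ==> cmod (prim b (weighted g) t) \<le> C2" unfolding bounded_iff by blast
 have C0: "C1 \<ge> 0" "C2 \<ge> 0" using order_trans[OF norm_ge_zero C1[of 0]] order_trans[OF norm_ge_zero C2[of 0]] Ivl_nonneg[OF R] by auto
 have "cmod (volterra g t) \<le> Pbound R * C1 + C2" if t: "0 \<le> t" "t \<le> R" for t
 proof -
  have "cmod (volterra g t) \<le> \<bar>P t\<bar> * cmod (prim b g t) + cmod (prim b (weighted g) t)"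
   unfolding volterra_def by (rule order_trans[OF norm_triangle_ineq4]) (simp add: norm_mult)
  also have "... \<le> Pbound R * C1 + C2"
   using t C1[of t] C2[of t] P_bound[OF t R] Pbound_nonneg[OF R] by (intro add_mono mult_mono) auto
  finally show ?thesis .
 qed
 moreover have "Pbound R * C1 + C2 \<ge> 0" using C0 Pbound_nonneg[OF R] by simp
 ultimately show ?thesis using that by blast
qed

lemma volterra_cut_L2:
 assumes g: "g \<in> L2 M" and R: "R \<in> I"
 shows "cut 0 R (volterra g) \<in> L2 M"
proof -
 obtain C where C: "C \<ge> 0" "\<And>t. 0 \<le> t ==> t \<le> R ==> cmod (volterra g t) \<le> C" by (rule volterra_bounded[OF g R]) blast
 show ?thesis
  by (rule cut_bounded_L2(1)[OF order_refl Ivl_nonneg[OF R] R volterra_measurable[OF g] _ C(1)]) (use C(2) in auto)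
qed

lemma volterra_cnj: "volterra (%s. cnj (g s)) t = cnj (volterra g t)"
proof -
 have "weighted (%s. cnj (g s)) = (%s. cnj (weighted g s))" by (auto simp: weighted_def)
 then show ?thesis by (simp add: volterra_def prim_cnj)
qed

lemma volterra_lincomb:
 assumes g: "g \<in> L2 M" and h: "h \<in> L2 M" and t: "t \<in> I"
 shows "volterra (%s. p * g s + q * h s) t = p * volterra g t + q * volterra h t"
 unfolding volterra_def prim_lincomb[OF g h t] prim_weighted_inner
 using weighted_window_L2[OF t] by (simp add: L2_inner_add_left L2_inner_cmult_left L2_cmult g h algebra_simps)

lemma L2_cnj: "g \<in> L2 N ==> (%t. cnj (g t)) \<in> L2 N"
 by (simp add: L2_def borel_measurable_cnj)

text \<open>After truncation at \<open>R\<close>, the factor \<open>P\<close> is moved onto the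
  function it stands next to. The four terms then pair up into two integrations by parts,
  \<open>weighted g\<close> with \<open>h\<close> and \<open>weighted h\<close> with
  \<open>g\<close>, which leave boundary terms only.\<close>

lemma volterra_green:
 assumes g: "g \<in> L2 M" and h: "h \<in> L2 M" and R: "R \<in> I"
 shows "(LINT t|M. cut 0 R (%t. g t * volterra h t - h t * volterra g t) t)
  = prim b g R * volterra h R - volterra g R * prim b h R"
proof -
 define p q p' q' where "p = cut 0 R g" and "q = cut 0 R h" and "p' = cut 0 R (weighted g)" and "q' = cut 0 R (weighted h)"
 have R0: "0 \<le> R" using Ivl_nonneg[OF R] .
 have ii: "integrable M (cut 0 R g)" if "cut 0 R g \<in> L2 M" for g
 proof -
  have "cut 0 R (cut 0 R g) = cut 0 R g" by (auto simp: cut_def)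
  then show ?thesis using cut_integrable[OF that order_refl R0 R] by simp
 qed
 have int: "integrable M p" "integrable M q" "integrable M p'" "integrable M q'"
  unfolding p_def q_def p'_def q'_def by (intro ii cut_L2 g h cut_weighted_L2 R)+
 have pt: "cut 0 R (%t. g t * volterra h t - h t * volterra g t) t
   = p' t * prim b q t + q t * prim b p' t - (q' t * prim b p t + p t * prim b q' t)" for t
 proof (cases "0 \<le> t \<and> t < R")
  case True
  then have "prim b q t = prim b h t" "prim b p t = prim b g t" "prim b q' t = prim b (weighted h) t" "prim b p' t = prim b (weighted g) t"
   unfolding p_def q_def p'_def q'_def by (simp_all add: prim_cut)
  then show ?thesis using True
   by (simp add: p_def q_def p'_def q'_def cut_def volterra_def weighted_def algebra_simps)
 next
  case False
  then have "cut 0 R u t = 0" for u unfolding cut_def by (simp only: if_False)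
  then show ?thesis by (simp add: p_def q_def p'_def q'_def)
 qed
 have "(LINT t|M. cut 0 R (%t. g t * volterra h t - h t * volterra g t) t)
   = ((LINT t|M. p' t * prim b q t) + (LINT t|M. q t * prim b p' t)) - ((LINT t|M. q' t * prim b p t) + (LINT t|M. p t * prim b q' t))"
  unfolding pt using prim_by_parts(1)[OF int(3,2)] prim_by_parts(1)[OF int(2,3)] prim_by_parts(1)[OF int(4,1)] prim_by_parts(1)[OF int(1,4)]
  by simp
 also have "... = (LINT t|M. p' t) * (LINT t|M. q t) - (LINT t|M. q' t) * (LINT t|M. p t)"
  unfolding prim_by_parts(2)[OF int(3,2)] prim_by_parts(2)[OF int(4,1)] ..
 also have "... = prim b (weighted g) R * prim b h R - prim b (weighted h) R * prim b g R"
  by (simp add: p_def q_def p'_def q'_def prim_def)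
 finally show ?thesis by (simp add: volterra_def algebra_simps)
qed

text \<open>\<open>volterra w\<close> is the integral of \<open>prim b w\<close> with respect to \<open>dP\<close>.\<close>

lemma volterra_eq_integral:
 assumes w: "w \<in> L2 M" and t: "t \<in> I"
 shows "volterra w t = prim b (prim b w) t + (\<Sum>j | 1 \<le> j \<and> x j \<le> t. of_real (\<beta> j) * prim b w (x j))"
proof -
 let ?J = "{j. 1 \<le> j \<and> x j \<le> t}"
 have t0: "0 \<le> t" using Ivl_nonneg[OF t] .
 note fin = finite_x_le[OF t]
 have int1: "integrable M (cut 0 t (%_. 1))" using lint_window(1)[OF order_refl t0 t, of "1::complex"] by (simp add: cut_def)
 have intw: "integrable M (cut 0 t w)" by (rule cut_integrable[OF w order_refl t0 t])
 have p1: "prim b (cut 0 t (%_. 1)) s = of_real s" if "0 \<le> s" "s < t" for s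
 proof -
  have sI: "s \<in> I" using that t by (auto intro: Ivl_downward)
  have "prim b (cut 0 t (%_. 1)) s = prim b (%_. 1) s" using that by (intro prim_cut) simp
  then show ?thesis unfolding prim_def using lint_window(2)[OF order_refl that(1) sI, of "1::complex"] by (simp add: cut_def scaleR_conv_of_real)
 qed
 have idw: "integrable M (cut 0 t (%s. of_real s * w s))"
 proof (rule Bochner_Integration.integrable_bound)
  show "cut 0 t (%s. of_real s * w s) \<in> borel_measurable M"
   by (intro cut_measurable borel_measurable_times L2_measurable[OF w] continuous_on_Ivl_measurable continuous_intros)
  show "integrable M (%s. of_real t * cut 0 t w s)" using intw by simp
  have "norm (cut 0 t (%s. of_real s * w s) s) \<le> norm (of_real t * cut 0 t w s)" for s
  proof (cases "0 \<le> s \<and> s < t")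
   case True
   have "\<bar>s\<bar> * cmod (w s) \<le> \<bar>t\<bar> * cmod (w s)" using True by (intro mult_right_mono) auto
   then show ?thesis using True by (simp add: cut_in norm_mult)
  next
   case False
   then show ?thesis unfolding cut_out[OF False] by simp
  qed
  then show "AE s in M. norm (cut 0 t (%s. of_real s * w s) s) \<le> norm (of_real t * cut 0 t w s)" by (intro AE_I2)
 qed
 have "of_real t * prim b w t = (LINT s|M. cut 0 t (%_. 1) s) * (LINT s|M. cut 0 t w s)"
  using lint_window(2)[OF order_refl t0 t, of "1::complex"] by (simp add: prim_def cut_def[of 0 t "%_. 1"] scaleR_conv_of_real)
 also have "... = (LINT s|M. cut 0 t (%_. 1) s * prim b (cut 0 t w) s) + (LINT s|M. cut 0 t w s * prim b (cut 0 t (%_. 1)) s)"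
  by (rule prim_by_parts(2)[OF int1 intw, symmetric])
 also have "(LINT s|M. cut 0 t (%_. 1) s * prim b (cut 0 t w) s) = prim b (prim b w) t"
  unfolding prim_def[of b "prim b w"]
 proof (rule Bochner_Integration.integral_cong[OF refl])
  fix s
  show "cut 0 t (%_. 1) s * prim b (cut 0 t w) s = cut 0 t (prim b w) s"
   using prim_cut[of s t b w] by (cases "0 \<le> s \<and> s < t") (simp_all add: cut_in cut_out)
 qed
 also have "(LINT s|M. cut 0 t w s * prim b (cut 0 t (%_. 1)) s) = (LINT s|M. cut 0 t (%s. of_real s * w s) s)"
 proof (rule Bochner_Integration.integral_cong[OF refl])
  fix s
  show "cut 0 t w s * prim b (cut 0 t (%_. 1)) s = cut 0 t (%s. of_real s * w s) s"
   using p1[of s] by (cases "0 \<le> s \<and> s < t") (simp_all add: cut_in cut_out)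
 qed
 finally have A: "of_real t * prim b w t = prim b (prim b w) t + (LINT s|M. cut 0 t (%s. of_real s * w s) s)" .
 have cj: "integrable M (cut (x j) t w)" "(LINT s|M. cut (x j) t w s) = prim b w t - prim b w (x j)" if "j \<in> ?J" for j
  using that cut_integrable[OF w x_nonneg _ t, of j] prim_diff[OF w x_nonneg _ t, of j] by auto
 have wt: "cut 0 t (weighted w) s = cut 0 t (%s. of_real s * w s) s + (\<Sum>j\<in>?J. of_real (\<beta> j) * cut (x j) t w s)" for s
 proof (cases "0 \<le> s \<and> s < t")
  case True
  have "(\<Sum>j\<in>?J. of_real (\<beta> j) * cut (x j) t w s) = (\<Sum>j\<in>?J. if x j \<le> s then of_real (\<beta> j) * w s else 0)"
   using True by (intro sum.cong) (auto simp: cut_def)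
  also have "... = (\<Sum>j\<in>{j\<in>?J. x j \<le> s}. of_real (\<beta> j) * w s)" by (rule sum.inter_filter[OF fin, symmetric])
  also have "{j\<in>?J. x j \<le> s} = {j. 1 \<le> j \<and> x j \<le> s}" using True by auto
  also have "(\<Sum>j | 1 \<le> j \<and> x j \<le> s. of_real (\<beta> j) * w s) = of_real (\<Sum>j | 1 \<le> j \<and> x j \<le> s. \<beta> j) * w s"
   by (simp add: sum_distrib_right)
  finally show ?thesis using True by (simp add: cut_def weighted_def P_def algebra_simps)
 next
  case False
  have "cut (x j) t w s = 0" if "j \<in> ?J" for j using False x_nonneg[of j] by (auto simp: cut_def)
  then show ?thesis using False by (auto simp: cut_def)
 qed
 have "prim b (weighted w) t = (LINT s|M. cut 0 t (%s. of_real s * w s) s) + (\<Sum>j\<in>?J. of_real (\<beta> j) * (prim b w t - prim b w (x j)))"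
 proof -
  have "prim b (weighted w) t = (LINT s|M. cut 0 t (%s. of_real s * w s) s) + (LINT s|M. (\<Sum>j\<in>?J. of_real (\<beta> j) * cut (x j) t w s))"
   unfolding prim_def[of b "weighted w"] wt
   by (rule Bochner_Integration.integral_add[OF idw]) (intro Bochner_Integration.integrable_sum integrable_mult_right cj)
  also have "(LINT s|M. (\<Sum>j\<in>?J. of_real (\<beta> j) * cut (x j) t w s)) = (\<Sum>j\<in>?J. LINT s|M. of_real (\<beta> j) * cut (x j) t w s)"
   by (rule Bochner_Integration.integral_sum) (intro integrable_mult_right cj)
  also have "... = (\<Sum>j\<in>?J. of_real (\<beta> j) * (prim b w t - prim b w (x j)))"
   by (rule sum.cong[OF refl]) (simp only: integral_mult_right_zero cj(2))
  finally show ?thesis .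
 qed
 also have "(\<Sum>j\<in>?J. of_real (\<beta> j) * (prim b w t - prim b w (x j)))
   = of_real (\<Sum>j\<in>?J. \<beta> j) * prim b w t - (\<Sum>j\<in>?J. of_real (\<beta> j) * prim b w (x j))"
  by (simp only: right_diff_distrib sum_subtractf of_real_sum sum_distrib_right)
 finally have "volterra w t = (of_real t * prim b w t - (LINT s|M. cut 0 t (%s. of_real s * w s) s)) + (\<Sum>j\<in>?J. of_real (\<beta> j) * prim b w (x j))"
  unfolding volterra_def P_def of_real_add distrib_right by simp
 then show ?thesis unfolding A by simp
qed

text \<open>The domain of the maximal operator consists of the functions \<open>c + \<integral> f' dP\<close> with
 \<open>f' = - prim b g\<close>.\<close>

definition Hmax :: "real graph" where
 "Hmax = {(f, g). f \<in> L2 M \<and> g \<in> L2 M \<and> (\<exists>c. AE t in M. f t = c - volterra g t)}"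

lemma HmaxI: "f \<in> L2 M ==> g \<in> L2 M ==> (AE t in M. f t = c - volterra g t) ==> (f, g) \<in> Hmax"
 unfolding Hmax_def by blast

lemma HmaxE:
 assumes "(f, g) \<in> Hmax"
 obtains c where "f \<in> L2 M" "g \<in> L2 M" "AE t in M. f t = c - volterra g t"
 using assms unfolding Hmax_def by blast

text \<open>An element of the domain is known only almost everywhere, so the boundary values at
  \<open>R\<close> are those of the representative \<open>c - volterra g\<close> and of the
  derivative \<open>- prim b g\<close>. The formula thus holds at every \<open>R\<close>, nodes
  included.\<close>

lemma green:
 assumes f: "f \<in> borel_measurable M" and g: "g \<in> L2 M" and fc: "AE t in M. f t = c - volterra g t"
  and k: "k \<in> borel_measurable M" and h: "h \<in> L2 M" and ka: "AE t in M. k t = a - volterra h t" and R: "R \<in> I"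
 shows "(LINT t|M. cut 0 R (%t. f t * cnj (h t) - g t * cnj (k t)) t)
  = (c - volterra g R) * cnj (prim b h R) - prim b g R * cnj (a - volterra h R)"
proof -
 define h' where "h' = (%t. cnj (h t))"
 have h': "h' \<in> L2 M" unfolding h'_def by (rule L2_cnj[OF h])
 have R0: "0 \<le> R" using Ivl_nonneg[OF R] .
 have ig: "integrable M (cut 0 R g)" and ih: "integrable M (cut 0 R h')"
  by (rule cut_integrable[OF _ order_refl R0 R], fact)+
 let ?G = "%t. g t * volterra h' t - h' t * volterra g t"
 have prodint: "integrable M (%t. cut 0 R u t * cut 0 R v t)" if u: "u \<in> L2 M" and v: "cut 0 R v \<in> L2 M" for u v
  using L2_mult_integrable[OF cut_L2[OF u, of 0 R] L2_cnj[OF v]] by simp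
 have Gint: "integrable M (cut 0 R ?G)"
 proof -
  have "cut 0 R ?G = (%t. cut 0 R g t * cut 0 R (volterra h') t - cut 0 R h' t * cut 0 R (volterra g) t)"
   by (auto simp: cut_def)
  then show ?thesis using prodint[OF g volterra_cut_L2[OF h' R]] prodint[OF h' volterra_cut_L2[OF g R]] by simp
 qed
 have "(LINT t|M. cut 0 R (%t. f t * cnj (h t) - g t * cnj (k t)) t)
   = (LINT t|M. c * cut 0 R h' t - cnj a * cut 0 R g t + cut 0 R ?G t)"
 proof (rule integral_cong_AE)
  show "cut 0 R (%t. f t * cnj (h t) - g t * cnj (k t)) \<in> borel_measurable M"
   by (intro cut_measurable borel_measurable_diff borel_measurable_times borel_measurable_cnj f k L2_measurable[OF g] L2_measurable[OF h])
  show "(%t. c * cut 0 R h' t - cnj a * cut 0 R g t + cut 0 R ?G t) \<in> borel_measurable M"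
   using borel_measurable_integrable[OF ig] borel_measurable_integrable[OF ih] borel_measurable_integrable[OF Gint] by simp
  show "AE t in M. cut 0 R (%t. f t * cnj (h t) - g t * cnj (k t)) t = c * cut 0 R h' t - cnj a * cut 0 R g t + cut 0 R ?G t"
   using fc ka
  proof eventually_elim
   case (elim t)
   show ?case
   proof (cases "0 \<le> t \<and> t < R")
    case True
    then show ?thesis unfolding cut_in[OF True[THEN conjunct1] True[THEN conjunct2]] h'_def volterra_cnj elim by (simp add: algebra_simps)
   next
    case False
    then show ?thesis unfolding cut_out[OF False] by simp
   qed
  qed
 qed
 also have "... = c * prim b h' R - cnj a * prim b g R + (LINT t|M. cut 0 R ?G t)"
  using ig ih Gint by (simp add: prim_def)
 also have "... = (c - volterra g R) * cnj (prim b h R) - prim b g R * cnj (a - volterra h R)"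
  unfolding volterra_green[OF g h' R] unfolding h'_def prim_cnj volterra_cnj by (simp add: algebra_simps)
 finally show ?thesis .
qed

end

section \<open>Gauge integrals and one-sided limits on \<open>Ivl b\<close>\<close>

lemma AE_Ivl_negligible:
 assumes "AE t in Ivl_measure b. Q t"
 obtains N where "negligible N" "\<And>t. t \<in> Ivl b ==> t \<notin> N ==> Q t"
proof -
 obtain N where N: "N \<in> null_sets (Ivl_measure b)" "{t \<in> space (Ivl_measure b). \<not> Q t} \<subseteq> N"
  using assms unfolding eventually_ae_filter by blast
 have "N \<in> null_sets lebesgue" using N(1) by (simp add: null_sets_restrict_space)
 then have "negligible N" by (simp add: negligible_iff_null_sets)
 moreover have "Q t" if "t \<in> Ivl b" "t \<notin> N" for t using N(2) that by auto
 ultimately show ?thesis using that by blast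
qed

lemma negligible_AE_Ivl:
 assumes "negligible N" "\<And>t. t \<in> Ivl b ==> t \<notin> N ==> Q t"
 shows "AE t in Ivl_measure b. Q t"
proof -
 have "N \<in> null_sets lebesgue" using assms(1) by (simp add: negligible_iff_null_sets)
 then have "AE t in lebesgue. t \<notin> N" by (rule AE_not_in)
 then have "AE t in lebesgue. t \<in> Ivl b --> Q t" by eventually_elim (use assms(2) in blast)
 then show ?thesis by (simp add: AE_restrict_space_iff)
qed

lemma has_integral_cut:
 fixes g :: "real \<Rightarrow> complex"
 assumes i: "integrable (Ivl_measure b) (cut a c g)" and ac: "0 \<le> a" "c \<in> Ivl b"
 shows "(g has_integral (LINT s|Ivl_measure b. cut a c g s)) {a..c}"
proof -
 have sub: "{a..c} \<subseteq> Ivl b" using ac by (auto intro: Ivl_downward)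
 have "(cut a c g has_integral (LINT s|Ivl_measure b. cut a c g s)) (Ivl b)"
  by (rule has_integral_integral_lebesgue_on[OF i]) simp
 then have "((%s. if s \<in> {a..c} then g s else 0) has_integral (LINT s|Ivl_measure b. cut a c g s)) (Ivl b)"
  by (rule has_integral_spike[of "{c}", rotated 2]) (auto simp: cut_def)
 then show ?thesis by (simp only: has_integral_restrict[OF sub])
qed

lemma has_integral_prim:
 assumes g: "g \<in> L2 (Ivl_measure b)" and ac: "0 \<le> a" "a \<le> c" "c \<in> Ivl b"
 shows "(g has_integral (prim b g c - prim b g a)) {a..c}"
 unfolding prim_diff[OF g ac] by (rule has_integral_cut[OF cut_integrable[OF g ac] ac(1,3)])

lemma tendsto_one_sided:
 fixes g :: "real \<Rightarrow> complex"
 assumes g: "continuous_on (Ivl b) g" and t: "t \<in> Ivl b"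
 shows "t < r ==> r \<in> Ivl b ==> (g \<longlongrightarrow> g t) (at_right t)" and "0 < t ==> (g \<longlongrightarrow> g t) (at_left t)"
proof -
 assume r: "t < r" "r \<in> Ivl b"
 have "continuous_on {t..r} g" by (rule continuous_on_subset[OF g]) (use r Ivl_nonneg[OF t] in "auto intro: Ivl_downward")
 then have "(g \<longlongrightarrow> g t) (at t within {t..r})" using r by (auto simp: continuous_on_def)
 then show "(g \<longlongrightarrow> g t) (at_right t)" using r by (simp add: at_within_Icc_at_right)
next
 assume r: "0 < t"
 have "continuous_on {0..t} g" by (rule continuous_on_subset[OF g]) (use t in "auto intro: Ivl_downward")
 then have "(g \<longlongrightarrow> g t) (at t within {0..t})" using r by (auto simp: continuous_on_def)
 then show "(g \<longlongrightarrow> g t) (at_left t)" using r by (simp add: at_within_Icc_at_left)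
qed

context delta_chain
begin

abbreviation X :: "real set" where "X \<equiv> x ` {1..}"

lemma zero_notin_X: "0 \<notin> X"
proof
 assume "0 \<in> X"
 then obtain n where "n \<ge> 1" "x n = x 0" using x0 by force
 then show False using x_less_iff[of 0 n] by simp
qed

lemma x_pos: "1 \<le> n ==> 0 < x n"
 using x_less_iff[of 0 n] x0 by simp

lemma open_interval_off_X:
 assumes "x n < a" "c < x (Suc n)"
 shows "{a..c} \<subseteq> I - X"
proof
 fix t assume "t \<in> {a..c}"
 then have t: "x n < t" "t < x (Suc n)" using assms by auto
 have "t \<in> I" using Ivl_downward[OF x_in_I[of "Suc n"], of t] t x_nonneg[of n] by linarith
 moreover have "t \<notin> X"
 proof
  assume "t \<in> X"
  then obtain m where "t = x m" by auto
  then have "n < m" "m < Suc n" using t by auto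
  then show False by simp
 qed
 ultimately show "t \<in> I - X" by blast
qed

lemma first_interval_off_X:
 assumes "0 \<le> a" "c < x 1"
 shows "{a..c} \<subseteq> I - X"
proof
 fix t assume "t \<in> {a..c}"
 then have t: "0 \<le> t" "t < x 1" using assms by auto
 show "t \<in> I - X"
 proof (cases "t = 0")
  case True
  then show ?thesis using zero_in_I zero_notin_X by simp
 next
  case False
  then have "t \<in> {t..t}" "x 0 < t" using t x0 by auto
  then show ?thesis using open_interval_off_X[of 0 t t] t by auto
 qed
qed

lemma off_X_interval_obtain:
 assumes "t \<in> I - X"
 obtains n where "x n < t" "t < x (Suc n)" | "t = 0"
proof -
 obtain n where n: "x n \<le> t" "t < x (Suc n)" using interval_obtain assms by blast
 show ?thesis
 proof (cases "x n = t")
  case True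
  then have "n = 0" using assms by (cases n) auto
  then show ?thesis using that(2) True x0 by simp
 next
  case False
  then show ?thesis using that(1)[of n] n by simp
 qed
qed

text \<open>The value zero enters at \<open>0+\<close> and is passed on from cell to cell, since
  equal one-sided limits at a node transmit it. The point \<open>0\<close> belongs to the first cell
  and is reached by \<open>const\<close> from inside.\<close>

lemma piecewise_constant_zero:
 fixes D :: "real \<Rightarrow> complex"
 assumes const: "\<And>a c. a \<le> c ==> {a..c} \<subseteq> I - X ==> D c = D a"
  and D0: "(D \<longlongrightarrow> 0) (at_right 0)"
  and glue: "\<And>n. 1 \<le> n ==> \<exists>l. (D \<longlongrightarrow> l) (at_right (x n)) \<and> (D \<longlongrightarrow> l) (at_left (x n))"
  and t: "t \<in> I - X"
 shows "D t = 0"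
proof -
 have zero: "D t = 0" if lim: "(D \<longlongrightarrow> 0) (at_right (x n))" and t: "x n < t" "t < x (Suc n)" for n t
 proof -
  have ev: "\<forall>\<^sub>F s in at_right (x n). D t = D s"
   unfolding eventually_at_right_field
  proof (intro exI[of _ t] conjI allI impI t(1))
   fix s assume "x n < s" "s < t"
   then show "D t = D s" using const[of s t] open_interval_off_X[of n s t] t by simp
  qed
  have "(D \<longlongrightarrow> D t) (at_right (x n))" by (rule tendsto_eventually) (use ev in "auto elim: eventually_mono")
  then show ?thesis using lim by (intro tendsto_unique[OF trivial_limit_at_right_real])
 qed
 have lim: "(D \<longlongrightarrow> 0) (at_right (x n))" for n
 proof (induction n)
  case 0
  then show ?case using D0 x0 by simp
 next
  case (Suc n)
  have "\<forall>\<^sub>F s in at_left (x (Suc n)). D s = 0"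
   unfolding eventually_at_left_field
   by (intro exI[of _ "x n"]) (use zero[OF Suc] in auto)
  then have left: "(D \<longlongrightarrow> 0) (at_left (x (Suc n)))" by (rule tendsto_eventually)
  obtain l where l: "(D \<longlongrightarrow> l) (at_right (x (Suc n)))" "(D \<longlongrightarrow> l) (at_left (x (Suc n)))" using glue[of "Suc n"] by auto
  have "l = 0" by (rule tendsto_unique[OF trivial_limit_at_left_real l(2) left])
  then show ?case using l(1) by simp
 qed
 from t show ?thesis
 proof (cases rule: off_X_interval_obtain)
  case (1 n)
  then show ?thesis using zero[OF lim] by blast
 next
  case 2
  have x1: "0 < x 1" by (rule x_pos) simp
  have "D (x 1 / 2) = D 0" by (rule const) (use x1 first_interval_off_X[of 0 "x 1 / 2"] in auto)
  moreover have "D (x 1 / 2) = 0" by (rule zero[OF lim, of 0]) (use x1 x0 in auto)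
  ultimately show ?thesis using 2 by simp
 qed
qed

lemma cut_prim_L2:
 assumes w: "w \<in> L2 M" and R: "R \<in> I"
 shows "cut 0 R (prim b w) \<in> L2 M"
proof (rule cut_bounded_L2(1)[OF order_refl Ivl_nonneg[OF R] R prim_measurable[OF w]])
 fix r assume r: "0 \<le> r" "r < R"
 have "r \<in> I" using r R by (auto intro: Ivl_downward)
 then have "cmod (prim b w r) \<le> sqrt r * nrm w" by (rule prim_bound[OF w])
 also have "... \<le> sqrt R * nrm w" using r by (intro mult_right_mono) auto
 finally show "cmod (prim b w r) \<le> sqrt R * nrm w" .
qed (use Ivl_nonneg[OF R] in simp)

text \<open>\<open>prim b w\<close> need not be square integrable up to \<open>b\<close>; its
  truncation at a node beyond \<open>c\<close> is, and coincides with it on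
  \<open>[a, c]\<close>.\<close>

lemma has_integral_prim_prim:
 assumes w: "w \<in> L2 M" and ac: "0 \<le> a" "a \<le> c" "c \<in> I"
 shows "(prim b w has_integral (prim b (prim b w) c - prim b (prim b w) a)) {a..c}"
proof -
 obtain n where n: "c < x n" using ex_x_gt[OF ac(3)] by blast
 have "(cut 0 (x n) (prim b w) has_integral (prim b (cut 0 (x n) (prim b w)) c - prim b (cut 0 (x n) (prim b w)) a)) {a..c}"
  by (rule has_integral_prim[OF cut_prim_L2[OF w x_in_I] ac])
 then have "(cut 0 (x n) (prim b w) has_integral (prim b (prim b w) c - prim b (prim b w) a)) {a..c}"
  using n ac by (simp add: prim_cut)
 then show ?thesis by (rule has_integral_eq[rotated]) (use n ac in "auto simp: cut_def")
qed

lemma prim_prim_continuous_on: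
 assumes w: "w \<in> L2 M" and R: "R \<in> I"
 shows "continuous_on {0..R} (prim b (prim b w))"
proof -
 have "continuous_on {0..R} (prim b (cut 0 R (prim b w)))"
  by (rule continuous_on_subset[OF prim_continuous_on[OF cut_prim_L2[OF w R]]]) (use R in "auto intro: Ivl_downward")
 then show ?thesis by (rule continuous_on_eq) (simp add: prim_cut)
qed

lemma prim_prim_derivative:
 assumes w: "w \<in> L2 M" and R: "R \<in> I" and t: "0 \<le> t" "t \<le> R"
 shows "(prim b (prim b w) has_vector_derivative prim b w t) (at t within {0..R})"
proof -
 have sub: "{0..R} \<subseteq> I" using R by (auto intro: Ivl_downward)
 have "continuous_on {0..R} (prim b w)" by (rule continuous_on_subset[OF prim_continuous_on[OF w] sub])
 then have "((%u. integral {0..u} (prim b w)) has_vector_derivative prim b w t) (at t within {0..R})"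
  by (rule integral_has_vector_derivative) (use t in simp)
 then show ?thesis
 proof (rule has_vector_derivative_transform[rotated 2])
  fix u assume "u \<in> {0..R}"
  then show "prim b (prim b w) u = integral {0..u} (prim b w)"
   using integral_unique[OF has_integral_prim_prim[OF w order_refl, of u]] sub by auto
 qed (use t in simp)
qed

lemma volterra_on_interval:
 assumes w: "w \<in> L2 M" and t: "x n \<le> t" "t < x (Suc n)"
 shows "volterra w t = prim b (prim b w) t + (\<Sum>j=1..n. of_real (\<beta> j) * prim b w (x j))"
proof -
 have "t \<in> I" using Ivl_downward[OF x_in_I[of "Suc n"], of t] t x_nonneg[of n] by linarith
 then show ?thesis by (simp only: volterra_eq_integral[OF w] x_le_set[OF t])
qed

lemma volterra_diff:
 assumes w: "w \<in> L2 M" and ac: "a \<le> c" "{a..c} \<subseteq> I - X"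
 shows "volterra w c - volterra w a = prim b (prim b w) c - prim b (prim b w) a"
proof -
 have a: "a \<in> I" and c: "c \<in> I" using ac by auto
 have "{j. 1 \<le> j \<and> x j \<le> c} = {j. 1 \<le> j \<and> x j \<le> a}"
 proof (intro Collect_cong conj_cong refl iffI)
  fix j :: nat assume j: "1 \<le> j" "x j \<le> c"
  have "x j \<in> X" using j by simp
  then have "x j \<notin> {a..c}" using ac by blast
  then show "x j \<le> a" using j by simp
 qed (use ac in auto)
 then show ?thesis by (simp add: volterra_eq_integral w a c del: One_nat_def)
qed

lemma volterra_right_limit:
 assumes w: "w \<in> L2 M"
 shows "(volterra w \<longlongrightarrow> volterra w (x n)) (at_right (x n))"
proof -
 have lt: "x n < x (Suc n)" by simp
 have "continuous_on {x n..x (Suc n)} (prim b (prim b w))"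
  by (rule continuous_on_subset[OF prim_prim_continuous_on[OF w x_in_I]]) (use x_nonneg in auto)
 then have "(prim b (prim b w) \<longlongrightarrow> prim b (prim b w) (x n)) (at (x n) within {x n..x (Suc n)})"
  using lt by (auto simp: continuous_on_def)
 then have "(prim b (prim b w) \<longlongrightarrow> prim b (prim b w) (x n)) (at_right (x n))"
  using lt by (simp only: at_within_Icc_at_right)
 then have "((%t. prim b (prim b w) t + (\<Sum>j=1..n. of_real (\<beta> j) * prim b w (x j))) \<longlongrightarrow> volterra w (x n)) (at_right (x n))"
  unfolding volterra_on_interval[OF w order_refl lt] by (intro tendsto_intros)
 then show ?thesis
 proof (rule Lim_transform_eventually)
  show "\<forall>\<^sub>F t in at_right (x n). prim b (prim b w) t + (\<Sum>j=1..n. of_real (\<beta> j) * prim b w (x j)) = volterra w t"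
   unfolding eventually_at_right_field
   by (intro exI[of _ "x (Suc n)"] conjI lt allI impI, rule volterra_on_interval[OF w, symmetric]) simp_all
 qed
qed

lemma volterra_left_limit:
 assumes w: "w \<in> L2 M"
 shows "(volterra w \<longlongrightarrow> volterra w (x (Suc n)) - of_real (\<beta> (Suc n)) * prim b w (x (Suc n))) (at_left (x (Suc n)))"
proof -
 have lt: "x n < x (Suc n)" "x (Suc n) < x (Suc (Suc n))" by simp_all
 have "continuous_on {x n..x (Suc n)} (prim b (prim b w))"
  by (rule continuous_on_subset[OF prim_prim_continuous_on[OF w x_in_I]]) (use x_nonneg in auto)
 then have "(prim b (prim b w) \<longlongrightarrow> prim b (prim b w) (x (Suc n))) (at (x (Suc n)) within {x n..x (Suc n)})"
  using lt by (auto simp: continuous_on_def)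
 then have "(prim b (prim b w) \<longlongrightarrow> prim b (prim b w) (x (Suc n))) (at_left (x (Suc n)))"
  using lt by (simp only: at_within_Icc_at_left)
 then have "((%t. prim b (prim b w) t + (\<Sum>j=1..n. of_real (\<beta> j) * prim b w (x j))) \<longlongrightarrow>
   prim b (prim b w) (x (Suc n)) + (\<Sum>j=1..n. of_real (\<beta> j) * prim b w (x j))) (at_left (x (Suc n)))"
  by (intro tendsto_intros)
 also have "prim b (prim b w) (x (Suc n)) + (\<Sum>j=1..n. of_real (\<beta> j) * prim b w (x j))
   = volterra w (x (Suc n)) - of_real (\<beta> (Suc n)) * prim b w (x (Suc n))"
  unfolding volterra_on_interval[OF w order_refl lt(2)] by simp
 finally show ?thesis
 proof (rule Lim_transform_eventually)
  show "\<forall>\<^sub>F t in at_left (x (Suc n)). prim b (prim b w) t + (\<Sum>j=1..n. of_real (\<beta> j) * prim b w (x j)) = volterra w t"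
   unfolding eventually_at_left_field
   by (intro exI[of _ "x n"] conjI lt allI impI, rule volterra_on_interval[OF w, symmetric]) simp_all
 qed
qed

lemma volterra_derivative:
 assumes w: "w \<in> L2 M" and t: "t \<in> I - X"
 shows "(volterra w has_vector_derivative prim b w t) (at t within I - X)"
proof -
 obtain n where n: "x n \<le> t" "t < x (Suc n)" using interval_obtain t by blast
 have Ra: "x (Suc n) \<in> I" by (rule x_in_I)
 have t0: "0 \<le> t" using n x_nonneg[of n] by linarith
 have nn: "x n < t \<or> n = 0"
 proof (rule disjCI)
  assume "n \<noteq> 0"
  then have "x n \<in> X" by simp
  then have "x n \<noteq> t" using t by blast
  then show "x n < t" using n(1) by linarith
 qed
 \<comment> \<open>The distance of \<open>t\<close> to the ends of its cell. In the first cell only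
   the right end counts, since \<open>I\<close> has no points to the left of \<open>0\<close>; this
   includes \<open>t = 0\<close>.\<close>
 define d where "d = (if n = 0 then x (Suc n) - t else min (t - x n) (x (Suc n) - t))"
 have d: "d > 0" using n nn by (auto simp: d_def)
 have near: "x n \<le> s \<and> s < x (Suc n)" if s: "s \<in> I - X" "dist s t < d" for s
 proof (cases "n = 0")
  case True
  have "0 \<le> s" using s(1) Ivl_nonneg by blast
  moreover have "\<bar>s - t\<bar> < x (Suc n) - t" using s(2) True by (simp add: d_def dist_real_def)
  moreover have "x n = 0" using True x0 by simp
  ultimately show ?thesis by (intro conjI) linarith+
 next
  case False
  then have "\<bar>s - t\<bar> < t - x n" "\<bar>s - t\<bar> < x (Suc n) - t" using s(2) by (simp_all add: d_def dist_real_def)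
  then show ?thesis by (intro conjI) linarith+
 qed
 have "(prim b (prim b w) has_vector_derivative prim b w t) (at t within {0..x (Suc n)})"
  by (rule prim_prim_derivative[OF w Ra t0]) (use n in simp)
 then have "((%s. prim b (prim b w) s + (\<Sum>j=1..n. of_real (\<beta> j) * prim b w (x j))) has_vector_derivative prim b w t) (at t within {0..x (Suc n)})"
  by (rule has_vector_derivative_add_const[THEN iffD2])
 then have "((%s. prim b (prim b w) s + (\<Sum>j=1..n. of_real (\<beta> j) * prim b w (x j))) has_vector_derivative prim b w t) (at t within (I - X) \<inter> {0..x (Suc n)})"
  by (rule has_vector_derivative_within_subset) auto
 moreover have "at t within (I - X) \<inter> {0..x (Suc n)} = at t within I - X"
 proof (rule at_within_nhd)
  show "t \<in> ball t d" "open (ball t d)" using d by auto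
  show "(I - X) \<inter> {0..x (Suc n)} \<inter> ball t d - {t} = (I - X) \<inter> ball t d - {t}"
  proof (intro equalityI subsetI)
   fix s assume s: "s \<in> (I - X) \<inter> ball t d - {t}"
   then have "dist s t < d" by (simp add: dist_commute)
   then have "x n \<le> s \<and> s < x (Suc n)" using near s by blast
   then have "s \<in> {0..x (Suc n)}" using x_nonneg[of n] by auto
   then show "s \<in> (I - X) \<inter> {0..x (Suc n)} \<inter> ball t d - {t}" using s by blast
  qed blast
 qed
 ultimately have D: "((%s. prim b (prim b w) s + (\<Sum>j=1..n. of_real (\<beta> j) * prim b w (x j))) has_vector_derivative prim b w t) (at t within I - X)"
  by simp
 show ?thesis
 proof (rule has_vector_derivative_transform_within[OF D d t])
  fix s assume "s \<in> I - X" "dist s t < d"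
  from near[OF this] show "prim b (prim b w) s + (\<Sum>j=1..n. of_real (\<beta> j) * prim b w (x j)) = volterra w s"
   by (intro volterra_on_interval[OF w, symmetric]) blast+
 qed
qed

end

lemma L2_norm_integrable_on:
 assumes g: "g \<in> L2 (Ivl_measure b)" and ac: "0 \<le> a" "a \<le> c" "c \<in> Ivl b"
 shows "(%t. cmod (g t)) integrable_on {a..c}" "(%t. (cmod (g t))^2) integrable_on {a..c}"
proof -
 have sub: "{a..c} \<subseteq> Ivl b" using ac by (auto intro: Ivl_downward)
 have "(%t. (cmod (g t))^2) integrable_on Ivl b"
  by (rule integrable_on_lebesgue_on[OF L2_integrable_sq[OF g]]) simp
 then show "(%t. (cmod (g t))^2) integrable_on {a..c}" by (rule integrable_on_subinterval[OF _ sub])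
 have "integrable (Ivl_measure b) (%t. cmod (cut a c g t))" by (rule integrable_norm[OF cut_integrable[OF g ac]])
 then have "(%t. cmod (cut a c g t)) integrable_on Ivl b" by (rule integrable_on_lebesgue_on) simp
 then have "(%t. cmod (cut a c g t)) integrable_on {a..c}" by (rule integrable_on_subinterval[OF _ sub])
 then show "(%t. cmod (g t)) integrable_on {a..c}"
  by (rule integrable_spike[of _ _ "{c}"]) (auto simp: cut_def)
qed

section \<open>The minimal operator\<close>

context delta_chain
begin

lemma has_vector_derivative_AE_FTC:
 assumes ac: "a \<le> c" "{a..c} \<subseteq> I - X" and F: "AC_loc (I - X) F" and g: "g \<in> L2 M"
  and der: "AE t in M. (F has_vector_derivative g t) (at t within I - X)"
 shows "F c - F a = prim b g c - prim b g a"
proof -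
 have a: "0 \<le> a" and c: "c \<in> I" using ac Ivl_nonneg[of a b] by auto
 obtain N where N: "negligible N" "\<And>t. t \<in> I ==> t \<notin> N ==> (F has_vector_derivative g t) (at t within I - X)"
  using AE_Ivl_negligible[OF der] by blast
 have "(g has_integral (F c - F a)) {a..c}"
 proof (rule fundamental_theorem_of_calculus_abs_continuous[OF ac(1) _ N(1)])
  show "abs_continuous_on {a..c} F" using F ac(2) unfolding AC_loc_def by blast
  fix t assume "t \<in> {a..c} - N"
  then show "(F has_vector_derivative g t) (at t within {a..c})"
   using N(2)[of t] ac(2) by (intro has_vector_derivative_within_subset[OF _ ac(2)]) auto
 qed
 then show ?thesis using has_integral_unique has_integral_prim[OF g a ac(1) c] by blast
qed

text \<open>Elements of the minimal operator lie in the maximal one and have vanishing boundary data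
 near \<open>b\<close>.\<close>

lemma H0_structure:
 assumes H: "(\<phi>, \<psi>) \<in> H0 b x \<beta>"
 obtains c R where "\<phi> \<in> L2 M" "\<psi> \<in> L2 M" "AE t in M. \<phi> t = c - volterra \<psi> t" "R \<in> I"
  "\<And>t. t \<in> I - X ==> R < t ==> c - volterra \<psi> t = 0 \<and> prim b \<psi> t = 0"
proof -
 obtain f1 f2 where \<psi>: "\<psi> = (%t. - f2 t)" and jet: "W22_jet b X \<phi> f1 f2"
  and supp: "compact_support_in_Ivl b X \<phi>" and bc: "delta'_conditions x \<beta> \<phi> f1"
  using H unfolding H0_def by blast
 have fL: "\<phi> \<in> L2 M" and wL: "f2 \<in> L2 M" and ac1: "AC_loc (I - X) f1"
  and der0: "\<And>t. t \<in> I - X ==> (\<phi> has_vector_derivative f1 t) (at t within I - X)"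
  and der1: "AE t in M. (f1 has_vector_derivative f2 t) (at t within I - X)"
  using jet unfolding W22_jet_def by blast+
 have \<psi>L: "\<psi> \<in> L2 M" unfolding \<psi> by (rule L2_uminus[OF wL])
 have pc: "continuous_on I (prim b f2)" by (rule prim_continuous_on[OF wL])
 have pr: "(prim b f2 \<longlongrightarrow> prim b f2 (x n)) (at_right (x n))" for n
  by (rule tendsto_one_sided(1)[OF pc x_in_I _ x_in_I[of "Suc n"]]) simp
 have pl: "(prim b f2 \<longlongrightarrow> prim b f2 (x n)) (at_left (x n))" if "1 \<le> n" for n
  by (rule tendsto_one_sided(2)[OF pc x_in_I x_pos[OF that]])
 have bc0: "(f1 \<longlongrightarrow> 0) (at_right 0)" using bc unfolding delta'_conditions_def by blast
 have bcn: "\<exists>fr fl f1x. (\<phi> \<longlongrightarrow> fr) (at_right (x n)) \<and> (\<phi> \<longlongrightarrow> fl) (at_left (x n)) \<and>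
    (f1 \<longlongrightarrow> f1x) (at_right (x n)) \<and> (f1 \<longlongrightarrow> f1x) (at_left (x n)) \<and> fr - fl = of_real (\<beta> n) * f1x" if "1 \<le> n" for n
  using bc that unfolding delta'_conditions_def by blast
 have f1: "f1 t = prim b f2 t" if t: "t \<in> I - X" for t
 proof -
  have "f1 t - prim b f2 t = 0"
  proof (rule piecewise_constant_zero[OF _ _ _ t])
   show "f1 c - prim b f2 c = f1 a - prim b f2 a" if "a \<le> c" "{a..c} \<subseteq> I - X" for a c
    using has_vector_derivative_AE_FTC[OF that ac1 wL der1] by (simp add: algebra_simps)
   show "((%t. f1 t - prim b f2 t) \<longlongrightarrow> 0) (at_right 0)"
    using tendsto_diff[OF bc0 pr[of 0, unfolded x0]] by simp
   fix n :: nat assume n: "1 \<le> n"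
   then obtain f1x where l: "(f1 \<longlongrightarrow> f1x) (at_right (x n))" "(f1 \<longlongrightarrow> f1x) (at_left (x n))" using bcn by blast
   show "\<exists>l. ((%t. f1 t - prim b f2 t) \<longlongrightarrow> l) (at_right (x n)) \<and> ((%t. f1 t - prim b f2 t) \<longlongrightarrow> l) (at_left (x n))"
    by (rule exI, rule conjI[OF tendsto_diff[OF l(1) pr] tendsto_diff[OF l(2) pl[OF n]]])
  qed
  then show ?thesis by simp
 qed
 have \<phi>: "\<phi> t = \<phi> 0 + volterra f2 t" if t: "t \<in> I - X" for t
 proof -
  have "\<phi> t - \<phi> 0 - volterra f2 t = 0"
  proof (rule piecewise_constant_zero[OF _ _ _ t])
   show "\<phi> c - \<phi> 0 - volterra f2 c = \<phi> a - \<phi> 0 - volterra f2 a" if ac: "a \<le> c" "{a..c} \<subseteq> I - X" for a c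
   proof -
    have a: "0 \<le> a" and c: "c \<in> I" using ac Ivl_nonneg[of a b] by auto
    have "(prim b f2 has_integral (\<phi> c - \<phi> a)) {a..c}"
    proof (rule fundamental_theorem_of_calculus[OF ac(1)])
     fix s assume s: "s \<in> {a..c}"
     then have s': "s \<in> I - X" using ac(2) by blast
     show "(\<phi> has_vector_derivative prim b f2 s) (at s within {a..c})"
      using has_vector_derivative_within_subset[OF der0[OF s'] ac(2)] f1[OF s'] by simp
    qed
    then have "\<phi> c - \<phi> a = prim b (prim b f2) c - prim b (prim b f2) a"
     using has_integral_unique has_integral_prim_prim[OF wL a ac(1) c] by blast
    then have "\<phi> c - \<phi> a = volterra f2 c - volterra f2 a" using volterra_diff[OF wL ac] by (simp only:)
    then show ?thesis by (simp add: algebra_simps)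
   qed
   have x1: "0 < x 1" by (rule x_pos) simp
   have "(\<phi> has_vector_derivative f1 0) (at 0 within {0..x 1 / 2})"
    by (rule has_vector_derivative_within_subset[OF der0])
     (use zero_in_I zero_notin_X first_interval_off_X[of 0 "x 1 / 2"] x1 in auto)
   then have "continuous (at 0 within {0..x 1 / 2}) \<phi>" by (rule has_vector_derivative_continuous)
   then have "(\<phi> \<longlongrightarrow> \<phi> 0) (at_right 0)" using x1 by (simp add: continuous_within at_within_Icc_at_right)
   then have "((%t. \<phi> t - \<phi> 0 - volterra f2 t) \<longlongrightarrow> \<phi> 0 - \<phi> 0 - volterra f2 0) (at_right 0)"
    using volterra_right_limit[OF wL, of 0] unfolding x0 by (intro tendsto_intros)
   then show "((%t. \<phi> t - \<phi> 0 - volterra f2 t) \<longlongrightarrow> 0) (at_right 0)" by simp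
   fix n :: nat assume n: "1 \<le> n"
   then obtain m where m: "n = Suc m" by (cases n) auto
   obtain fr fl f1x where fr: "(\<phi> \<longlongrightarrow> fr) (at_right (x n))" and fl: "(\<phi> \<longlongrightarrow> fl) (at_left (x n))"
    and f1r: "(f1 \<longlongrightarrow> f1x) (at_right (x n))" and jump: "fr - fl = of_real (\<beta> n) * f1x" using bcn[OF n] by blast
   \<comment> \<open>Off \<open>X\<close> the derivative \<open>f1\<close> agrees with the
     continuous function \<open>prim b f2\<close>, which identifies its common limit at the node.
     The prescribed jump of \<open>\<phi>\<close> is then exactly the jump of
     \<open>volterra f2\<close>, so the difference has equal one-sided limits.\<close>
   have "(f1 \<longlongrightarrow> prim b f2 (x n)) (at_right (x n))"
   proof (rule Lim_transform_eventually[OF pr])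
    show "\<forall>\<^sub>F t in at_right (x n). prim b f2 t = f1 t"
     unfolding eventually_at_right_field
    proof (intro exI[of _ "x (Suc n)"] conjI allI impI)
     fix s assume "x n < s" "s < x (Suc n)"
     then have "s \<in> I - X" using open_interval_off_X[of n s s] by auto
     then show "prim b f2 s = f1 s" using f1 by simp
    qed simp
   qed
   then have f1x: "f1x = prim b f2 (x n)" using f1r by (intro tendsto_unique[OF trivial_limit_at_right_real])
   have "((%t. \<phi> t - \<phi> 0 - volterra f2 t) \<longlongrightarrow> fr - \<phi> 0 - volterra f2 (x n)) (at_right (x n))"
    by (intro tendsto_intros fr volterra_right_limit[OF wL])
   moreover have "((%t. \<phi> t - \<phi> 0 - volterra f2 t) \<longlongrightarrow> fl - \<phi> 0 - (volterra f2 (x n) - of_real (\<beta> n) * prim b f2 (x n))) (at_left (x n))"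
    unfolding m by (intro tendsto_intros fl[unfolded m] volterra_left_limit[OF wL])
   moreover have "fl - \<phi> 0 - (volterra f2 (x n) - of_real (\<beta> n) * prim b f2 (x n)) = fr - \<phi> 0 - volterra f2 (x n)"
    using jump f1x by (simp add: algebra_simps)
   ultimately have "((%t. \<phi> t - \<phi> 0 - volterra f2 t) \<longlongrightarrow> fr - \<phi> 0 - volterra f2 (x n)) (at_right (x n)) \<and>
     ((%t. \<phi> t - \<phi> 0 - volterra f2 t) \<longlongrightarrow> fr - \<phi> 0 - volterra f2 (x n)) (at_left (x n))"
    by (simp only: simp_thms)
   then show "\<exists>l. ((%t. \<phi> t - \<phi> 0 - volterra f2 t) \<longlongrightarrow> l) (at_right (x n)) \<and> ((%t. \<phi> t - \<phi> 0 - volterra f2 t) \<longlongrightarrow> l) (at_left (x n))"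
    by (rule exI)
  qed
  then show ?thesis by (simp add: algebra_simps)
 qed
 have vneg: "volterra \<psi> t = - volterra f2 t" "prim b \<psi> t = - prim b f2 t" if "t \<in> I" for t
  using volterra_lincomb[OF wL wL that, of "-1" 0] prim_lincomb[OF wL wL that, of "-1" 0] unfolding \<psi> by simp_all
 have AE: "AE t in M. \<phi> t = \<phi> 0 - volterra \<psi> t"
 proof (rule negligible_AE_Ivl)
  show "negligible X" by (intro negligible_iff_null_sets[THEN iffD2] null_sets_completionI countable_imp_null_set_lborel) simp
  show "\<phi> t = \<phi> 0 - volterra \<psi> t" if "t \<in> I" "t \<notin> X" for t using \<phi>[of t] vneg(1)[of t] that by simp
 qed
 let ?S = "{t \<in> I - X. \<phi> t \<noteq> 0}"
 have cS: "compact (closure ?S)" "closure ?S \<subseteq> I" using supp unfolding compact_support_in_Ivl_def by blast+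
 obtain R where R: "R \<in> I" "\<And>t. t \<in> ?S ==> t \<le> R"
 proof (cases "closure ?S = {}")
  case True
  then have "?S = {}" by simp
  then show ?thesis using that[OF zero_in_I] by blast
 next
  case False
  then obtain R where "R \<in> closure ?S" "\<forall>t\<in>closure ?S. t \<le> R" using compact_attains_sup[OF cS(1)] by blast
  then show ?thesis using that[of R] cS(2) closure_subset[of ?S] by blast
 qed
 have z: "\<phi> t = 0" if "t \<in> I - X" "R < t" for t
 proof (rule ccontr)
  assume "\<phi> t \<noteq> 0"
  then have "t \<in> ?S" using that by blast
  then show False using R(2)[of t] that by simp
 qed
 have "\<phi> 0 - volterra \<psi> t = 0 \<and> prim b \<psi> t = 0" if t: "t \<in> I - X" "R < t" for t
 proof
  show "\<phi> 0 - volterra \<psi> t = 0" using \<phi>[OF t(1)] z[OF t] vneg(1)[of t] t by simp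
  obtain n where n: "x n \<le> t" "t < x (Suc n)" using interval_obtain t by blast
  have "open {R<..<x (Suc n)}" by simp
  have tt: "t < x (Suc n)" "R < t" "x n \<le> t" using n t by auto
  \<comment> \<open>The derivative at \<open>t\<close> is read off on \<open>[t, c]\<close>: there
    \<open>\<phi>\<close> vanishes because \<open>t > R\<close>, and the interval stays inside one
    cell. For \<open>t = 0\<close> this is the first cell with its left end.\<close>
  define c where "c = (t + x (Suc n)) / 2"
  have c: "t < c" "c < x (Suc n)" using tt by (auto simp: c_def)
  have sub: "{t..c} \<subseteq> I - X"
  proof (cases "t = 0")
   case True
   then have "n = 0" using n(1) x_pos[of n] by (cases n) auto
   then show ?thesis using True first_interval_off_X[of 0 c] c by simp
  next
   case False
   have "x n \<noteq> t"
   proof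
    assume "x n = t"
    then show False using t(1) False x0 by (cases n) auto
   qed
   then show ?thesis using open_interval_off_X[of n t c] n c by simp
  qed
  have "(\<phi> has_vector_derivative f1 t) (at t within {t..c})" by (rule has_vector_derivative_within_subset[OF der0[OF t(1)] sub])
  moreover have "(\<phi> has_vector_derivative 0) (at t within {t..c})"
   by (rule has_vector_derivative_transform[OF _ _ has_vector_derivative_const[of 0]])
    (use z sub t c in auto)
  ultimately have "f1 t = 0"
   by (rule vector_derivative_unique_within[rotated]) (use c in "auto simp: at_within_Icc_at_right")
  then show "prim b \<psi> t = 0" using f1[OF t(1)] vneg(2)[of t] t by simp
 qed
 then show ?thesis using that[OF fL \<psi>L AE R(1)] by blast
qed

text \<open>A supply of test functions parametrised by their second derivative. Mean zero makes the
  derivative \<open>prim b w\<close> vanish beyond \<open>R\<close>; \<open>volterra w\<close> is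
  then constant there, and subtracting this constant gives compact support.\<close>

lemma H0_member:
 assumes w: "w \<in> L2 M" and R: "R \<in> I" and wR: "w = cut 0 R w" and w0: "prim b w R = 0"
 shows "(%t. volterra w t - volterra w R, %t. - w t) \<in> H0 b x \<beta>"
proof -
 let ?\<phi> = "%t. volterra w t - volterra w R"
 have pw: "prim b w t = 0" if "R \<le> t" for t using prim_cut_ge[OF that, of b w] wR w0 by simp
 have wwR: "weighted w = cut 0 R (weighted w)"
 proof
  fix t show "weighted w t = cut 0 R (weighted w) t"
   using fun_cong[OF wR, of t] by (auto simp: cut_def weighted_def)
 qed
 have \<phi>0: "?\<phi> t = 0" if "R \<le> t" for t
  using prim_cut_ge[OF that, of b "weighted w"] wwR pw[OF that] pw[OF order_refl] by (simp add: volterra_def)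
 have "cut 0 R ?\<phi> \<in> L2 M"
 proof -
  have c: "(%_. volterra w R) \<in> borel_measurable M" by simp
  have "cut 0 R (%_. volterra w R) \<in> L2 M"
   by (rule cut_bounded_L2(1)[OF order_refl Ivl_nonneg[OF R] R c order_refl]) simp
  then have "(%t. cut 0 R (volterra w) t - cut 0 R (%_. volterra w R) t) \<in> L2 M" by (intro L2_diff volterra_cut_L2 w R)
  moreover have "(%t. cut 0 R (volterra w) t - cut 0 R (%_. volterra w R) t) = cut 0 R ?\<phi>" by (auto simp: cut_def)
  ultimately show ?thesis by simp
 qed
 then have \<phi>L: "?\<phi> \<in> L2 M"
 proof (rule L2_cong_AE[OF _ _ AE_I2])
  show "?\<phi> \<in> borel_measurable M" using volterra_measurable[OF w] by simp
  fix t assume "t \<in> space M"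
  then have "0 \<le> t" by (simp add: Ivl_def)
  then show "cut 0 R ?\<phi> t = ?\<phi> t" using \<phi>0[of t] by (cases "t < R") (simp_all add: cut_in cut_out)
 qed
 have ac: "0 \<le> a" "c \<in> I" if "{a..c} \<subseteq> I - X" "a \<le> c" for a c
  using that Ivl_nonneg[of a b] by auto
 have AC0: "AC_loc (I - X) ?\<phi>"
  unfolding AC_loc_def
 proof (intro allI impI)
  fix a c assume sub: "{a..c} \<subseteq> I - X"
  show "abs_continuous_on {a..c} ?\<phi>"
  proof (cases "a \<le> c")
   case True
   define C where "C = sqrt c * nrm w"
   have c0: "0 \<le> c" using ac[OF sub True] True by simp
   have C0: "C \<ge> 0" using c0 by (simp add: C_def)
   show ?thesis
   proof (rule abs_continuous_onI[OF C0, of "%_. 0"])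
    fix u v assume uv: "a \<le> u" "u \<le> v" "v \<le> c"
    have "{u..v} \<subseteq> {a..c}" using uv by simp
    then have suv: "{u..v} \<subseteq> I - X" using sub by (rule subset_trans)
    have i: "(prim b w has_integral (?\<phi> v - ?\<phi> u)) {u..v}"
     using has_integral_prim_prim[OF w ac(1)[OF suv uv(2)] uv(2) ac(2)[OF suv uv(2)]] volterra_diff[OF w uv(2) suv] by simp
    have "norm (?\<phi> v - ?\<phi> u) \<le> C * measure lborel (cbox u v)"
    proof (rule has_integral_bound[OF C0])
     show "(prim b w has_integral (?\<phi> v - ?\<phi> u)) (cbox u v)" using i by simp
     fix s assume "s \<in> cbox u v"
     then have s: "s \<in> I" "s \<le> c" using suv uv by auto
     have "cmod (prim b w s) \<le> sqrt s * nrm w" by (rule prim_bound[OF w s(1)])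
     also have "... \<le> C" unfolding C_def using s(2) by (intro mult_right_mono) auto
     finally show "norm (prim b w s) \<le> C" .
    qed
    then show "cmod (?\<phi> v - ?\<phi> u) \<le> C * (v - u) + integral {u..v} (%_. 0)" using uv by simp
   qed auto
  next
   case False
   then show ?thesis by (intro abs_continuous_onI[of 0 "%_. 0"]) (simp_all add: integrable_on_empty)
  qed
 qed
 have AC1: "AC_loc (I - X) (prim b w)"
  unfolding AC_loc_def
 proof (intro allI impI)
  fix a c assume sub: "{a..c} \<subseteq> I - X"
  show "abs_continuous_on {a..c} (prim b w)"
  proof (cases "a \<le> c")
   case True
   note ac = ac[OF sub True]
   show ?thesis
   proof (rule abs_continuous_onI[OF order_refl L2_norm_integrable_on[OF w ac(1) True ac(2)]])
    fix u v assume uv: "a \<le> u" "u \<le> v" "v \<le> c"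
    have uv': "0 \<le> u" "v \<in> I" using ac uv by (auto intro: Ivl_downward)
    have "cmod (integral {u..v} w) \<le> integral {u..v} (%t. cmod (w t))"
     by (rule Henstock_Kurzweil_Integration.integral_norm_bound_integral)
      (use has_integral_prim[OF w uv'(1) uv(2) uv'(2)] L2_norm_integrable_on(1)[OF w uv'(1) uv(2) uv'(2)] in auto)
    then show "cmod (prim b w v - prim b w u) \<le> 0 * (v - u) + integral {u..v} (%t. cmod (w t))"
     using integral_unique[OF has_integral_prim[OF w uv'(1) uv(2) uv'(2)]] by simp
   qed
  next
   case False
   then show ?thesis by (intro abs_continuous_onI[of 0 "%_. 0"]) (simp_all add: integrable_on_empty)
  qed
 qed
 have der0: "(?\<phi> has_vector_derivative prim b w t) (at t within I - X)" if "t \<in> I - X" for t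
  using volterra_derivative[OF w that] by (simp add: has_vector_derivative_diff_const)
 have der1: "AE t in M. (prim b w has_vector_derivative w t) (at t within I - X)"
 proof -
  have "w integrable_on {0..R}" using has_integral_prim[OF w order_refl Ivl_nonneg[OF R] R] by auto
  moreover have "w t = 0" if "t \<notin> {0..R}" for t
   using fun_cong[OF wR, of t] cut_out[of 0 t R w] that by auto
  ultimately have "w integrable_on UNIV" by (intro integrable_on_superset[of w "{0..R}" UNIV]) auto
  then have "w integrable_on {a..c}" for a c by (rule integrable_on_subinterval) simp
  then obtain N where N: "negligible N"
   "\<And>a t. a < t ==> t \<notin> N ==> ((%t. integral {a..t} w) has_vector_derivative w t) (at t)"
   using indefinite_integral_vector_derivative_AE by blast
  show ?thesis
  proof (rule negligible_AE_Ivl)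
   show "negligible (N \<union> insert 0 X)" by (rule negligible_Un[OF N(1)], intro negligible_iff_null_sets[THEN iffD2] null_sets_completionI countable_imp_null_set_lborel) simp
   fix t assume t: "t \<in> I" "t \<notin> N \<union> insert 0 X"
   then have t0: "0 < t" using Ivl_nonneg[of t b] by (auto simp: order_less_le)
   have "((%t. integral {0..t} w) has_vector_derivative w t) (at t within I - X)"
    by (rule has_vector_derivative_at_within[OF N(2)]) (use t t0 in auto)
   then show "(prim b w has_vector_derivative w t) (at t within I - X)"
   proof (rule has_vector_derivative_transform[rotated 2])
    show "t \<in> I - X" using t by blast
    fix s assume "s \<in> I - X"
    then have s: "s \<in> I" "0 \<le> s" using Ivl_nonneg by blast+
    show "prim b w s = integral {0..s} w" using integral_unique[OF has_integral_prim[OF w order_refl s(2,1)]] by simp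
   qed
  qed
 qed
 have "compact_support_in_Ivl b X ?\<phi>"
 proof -
  have "{t \<in> I - X. ?\<phi> t \<noteq> 0} \<subseteq> {0..R}"
  proof
   fix t assume "t \<in> {t \<in> I - X. ?\<phi> t \<noteq> 0}"
   then show "t \<in> {0..R}" using \<phi>0[of t] Ivl_nonneg[of t b] by force
  qed
  then have "closure {t \<in> I - X. ?\<phi> t \<noteq> 0} \<subseteq> {0..R}" by (intro closure_minimal) auto
  moreover have "compact (closure {t \<in> I - X. ?\<phi> t \<noteq> 0})"
   using \<open>{t \<in> I - X. ?\<phi> t \<noteq> 0} \<subseteq> {0..R}\<close> by (intro compact_closure[THEN iffD2] bounded_subset[OF bounded_closed_interval[of 0 R]])
  moreover have "{0..R} \<subseteq> I" using R by (auto intro: Ivl_downward)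
  ultimately show ?thesis unfolding compact_support_in_Ivl_def by blast
 qed
 moreover have "delta'_conditions x \<beta> ?\<phi> (prim b w)"
  unfolding delta'_conditions_def
 proof (intro conjI allI impI)
  have pc: "continuous_on I (prim b w)" by (rule prim_continuous_on[OF w])
  have pr: "(prim b w \<longlongrightarrow> prim b w (x n)) (at_right (x n))" for n
   by (rule tendsto_one_sided(1)[OF pc x_in_I _ x_in_I[of "Suc n"]]) simp
  show "(prim b w \<longlongrightarrow> 0) (at_right 0)" using pr[of 0] by (simp add: x0)
  fix n :: nat assume n: "1 \<le> n"
  then obtain m where m: "n = Suc m" by (cases n) auto
  show "\<exists>fr fl f1x. (?\<phi> \<longlongrightarrow> fr) (at_right (x n)) \<and> (?\<phi> \<longlongrightarrow> fl) (at_left (x n)) \<and>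
    (prim b w \<longlongrightarrow> f1x) (at_right (x n)) \<and> (prim b w \<longlongrightarrow> f1x) (at_left (x n)) \<and> fr - fl = of_real (\<beta> n) * f1x"
  proof (intro exI conjI)
   show "(?\<phi> \<longlongrightarrow> volterra w (x n) - volterra w R) (at_right (x n))"
    by (intro tendsto_intros volterra_right_limit[OF w])
   show "(?\<phi> \<longlongrightarrow> volterra w (x n) - of_real (\<beta> n) * prim b w (x n) - volterra w R) (at_left (x n))"
    unfolding m by (intro tendsto_intros volterra_left_limit[OF w])
   show "(prim b w \<longlongrightarrow> prim b w (x n)) (at_right (x n))" by (rule pr)
   show "(prim b w \<longlongrightarrow> prim b w (x n)) (at_left (x n))"
    by (rule tendsto_one_sided(2)[OF pc x_in_I x_pos[OF n]])
  qed simp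
 qed
 moreover have "W22_jet b X ?\<phi> (prim b w) w"
  unfolding W22_jet_def using \<phi>L w AC0 AC1 der0 der1 by blast
 ultimately show ?thesis unfolding H0_def by blast
qed

end

section \<open>Adjoints and closures of graphs\<close>

lemma adjoint_graph_mono: "S \<subseteq> T ==> adjoint_graph M T \<subseteq> adjoint_graph M S"
 unfolding adjoint_graph_def by auto

lemma adjoint_graph_closed:
 assumes T: "\<And>u v. (u, v) \<in> T ==> u \<in> L2 M \<and> v \<in> L2 M"
  and FG: "\<And>n::nat. (F n, G n) \<in> adjoint_graph M T" and f: "f \<in> L2 M" and g: "g \<in> L2 M"
  and lim: "(%n. L2_norm M (%t. F n t - f t)) \<longlonglongrightarrow> 0" "(%n. L2_norm M (%t. G n t - g t)) \<longlonglongrightarrow> 0"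
 shows "(f, g) \<in> adjoint_graph M T"
proof -
 have FL: "F n \<in> L2 M" and GL: "G n \<in> L2 M" for n using FG[of n] unfolding adjoint_graph_def by auto
 have "L2_inner M v f = L2_inner M u g" if uv: "(u, v) \<in> T" for u v
 proof (rule LIMSEQ_unique)
  have uL: "u \<in> L2 M" and vL: "v \<in> L2 M" using T[OF uv] by auto
  show "(%n. L2_inner M v (F n)) \<longlonglongrightarrow> L2_inner M v f" by (rule L2_inner_tendsto_right[OF FL f vL lim(1)])
  have "L2_inner M v (F n) = L2_inner M u (G n)" for n using FG[of n] uv unfolding adjoint_graph_def by auto
  then show "(%n. L2_inner M v (F n)) \<longlonglongrightarrow> L2_inner M u g"
   using L2_inner_tendsto_right[OF GL g uL lim(2)] by simp
 qed
 then show ?thesis using f g unfolding adjoint_graph_def by auto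
qed

lemma graph_closure_subset:
 assumes "\<And>u v. (u, v) \<in> T ==> u \<in> L2 M \<and> v \<in> L2 M"
 shows "T \<subseteq> graph_closure M T"
proof
 fix z assume z: "z \<in> T"
 obtain u v where uv: "z = (u, v)" by (cases z)
 have "(%n::nat. L2_norm M (%t. u t - u t)) \<longlonglongrightarrow> 0" "(%n::nat. L2_norm M (%t. v t - v t)) \<longlonglongrightarrow> 0" by simp_all
 then show "z \<in> graph_closure M T"
  using z assms[of u v] unfolding uv graph_closure_def by fast
qed

lemma graph_closure_mono: "S \<subseteq> T ==> graph_closure M S \<subseteq> graph_closure M T"
 unfolding graph_closure_def by fast

lemma graph_closure_adjoint_subset:
 assumes T: "\<And>u v. (u, v) \<in> T ==> u \<in> L2 M \<and> v \<in> L2 M" and S: "S \<subseteq> adjoint_graph M T"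
 shows "graph_closure M S \<subseteq> adjoint_graph M T"
proof
 fix z assume z: "z \<in> graph_closure M S"
 obtain f g where fg: "z = (f, g)" by (cases z)
 obtain F G where FG: "\<And>n::nat. (F n, G n) \<in> S" "f \<in> L2 M" "g \<in> L2 M"
  "(%n. L2_norm M (%t. F n t - f t)) \<longlonglongrightarrow> 0" "(%n. L2_norm M (%t. G n t - g t)) \<longlonglongrightarrow> 0"
  using z unfolding fg graph_closure_def by blast
 show "z \<in> adjoint_graph M T" unfolding fg
  by (rule adjoint_graph_closed[OF T _ FG(2-5)]) (use FG(1) S in auto)
qed

text \<open>That \<open>(f, g)\<close> lies in the adjoint of \<open>T\<close> says, after
  conjugation, that \<open>T\<close> is contained in the adjoint of the single pair
  \<open>(f, g)\<close>. Adjoints are closed, so the closure of \<open>T\<close> is contained in it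
  as well.\<close>

lemma adjoint_graph_closure:
 assumes T: "\<And>u v. (u, v) \<in> T ==> u \<in> L2 M \<and> v \<in> L2 M"
 shows "adjoint_graph M (graph_closure M T) = adjoint_graph M T"
proof
 show "adjoint_graph M (graph_closure M T) \<subseteq> adjoint_graph M T"
  by (rule adjoint_graph_mono[OF graph_closure_subset[OF T]])
 show "adjoint_graph M T \<subseteq> adjoint_graph M (graph_closure M T)"
 proof
  fix z assume z: "z \<in> adjoint_graph M T"
  obtain f g where fg: "z = (f, g)" by (cases z)
  have L: "f \<in> L2 M" "g \<in> L2 M" using z unfolding fg adjoint_graph_def by auto
  have "T \<subseteq> adjoint_graph M {(f, g)}"
  proof
   fix w assume w: "w \<in> T"
   obtain u v where uv: "w = (u, v)" by (cases w)
   have "L2_inner M v f = L2_inner M u g" using z w unfolding fg uv adjoint_graph_def by auto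
   then have "L2_inner M g u = L2_inner M f v" by (metis L2_inner_cnj)
   then show "w \<in> adjoint_graph M {(f, g)}" using T[of u v] w unfolding uv adjoint_graph_def by auto
  qed
  then have sub: "graph_closure M T \<subseteq> adjoint_graph M {(f, g)}"
   by (intro graph_closure_adjoint_subset) (use L in auto)
  have "L2_inner M v f = L2_inner M u g" if "(u, v) \<in> graph_closure M T" for u v
  proof -
   have "(u, v) \<in> adjoint_graph M {(f, g)}" using sub that by blast
   then have "L2_inner M g u = L2_inner M f v" unfolding adjoint_graph_def by auto
   then show ?thesis by (metis L2_inner_cnj)
  qed
  then show "z \<in> adjoint_graph M (graph_closure M T)" using L unfolding fg adjoint_graph_def by auto
 qed
qed

text \<open>If the adjoint is symmetric, then \<open>T + i\<close> has dense range and
 \<open>\<parallel>g + i f\<parallel>\<^sup>2 = \<parallel>f\<parallel>\<^sup>2 + \<parallel>g\<parallel>\<^sup>2\<close> on the adjoint.\<close>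

lemma symmetric_adjoint_subset_closure:
 assumes T: "\<And>u v. (u, v) \<in> T ==> u \<in> L2 M \<and> v \<in> L2 M" and TA: "T \<subseteq> adjoint_graph M T"
  and zero: "(%_. 0, %_. 0) \<in> T"
  and lin: "\<And>u v u' v' a c. (u, v) \<in> T ==> (u', v') \<in> T ==> (%t. a * u t + c * u' t, %t. a * v t + c * v' t) \<in> T"
  and sym: "\<And>u v u' v'. (u, v) \<in> adjoint_graph M T ==> (u', v') \<in> adjoint_graph M T ==> L2_inner M v u' = L2_inner M u v'"
 shows "adjoint_graph M T \<subseteq> graph_closure M T"
proof
 fix z assume z: "z \<in> adjoint_graph M T"
 obtain f g where fg: "z = (f, g)" by (cases z)
 have L: "f \<in> L2 M" "g \<in> L2 M" using z unfolding fg adjoint_graph_def by auto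
 let ?S = "{%t. v t + \<i> * u t | u v. (u, v) \<in> T}"
 have SI: "(%t. v t + \<i> * u t) \<in> ?S" if "(u, v) \<in> T" for u v using that by blast
 have S: "L2_subspace M ?S"
  unfolding L2_subspace_def
 proof (intro conjI ballI allI subsetI)
  fix s assume "s \<in> ?S"
  then show "s \<in> L2 M" using T by (auto intro!: L2_add L2_cmult)
 next
  show "(%_. 0) \<in> ?S" using SI[OF zero] by simp
 next
  fix s s' assume "s \<in> ?S" "s' \<in> ?S"
  then obtain u v u' v' where uv: "s = (%t. v t + \<i> * u t)" "(u, v) \<in> T" "s' = (%t. v' t + \<i> * u' t)" "(u', v') \<in> T" by blast
  have "(%t. s t + s' t) = (%t. (1 * v t + 1 * v' t) + \<i> * (1 * u t + 1 * u' t))" unfolding uv by (auto simp: algebra_simps)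
  then show "(%t. s t + s' t) \<in> ?S" using SI[OF lin[OF uv(2,4), of 1 1]] by (simp only:)
 next
  fix s c assume "s \<in> ?S"
  then obtain u v where uv: "s = (%t. v t + \<i> * u t)" "(u, v) \<in> T" by blast
  have "(%t. c * s t) = (%t. (c * v t + 0 * v t) + \<i> * (c * u t + 0 * u t))" unfolding uv by (auto simp: algebra_simps)
  then show "(%t. c * s t) \<in> ?S" using SI[OF lin[OF uv(2,2), of c 0]] by (simp only:)
 qed
 have h: "(%t. g t + \<i> * f t) \<in> L2 M" by (intro L2_add L2_cmult L)
 have orth: "L2_inner M (%t. g t + \<i> * f t) w = 0" if w: "w \<in> L2 M" "\<And>s. s \<in> ?S ==> L2_inner M s w = 0" for w
 proof -
  have "L2_inner M v w = L2_inner M u (%t. \<i> * w t)" if uv: "(u, v) \<in> T" for u v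
  proof -
   have "L2_inner M (%t. v t + \<i> * u t) w = 0" by (rule w(2)) (use uv in blast)
   then show ?thesis using T[OF uv] w(1)
    by (simp add: L2_inner_add_left L2_cmult L2_inner_cmult_left L2_inner_cmult_right add_eq_0_iff)
  qed
  then have A: "(w, %t. \<i> * w t) \<in> adjoint_graph M T" using w(1) unfolding adjoint_graph_def by (auto intro: L2_cmult)
  have "L2_norm M w = 0" using sym[OF A A] by (simp add: L2_inner_cmult_left L2_inner_cmult_right L2_inner_self)
  then show ?thesis using L2_Cauchy_Schwarz[OF h w(1)] by simp
 qed
 define Q where "Q n p \<longleftrightarrow> p \<in> T \<and> L2_norm M (%t. (g t + \<i> * f t) - (snd p t + \<i> * fst p t)) < 1 / Suc n" for n and p :: "('a \<Rightarrow> complex) \<times> ('a \<Rightarrow> complex)"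
 have "\<exists>p. Q n p" for n
 proof -
  have "\<exists>s\<in>?S. L2_norm M (%t. (g t + \<i> * f t) - s t) < 1 / Suc n"
   by (rule L2_biorthogonal_in_closure[OF S h orth]) auto
  then obtain s where s: "s \<in> ?S" "L2_norm M (%t. (g t + \<i> * f t) - s t) < 1 / Suc n" by (elim bexE)
  from s(1) obtain u v where uv: "s = (%t. v t + \<i> * u t)" "(u, v) \<in> T" by blast
  have "Q n (u, v)" unfolding Q_def using uv s(2) by simp
  then show ?thesis by blast
 qed
 then obtain p where p: "\<And>n. Q n (p n)" by metis
 define F G where "F n = fst (p n)" and "G n = snd (p n)" for n
 have FG: "(F n, G n) \<in> T" and d: "L2_norm M (%t. (g t + \<i> * f t) - (G n t + \<i> * F n t)) < 1 / Suc n" for n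
  using p[of n] unfolding Q_def F_def G_def by simp_all
 have FL: "F n \<in> L2 M" and GL: "G n \<in> L2 M" for n using T[OF FG] by auto
 have key: "L2_norm M (%t. F n t - f t) \<le> 1 / Suc n \<and> L2_norm M (%t. G n t - g t) \<le> 1 / Suc n" for n
 proof -
  define u v where "u = (%t. f t - F n t)" and "v = (%t. g t - G n t)"
  have uv: "u \<in> L2 M" "v \<in> L2 M" unfolding u_def v_def by (intro L2_diff L FL GL)+
  have FGA: "(F n, G n) \<in> adjoint_graph M T" using TA FG by blast
  have fgA: "(f, g) \<in> adjoint_graph M T" using z fg by simp
  have "L2_inner M v u = L2_inner M u v"
   unfolding u_def v_def
   using sym[OF fgA fgA] sym[OF fgA FGA] sym[OF FGA fgA] sym[OF FGA FGA]
   by (simp add: L2_inner_diff_left L2_inner_diff_right L2_diff L FL GL)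
  then have "cnj (L2_inner M v u) = L2_inner M v u" by (simp add: L2_inner_cnj)
  then have "Im (L2_inner M v u) = 0" by (auto simp: complex_eq_iff)
  then have re: "Re (L2_inner M v (%t. \<i> * u t)) = 0" by (simp add: L2_inner_cmult_right)
  have "(L2_norm M (%t. v t + \<i> * u t))^2 = (L2_norm M v)^2 + (L2_norm M u)^2"
   using L2_norm_add_sq[OF uv(2) L2_cmult[OF uv(1)], of \<i>] re L2_norm_cmult[of M \<i> u] by simp
  moreover have "(%t. v t + \<i> * u t) = (%t. (g t + \<i> * f t) - (G n t + \<i> * F n t))"
   by (auto simp: u_def v_def algebra_simps)
  moreover have "(L2_norm M (%t. (g t + \<i> * f t) - (G n t + \<i> * F n t)))^2 \<le> (1 / Suc n)^2"
   using d[of n] by (intro power_mono) auto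
  ultimately have s: "(L2_norm M v)^2 + (L2_norm M u)^2 \<le> (1 / Suc n)^2" by simp
  have "(L2_norm M u)^2 \<le> (1 / Suc n)^2" "(L2_norm M v)^2 \<le> (1 / Suc n)^2"
   using s zero_le_power2[of "L2_norm M u"] zero_le_power2[of "L2_norm M v"] by linarith+
  then have "L2_norm M u \<le> 1 / Suc n" "L2_norm M v \<le> 1 / Suc n" by (auto intro: power2_le_imp_le)
  then show ?thesis unfolding u_def v_def by (simp add: L2_norm_minus_commute[of M f] L2_norm_minus_commute[of M g])
 qed
 have "(%n. L2_norm M (%t. F n t - f t)) \<longlonglongrightarrow> 0" "(%n. L2_norm M (%t. G n t - g t)) \<longlonglongrightarrow> 0"
  by (rule Lim_null_comparison[OF _ LIMSEQ_Suc[OF lim_1_over_n]], use key in simp)+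
 then show "z \<in> graph_closure M T" unfolding fg graph_closure_def using L FG by blast
qed

section \<open>The adjoint of the minimal operator\<close>

context delta_chain
begin

lemma cut_integral_tendsto:
 fixes F :: "real \<Rightarrow> complex"
 assumes F: "integrable M F" and R: "\<And>t. t \<in> I ==> \<forall>\<^sub>F n in sequentially. t < R n"
 shows "(%n. LINT t|M. cut 0 (R n) F t) \<longlonglongrightarrow> (LINT t|M. F t)"
proof (rule integral_dominated_convergence[where w="%t. norm (F t)"])
 show "F \<in> borel_measurable M" by (rule borel_measurable_integrable[OF F])
 then show "cut 0 (R n) F \<in> borel_measurable M" for n by (rule cut_measurable)
 show "integrable M (%t. norm (F t))" by (rule integrable_norm[OF F])
 show "AE t in M. (%n. cut 0 (R n) F t) \<longlonglongrightarrow> F t"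
 proof (rule AE_I2)
  fix t assume "t \<in> space M"
  then have t: "t \<in> I" by simp
  have "\<forall>\<^sub>F n in sequentially. cut 0 (R n) F t = F t"
   using R[OF t] by eventually_elim (simp add: cut_in Ivl_nonneg[OF t])
  then show "(%n. cut 0 (R n) F t) \<longlonglongrightarrow> F t" by (rule tendsto_eventually)
 qed
 show "AE t in M. norm (cut 0 (R n) F t) \<le> norm (F t)" for n by (rule AE_I2) (auto simp: cut_def)
qed

lemma eventually_lt_x: "t \<in> I ==> \<forall>\<^sub>F n in sequentially. t < x n"
proof -
 assume "t \<in> I"
 then obtain n where n: "t < x n" using ex_x_gt by blast
 show ?thesis
 proof (rule eventually_sequentiallyI[of n])
  fix m assume "n \<le> m"
  then have "x n \<le> x m" by simp
  then show "t < x m" using n by linarith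
 qed
qed

lemma Hmax_L2: "(f, g) \<in> Hmax ==> f \<in> L2 M \<and> g \<in> L2 M"
 unfolding Hmax_def by blast

lemma H0_subset_Hmax: "H0 b x \<beta> \<subseteq> Hmax"
proof
 fix z assume z: "z \<in> H0 b x \<beta>"
 obtain \<phi> \<psi> where e: "z = (\<phi>, \<psi>)" by (cases z)
 show "z \<in> Hmax" using z unfolding e by (elim H0_structure) (rule HmaxI)
qed

lemma Hmax_subset_adjoint: "Hmax \<subseteq> adjoint_graph M (H0 b x \<beta>)"
proof
 fix z assume z: "z \<in> Hmax"
 obtain f g where fg: "z = (f, g)" by (cases z)
 obtain a where f: "f \<in> L2 M" and g: "g \<in> L2 M" and fa: "AE t in M. f t = a - volterra g t"
  using z unfolding fg by (elim HmaxE)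
 have "ip \<psi> f = ip \<phi> g" if H: "(\<phi>, \<psi>) \<in> H0 b x \<beta>" for \<phi> \<psi>
 proof -
  obtain c R where \<phi>: "\<phi> \<in> L2 M" and \<psi>: "\<psi> \<in> L2 M" and \<phi>c: "AE t in M. \<phi> t = c - volterra \<psi> t" and R: "R \<in> I"
   and 0: "\<And>t. t \<in> I - X ==> R < t ==> c - volterra \<psi> t = 0 \<and> prim b \<psi> t = 0"
   by (rule H0_structure[OF H]) blast
  \<comment> \<open>Midpoints of the cells tend to \<open>b\<close> and avoid \<open>X\<close>,
    where the vanishing of the boundary data is not asserted. From some \<open>n\<close> on Green's
    formula has no boundary terms at \<open>m n\<close>.\<close>
  define m where "m n = (x n + x (Suc n)) / 2" for n
  have mx: "x n < m n" "m n < x (Suc n)" for n using x_less_iff[of n "Suc n"] unfolding m_def by auto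
  have mI: "m n \<in> I - X" for n using open_interval_off_X[of n "m n" "m n"] mx[of n] by auto
  have ev: "\<forall>\<^sub>F n in sequentially. t < m n" if "t \<in> I" for t
   using eventually_lt_x[OF that] by eventually_elim (use mx in "blast intro: less_trans")
  let ?F = "%t. \<phi> t * cnj (g t) - \<psi> t * cnj (f t)"
  have Fi: "integrable M ?F" by (intro Bochner_Integration.integrable_diff L2_mult_integrable \<phi> \<psi> f g)
  have "(%n. LINT t|M. cut 0 (m n) ?F t) \<longlonglongrightarrow> (LINT t|M. ?F t)" by (rule cut_integral_tendsto[OF Fi ev])
  moreover have "(%n. LINT t|M. cut 0 (m n) ?F t) \<longlonglongrightarrow> 0"
  proof (rule tendsto_eventually)
   show "\<forall>\<^sub>F n in sequentially. (LINT t|M. cut 0 (m n) ?F t) = 0"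
    using ev[OF R]
   proof eventually_elim
    case (elim n)
    have "m n \<in> I" using mI by blast
    have e: "c - volterra \<psi> (m n) = 0" "prim b \<psi> (m n) = 0" using 0[OF mI elim] by auto
    show ?case
     unfolding green[OF L2_measurable[OF \<phi>] \<psi> \<phi>c L2_measurable[OF f] g fa \<open>m n \<in> I\<close>] e by simp
   qed
  qed
  ultimately have "(LINT t|M. ?F t) = 0" by (rule LIMSEQ_unique)
  then show ?thesis
   using L2_mult_integrable[OF \<phi> g] L2_mult_integrable[OF \<psi> f] by (simp add: L2_inner_def)
 qed
 then show "z \<in> adjoint_graph M (H0 b x \<beta>)" using f g unfolding fg adjoint_graph_def by auto
qed

text \<open>The part of \<open>H0\<close> given by an explicit formula: linearity is checked on
  \<open>w\<close> alone, and the test functions are already numerous enough to determine the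
  adjoint.\<close>

definition Hmin :: "real graph" where
 "Hmin = {(%t. volterra w t - volterra w R, %t. - w t) | w R. w \<in> L2 M \<and> R \<in> I \<and> w = cut 0 R w \<and> prim b w R = 0}"

lemma Hmin_subset_H0: "Hmin \<subseteq> H0 b x \<beta>"
 unfolding Hmin_def using H0_member by blast

lemma HminE:
 assumes "(u, v) \<in> Hmin"
 obtains w R where "u = (%t. volterra w t - volterra w R)" "v = (%t. - w t)" "w \<in> L2 M" "R \<in> I" "w = cut 0 R w" "prim b w R = 0"
 using assms unfolding Hmin_def by blast

lemma HminI: "w \<in> L2 M ==> R \<in> I ==> w = cut 0 R w ==> prim b w R = 0 ==> (%t. volterra w t - volterra w R, %t. - w t) \<in> Hmin"
 unfolding Hmin_def by blast

lemma volterra_beyond: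
 assumes wR: "w = cut 0 R w" and w0: "prim b w R = 0" and t: "R \<le> t"
 shows "prim b w t = 0" "volterra w t = volterra w R"
proof -
 have p: "prim b w t = 0" if "R \<le> t" for t using prim_cut_ge[OF that, of b w] wR w0 by simp
 then show "prim b w t = 0" using t .
 have "weighted w = cut 0 R (weighted w)"
 proof
  fix t show "weighted w t = cut 0 R (weighted w) t"
   using fun_cong[OF wR, of t] by (auto simp: cut_def weighted_def)
 qed
 then show "volterra w t = volterra w R"
  using prim_cut_ge[OF t, of b "weighted w"] p[OF t] p[OF order_refl] by (simp add: volterra_def)
qed

text \<open>Two supports are enlarged to the common \<open>[0, S)\<close>. Graphs are sets of
  functions on all of the real line, so the formula for the combination has to hold everywhere: on
  \<open>I\<close> by linearity, beyond \<open>S\<close> because everything is constant there, and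
  for negative arguments because \<open>volterra\<close> is zero.\<close>

lemma Hmin_lincomb:
 assumes "(u, v) \<in> Hmin" "(u', v') \<in> Hmin"
 shows "(%t. a * u t + c * u' t, %t. a * v t + c * v' t) \<in> Hmin"
proof -
 obtain w R where w: "u = (%t. volterra w t - volterra w R)" "v = (%t. - w t)" "w \<in> L2 M" "R \<in> I" "w = cut 0 R w" "prim b w R = 0"
  using assms(1) by (rule HminE)
 obtain w' R' where w': "u' = (%t. volterra w' t - volterra w' R')" "v' = (%t. - w' t)" "w' \<in> L2 M" "R' \<in> I" "w' = cut 0 R' w'" "prim b w' R' = 0"
  using assms(2) by (rule HminE)
 define S where "S = max R R'"
 have S: "S \<in> I" "R \<le> S" "R' \<le> S" using w(4) w'(4) by (auto simp: S_def max_def)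
 define q where "q = (%t. a * w t + c * w' t)"
 have qL: "q \<in> L2 M" unfolding q_def by (intro L2_add L2_cmult w(3) w'(3))
 have qS: "q = cut 0 S q"
 proof
  fix t
  show "q t = cut 0 S q t"
  proof (cases "0 \<le> t \<and> t < S")
   case True
   then show ?thesis by (simp add: cut_in)
  next
   case False
   then have "\<not> (0 \<le> t \<and> t < R)" "\<not> (0 \<le> t \<and> t < R')" using S by auto
   then have "w t = 0" "w' t = 0" using fun_cong[OF w(5), of t] fun_cong[OF w'(5), of t] cut_out by metis+
   then show ?thesis using cut_out[OF False] by (simp add: q_def)
  qed
 qed
 have q0: "prim b q S = 0"
  unfolding q_def prim_lincomb[OF w(3) w'(3) S(1)] using volterra_beyond(1)[OF w(5,6) S(2)] volterra_beyond(1)[OF w'(5,6) S(3)] by simp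
 have v0: "volterra g t = 0" if "t < 0" for g t
 proof -
  have c: "cut 0 t h = (%_. 0)" for h using that by (auto simp: cut_def fun_eq_iff)
  show ?thesis by (simp add: volterra_def prim_def c)
 qed
 have vS: "volterra w S = volterra w R" "volterra w' S = volterra w' R'"
  using volterra_beyond(2)[OF w(5,6) S(2)] volterra_beyond(2)[OF w'(5,6) S(3)] by auto
 have vqS: "volterra q S = a * volterra w R + c * volterra w' R'"
  unfolding q_def volterra_lincomb[OF w(3) w'(3) S(1)] by (simp only: vS)
 have vq: "volterra q t = a * volterra w t + c * volterra w' t" for t
 proof -
  consider "t < 0" | "t \<in> I" | "S \<le> t"
   using Ivl_downward[OF S(1), of t] by linarith
  then show ?thesis
  proof cases
   case 1
   then show ?thesis by (simp add: v0)
  next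
   case 2
   then show ?thesis unfolding q_def by (rule volterra_lincomb[OF w(3) w'(3)])
  next
   case 3
   have "volterra q t = volterra q S" using volterra_beyond(2)[OF qS q0 3] .
   moreover have "volterra w t = volterra w R" "volterra w' t = volterra w' R'"
    using volterra_beyond(2)[OF w(5,6) order_trans[OF S(2) 3]] volterra_beyond(2)[OF w'(5,6) order_trans[OF S(3) 3]] .
   ultimately show ?thesis by (simp only: vqS)
  qed
 qed
 have e1: "(%t. volterra q t - volterra q S) = (%t. a * u t + c * u' t)"
  by (rule ext) (simp add: vq vS w(1) w'(1) algebra_simps)
 have e2: "(%t. - q t) = (%t. a * v t + c * v' t)"
  by (rule ext) (simp add: q_def w(2) w'(2))
 show ?thesis using HminI[OF qL S(1) qS q0] unfolding e1 e2 .
qed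

text \<open>The test functions \<open>w\<close> in the minimal operator are only constrained by \<open>\<integral>w = 0\<close>; choosing \<open>w\<close>
 to be \<open>f + volterra g\<close> minus its mean shows that \<open>f + volterra g\<close> is constant.\<close>

lemma adjoint_Hmin_subset: "adjoint_graph M Hmin \<subseteq> Hmax"
proof
 fix z assume z: "z \<in> adjoint_graph M Hmin"
 obtain f g where fg: "z = (f, g)" by (cases z)
 have f: "f \<in> L2 M" and g: "g \<in> L2 M" and adj: "\<And>u v. (u, v) \<in> Hmin ==> ip v f = ip u g"
  using z unfolding fg adjoint_graph_def by auto
 have const: "\<exists>\<kappa>. AE t in M. t < R --> f t + volterra g t = \<kappa>" if R: "R \<in> I" "0 < R" for R
 proof -
  have R0: "0 \<le> R" using R by simp
  define u where "u = (%t. cut 0 R f t + cut 0 R (volterra g) t)"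
  have uL: "u \<in> L2 M" unfolding u_def by (intro L2_add cut_L2 f volterra_cut_L2 g R)
  have uc: "u = cut 0 R u" by (auto simp: u_def cut_def)
  define \<kappa> where "\<kappa> = prim b u R / of_real R"
  have oneL: "cut 0 R (%_. 1) \<in> L2 M" by (rule window_L2(1)[OF order_refl R0 R(1)])
  define w where "w = (%t. 1 * u t + (- \<kappa>) * cut 0 R (%_. 1) t)"
  have wL: "w \<in> L2 M" unfolding w_def by (intro L2_add L2_cmult uL oneL)
  have wc: "w = cut 0 R w" by (auto simp: w_def u_def cut_def)
  have one: "prim b (cut 0 R (%_. 1)) R = of_real R"
   using lint_window(2)[OF order_refl R0 R(1), of "1::complex"] unfolding prim_cut[OF order_refl]
   by (simp add: prim_def cut_def scaleR_conv_of_real)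
  have w0: "prim b w R = 0" unfolding w_def prim_lincomb[OF uL oneL R(1)] one using R(2) by (simp add: \<kappa>_def)
  define \<phi> where "\<phi> = (%t. volterra w t - volterra w R)"
  have H: "(\<phi>, %t. - w t) \<in> Hmin" unfolding \<phi>_def by (rule HminI[OF wL R(1) wc w0])
  have \<phi>L: "\<phi> \<in> L2 M" using H Hmin_subset_H0 H0_subset_Hmax Hmax_L2 by blast
  have nw: "(%t. - w t) \<in> L2 M" by (rule L2_uminus[OF wL])
  have pn: "prim b (%t. - w t) R = 0" using prim_lincomb[OF wL wL R(1), of "-1" 0] w0 by simp
  have vn: "volterra (%t. - w t) t = - volterra w t" if "t \<in> I" for t using volterra_lincomb[OF wL wL that, of "-1" 0] by simp
  define k where "k = (%t. 0 - volterra g t)"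
  have km: "k \<in> borel_measurable M" unfolding k_def using volterra_measurable[OF g] by simp
  have "(LINT t|M. cut 0 R (%t. \<phi> t * cnj (g t) - (- w t) * cnj (k t)) t)
    = (- volterra w R - volterra (%t. - w t) R) * cnj (prim b g R) - prim b (%t. - w t) R * cnj (0 - volterra g R)"
  proof (rule green[OF L2_measurable[OF \<phi>L] nw _ km g _ R(1)])
   show "AE t in M. \<phi> t = - volterra w R - volterra (%t. - w t) t"
    by (rule AE_I2) (simp add: \<phi>_def vn)
   show "AE t in M. k t = 0 - volterra g t" by (simp add: k_def)
  qed
  also have "... = 0" unfolding pn vn[OF R(1)] by simp
  finally have gr: "(LINT t|M. cut 0 R (%t. \<phi> t * cnj (g t) - (- w t) * cnj (k t)) t) = 0" .
  have vgL: "cut 0 R (volterra g) \<in> L2 M" by (rule volterra_cut_L2[OF g R(1)])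
  have e: "cut 0 R (%t. \<phi> t * cnj (g t) - (- w t) * cnj (k t)) t = \<phi> t * cnj (g t) - w t * cnj (cut 0 R (volterra g) t)" if "t \<in> I" for t
  proof (cases "t < R")
   case True
   then show ?thesis using Ivl_nonneg[OF that] by (simp add: cut_in k_def)
  next
   case False
   then have Rt: "R \<le> t" by simp
   have "\<phi> t = 0" unfolding \<phi>_def volterra_beyond(2)[OF wc w0 Rt] by simp
   moreover have nt: "\<not> (0 \<le> t \<and> t < R)" using Rt by simp
   ultimately show ?thesis unfolding cut_out[OF nt] by simp
  qed
  have "(LINT t|M. cut 0 R (%t. \<phi> t * cnj (g t) - (- w t) * cnj (k t)) t) = (LINT t|M. \<phi> t * cnj (g t) - w t * cnj (cut 0 R (volterra g) t))"
   by (rule Bochner_Integration.integral_cong[OF refl e]) simp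
  also have "... = ip \<phi> g - ip w (cut 0 R (volterra g))"
   unfolding L2_inner_def
   by (rule Bochner_Integration.integral_diff[OF L2_mult_integrable[OF \<phi>L g] L2_mult_integrable[OF wL vgL]])
  finally have "ip \<phi> g = ip w (cut 0 R (volterra g))" using gr by simp
  moreover have "ip \<phi> g = - ip w f"
   using adj[OF H] L2_inner_cmult_left[of M "-1" w f] by simp
  moreover have "ip w f = ip w (cut 0 R f)" using inner_cut[of M 0 R w f] wc by simp
  ultimately have vf: "ip w (cut 0 R (volterra g)) = - ip w (cut 0 R f)" by simp
  have "ip w u = 0"
   unfolding u_def L2_inner_add_right[OF cut_L2[OF f] vgL wL] vf by simp
  moreover have "ip w (cut 0 R (%_. 1)) = 0"
   unfolding inner_window using w0 by (simp add: prim_def)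
  moreover have "ip w (%t. 1 * u t + (- \<kappa>) * cut 0 R (%_. 1) t) = cnj 1 * ip w u + cnj (- \<kappa>) * ip w (cut 0 R (%_. 1))"
   unfolding L2_inner_add_right[OF L2_cmult[OF uL] L2_cmult[OF oneL] wL] L2_inner_cmult_right ..
  ultimately have "ip w w = 0"
   unfolding w_def[symmetric] by simp
  then have "nrm w = 0" by (simp add: L2_inner_self)
  then have "AE t in M. w t = 0" using L2_norm_eq_0_iff[OF wL] by (simp add: L2_eq_def)
  moreover have "AE t in M. t \<in> I" by (rule AE_I2) simp
  ultimately have "AE t in M. t < R --> f t + volterra g t = \<kappa>"
  proof eventually_elim
   case (elim t)
   show ?case
   proof
    assume t: "t < R"
    have "w t = f t + volterra g t - \<kappa>"
     unfolding w_def u_def cut_in[OF Ivl_nonneg[OF elim(2)] t] by simp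
    then show "f t + volterra g t = \<kappa>" using elim(1) by simp
   qed
  qed
  then show ?thesis by blast
 qed
 have "\<exists>\<kappa>. AE t in M. t < x (Suc n) --> f t + volterra g t = \<kappa>" for n
  by (rule const[OF x_in_I x_pos]) simp
 then obtain \<kappa> where k: "\<And>n. AE t in M. t < x (Suc n) --> f t + volterra g t = \<kappa> n" by metis
 have same: "\<kappa> n = \<kappa> 0" for n
 proof (rule ccontr)
  assume ne: "\<kappa> n \<noteq> \<kappa> 0"
  have x1: "0 < x (Suc 0)" by (rule x_pos) simp
  have "AE t in M. \<not> t < x (Suc 0)"
   using k[of n] k[of 0]
  proof eventually_elim
   case (elim t)
   have "x (Suc 0) \<le> x (Suc n)" by simp
   then show ?case using elim ne by (metis less_le_trans)
  qed
  then obtain N where N: "negligible N" "\<And>t. t \<in> I ==> t \<notin> N ==> \<not> t < x (Suc 0)" by (rule AE_Ivl_negligible) blast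
  have "{0<..<x (Suc 0)} \<subseteq> N"
  proof
   fix t assume t: "t \<in> {0<..<x (Suc 0)}"
   then have "t \<in> I" using Ivl_downward[OF x_in_I[of "Suc 0"], of t] by simp
   then show "t \<in> N" using N(2)[of t] t by auto
  qed
  then have "negligible {0<..<x (Suc 0)}" by (rule negligible_subset[OF N(1)])
  moreover have "open {0<..<x (Suc 0)}" by simp
  ultimately have "{0<..<x (Suc 0)} = {}" using open_not_negligible by blast
  then show False using x1 by (simp add: greaterThanLessThan_empty_iff)
 qed
 have "AE t in M. \<forall>n. t < x (Suc n) --> f t + volterra g t = \<kappa> n" using k by (simp add: AE_all_countable)
 moreover have "AE t in M. t \<in> I" by (rule AE_I2) simp
 ultimately have "AE t in M. f t = \<kappa> 0 - volterra g t"
 proof eventually_elim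
  case (elim t)
  obtain n where "t < x (Suc n)" using interval_obtain[OF elim(2)] by blast
  then have "f t + volterra g t = \<kappa> 0" using elim(1) same by metis
  then show ?case by (simp add: eq_diff_eq)
 qed
 then show "z \<in> Hmax" unfolding fg by (rule HmaxI[OF f g])
qed

lemma adjoint_H0: "adjoint_graph M (H0 b x \<beta>) = Hmax"
 using Hmax_subset_adjoint adjoint_Hmin_subset adjoint_graph_mono[OF Hmin_subset_H0] by blast

lemma adjoint_Hmin: "adjoint_graph M Hmin = Hmax"
 using Hmax_subset_adjoint adjoint_Hmin_subset adjoint_graph_mono[OF Hmin_subset_H0] by blast

lemma H0_L2: "(u, v) \<in> H0 b x \<beta> ==> u \<in> L2 M \<and> v \<in> L2 M"
 using H0_subset_Hmax Hmax_L2 by blast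

lemma adjoint_Hamiltonian: "adjoint_graph M (Hamiltonian b x \<beta>) = Hmax"
 using adjoint_graph_closure[of "H0 b x \<beta>" M, OF H0_L2] adjoint_H0 by (simp only: Hamiltonian_def)

lemma Hamiltonian_subset_Hmax: "Hamiltonian b x \<beta> \<subseteq> Hmax"
 unfolding Hamiltonian_def adjoint_H0[symmetric]
 by (rule graph_closure_adjoint_subset[OF H0_L2]) (use H0_subset_Hmax adjoint_H0 in auto)

text \<open>\<open>Hmax\<close> is the adjoint of \<open>Hmin\<close>; if it is symmetric,
  \<open>Hmin\<close> is essentially self-adjoint, and its closure, which is contained in the
  Hamiltonian, is already \<open>Hmax\<close>.\<close>

lemma Hmax_subset_Hamiltonian:
 assumes sym: "\<And>u v u' v'. (u, v) \<in> Hmax ==> (u', v') \<in> Hmax ==> ip v u' = ip u v'"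
 shows "Hmax \<subseteq> Hamiltonian b x \<beta>"
proof -
 have HL: "\<And>u v. (u, v) \<in> Hmin ==> u \<in> L2 M \<and> v \<in> L2 M" using Hmin_subset_H0 H0_L2 by blast
 have z: "(%_. 0, %_. 0) \<in> Hmin"
 proof -
  have c: "(%_. 0) = cut 0 0 (%_. 0)" by (auto simp: cut_def)
  have "prim b (%_. 0) t = 0" for t by (simp add: prim_def cut_def)
  moreover have "weighted (%_. 0) = (%_. 0)" by (simp add: weighted_def)
  ultimately have "volterra (%_. 0) t = 0" for t by (simp add: volterra_def)
  then show ?thesis using HminI[OF L2_zero zero_in_I c] by simp
 qed
 have "adjoint_graph M Hmin \<subseteq> graph_closure M Hmin"
  by (rule symmetric_adjoint_subset_closure[OF HL _ z Hmin_lincomb])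
   (use Hmin_subset_H0 H0_subset_Hmax sym in "auto simp: adjoint_Hmin")
 then show ?thesis unfolding adjoint_Hmin Hamiltonian_def using graph_closure_mono[OF Hmin_subset_H0] by blast
qed

section \<open>Self-adjointness on the half-line\<close>

lemma tail_L2_tendsto:
 assumes inf: "b = \<infinity>" and f: "f \<in> L2 M"
 shows "((%N. LINT t|M. (if N \<le> t then (cmod (f t))^2 else 0)) \<longlongrightarrow> 0) at_top"
proof -
 have mN: "{t \<in> I. N \<le> t} \<in> sets M" for N
 proof -
  have "{t \<in> I. N \<le> t} = space M - {t \<in> I. t < N}" by auto
  then show ?thesis using sets.compl_sets[OF sets_Ivl_measure_conv(1)] by metis
 qed
 have "((%N. LINT t|M. (if N \<le> t then (cmod (f t))^2 else 0)) \<longlongrightarrow> (LINT t|M. 0)) at_top"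
 proof (rule integral_dominated_convergence_at_top)
  show "integrable M (%t. (cmod (f t))^2)" by (rule L2_integrable_sq[OF f])
  show "(%t. if N \<le> t then (cmod (f t))^2 else 0) \<in> borel_measurable M" for N
   by (rule measurable_If) (use L2_measurable[OF f] mN in simp_all)
  show "\<forall>\<^sub>F N in at_top. AE t in M. norm (if N \<le> t then (cmod (f t))^2 else 0) \<le> (cmod (f t))^2" by simp
  show "AE t in M. ((%N. if N \<le> t then (cmod (f t))^2 else 0) \<longlongrightarrow> 0) at_top"
  proof (rule AE_I2)
   fix t
   have "\<forall>\<^sub>F N in at_top. (if N \<le> t then (cmod (f t))^2 else 0) = 0"
    using eventually_gt_at_top[of t] by eventually_elim simp
   then show "((%N. if N \<le> t then (cmod (f t))^2 else 0) \<longlongrightarrow> 0) at_top" by (rule tendsto_eventually)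
  qed
 qed simp
 then show ?thesis by simp
qed

text \<open>The boundary term at \<open>R\<close> is at most \<open>\<surd>R (\<parallel>h\<parallel> \<bar>f(R)\<bar> + \<parallel>g\<parallel> \<bar>k(R)\<bar>)\<close>, whose square has a
 small mean over \<open>[N, 2N]\<close>.\<close>

lemma Hmax_symmetric:
 assumes inf: "b = \<infinity>" and fg: "(f, g) \<in> Hmax" and kh: "(k, h) \<in> Hmax"
 shows "ip g k = ip f h"
proof -
 have I: "I = {0..}" using inf by (auto simp: Ivl_def)
 obtain c where f: "f \<in> L2 M" and g: "g \<in> L2 M" and fc: "AE t in M. f t = c - volterra g t" using fg by (rule HmaxE)
 obtain a where k: "k \<in> L2 M" and h: "h \<in> L2 M" and ka: "AE t in M. k t = a - volterra h t" using kh by (rule HmaxE)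
 let ?F = "%t. f t * cnj (h t) - g t * cnj (k t)"
 have Fi: "integrable M ?F" by (intro Bochner_Integration.integrable_diff L2_mult_integrable f g h k)
 define D where "D = (LINT t|M. ?F t)"
 have lim: "((%R. LINT t|M. cut 0 R ?F t) \<longlongrightarrow> D) at_top"
  unfolding D_def
 proof (rule integral_dominated_convergence_at_top)
  show "?F \<in> borel_measurable M" by (rule borel_measurable_integrable[OF Fi])
  then show "cut 0 R ?F \<in> borel_measurable M" for R by (rule cut_measurable)
  show "integrable M (%t. norm (?F t))" by (rule integrable_norm[OF Fi])
  show "\<forall>\<^sub>F R in at_top. AE t in M. norm (cut 0 R ?F t) \<le> norm (?F t)"
   by (intro always_eventually allI AE_I2) (simp add: cut_def)
  show "AE t in M. ((%R. cut 0 R ?F t) \<longlongrightarrow> ?F t) at_top"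
  proof (rule AE_I2)
   fix t assume "t \<in> space M"
   then have t: "0 \<le> t" using I by simp
   have "\<forall>\<^sub>F R in at_top. cut 0 R ?F t = ?F t"
    using eventually_gt_at_top[of t] by eventually_elim (simp add: cut_in t)
   then show "((%R. cut 0 R ?F t) \<longlongrightarrow> ?F t) at_top" by (rule tendsto_eventually)
  qed
 qed
 have "D = 0"
 proof (rule ccontr)
  assume "D \<noteq> 0"
  then have Dp: "cmod D > 0" by simp
  define C where "C = nrm g + nrm h + 1"
  have C: "C > 0" "nrm g \<le> C" "nrm h \<le> C" unfolding C_def using L2_norm_nonneg[of M g] L2_norm_nonneg[of M h] by linarith+
  have "((%R. cmod (LINT t|M. cut 0 R ?F t)) \<longlongrightarrow> cmod D) at_top" by (rule tendsto_norm[OF lim])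
  then have "\<forall>\<^sub>F R in at_top. cmod D / 2 < cmod (LINT t|M. cut 0 R ?F t)"
   by (rule order_tendstoD(1)) (use Dp in simp)
  then obtain R0 where R0: "\<And>R. R \<ge> R0 ==> cmod D / 2 < cmod (LINT t|M. cut 0 R ?F t)"
   unfolding eventually_at_top_linorder by blast
  let ?q = "%t. (cmod (f t))^2 + (cmod (k t))^2"
  have B: "AE R in M. R0 \<le> R --> (cmod D / 2)^2 \<le> 2 * R * C^2 * ?q R"
   using fc ka AE_space
  proof eventually_elim
   case (elim R)
   show ?case
   proof
    assume R: "R0 \<le> R"
    have RI: "R \<in> I" using elim(3) by simp
    have R1: "0 \<le> R" using Ivl_nonneg[OF RI] .
    have bg: "cmod (prim b g R) \<le> sqrt R * C" and bh: "cmod (prim b h R) \<le> sqrt R * C"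
     by (rule order_trans[OF prim_bound[OF g RI] mult_left_mono[OF C(2)]], use R1 in simp)
      (rule order_trans[OF prim_bound[OF h RI] mult_left_mono[OF C(3)]], use R1 in simp)
    have "(LINT t|M. cut 0 R ?F t) = f R * cnj (prim b h R) - prim b g R * cnj (k R)"
     unfolding green[OF L2_measurable[OF f] g fc L2_measurable[OF k] h ka RI] elim(1,2) ..
    then have "cmod (LINT t|M. cut 0 R ?F t) \<le> cmod (f R) * cmod (prim b h R) + cmod (prim b g R) * cmod (k R)"
     using norm_triangle_ineq4[of "f R * cnj (prim b h R)" "prim b g R * cnj (k R)"] by (simp add: norm_mult)
    also have "... \<le> cmod (f R) * (sqrt R * C) + (sqrt R * C) * cmod (k R)"
     by (intro add_mono mult_left_mono mult_right_mono bg bh) auto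
    also have "... = sqrt R * C * (cmod (f R) + cmod (k R))" by (simp add: algebra_simps)
    finally have "cmod D / 2 \<le> sqrt R * C * (cmod (f R) + cmod (k R))" using R0[OF R] by linarith
    then have "(cmod D / 2)^2 \<le> (sqrt R * C * (cmod (f R) + cmod (k R)))^2" by (intro power_mono) auto
    also have "... = R * C^2 * (cmod (f R) + cmod (k R))^2" using R1 by (simp add: power_mult_distrib)
    also have "... \<le> R * C^2 * (2 * ?q R)"
     using sum_squares_bound[of "cmod (f R)" "cmod (k R)"] R1 by (intro mult_left_mono) (auto simp: power2_sum)
    finally show "(cmod D / 2)^2 \<le> 2 * R * C^2 * ?q R" by (simp add: algebra_simps)
   qed
  qed
  have avg: "(cmod D / 2)^2 \<le> 4 * C^2 * ((LINT t|M. (if N \<le> t then (cmod (f t))^2 else 0)) + (LINT t|M. (if N \<le> t then (cmod (k t))^2 else 0)))"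
   if N: "N > 0" "N \<ge> R0" for N
  proof -
   have w: "0 \<le> N" "N \<le> 2 * N" "2 * N \<in> I" using N I by auto
   have mN: "{t \<in> I. N \<le> t} \<in> sets M"
   proof -
    have "{t \<in> I. N \<le> t} = space M - {t \<in> I. t < N}" by auto
    then show ?thesis using sets.compl_sets[OF sets_Ivl_measure_conv(1)] by metis
   qed
   have int: "integrable M (%t. if N \<le> t then (cmod (u t))^2 else 0)" if u: "u \<in> L2 M" for u
   proof (rule Bochner_Integration.integrable_bound[OF L2_integrable_sq[OF u]])
    show "(%t. if N \<le> t then (cmod (u t))^2 else 0) \<in> borel_measurable M"
     by (rule measurable_If) (use L2_measurable[OF u] mN in simp_all)
   qed simp
   have "N * (cmod D / 2)^2 = (LINT r|M. (if N \<le> r \<and> r < 2 * N then (cmod D / 2)^2 else 0))"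
    using lint_window(2)[OF w, of "(cmod D / 2)^2"] by simp
   also have "... \<le> (LINT r|M. 4 * N * C^2 * ((if N \<le> r then (cmod (f r))^2 else 0) + (if N \<le> r then (cmod (k r))^2 else 0)))"
   proof (rule integral_mono_AE[OF lint_window(1)[OF w]])
    show "integrable M (%r. 4 * N * C^2 * ((if N \<le> r then (cmod (f r))^2 else 0) + (if N \<le> r then (cmod (k r))^2 else 0)))"
     by (intro integrable_mult_right Bochner_Integration.integrable_add int f k)
    show "AE r in M. (if N \<le> r \<and> r < 2 * N then (cmod D / 2)^2 else 0) \<le> 4 * N * C^2 * ((if N \<le> r then (cmod (f r))^2 else 0) + (if N \<le> r then (cmod (k r))^2 else 0))"
     using B
    proof eventually_elim
     case (elim r)
     show ?case
     proof (cases "N \<le> r \<and> r < 2 * N")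
      case True
      have "(cmod D / 2)^2 \<le> 2 * r * C^2 * ?q r" using elim True N by auto
      also have "... \<le> 2 * (2 * N) * C^2 * ?q r" using True by (intro mult_right_mono) auto
      finally show ?thesis using True by simp
     next
      case False
      have "0 \<le> 4 * N * C^2 * ((if N \<le> r then (cmod (f r))^2 else 0) + (if N \<le> r then (cmod (k r))^2 else 0))"
       using N by (intro mult_nonneg_nonneg add_nonneg_nonneg) auto
      then show ?thesis unfolding if_not_P[OF False] .
     qed
    qed
   qed
   also have "... = 4 * N * C^2 * ((LINT t|M. (if N \<le> t then (cmod (f t))^2 else 0)) + (LINT t|M. (if N \<le> t then (cmod (k t))^2 else 0)))"
    using int[OF f] int[OF k] by simp
   finally have "N * (cmod D / 2)^2 \<le> N * (4 * C^2 * ((LINT t|M. (if N \<le> t then (cmod (f t))^2 else 0)) + (LINT t|M. (if N \<le> t then (cmod (k t))^2 else 0))))"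
    by (simp only: mult_ac)
   then show ?thesis using N(1) by (rule mult_left_le_imp_le)
  qed
  have "((%N. 4 * C^2 * ((LINT t|M. (if N \<le> t then (cmod (f t))^2 else 0)) + (LINT t|M. (if N \<le> t then (cmod (k t))^2 else 0)))) \<longlongrightarrow> 4 * C^2 * (0 + 0)) at_top"
   by (intro tendsto_intros tail_L2_tendsto[OF inf] f k)
  then have "(cmod D / 2)^2 \<le> 4 * C^2 * (0 + 0)"
  proof (rule tendsto_lowerbound)
   show "\<forall>\<^sub>F N in at_top. (cmod D / 2)^2 \<le> 4 * C^2 * ((LINT t|M. (if N \<le> t then (cmod (f t))^2 else 0)) + (LINT t|M. (if N \<le> t then (cmod (k t))^2 else 0)))"
    using eventually_gt_at_top[of 0] eventually_ge_at_top[of R0] by eventually_elim (rule avg)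
  qed simp
  then show False using Dp by simp
 qed
 then show ?thesis
  using L2_mult_integrable[OF f h] L2_mult_integrable[OF g k] by (simp add: D_def L2_inner_def)
qed

text \<open>On an open cell \<open>volterra w\<close> is continuous, so a constant value almost
  everywhere is attained everywhere. Its derivative \<open>prim b w\<close> therefore vanishes on
  the cell, and differentiating once more, almost everywhere, gives \<open>w = 0\<close>.\<close>

lemma volterra_constant_imp_zero:
 assumes w: "w \<in> L2 M" and c: "AE t in M. volterra w t = c"
 shows "AE t in M. w t = 0"
proof -
 obtain N where N: "negligible N" "\<And>t. t \<in> I ==> t \<notin> N ==> volterra w t = c" using AE_Ivl_negligible[OF c] by blast
 have gap: "{x n<..<x (Suc n)} \<subseteq> I - X" for n
 proof
  fix t assume "t \<in> {x n<..<x (Suc n)}"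
  then show "t \<in> I - X" using open_interval_off_X[of n t t] by auto
 qed
 have const: "volterra w t = c" if t: "t \<in> {x n<..<x (Suc n)}" for n t
 proof (rule ccontr)
  assume ne: "volterra w t \<noteq> c"
  have "continuous_on {x n<..<x (Suc n)} (volterra w)"
   unfolding continuous_on_eq_continuous_within
  proof
   fix s assume "s \<in> {x n<..<x (Suc n)}"
   then have "(volterra w has_vector_derivative prim b w s) (at s within {x n<..<x (Suc n)})"
    using gap[of n] by (intro has_vector_derivative_within_subset[OF volterra_derivative[OF w] gap]) blast
   then show "continuous (at s within {x n<..<x (Suc n)}) (volterra w)" by (rule has_vector_derivative_continuous)
  qed
  then have "open ({x n<..<x (Suc n)} \<inter> volterra w -` (- {c}))"
   by (intro continuous_open_preimage) auto
  moreover have "{x n<..<x (Suc n)} \<inter> volterra w -` (- {c}) \<subseteq> N" using N(2) gap by blast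
  then have "negligible ({x n<..<x (Suc n)} \<inter> volterra w -` (- {c}))" by (rule negligible_subset[OF N(1)])
  ultimately have "{x n<..<x (Suc n)} \<inter> volterra w -` (- {c}) = {}" using open_not_negligible by blast
  then show False using t ne by blast
 qed
 have p0: "prim b w t = 0" if t: "t \<in> {x n<..<x (Suc n)}" for n t
 proof -
  have "(volterra w has_vector_derivative prim b w t) (at t within {x n<..<x (Suc n)})"
   using gap[of n] t by (intro has_vector_derivative_within_subset[OF volterra_derivative[OF w] gap]) blast
  then have "(volterra w has_vector_derivative prim b w t) (at t)" by (simp only: at_within_open[OF t open_greaterThanLessThan])
  moreover have "(volterra w has_vector_derivative 0) (at t)"
   by (rule has_vector_derivative_transform_within_open[OF has_vector_derivative_const[of c] open_greaterThanLessThan t])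
    (simp add: const)
  ultimately show ?thesis by (rule vector_derivative_unique_at)
 qed
 have "AE t in M. t < x (Suc n) --> w t = 0" for n
 proof -
  define R where "R = x (Suc n)"
  have R: "R \<in> I" unfolding R_def by (rule x_in_I)
  define w' where "w' = cut 0 R w"
  have w'L: "w' \<in> L2 M" unfolding w'_def by (rule cut_L2[OF w])
  have "w' integrable_on {0..R}" using has_integral_prim[OF w'L order_refl Ivl_nonneg[OF R] R] by auto
  moreover have "w' t = 0" if "t \<notin> {0..R}" for t unfolding w'_def using that by (intro cut_out) auto
  ultimately have "w' integrable_on UNIV" by (intro integrable_on_superset[of w' "{0..R}" UNIV]) auto
  then have "w' integrable_on {a..c}" for a c by (rule integrable_on_subinterval) simp
  then obtain N where N: "negligible N"
   "\<And>a t. a < t ==> t \<notin> N ==> ((%t. integral {a..t} w') has_vector_derivative w' t) (at t)"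
   using indefinite_integral_vector_derivative_AE by blast
  show ?thesis
  proof (rule negligible_AE_Ivl)
   show "negligible (N \<union> range x)"
    by (rule negligible_Un[OF N(1)], intro negligible_iff_null_sets[THEN iffD2] null_sets_completionI countable_imp_null_set_lborel) simp
   fix t assume t: "t \<in> I" "t \<notin> N \<union> range x"
   show "t < x (Suc n) --> w t = 0"
   proof
    assume tR: "t < x (Suc n)"
    obtain m where m: "x m \<le> t" "t < x (Suc m)" using interval_obtain[OF t(1)] .
    have tm: "t \<in> {x m<..<x (Suc m)}" using m t(2) by (auto simp: order_less_le)
    have t0: "0 < t" using tm x_nonneg[of m] by auto
    have Suc_mn: "x (Suc m) \<le> R"
    proof -
     have "x m < x (Suc n)" using m tR by linarith
     then show ?thesis by (simp add: R_def)
    qed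
    have z: "integral {0..s} w' = 0" if s: "s \<in> {x m<..<x (Suc m)}" for s
    proof -
     have sI: "s \<in> I" using gap[of m] s by blast
     have "prim b w' s = prim b w s" unfolding w'_def by (rule prim_cut) (use s Suc_mn in auto)
     then have "prim b w' s - prim b w' 0 = 0" using p0[OF s] by simp
     then show ?thesis using integral_unique[OF has_integral_prim[OF w'L order_refl Ivl_nonneg[OF sI] sI]] by (simp only:)
    qed
    have "((%t. integral {0..t} w') has_vector_derivative w' t) (at t)" by (rule N(2)[OF t0]) (use t(2) in blast)
    moreover have "((%t. integral {0..t} w') has_vector_derivative 0) (at t)"
     by (rule has_vector_derivative_transform_within_open[OF has_vector_derivative_const[of 0] open_greaterThanLessThan tm])
      (simp add: z)
    ultimately have "w' t = 0" by (rule vector_derivative_unique_at)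
    then show "w t = 0" unfolding w'_def using t0 tR by (simp add: cut_in R_def)
   qed
  qed
 qed
 then have "AE t in M. \<forall>n. t < x (Suc n) --> w t = 0" by (rule AE_all_countable[THEN iffD2, OF allI])
 then show ?thesis using AE_space
 proof eventually_elim
  case (elim t)
  then have "t \<in> I" by simp
  then obtain n where "t < x (Suc n)" using interval_obtain by blast
  then show ?case using elim by blast
 qed
qed

lemma selfadjoint_graph_Hmax: "Hamiltonian b x \<beta> = Hmax ==> selfadjoint_graph M Hmax"
 using adjoint_Hamiltonian by unfold_locales simp

text \<open>Density of the domain comes from the maximal operator: for \<open>w\<close> orthogonal
  to the domain, the pair \<open>(0, w)\<close> satisfies the adjoint relation, so
  \<open>volterra w\<close> is constant almost everywhere and \<open>w\<close> vanishes.\<close>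

theorem Hamiltonian_selfadjoint:
 assumes inf: "b = \<infinity>"
 shows "Hamiltonian b x \<beta> = Hmax" "self_adjoint M (Hamiltonian b x \<beta>)"
proof -
 show eq: "Hamiltonian b x \<beta> = Hmax"
  using Hamiltonian_subset_Hmax Hmax_subset_Hamiltonian[OF Hmax_symmetric[OF inf]] by blast
 interpret selfadjoint_graph M Hmax by (rule selfadjoint_graph_Hmax[OF eq])
 have S: "L2_subspace M (Domain Hmax)"
  unfolding L2_subspace_def
 proof (intro conjI ballI allI subsetI)
  show "(%_. 0) \<in> Domain Hmax" using T_zero by (rule DomainI)
 next
  fix f f' assume "f \<in> Domain Hmax" "f' \<in> Domain Hmax"
  then show "(%t. f t + f' t) \<in> Domain Hmax" by (elim DomainE) (rule DomainI, rule T_add)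
 next
  fix f c assume "f \<in> Domain Hmax"
  then show "(%t. c * f t) \<in> Domain Hmax" by (elim DomainE) (rule DomainI, rule T_cmult)
 qed (elim DomainE, rule T_L2(1))
 have "\<exists>f\<in>Domain Hmax. nrm (%t. f t - h t) < e" if h: "h \<in> L2 M" and e: "e > 0" for h e
 proof -
  have "\<exists>s\<in>Domain Hmax. nrm (%t. h t - s t) < e"
  proof (rule L2_biorthogonal_in_closure[OF S h _ e])
   fix w assume w: "w \<in> L2 M" "\<And>s. s \<in> Domain Hmax ==> ip s w = 0"
   have "((%_. 0), w) \<in> Hmax"
    by (subst T_iff) (use w in "auto simp: Domain_iff")
   then obtain c where "AE t in M. 0 = c - volterra w t" by (rule HmaxE)
   then have "AE t in M. volterra w t = c" by eventually_elim simp
   then have "AE t in M. w t = 0" by (rule volterra_constant_imp_zero[OF w(1)])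
   then have "nrm w = 0" using L2_norm_eq_0_iff[OF w(1)] by (simp add: L2_eq_def)
   then show "ip h w = 0" using L2_Cauchy_Schwarz[OF h w(1)] by simp
  qed
  then show ?thesis by (simp only: L2_norm_minus_commute[of M _ h])
 qed
 then show "self_adjoint M (Hamiltonian b x \<beta>)"
  unfolding self_adjoint_def densely_defined_def eq using adjoint_Hamiltonian eq by auto
qed

end

section \<open>A weighted Hardy inequality\<close>

lemma nn_integral_Cauchy_Schwarz_weighted:
 fixes \<omega> g :: "'a \<Rightarrow> real"
 assumes m: "\<omega> \<in> borel_measurable N" "g \<in> borel_measurable N" "{s \<in> space N. \<pi> s} \<in> sets N"
  and pos: "AE s in N. 0 < \<omega> s"
 shows "(\<integral>\<^sup>+s. (if \<pi> s then ennreal \<bar>g s\<bar> else 0) \<partial>N)^2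
  \<le> (\<integral>\<^sup>+s. (if \<pi> s then ennreal (1 / \<omega> s) else 0) \<partial>N) * (\<integral>\<^sup>+s. (if \<pi> s then ennreal (\<omega> s * (g s)^2) else 0) \<partial>N)"
proof -
 define u v where "u s = (if \<pi> s then ennreal (sqrt (1 / \<omega> s)) else 0)"
  and "v s = (if \<pi> s then ennreal (sqrt (\<omega> s * (g s)^2)) else 0)" for s
 have uv: "u \<in> borel_measurable N" "v \<in> borel_measurable N"
  unfolding u_def v_def using m by (auto intro!: measurable_If)
 have "(\<integral>\<^sup>+s. (if \<pi> s then ennreal \<bar>g s\<bar> else 0) \<partial>N) = (\<integral>\<^sup>+s. u s * v s \<partial>N)"
 proof (rule nn_integral_cong_AE)
  show "AE s in N. (if \<pi> s then ennreal \<bar>g s\<bar> else 0) = u s * v s"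
   using pos
  proof eventually_elim
   case (elim s)
   have "sqrt (1 / \<omega> s) * sqrt (\<omega> s * (g s)^2) = \<bar>g s\<bar>"
    using elim by (simp add: real_sqrt_mult[symmetric])
   then show ?case unfolding u_def v_def using elim by (auto simp: ennreal_mult[symmetric])
  qed
 qed
 also have "...^2 \<le> (\<integral>\<^sup>+s. (u s)^2 \<partial>N) * (\<integral>\<^sup>+s. (v s)^2 \<partial>N)" by (rule Cauchy_Schwarz_nn_integral[OF uv])
 also have "(\<integral>\<^sup>+s. (u s)^2 \<partial>N) = (\<integral>\<^sup>+s. (if \<pi> s then ennreal (1 / \<omega> s) else 0) \<partial>N)"
  by (rule nn_integral_cong_AE, rule AE_mp[OF pos], rule AE_I2) (auto simp: u_def ennreal_power real_sqrt_pow2)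
 also have "(\<integral>\<^sup>+s. (v s)^2 \<partial>N) = (\<integral>\<^sup>+s. (if \<pi> s then ennreal (\<omega> s * (g s)^2) else 0) \<partial>N)"
  by (rule nn_integral_cong_AE, rule AE_mp[OF pos], rule AE_I2) (auto simp: v_def ennreal_power real_sqrt_pow2)
 finally show ?thesis .
qed

text \<open>The relation is abstract because both orientations of the order occur:
  \<open>s \<le> t\<close> on the half-line and \<open>t \<le> s\<close> on bounded
  intervals.\<close>

locale triangle = sigma_finite_measure N for N :: "'a measure" +
 fixes \<rho> :: "'a \<Rightarrow> 'a \<Rightarrow> bool"
 assumes pred_rel: "Measurable.pred (N \<Otimes>\<^sub>M N) (%z. \<rho> (fst z) (snd z))"
begin

lemma section_sets:
 "t \<in> space N ==> {s \<in> space N. \<rho> s t} \<in> sets N" "t \<in> space N ==> {s \<in> space N. \<rho> t s} \<in> sets N"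
proof -
 assume t: "t \<in> space N"
 have "Measurable.pred N (%s. \<rho> (fst (s, t)) (snd (s, t)))"
  by (rule measurable_compose[OF _ pred_rel]) (use t in measurable)
 then show "{s \<in> space N. \<rho> s t} \<in> sets N" by (simp add: pred_def)
 have "Measurable.pred N (%s. \<rho> (fst (t, s)) (snd (t, s)))"
  by (rule measurable_compose[OF _ pred_rel]) (use t in measurable)
 then show "{s \<in> space N. \<rho> t s} \<in> sets N" by (simp add: pred_def)
qed

lemma tonelli:
 fixes F G :: "'a \<Rightarrow> ennreal"
 assumes F: "F \<in> borel_measurable N" and G: "G \<in> borel_measurable N"
 shows "(\<integral>\<^sup>+t. F t * (\<integral>\<^sup>+s. (if \<rho> s t then G s else 0) \<partial>N) \<partial>N) = (\<integral>\<^sup>+s. G s * (\<integral>\<^sup>+t. (if \<rho> s t then F t else 0) \<partial>N) \<partial>N)"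
  and "(%t. \<integral>\<^sup>+s. (if \<rho> s t then G s else 0) \<partial>N) \<in> borel_measurable N"
  and "(%s. \<integral>\<^sup>+t. (if \<rho> s t then F t else 0) \<partial>N) \<in> borel_measurable N"
proof -
 interpret NN: pair_sigma_finite N N ..
 note [measurable] = F G
 have *: "{z \<in> space (N \<Otimes>\<^sub>M N). \<rho> (fst z) (snd z)} \<in> sets (N \<Otimes>\<^sub>M N)" using pred_rel by (simp only: pred_def)
 have h: "(%(s, t). if \<rho> s t then G s * F t else 0) \<in> borel_measurable (N \<Otimes>\<^sub>M N)"
  unfolding split_beta' by (rule measurable_If[OF _ _ *]) measurable
 have hG: "(%(s, t). if \<rho> s t then G s else 0) \<in> borel_measurable (N \<Otimes>\<^sub>M N)"
  unfolding split_beta' by (rule measurable_If[OF _ _ *]) measurable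
 have hF: "(%(s, t). if \<rho> s t then F t else 0) \<in> borel_measurable (N \<Otimes>\<^sub>M N)"
  unfolding split_beta' by (rule measurable_If[OF _ _ *]) measurable
 show "(%s. \<integral>\<^sup>+t. (if \<rho> s t then F t else 0) \<partial>N) \<in> borel_measurable N"
  using borel_measurable_nn_integral_fst[OF hF] by (simp only: prod.case)
 show "(%t. \<integral>\<^sup>+s. (if \<rho> s t then G s else 0) \<partial>N) \<in> borel_measurable N"
  using borel_measurable_nn_integral_fst[OF measurable_compose[OF measurable_pair_swap' hG]] by (simp only: prod.case)
 have "(\<integral>\<^sup>+t. F t * (\<integral>\<^sup>+s. (if \<rho> s t then G s else 0) \<partial>N) \<partial>N) = (\<integral>\<^sup>+t. (\<integral>\<^sup>+s. (if \<rho> s t then G s * F t else 0) \<partial>N) \<partial>N)"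
 proof (rule nn_integral_cong)
  fix t assume t: "t \<in> space N"
  have "(%s. if \<rho> s t then G s else 0) \<in> borel_measurable N" by (rule measurable_If[OF G _ section_sets(1)[OF t]]) simp
  then have "F t * (\<integral>\<^sup>+s. (if \<rho> s t then G s else 0) \<partial>N) = (\<integral>\<^sup>+s. F t * (if \<rho> s t then G s else 0) \<partial>N)"
   by (rule nn_integral_cmult[symmetric])
  also have "... = (\<integral>\<^sup>+s. (if \<rho> s t then G s * F t else 0) \<partial>N)" by (rule nn_integral_cong) (simp add: mult.commute)
  finally show "F t * (\<integral>\<^sup>+s. (if \<rho> s t then G s else 0) \<partial>N) = (\<integral>\<^sup>+s. (if \<rho> s t then G s * F t else 0) \<partial>N)" .
 qed
 also have "... = (\<integral>\<^sup>+s. (\<integral>\<^sup>+t. (if \<rho> s t then G s * F t else 0) \<partial>N) \<partial>N)"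
  using NN.Fubini[OF h] by (simp only: prod.case)
 also have "... = (\<integral>\<^sup>+s. G s * (\<integral>\<^sup>+t. (if \<rho> s t then F t else 0) \<partial>N) \<partial>N)"
 proof (rule nn_integral_cong)
  fix s assume s: "s \<in> space N"
  have "(%t. if \<rho> s t then F t else 0) \<in> borel_measurable N" by (rule measurable_If[OF F _ section_sets(2)[OF s]]) simp
  then have "G s * (\<integral>\<^sup>+t. (if \<rho> s t then F t else 0) \<partial>N) = (\<integral>\<^sup>+t. G s * (if \<rho> s t then F t else 0) \<partial>N)"
   by (rule nn_integral_cmult[symmetric])
  also have "... = (\<integral>\<^sup>+t. (if \<rho> s t then G s * F t else 0) \<partial>N)" by (rule nn_integral_cong) simp
  finally show "(\<integral>\<^sup>+t. (if \<rho> s t then G s * F t else 0) \<partial>N) = G s * (\<integral>\<^sup>+t. (if \<rho> s t then F t else 0) \<partial>N)" by simp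
 qed
 finally show "(\<integral>\<^sup>+t. F t * (\<integral>\<^sup>+s. (if \<rho> s t then G s else 0) \<partial>N) \<partial>N) = (\<integral>\<^sup>+s. G s * (\<integral>\<^sup>+t. (if \<rho> s t then F t else 0) \<partial>N) \<partial>N)" .
qed

context
 fixes \<omega> q g :: "'a \<Rightarrow> real" and A B :: real
 assumes mw: "\<omega> \<in> borel_measurable N" and mq: "q \<in> borel_measurable N" and mg: "g \<in> borel_measurable N"
  and pos: "AE t in N. 0 < \<omega> t" and AB: "0 \<le> A" "0 \<le> B"
  and hA: "AE t in N. (\<integral>\<^sup>+s. (if \<rho> s t then ennreal (1 / \<omega> s) else 0) \<partial>N) \<le> ennreal (A * \<omega> t)"
  and hB: "AE s in N. (\<integral>\<^sup>+t. (if \<rho> s t then ennreal (\<omega> t * (q t)^2) else 0) \<partial>N) \<le> ennreal (B / \<omega> s)"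
begin

text \<open>A Schur test. The inner integral is split by the Cauchy-Schwarz inequality with the
  weight \<open>\<omega>\<close>; \<open>hA\<close> bounds its first factor, and after an exchange
  of the integrations \<open>hB\<close> bounds what has accumulated in front of
  \<open>g^2\<close>.\<close>

lemma Hardy_direct:
 "(\<integral>\<^sup>+t. ennreal ((q t)^2) * (\<integral>\<^sup>+s. (if \<rho> s t then ennreal \<bar>g s\<bar> else 0) \<partial>N)^2 \<partial>N) \<le> ennreal (A * B) * (\<integral>\<^sup>+t. ennreal ((g t)^2) \<partial>N)"
proof -
 have "(\<integral>\<^sup>+t. ennreal ((q t)^2) * (\<integral>\<^sup>+s. (if \<rho> s t then ennreal \<bar>g s\<bar> else 0) \<partial>N)^2 \<partial>N)
   \<le> (\<integral>\<^sup>+t. ennreal (A * (\<omega> t * (q t)^2)) * (\<integral>\<^sup>+s. (if \<rho> s t then ennreal (\<omega> s * (g s)^2) else 0) \<partial>N) \<partial>N)"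
 proof (rule nn_integral_mono_AE)
  show "AE t in N. ennreal ((q t)^2) * (\<integral>\<^sup>+s. (if \<rho> s t then ennreal \<bar>g s\<bar> else 0) \<partial>N)^2
    \<le> ennreal (A * (\<omega> t * (q t)^2)) * (\<integral>\<^sup>+s. (if \<rho> s t then ennreal (\<omega> s * (g s)^2) else 0) \<partial>N)"
   using hA pos AE_space
  proof eventually_elim
   case (elim t)
   let ?J = "\<integral>\<^sup>+s. (if \<rho> s t then ennreal (\<omega> s * (g s)^2) else 0) \<partial>N"
   have "(\<integral>\<^sup>+s. (if \<rho> s t then ennreal \<bar>g s\<bar> else 0) \<partial>N)^2 \<le> ennreal (A * \<omega> t) * ?J"
    by (rule order_trans[OF nn_integral_Cauchy_Schwarz_weighted[OF mw mg section_sets(1)[OF elim(3)] pos] mult_right_mono[OF elim(1)]]) simp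
   then have "ennreal ((q t)^2) * (\<integral>\<^sup>+s. (if \<rho> s t then ennreal \<bar>g s\<bar> else 0) \<partial>N)^2 \<le> ennreal ((q t)^2) * (ennreal (A * \<omega> t) * ?J)"
    by (rule mult_left_mono) simp
   also have "... = ennreal (A * (\<omega> t * (q t)^2)) * ?J"
   proof -
    have "ennreal ((q t)^2) * (ennreal (A * \<omega> t) * ?J) = ennreal ((q t)^2 * (A * \<omega> t)) * ?J"
     using elim(2) AB by (simp only: mult.assoc[symmetric]) (simp add: ennreal_mult mult.assoc)
    then show ?thesis by (simp only: mult.commute[of "(q t)^2"] mult.assoc)
   qed
   finally show ?case .
  qed
 qed
 also have "... = (\<integral>\<^sup>+s. ennreal (\<omega> s * (g s)^2) * (\<integral>\<^sup>+t. (if \<rho> s t then ennreal (A * (\<omega> t * (q t)^2)) else 0) \<partial>N) \<partial>N)"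
  by (rule tonelli(1)) (use mw mq mg in simp_all)
 also have "... \<le> (\<integral>\<^sup>+s. ennreal (A * B) * ennreal ((g s)^2) \<partial>N)"
 proof (rule nn_integral_mono_AE)
  show "AE s in N. ennreal (\<omega> s * (g s)^2) * (\<integral>\<^sup>+t. (if \<rho> s t then ennreal (A * (\<omega> t * (q t)^2)) else 0) \<partial>N) \<le> ennreal (A * B) * ennreal ((g s)^2)"
   using hB pos AE_space
  proof eventually_elim
   case (elim s)
   have "(\<integral>\<^sup>+t. (if \<rho> s t then ennreal (A * (\<omega> t * (q t)^2)) else 0) \<partial>N) = (\<integral>\<^sup>+t. ennreal A * (if \<rho> s t then ennreal (\<omega> t * (q t)^2) else 0) \<partial>N)"
    by (rule nn_integral_cong_AE, rule AE_mp[OF pos], rule AE_I2) (use AB in "auto simp: ennreal_mult")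
   also have "... = ennreal A * (\<integral>\<^sup>+t. (if \<rho> s t then ennreal (\<omega> t * (q t)^2) else 0) \<partial>N)"
    by (rule nn_integral_cmult, rule measurable_If[OF _ _ section_sets(2)[OF elim(3)]]) (use mw mq in simp_all)
   also have "... \<le> ennreal A * ennreal (B / \<omega> s)" by (rule mult_left_mono[OF elim(1)]) simp
   finally have "ennreal (\<omega> s * (g s)^2) * (\<integral>\<^sup>+t. (if \<rho> s t then ennreal (A * (\<omega> t * (q t)^2)) else 0) \<partial>N) \<le> ennreal (\<omega> s * (g s)^2) * (ennreal A * ennreal (B / \<omega> s))"
    by (rule mult_left_mono) simp
   also have "... = ennreal ((\<omega> s * (g s)^2) * (A * (B / \<omega> s)))"
    using elim(2) AB by (simp add: ennreal_mult[symmetric])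
   also have "(\<omega> s * (g s)^2) * (A * (B / \<omega> s)) = (A * B) * (g s)^2" using elim(2) by simp
   also have "ennreal ... = ennreal (A * B) * ennreal ((g s)^2)" using AB by (simp add: ennreal_mult)
   finally show ?case .
  qed
 qed
 also have "... = ennreal (A * B) * (\<integral>\<^sup>+t. ennreal ((g t)^2) \<partial>N)" by (rule nn_integral_cmult) (use mg in simp)
 finally show ?thesis .
qed

text \<open>The transposed operator is bounded under the same conditions, used in the other order:
  \<open>hB\<close> bounds the factor with \<open>q\<close> from the Cauchy-Schwarz inequality, and
  \<open>hA\<close> is used after the exchange of the integrations.\<close>

lemma Hardy_dual:
 "(\<integral>\<^sup>+t. (\<integral>\<^sup>+s. (if \<rho> t s then ennreal \<bar>q s * g s\<bar> else 0) \<partial>N)^2 \<partial>N) \<le> ennreal (A * B) * (\<integral>\<^sup>+t. ennreal ((g t)^2) \<partial>N)"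
proof -
 have CS: "(\<integral>\<^sup>+s. (if \<rho> t s then ennreal \<bar>q s * g s\<bar> else 0) \<partial>N)^2
   \<le> (\<integral>\<^sup>+s. (if \<rho> t s then ennreal (\<omega> s * (q s)^2) else 0) \<partial>N) * (\<integral>\<^sup>+s. (if \<rho> t s then ennreal ((g s)^2 / \<omega> s) else 0) \<partial>N)"
  if t: "t \<in> space N" for t
 proof -
  define u v where "u s = (if \<rho> t s then ennreal (sqrt (\<omega> s * (q s)^2)) else 0)"
   and "v s = (if \<rho> t s then ennreal (sqrt ((g s)^2 / \<omega> s)) else 0)" for s
  have uv: "u \<in> borel_measurable N" "v \<in> borel_measurable N"
   unfolding u_def v_def using mw mq mg section_sets(2)[OF t] by (auto intro!: measurable_If)
  have "(\<integral>\<^sup>+s. (if \<rho> t s then ennreal \<bar>q s * g s\<bar> else 0) \<partial>N) = (\<integral>\<^sup>+s. u s * v s \<partial>N)"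
  proof (rule nn_integral_cong_AE)
   show "AE s in N. (if \<rho> t s then ennreal \<bar>q s * g s\<bar> else 0) = u s * v s"
    using pos
   proof eventually_elim
    case (elim s)
    have "sqrt (\<omega> s * (q s)^2) * sqrt ((g s)^2 / \<omega> s) = \<bar>q s * g s\<bar>"
    proof -
     have "(\<omega> s * (q s)^2) * ((g s)^2 / \<omega> s) = (q s * g s)^2" using elim by (simp add: power2_eq_square)
     then show ?thesis by (metis real_sqrt_mult real_sqrt_abs)
    qed
    then show ?case unfolding u_def v_def using elim by (auto simp: ennreal_mult[symmetric])
   qed
  qed
  also have "...^2 \<le> (\<integral>\<^sup>+s. (u s)^2 \<partial>N) * (\<integral>\<^sup>+s. (v s)^2 \<partial>N)" by (rule Cauchy_Schwarz_nn_integral[OF uv])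
  also have "(\<integral>\<^sup>+s. (u s)^2 \<partial>N) = (\<integral>\<^sup>+s. (if \<rho> t s then ennreal (\<omega> s * (q s)^2) else 0) \<partial>N)"
   by (rule nn_integral_cong_AE, rule AE_mp[OF pos], rule AE_I2) (auto simp: u_def ennreal_power real_sqrt_pow2)
  also have "(\<integral>\<^sup>+s. (v s)^2 \<partial>N) = (\<integral>\<^sup>+s. (if \<rho> t s then ennreal ((g s)^2 / \<omega> s) else 0) \<partial>N)"
   by (rule nn_integral_cong_AE, rule AE_mp[OF pos], rule AE_I2) (auto simp: v_def ennreal_power real_sqrt_pow2)
  finally show ?thesis .
 qed
 have "(\<integral>\<^sup>+t. (\<integral>\<^sup>+s. (if \<rho> t s then ennreal \<bar>q s * g s\<bar> else 0) \<partial>N)^2 \<partial>N)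
   \<le> (\<integral>\<^sup>+t. ennreal (B / \<omega> t) * (\<integral>\<^sup>+s. (if \<rho> t s then ennreal ((g s)^2 / \<omega> s) else 0) \<partial>N) \<partial>N)"
 proof (rule nn_integral_mono_AE)
  show "AE t in N. (\<integral>\<^sup>+s. (if \<rho> t s then ennreal \<bar>q s * g s\<bar> else 0) \<partial>N)^2
    \<le> ennreal (B / \<omega> t) * (\<integral>\<^sup>+s. (if \<rho> t s then ennreal ((g s)^2 / \<omega> s) else 0) \<partial>N)"
   using hB AE_space
  proof eventually_elim
   case (elim t)
   show ?case by (rule order_trans[OF CS[OF elim(2)] mult_right_mono[OF elim(1)]]) simp
  qed
 qed
 also have "... = (\<integral>\<^sup>+s. ennreal ((g s)^2 / \<omega> s) * (\<integral>\<^sup>+t. (if \<rho> t s then ennreal (B / \<omega> t) else 0) \<partial>N) \<partial>N)"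
  by (rule tonelli(1)[symmetric]) (use mw mq mg in simp_all)
 also have "... \<le> (\<integral>\<^sup>+s. ennreal (A * B) * ennreal ((g s)^2) \<partial>N)"
 proof (rule nn_integral_mono_AE)
  show "AE s in N. ennreal ((g s)^2 / \<omega> s) * (\<integral>\<^sup>+t. (if \<rho> t s then ennreal (B / \<omega> t) else 0) \<partial>N) \<le> ennreal (A * B) * ennreal ((g s)^2)"
   using hA pos AE_space
  proof eventually_elim
   case (elim s)
   have "(\<integral>\<^sup>+t. (if \<rho> t s then ennreal (B / \<omega> t) else 0) \<partial>N) = (\<integral>\<^sup>+t. ennreal B * (if \<rho> t s then ennreal (1 / \<omega> t) else 0) \<partial>N)"
    by (rule nn_integral_cong_AE, rule AE_mp[OF pos], rule AE_I2) (use AB in "auto simp: ennreal_mult[symmetric]")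
   also have "... = ennreal B * (\<integral>\<^sup>+t. (if \<rho> t s then ennreal (1 / \<omega> t) else 0) \<partial>N)"
    by (rule nn_integral_cmult, rule measurable_If[OF _ _ section_sets(1)[OF elim(3)]]) (use mw in simp_all)
   also have "... \<le> ennreal B * ennreal (A * \<omega> s)" by (rule mult_left_mono[OF elim(1)]) simp
   finally have "ennreal ((g s)^2 / \<omega> s) * (\<integral>\<^sup>+t. (if \<rho> t s then ennreal (B / \<omega> t) else 0) \<partial>N) \<le> ennreal ((g s)^2 / \<omega> s) * (ennreal B * ennreal (A * \<omega> s))"
    by (rule mult_left_mono) simp
   also have "... = ennreal (((g s)^2 / \<omega> s) * (B * (A * \<omega> s)))"
    using elim(2) AB by (simp add: ennreal_mult[symmetric])
   also have "((g s)^2 / \<omega> s) * (B * (A * \<omega> s)) = (A * B) * (g s)^2" using elim(2) by simp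
   also have "ennreal ... = ennreal (A * B) * ennreal ((g s)^2)" using AB by (simp add: ennreal_mult)
   finally show ?case .
  qed
 qed
 also have "... = ennreal (A * B) * (\<integral>\<^sup>+t. ennreal ((g t)^2) \<partial>N)" by (rule nn_integral_cmult) (use mg in simp)
 finally show ?thesis .
qed

text \<open>The square of the sum is at most twice the sum of the squares, and each operator
  contributes \<open>A * B\<close>, hence the factor 4.\<close>

lemma Hardy_sum:
 assumes h: "AE t in N. ennreal (h t) \<le> ennreal \<bar>q t\<bar> * (\<integral>\<^sup>+s. (if \<rho> s t then ennreal \<bar>g s\<bar> else 0) \<partial>N)
   + (\<integral>\<^sup>+s. (if \<rho> t s then ennreal \<bar>q s * g s\<bar> else 0) \<partial>N)"
  and h0: "\<And>t. 0 \<le> h t"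
 shows "(\<integral>\<^sup>+t. ennreal ((h t)^2) \<partial>N) \<le> ennreal (4 * (A * B)) * (\<integral>\<^sup>+t. ennreal ((g t)^2) \<partial>N)"
proof -
 define U V where "U t = (\<integral>\<^sup>+s. (if \<rho> s t then ennreal \<bar>g s\<bar> else 0) \<partial>N)"
  and "V t = (\<integral>\<^sup>+s. (if \<rho> t s then ennreal \<bar>q s * g s\<bar> else 0) \<partial>N)" for t
 have U: "U \<in> borel_measurable N" unfolding U_def by (rule tonelli(2)[where F="%_. 0"]) (use mg in simp_all)
 have V: "V \<in> borel_measurable N" unfolding V_def by (rule tonelli(3)[where G="%_. 0"]) (use mg mq in simp_all)
 have sq: "(a + c)^2 \<le> 2 * a^2 + 2 * c^2" for a c :: ennreal
 proof (cases a; cases c)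
  fix r s assume *: "a = ennreal r" "0 \<le> r" "c = ennreal s" "0 \<le> s"
  have "2 * ennreal (r^2) + 2 * ennreal (s^2) = ennreal (2 * r^2 + 2 * s^2)"
   by (simp add: ennreal_mult)
  moreover have "(r + s)^2 \<le> 2 * r^2 + 2 * s^2"
   using zero_le_power2[of "r - s"] by (simp add: power2_eq_square algebra_simps)
  ultimately show ?thesis using * by (simp add: ennreal_power ennreal_leI flip: ennreal_plus)
 qed (auto simp: ennreal_mult_top ennreal_top_mult power2_eq_square)
 have "(\<integral>\<^sup>+t. ennreal ((h t)^2) \<partial>N) \<le> (\<integral>\<^sup>+t. 2 * (ennreal ((q t)^2) * (U t)^2) + 2 * (V t)^2 \<partial>N)"
 proof (rule nn_integral_mono_AE)
  show "AE t in N. ennreal ((h t)^2) \<le> 2 * (ennreal ((q t)^2) * (U t)^2) + 2 * (V t)^2"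
   using h
  proof eventually_elim
   case (elim t)
   have "ennreal ((h t)^2) = (ennreal (h t))^2" using h0 by (simp add: ennreal_power)
   also have "... \<le> (ennreal \<bar>q t\<bar> * U t + V t)^2" using elim unfolding U_def V_def by (rule power_mono) simp
   also have "... \<le> 2 * (ennreal \<bar>q t\<bar> * U t)^2 + 2 * (V t)^2" by (rule sq)
   also have "(ennreal \<bar>q t\<bar> * U t)^2 = ennreal ((q t)^2) * (U t)^2"
    by (simp add: power_mult_distrib ennreal_power)
   finally show ?case .
  qed
 qed
 also have "... = 2 * (\<integral>\<^sup>+t. ennreal ((q t)^2) * (U t)^2 \<partial>N) + 2 * (\<integral>\<^sup>+t. (V t)^2 \<partial>N)"
  using U V mq by (simp add: nn_integral_add nn_integral_cmult)
 also have "... \<le> 2 * (ennreal (A * B) * (\<integral>\<^sup>+t. ennreal ((g t)^2) \<partial>N)) + 2 * (ennreal (A * B) * (\<integral>\<^sup>+t. ennreal ((g t)^2) \<partial>N))"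
  using Hardy_direct Hardy_dual unfolding U_def V_def by (intro add_mono mult_left_mono) auto
 also have "... = (2 + 2) * (ennreal (A * B) * (\<integral>\<^sup>+t. ennreal ((g t)^2) \<partial>N))" by (simp only: distrib_right)
 also have "... = ennreal (4 * (A * B)) * (\<integral>\<^sup>+t. ennreal ((g t)^2) \<partial>N)"
  using AB by (simp add: ennreal_mult mult.assoc)
 finally show ?thesis .
qed

end

end

lemma nn_integral_Ivl_le: "(\<integral>\<^sup>+t. h t \<partial>Ivl_measure b) \<le> (\<integral>\<^sup>+t. h t \<partial>lborel)"
proof -
 have "(\<integral>\<^sup>+t. h t \<partial>Ivl_measure b) = (\<integral>\<^sup>+t. h t * indicator (Ivl b) t \<partial>lebesgue)"
  by (rule nn_integral_restrict_space) simp
 also have "... \<le> (\<integral>\<^sup>+t. h t \<partial>lebesgue)" by (rule nn_integral_mono) (simp add: indicator_def)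
 also have "... = (\<integral>\<^sup>+t. h t \<partial>lborel)" by (rule nn_integral_completion)
 finally show ?thesis .
qed

text \<open>Only an inequality, because \<open>[u, v]\<close> may stick out of \<open>Ivl b\<close>.
  The derivative is required in the open interval, which allows an integrable singularity of
  \<open>f\<close> at an end such as \<open>v = b\<close>.\<close>

lemma nn_integral_Ivl_FTC_le:
 assumes uv: "u \<le> v" and F: "continuous_on {u..v} F" and f: "f \<in> borel_measurable borel"
  and d: "\<And>t. u < t ==> t < v ==> (F has_real_derivative f t) (at t)" and f0: "\<And>t. u \<le> t ==> t \<le> v ==> 0 \<le> f t"
 shows "(\<integral>\<^sup>+t. (if u \<le> t \<and> t \<le> v then ennreal (f t) else 0) \<partial>Ivl_measure b) \<le> ennreal (F v - F u)"
proof -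
 define k where "k t = (if u \<le> t \<and> t \<le> v then f t else 0)" for t
 have k: "k \<in> borel_measurable borel" unfolding k_def using f by measurable
 have "(f has_integral (F v - F u)) {u..v}"
  by (rule fundamental_theorem_of_calculus_interior[OF uv F])
   (use d in "auto simp: has_real_derivative_iff_has_vector_derivative[symmetric]")
 then have "(k has_integral (F v - F u)) {u..v}"
  by (rule has_integral_eq[rotated]) (simp add: k_def)
 then have "(k has_integral (F v - F u)) UNIV"
  by (rule has_integral_on_superset) (auto simp: k_def)
 then have "(\<integral>\<^sup>+t. ennreal (k t) \<partial>lborel) = ennreal (F v - F u)"
  by (rule nn_integral_has_integral_lborel[rotated 2]) (use k f0 in "auto simp: k_def")
 moreover have "(\<integral>\<^sup>+t. ennreal (k t) \<partial>Ivl_measure b) \<le> (\<integral>\<^sup>+t. ennreal (k t) \<partial>lborel)"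
  by (rule nn_integral_Ivl_le)
 moreover have "(\<integral>\<^sup>+t. ennreal (k t) \<partial>Ivl_measure b) = (\<integral>\<^sup>+t. (if u \<le> t \<and> t \<le> v then ennreal (f t) else 0) \<partial>Ivl_measure b)"
  by (rule nn_integral_cong) (simp add: k_def)
 ultimately show ?thesis by simp
qed

section \<open>Forms that are compact relative to the graph norm\<close>

lemma L2_norm_mono_AE:
 assumes "f \<in> L2 M" "g \<in> L2 M" "AE t in M. cmod (f t) \<le> cmod (g t)"
 shows "L2_norm M f \<le> L2_norm M g"
 unfolding L2_norm_def
proof (intro real_sqrt_le_mono integral_mono_AE L2_integrable_sq assms(1,2))
 show "AE t in M. (cmod (f t))^2 \<le> (cmod (g t))^2"
  using assms(3) by eventually_elim (rule power_mono, simp_all)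
qed

context delta_chain
begin

text \<open>The inequality of \<open>finite_rank_approximable\<close> for an arbitrary quantity
  attached to \<open>(f, g)\<close>. Norms of pieces of \<open>f\<close>, point values of primitives
  and the constant of integration can then be estimated one at a time and added.\<close>

definition form_bounded where
 "form_bounded \<phi> \<epsilon> E K \<longleftrightarrow> finite E \<and> E \<subseteq> L2 M \<and> (\<forall>f g. (f, g) \<in> Hmax -->
   \<phi> f g \<le> \<epsilon> * (nrm f + nrm g) + K * (\<Sum>e\<in>E. cmod (ip f e) + cmod (ip g e)))"

definition form_compact :: "((real \<Rightarrow> complex) \<Rightarrow> (real \<Rightarrow> complex) \<Rightarrow> real) \<Rightarrow> bool" where
 "form_compact \<phi> \<longleftrightarrow> (\<forall>\<epsilon>>0. \<exists>E K. form_bounded \<phi> \<epsilon> E K)"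

lemma form_boundedI:
 "finite E ==> E \<subseteq> L2 M ==> (\<And>f g. (f, g) \<in> Hmax ==>
  \<phi> f g \<le> \<epsilon> * (nrm f + nrm g) + K * (\<Sum>e\<in>E. cmod (ip f e) + cmod (ip g e))) ==> form_bounded \<phi> \<epsilon> E K"
 by (simp only: form_bounded_def simp_thms) blast

lemma form_compactE:
 assumes "form_compact \<phi>" "\<epsilon> > 0"
 obtains E K where "finite E" "E \<subseteq> L2 M" "0 \<le> K" "\<And>f g. (f, g) \<in> Hmax ==>
  \<phi> f g \<le> \<epsilon> * (nrm f + nrm g) + K * (\<Sum>e\<in>E. cmod (ip f e) + cmod (ip g e))"
proof -
 obtain E K where *: "form_bounded \<phi> \<epsilon> E K" using assms by (auto simp only: form_compact_def)
 show thesis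
 proof (rule that[OF _ _ abs_ge_zero[of K]])
  show "finite E" "E \<subseteq> L2 M" using * by (simp_all only: form_bounded_def)
  fix f g assume fg: "(f, g) \<in> Hmax"
  let ?S = "\<Sum>e\<in>E. cmod (ip f e) + cmod (ip g e)"
  have "\<phi> f g \<le> \<epsilon> * (nrm f + nrm g) + K * ?S"
   using * fg by (simp only: form_bounded_def)
  moreover have "0 \<le> ?S" by (rule sum_nonneg) simp
  then have "K * ?S \<le> \<bar>K\<bar> * ?S" by (intro mult_right_mono) simp_all
  ultimately show "\<phi> f g \<le> \<epsilon> * (nrm f + nrm g) + \<bar>K\<bar> * ?S" by linarith
 qed
qed

text \<open>Compactness need only hold up to arbitrarily small multiples of the graph norm; the
  given \<open>\<epsilon>\<close> is shared equally by this error and by the estimate for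
  \<open>\<psi>\<close>.\<close>

lemma form_compactI:
 assumes "\<And>\<epsilon>. \<epsilon> > 0 ==> \<exists>\<psi>. form_compact \<psi> \<and> (\<forall>f g. (f, g) \<in> Hmax --> \<phi> f g \<le> \<epsilon> * (nrm f + nrm g) + \<psi> f g)"
 shows "form_compact \<phi>"
 unfolding form_compact_def
proof (intro allI impI)
 fix \<epsilon> :: real assume e: "\<epsilon> > 0"
 then have e2: "\<epsilon> / 2 > 0" by simp
 from assms[OF e2] obtain \<psi> where \<psi>: "form_compact \<psi>" "\<forall>f g. (f, g) \<in> Hmax --> \<phi> f g \<le> \<epsilon> / 2 * (nrm f + nrm g) + \<psi> f g"
  by (elim exE conjE)
 obtain E K where E: "finite E" "E \<subseteq> L2 M" "0 \<le> K" and le: "\<And>f g. (f, g) \<in> Hmax ==>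
  \<psi> f g \<le> \<epsilon> / 2 * (nrm f + nrm g) + K * (\<Sum>e\<in>E. cmod (ip f e) + cmod (ip g e))"
  by (rule form_compactE[OF \<psi>(1) e2]) blast
 have "form_bounded \<phi> \<epsilon> E K"
 proof (rule form_boundedI[OF E(1,2)])
  fix f g assume fg: "(f, g) \<in> Hmax"
  show "\<phi> f g \<le> \<epsilon> * (nrm f + nrm g) + K * (\<Sum>e\<in>E. cmod (ip f e) + cmod (ip g e))"
   using \<psi>(2)[rule_format, OF fg] le[OF fg] by (simp add: field_simps)
 qed
 then show "\<exists>E K. form_bounded \<phi> \<epsilon> E K" by blast
qed

lemma form_compact_mono:
 assumes "form_compact \<psi>" "\<And>f g. (f, g) \<in> Hmax ==> \<phi> f g \<le> \<psi> f g"
 shows "form_compact \<phi>"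
proof (rule form_compactI, intro exI conjI allI impI)
 fix \<epsilon> :: real and f g assume "\<epsilon> > 0" "(f, g) \<in> Hmax"
 then show "\<phi> f g \<le> \<epsilon> * (nrm f + nrm g) + \<psi> f g"
  using assms(2)[of f g] by (simp add: add_increasing)
qed (rule assms(1))

lemma form_compact_add:
 assumes "form_compact \<phi>" "form_compact \<psi>"
 shows "form_compact (%f g. \<phi> f g + \<psi> f g)"
 unfolding form_compact_def
proof (intro allI impI)
 fix \<epsilon> :: real assume "\<epsilon> > 0"
 then have e: "\<epsilon> / 2 > 0" by simp
 let ?S = "%E f g. \<Sum>e\<in>E. cmod (ip f e) + cmod (ip g e)"
 obtain E K where E: "finite E" "E \<subseteq> L2 M" "0 \<le> K" and le: "\<And>f g. (f, g) \<in> Hmax ==>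
  \<phi> f g \<le> \<epsilon> / 2 * (nrm f + nrm g) + K * ?S E f g" by (rule form_compactE[OF assms(1) e]) blast
 obtain E' K' where E': "finite E'" "E' \<subseteq> L2 M" "0 \<le> K'" and le': "\<And>f g. (f, g) \<in> Hmax ==>
  \<psi> f g \<le> \<epsilon> / 2 * (nrm f + nrm g) + K' * ?S E' f g" by (rule form_compactE[OF assms(2) e]) blast
 have "form_bounded (%f g. \<phi> f g + \<psi> f g) \<epsilon> (E \<union> E') (K + K')"
 proof (rule form_boundedI)
  fix f g assume that: "(f, g) \<in> Hmax"
  have "K * ?S E f g \<le> K * ?S (E \<union> E') f g" "K' * ?S E' f g \<le> K' * ?S (E \<union> E') f g"
   using E E' by (auto intro!: mult_left_mono sum_mono2)
  then show "\<phi> f g + \<psi> f g \<le> \<epsilon> * (nrm f + nrm g) + (K + K') * ?S (E \<union> E') f g"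
   using le[OF that] le'[OF that] by (simp add: algebra_simps)
 qed (use E E' in auto)
 then show "\<exists>E K. form_bounded (%f g. \<phi> f g + \<psi> f g) \<epsilon> E K" by blast
qed

lemma form_compact_cmult:
 assumes "form_compact \<phi>" "c \<ge> 0"
 shows "form_compact (%f g. c * \<phi> f g)"
 unfolding form_compact_def
proof (intro allI impI)
 fix \<epsilon> :: real assume "\<epsilon> > 0"
 then have e: "\<epsilon> / (c + 1) > 0" using assms(2) by simp
 let ?S = "%E f g. \<Sum>e\<in>E. cmod (ip f e) + cmod (ip g e)"
 obtain E K where E: "finite E" "E \<subseteq> L2 M" "0 \<le> K" and le: "\<And>f g. (f, g) \<in> Hmax ==>
  \<phi> f g \<le> \<epsilon> / (c + 1) * (nrm f + nrm g) + K * ?S E f g" by (rule form_compactE[OF assms(1) e]) blast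
 have "form_bounded (%f g. c * \<phi> f g) \<epsilon> E (c * K)"
 proof (rule form_boundedI[OF E(1,2)])
  fix f g assume that: "(f, g) \<in> Hmax"
  have "c * (\<epsilon> / (c + 1)) \<le> \<epsilon>" using \<open>\<epsilon> > 0\<close> assms(2) by (simp add: field_simps)
  then have "c * (\<epsilon> / (c + 1)) * (nrm f + nrm g) \<le> \<epsilon> * (nrm f + nrm g)"
   by (rule mult_right_mono) simp
  then show "c * \<phi> f g \<le> \<epsilon> * (nrm f + nrm g) + (c * K) * ?S E f g"
   using mult_left_mono[OF le[OF that] assms(2)] by (simp add: distrib_left mult.assoc)
 qed
 then show "\<exists>E K. form_bounded (%f g. c * \<phi> f g) \<epsilon> E K" by blast
qed

lemma form_compact_inner:
 assumes "e \<in> L2 M"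
 shows "form_compact (%f g. cmod (ip f e))" "form_compact (%f g. cmod (ip g e))"
 unfolding form_compact_def
 by (intro allI impI exI[of _ "{e}"] exI[of _ 1] form_boundedI, use assms in "simp_all add: add_increasing")+

lemma form_compact_sum: "finite A ==> (\<And>i. i \<in> A ==> form_compact (\<phi> i)) ==> form_compact (%f g. \<Sum>i\<in>A. \<phi> i f g)"
proof (induction A rule: finite_induct)
 case empty
 show ?case by (rule form_compact_mono[OF form_compact_inner(1)[OF L2_zero]]) simp
next
 case (insert a A)
 then show ?case by (simp add: form_compact_add)
qed

section \<open>Compactness on compact subintervals\<close>

lemma weighted_cut_norm_le:
 assumes g: "g \<in> L2 M" and R: "R \<in> I"
 shows "nrm (cut 0 R (weighted g)) \<le> Pbound R * nrm g"
proof -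
 have "nrm (cut 0 R (weighted g)) \<le> nrm (%t. of_real (Pbound R) * g t)"
 proof (rule L2_norm_mono_AE[OF cut_weighted_L2[OF g R] L2_cmult[OF g]], rule AE_I2)
  fix t
  show "cmod (cut 0 R (weighted g) t) \<le> cmod (of_real (Pbound R) * g t)"
   using P_bound[of t R] Pbound_nonneg[OF R] R
   by (auto simp: cut_def weighted_def norm_mult intro: mult_right_mono)
 qed
 then show ?thesis using Pbound_nonneg[OF R] by (simp add: L2_norm_cmult)
qed

text \<open>\<open>volterra g\<close> jumps with \<open>P\<close>, so it cannot be compared with its
  own values on a grid. Its ingredients can: \<open>prim b g\<close> and
  \<open>prim b (weighted g)\<close> are Hoelder continuous of order 1/2, while \<open>P t\<close>
  is kept as a bounded factor. The values at the finitely many grid points are functionals of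
  \<open>g\<close>.\<close>

lemma volterra_form_compact:
 assumes r: "r \<in> I" "0 < r" and e: "\<epsilon> > 0"
 obtains \<psi> where "form_compact \<psi>" "\<And>f g t. (f, g) \<in> Hmax ==> 0 \<le> t ==> t \<le> r ==> cmod (volterra g t) \<le> \<epsilon> * nrm g + \<psi> f g"
proof -
 define B where "B = Pbound r"
 have B: "0 \<le> B" unfolding B_def by (rule Pbound_nonneg[OF r(1)])
 have "(%n. 2 * B * sqrt (r / real (Suc n))) \<longlonglongrightarrow> 2 * B * sqrt 0"
  by (intro tendsto_intros LIMSEQ_Suc[OF lim_const_over_n])
 then have "\<forall>\<^sub>F n in sequentially. 2 * B * sqrt (r / real (Suc n)) < \<epsilon>" using e by (intro order_tendstoD(2)) auto
 \<comment> \<open>The mesh \<open>r / real (Suc n)\<close> is small enough for the two Hoelder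
   errors, each of which is \<open>B * nrm g\<close> times the root of the mesh.\<close>
 then obtain n where n: "2 * B * sqrt (r / real (Suc n)) < \<epsilon>" by (auto simp: eventually_sequentially)
 define \<eta> where "\<eta> = r / real (Suc n)"
 have \<eta>: "0 < \<eta>" "\<eta> * real (Suc n) = r" using r(2) by (simp_all add: \<eta>_def)
 define q where "q i = real i * \<eta>" for i :: nat
 define \<psi> where "\<psi> f g = (\<Sum>i\<le>Suc n. B * cmod (prim b g (q i)) + cmod (prim b (weighted g) (q i)))" for f g :: "real \<Rightarrow> complex"
 have q: "0 \<le> q i" "q i \<in> I" if "i \<le> Suc n" for i
 proof -
  have "q i \<le> r" unfolding q_def \<eta>(2)[symmetric] using that \<eta>(1) by (simp add: mult.commute)
  then show "q i \<in> I" "0 \<le> q i" using r(1) \<eta>(1) by (auto simp: q_def intro: Ivl_downward)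
 qed
 have "form_compact \<psi>"
  unfolding \<psi>_def prim_weighted_inner unfolding prim_inner
  by (intro form_compact_sum form_compact_add form_compact_cmult form_compact_inner B)
   (auto intro: q window_L2 weighted_window_L2)
 moreover have "cmod (volterra g t) \<le> \<epsilon> * nrm g + \<psi> f g" if fg: "(f, g) \<in> Hmax" and t: "0 \<le> t" "t \<le> r" for f g t
 proof -
  have g: "g \<in> L2 M" using fg by (rule HmaxE)
  define i where "i = nat \<lfloor>t / \<eta>\<rfloor>"
  have "real i = of_int \<lfloor>t / \<eta>\<rfloor>" using t \<eta> by (simp add: i_def)
  then have "real i \<le> t / \<eta>" "t / \<eta> < real i + 1" by linarith+
  then have it: "q i \<le> t" "t - q i \<le> \<eta>" using \<eta>(1) by (simp_all add: q_def field_simps)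
  have "real i * \<eta> \<le> real (Suc n) * \<eta>" using it(1) t(2) \<eta>(2) by (simp add: q_def mult.commute)
  then have i: "i \<le> Suc n" using \<eta>(1) by simp
  have tI: "t \<in> I" using t r(1) by (auto intro: Ivl_downward)
  have Pt: "\<bar>P t\<bar> \<le> B" unfolding B_def by (rule P_bound[OF t r(1)])
  have s: "sqrt (t - q i) \<le> sqrt \<eta>" using it(2) by simp
  have "cmod (prim b g t - prim b g (q i)) \<le> sqrt (t - q i) * nrm (cut (q i) t g)"
   by (rule prim_Holder[OF g q(1)[OF i] it(1) tI])
  also have "... \<le> sqrt \<eta> * nrm g" by (intro mult_mono s L2_norm_cut_le g) (use it \<eta> in auto)
  finally have G: "cmod (prim b g t) \<le> sqrt \<eta> * nrm g + cmod (prim b g (q i))"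
   using norm_triangle_sub[of "prim b g t" "prim b g (q i)"] by linarith
  let ?w = "cut 0 r (weighted g)"
  have w: "?w \<in> L2 M" by (rule cut_weighted_L2[OF g r(1)])
  have "cmod (prim b ?w t - prim b ?w (q i)) \<le> sqrt (t - q i) * nrm (cut (q i) t ?w)"
   by (rule prim_Holder[OF w q(1)[OF i] it(1) tI])
  also have "... \<le> sqrt \<eta> * (B * nrm g)"
   by (intro mult_mono s order_trans[OF L2_norm_cut_le[OF w]] weighted_cut_norm_le[OF g r(1), folded B_def]) (use it \<eta> in auto)
  finally have Y: "cmod (prim b (weighted g) t) \<le> sqrt \<eta> * (B * nrm g) + cmod (prim b (weighted g) (q i))"
   using norm_triangle_sub[of "prim b (weighted g) t" "prim b (weighted g) (q i)"] prim_cut[OF t(2), of b "weighted g"]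
    prim_cut[of "q i" r b "weighted g"] it(1) t(2) by simp
  have "cmod (volterra g t) \<le> \<bar>P t\<bar> * cmod (prim b g t) + cmod (prim b (weighted g) t)"
   unfolding volterra_def by (rule order_trans[OF norm_triangle_ineq4]) (simp add: norm_mult)
  also have "... \<le> B * (sqrt \<eta> * nrm g + cmod (prim b g (q i))) + (sqrt \<eta> * (B * nrm g) + cmod (prim b (weighted g) (q i)))"
   by (intro add_mono Y mult_mono Pt G) (use B in auto)
  also have "... = (2 * B * sqrt \<eta>) * nrm g + (B * cmod (prim b g (q i)) + cmod (prim b (weighted g) (q i)))"
   by (simp add: algebra_simps)
  also have "... \<le> \<epsilon> * nrm g + \<psi> f g"
  proof (rule add_mono)
   show "(2 * B * sqrt \<eta>) * nrm g \<le> \<epsilon> * nrm g"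
    by (rule mult_right_mono[OF less_imp_le[OF n[folded \<eta>_def]]]) simp
   show "B * cmod (prim b g (q i)) + cmod (prim b (weighted g) (q i)) \<le> \<psi> f g"
    unfolding \<psi>_def by (rule member_le_sum) (use i B in auto)
  qed
  finally show ?thesis .
 qed
 ultimately show thesis by (rule that)
qed

text \<open>Averaging \<open>f = c - volterra g\<close> over \<open>[0, x 1)\<close> expresses
  \<open>c\<close> through one functional of \<open>f\<close> and an integral of
  \<open>volterra g\<close>, which is uniformly controlled there.\<close>

lemma constant_form_compact:
 assumes e: "\<epsilon> > 0"
 obtains \<psi> where "form_compact \<psi>" "\<And>f g c. (f, g) \<in> Hmax ==> (AE t in M. f t = c - volterra g t) ==> cmod c \<le> \<epsilon> * nrm g + \<psi> f g"
proof -
 define r where "r = x 1"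
 have r: "r \<in> I" "0 < r" using x_in_I[of 1] x_pos[of 1] by (simp_all add: r_def)
 obtain \<psi> where \<psi>: "form_compact \<psi>" "\<And>f g t. (f, g) \<in> Hmax ==> 0 \<le> t ==> t \<le> r ==> cmod (volterra g t) \<le> \<epsilon> * nrm g + \<psi> f g"
  by (rule volterra_form_compact[OF r e]) blast
 let ?w = "cut 0 r (%_. 1) :: real \<Rightarrow> complex"
 have w: "?w \<in> L2 M" "nrm ?w = sqrt r" using window_L2[OF order_refl less_imp_le[OF r(2)] r(1)] by simp_all
 show thesis
 proof (rule that)
  show "form_compact (%f g. 1 / r * cmod (ip f ?w) + \<psi> f g)"
   by (intro form_compact_add form_compact_cmult form_compact_inner \<psi>(1) w) (use r in simp)
  fix f g c assume fg: "(f, g) \<in> Hmax" and c: "AE t in M. f t = c - volterra g t"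
  have f: "f \<in> L2 M" and g: "g \<in> L2 M" using fg by (auto elim: HmaxE)
  have V: "cut 0 r (volterra g) \<in> L2 M" by (rule volterra_cut_L2[OF g r(1)])
  define C where "C = \<epsilon> * nrm g + \<psi> f g"
  have C: "cmod (volterra g t) \<le> C" if "0 \<le> t" "t \<le> r" for t unfolding C_def by (rule \<psi>(2)[OF fg that])
  have C0: "0 \<le> C" using C[of 0] r by simp
  have "ip (%t. c * ?w t) ?w = ip (%t. cut 0 r f t + cut 0 r (volterra g) t) ?w"
  proof (rule L2_inner_cong_AE(1))
   show "AE t in M. c * ?w t = cut 0 r f t + cut 0 r (volterra g) t"
    using c by eventually_elim (simp add: cut_def)
  qed (auto intro!: L2_measurable L2_add V cut_L2 f L2_cmult w)
  moreover have ww: "cut 0 r ?w = ?w" by (rule ext) (simp add: cut_def)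
  ultimately have "c * of_real r = ip f ?w + ip (cut 0 r (volterra g)) ?w"
   unfolding L2_inner_cmult_left L2_inner_add_left[OF cut_L2[OF f] V w(1)] inner_cut[of M 0 r f] ww L2_inner_self w(2)
   using r by simp
  then have "cmod (c * of_real r) = cmod (ip f ?w + ip (cut 0 r (volterra g)) ?w)"
   by (rule arg_cong)
  then have "cmod c * r = cmod (ip f ?w + ip (cut 0 r (volterra g)) ?w)"
   using r(2) by (simp only: norm_mult norm_of_real abs_of_pos)
  also have "... \<le> cmod (ip f ?w) + nrm (cut 0 r (volterra g)) * sqrt r"
   by (rule order_trans[OF norm_triangle_ineq add_left_mono]) (use L2_Cauchy_Schwarz[OF V w(1)] w(2) in simp)
  also have "... \<le> cmod (ip f ?w) + (C * sqrt (r - 0)) * sqrt r"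
   by (intro add_left_mono mult_right_mono cut_bounded_L2(2)[OF order_refl less_imp_le[OF r(2)] r(1) volterra_measurable[OF g] C C0]) (use r in auto)
  also have "(C * sqrt (r - 0)) * sqrt r = C * r" using r by simp
  finally have "cmod c \<le> (cmod (ip f ?w) + C * r) / r" using r(2) by (simp only: pos_le_divide_eq)
  also have "... = \<epsilon> * nrm g + (1 / r * cmod (ip f ?w) + \<psi> f g)"
   using r(2) by (simp add: C_def field_simps)
  finally show "cmod c \<le> \<epsilon> * nrm g + (1 / r * cmod (ip f ?w) + \<psi> f g)" .
 qed
qed

lemma cut_form_compact:
 assumes r: "r \<in> I" "0 < r"
 shows "form_compact (%f g. nrm (cut 0 r f))"
proof (rule form_compactI)
 fix \<epsilon> :: real assume "\<epsilon> > 0"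
 then have e: "\<epsilon> / (2 * sqrt r) > 0" using r by simp
 obtain \<psi> where \<psi>: "form_compact \<psi>" "\<And>f g t. (f, g) \<in> Hmax ==> 0 \<le> t ==> t \<le> r ==> cmod (volterra g t) \<le> \<epsilon> / (2 * sqrt r) * nrm g + \<psi> f g"
  by (rule volterra_form_compact[OF r e]) blast
 obtain \<theta> where \<theta>: "form_compact \<theta>" "\<And>f g c. (f, g) \<in> Hmax ==> (AE t in M. f t = c - volterra g t) ==> cmod c \<le> \<epsilon> / (2 * sqrt r) * nrm g + \<theta> f g"
  by (rule constant_form_compact[OF e]) blast
 show "\<exists>\<psi>. form_compact \<psi> \<and> (\<forall>f g. (f, g) \<in> Hmax --> nrm (cut 0 r f) \<le> \<epsilon> * (nrm f + nrm g) + \<psi> f g)"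
 proof (intro exI conjI allI impI)
  show "form_compact (%f g. sqrt r * (\<theta> f g + \<psi> f g))"
   by (intro form_compact_cmult form_compact_add \<psi>(1) \<theta>(1)) (use r in simp)
  fix f g assume fg: "(f, g) \<in> Hmax"
  obtain c where f: "f \<in> L2 M" and g: "g \<in> L2 M" and c: "AE t in M. f t = c - volterra g t" using fg by (rule HmaxE)
  define N where "N = \<epsilon> / (2 * sqrt r) * nrm g"
  define C where "C = (N + \<theta> f g) + (N + \<psi> f g)"
  have le: "cmod (c - volterra g t) \<le> C" if "0 \<le> t" "t < r" for t
   unfolding C_def N_def
   by (rule order_trans[OF norm_triangle_ineq4 add_mono[OF \<theta>(2)[OF fg c] \<psi>(2)[OF fg]]]) (use that in auto)
  have C0: "0 \<le> C" using le[of 0] r norm_ge_zero order_trans by blast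
  have m: "(%t. c - volterra g t) \<in> borel_measurable M" using volterra_measurable[OF g] by simp
  have "nrm (cut 0 r f) = nrm (cut 0 r (%t. c - volterra g t))"
  proof (rule L2_norm_cong_AE)
   show "AE t in M. cut 0 r f t = cut 0 r (%t. c - volterra g t) t" using c by eventually_elim (simp add: cut_def)
  qed (rule cut_measurable[OF L2_measurable[OF f]], rule cut_measurable[OF m])
  also have "... \<le> C * sqrt (r - 0)"
   by (rule cut_bounded_L2(2)[OF order_refl less_imp_le[OF r(2)] r(1) m le C0])
  also have "... = \<epsilon> * nrm g + sqrt r * (\<theta> f g + \<psi> f g)"
   using r by (simp add: C_def N_def field_simps)
  also have "... \<le> \<epsilon> * (nrm f + nrm g) + sqrt r * (\<theta> f g + \<psi> f g)"
   using \<open>\<epsilon> > 0\<close> by (simp add: distrib_left)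
  finally show "nrm (cut 0 r f) \<le> \<epsilon> * (nrm f + nrm g) + sqrt r * (\<theta> f g + \<psi> f g)" .
 qed
qed

section \<open>Reduction to the behaviour near \<open>b\<close>\<close>

definition tail :: "real \<Rightarrow> (real \<Rightarrow> complex) \<Rightarrow> real \<Rightarrow> complex" where
 "tail r f = (%t. if r \<le> t then f t else 0)"

lemma tail_measurable: "f \<in> borel_measurable M ==> tail r f \<in> borel_measurable M"
proof -
 have "{t \<in> space M. r \<le> t} = space M - {t \<in> I. t < r}" by auto
 then have *: "{t \<in> space M. r \<le> t} \<in> sets M" using sets.Diff[OF sets.top sets_Ivl_measure_conv(1)] by simp
 show "f \<in> borel_measurable M ==> tail r f \<in> borel_measurable M"
  unfolding tail_def by (rule measurable_If[OF _ _ *]) simp_all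
qed

lemma tail_L2: "f \<in> L2 M ==> tail r f \<in> L2 M"
 by (rule L2_bound[OF tail_measurable[OF L2_measurable] L2_integrable_sq]) (auto simp: tail_def)

text \<open>On \<open>[0, r)\<close> compactness is automatic, so it suffices to make the norm
  beyond some \<open>r\<close>, which may depend on \<open>\<epsilon>\<close>, small up to a compact
  quantity.\<close>

lemma discrete_spectrum_of_tails:
 assumes sa: "Hamiltonian b x \<beta> = Hmax"
  and tails: "\<And>\<epsilon>. \<epsilon> > 0 ==> \<exists>r\<in>I. 0 < r \<and> (\<exists>\<psi>. form_compact \<psi> \<and> (\<forall>f g. (f, g) \<in> Hmax --> nrm (tail r f) \<le> \<epsilon> * nrm g + \<psi> f g))"
 shows "has_discrete_spectrum M Hmax"
proof -
 interpret selfadjoint_graph M Hmax by (rule selfadjoint_graph_Hmax[OF sa])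
 have "form_compact (%f g. nrm f)"
 proof (rule form_compactI)
  fix \<epsilon> :: real assume e: "\<epsilon> > 0"
  obtain r \<psi> where r: "r \<in> I" "0 < r" and \<psi>: "form_compact \<psi>" "\<And>f g. (f, g) \<in> Hmax ==> nrm (tail r f) \<le> \<epsilon> * nrm g + \<psi> f g"
   using tails[OF e] by blast
  show "\<exists>\<psi>. form_compact \<psi> \<and> (\<forall>f g. (f, g) \<in> Hmax --> nrm f \<le> \<epsilon> * (nrm f + nrm g) + \<psi> f g)"
  proof (intro exI conjI allI impI)
   show "form_compact (%f g. nrm (cut 0 r f) + \<psi> f g)" by (intro form_compact_add cut_form_compact r \<psi>(1))
   fix f g assume fg: "(f, g) \<in> Hmax"
   have f: "f \<in> L2 M" using fg by (rule HmaxE)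
   have "nrm f = nrm (%t. cut 0 r f t + tail r f t)"
    unfolding L2_norm_def by (rule arg_cong[where f=sqrt], rule Bochner_Integration.integral_cong) (auto simp: cut_def tail_def Ivl_def)
   also have "... \<le> nrm (cut 0 r f) + nrm (tail r f)" by (rule L2_norm_triangle[OF cut_L2[OF f] tail_L2[OF f]])
   also have "... \<le> \<epsilon> * (nrm f + nrm g) + (nrm (cut 0 r f) + \<psi> f g)"
   proof -
    have "0 \<le> \<epsilon> * nrm f" using e by simp
    then show ?thesis using \<psi>(2)[OF fg] by (simp only: distrib_left)
   qed
   finally show "nrm f \<le> \<epsilon> * (nrm f + nrm g) + (nrm (cut 0 r f) + \<psi> f g)" .
  qed
 qed
 then show ?thesis by (intro discrete_spectrumI) (simp add: form_compact_def form_bounded_def finite_rank_approximable_def)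
qed

lemma P_eq_partial_sum:
 assumes "x n \<le> t" "t < x (Suc n)"
 shows "P t = (t - x n) + (\<Sum>j=1..n. \<beta> j + gap x j)"
proof -
 have "(\<Sum>j=1..n. gap x j) = x n"
  by (induction n) (simp_all add: gap_def x0)
 then show ?thesis using P_eq[OF assms] by (simp add: sum.distrib)
qed

text \<open>The last hypothesis is the shape that both cases produce: a weight times an integral of
  \<open>g\<close> over one side, plus the integral of the weight times \<open>g\<close> over the
  other side.\<close>

lemma tail_Hardy:
 assumes rel: "Measurable.pred (M \<Otimes>\<^sub>M M) (%z. \<rho> (fst z) (snd z))"
  and mw: "\<omega> \<in> borel_measurable M" and mq: "q \<in> borel_measurable M" and g: "g \<in> L2 M" and F: "F \<in> borel_measurable M"
  and pos: "AE t in M. 0 < \<omega> t" and AB: "0 \<le> A" "0 \<le> B"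
  and hA: "AE t in M. (\<integral>\<^sup>+s. (if \<rho> s t then ennreal (1 / \<omega> s) else 0) \<partial>M) \<le> ennreal (A * \<omega> t)"
  and hB: "AE s in M. (\<integral>\<^sup>+t. (if \<rho> s t then ennreal (\<omega> t * (q t)^2) else 0) \<partial>M) \<le> ennreal (B / \<omega> s)"
  and h: "AE t in M. ennreal (cmod (F t)) \<le> ennreal \<bar>q t\<bar> * (\<integral>\<^sup>+s. (if \<rho> s t then ennreal (cmod (g s)) else 0) \<partial>M)
   + (\<integral>\<^sup>+s. (if \<rho> t s then ennreal (\<bar>q s\<bar> * cmod (g s)) else 0) \<partial>M)"
 shows "F \<in> L2 M" "nrm F \<le> 2 * sqrt (A * B) * nrm g"
proof -
 interpret sigma_finite_measure M by (rule sigma_finite_lebesgue_on) simp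
 interpret triangle M \<rho> by (unfold_locales) (rule rel)
 have "(\<integral>\<^sup>+t. ennreal ((cmod (F t))^2) \<partial>M) \<le> ennreal (4 * (A * B)) * (\<integral>\<^sup>+t. ennreal ((cmod (g t))^2) \<partial>M)"
 proof (rule Hardy_sum[OF mw mq _ pos AB hA hB])
  show "(%t. cmod (g t)) \<in> borel_measurable M" using L2_measurable[OF g] by simp
  show "AE t in M. ennreal (cmod (F t)) \<le> ennreal \<bar>q t\<bar> * (\<integral>\<^sup>+s. (if \<rho> s t then ennreal \<bar>cmod (g s)\<bar> else 0) \<partial>M)
   + (\<integral>\<^sup>+s. (if \<rho> t s then ennreal \<bar>q s * cmod (g s)\<bar> else 0) \<partial>M)"
   unfolding abs_mult abs_norm_cancel by (rule h)
 qed (rule norm_ge_zero)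
 also have "... = ennreal (4 * (A * B) * (nrm g)^2)"
  unfolding nn_integral_L2_norm[OF g] using AB by (simp add: ennreal_mult)
 finally have le: "(\<integral>\<^sup>+t. ennreal ((cmod (F t))^2) \<partial>M) \<le> ennreal (4 * (A * B) * (nrm g)^2)" .
 show "F \<in> L2 M" by (rule L2_nnI(1)[OF F le])
 have "(nrm F)^2 \<le> 4 * (A * B) * (nrm g)^2" by (rule L2_nnI(2)[OF F le]) (use AB in simp)
 also have "... = (2 * sqrt (A * B) * nrm g)^2" using AB by (simp add: power_mult_distrib)
 finally show "nrm F \<le> 2 * sqrt (A * B) * nrm g" by (rule power2_le_imp_le) (use AB in simp)
qed

lemma pred_le_Ivl: "Measurable.pred (M \<Otimes>\<^sub>M M) (%z. fst z \<le> snd z)" "Measurable.pred (M \<Otimes>\<^sub>M M) (%z. snd z \<le> fst z)"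
proof -
 have 1: "(%z. fst z) \<in> borel_measurable (M \<Otimes>\<^sub>M M)" "(%z. snd z) \<in> borel_measurable (M \<Otimes>\<^sub>M M)"
  by (rule measurable_compose[OF measurable_fst id_borel_measurable_Ivl], rule measurable_compose[OF measurable_snd id_borel_measurable_Ivl])
 show "Measurable.pred (M \<Otimes>\<^sub>M M) (%z. fst z \<le> snd z)" "Measurable.pred (M \<Otimes>\<^sub>M M) (%z. snd z \<le> fst z)"
  unfolding not_less[symmetric] by (intro pred_intros_logic borel_measurable_pred_less 1)+
qed

section \<open>Bounded intervals: sufficiency\<close>

context
 fixes B :: real
 assumes bB: "b = ereal B" and sa: "Hamiltonian b x \<beta> = Hmax"
begin

lemma Ivl_bounded: "I = {0..<B}" and B_pos: "0 < B"
 using bB zero_in_I by (auto simp: Ivl_def)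

lemma one_L2: "(%_. 1) \<in> L2 M"
proof -
 have "emeasure lebesgue {0..<B} < \<infinity>" using B_pos by simp
 then have "emeasure M (space M) < \<infinity>" unfolding Ivl_bounded by (subst emeasure_restrict_space) auto
 then have "finite_measure M" by (intro finite_measureI) auto
 then show ?thesis unfolding L2_def by (simp add: finite_measure.integrable_const)
qed

lemma volterra_zero: "volterra (%_. 0) t = 0"
 by (simp add: volterra_def weighted_def prim_inner)

lemma one_kernel: "((%_. c), (%_. 0)) \<in> Hmax"
proof (rule HmaxI)
 show "(%_. c) \<in> L2 M" using L2_cmult[OF one_L2, of c] by simp
 show "AE t in M. c = c - volterra (%_. 0) t" by (simp add: volterra_zero)
qed simp

lemma range_orthogonal_one:
 assumes "(f, g) \<in> Hmax" shows "ip g (%_. 1) = 0"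
proof -
 interpret selfadjoint_graph M Hmax by (rule selfadjoint_graph_Hmax[OF sa])
 show ?thesis using T_symmetric[OF one_kernel assms] by simp
qed

text \<open>Near \<open>B\<close> the large factor \<open>P\<close> must multiply a short integral.
  Since constants lie in the kernel, \<open>g\<close> has mean zero, and the primitive from
  \<open>0\<close> is minus the integral over \<open>[t, B)\<close>.\<close>

lemma prim_tail:
 assumes fg: "(f, g) \<in> Hmax" and t: "t \<in> I"
 shows "prim b g t = - ip g (tail t (%_. 1))"
proof -
 have g: "g \<in> L2 M" using fg by (rule HmaxE)
 have w: "cut 0 t (%_. 1) \<in> L2 M" "tail t (%_. 1) \<in> L2 M"
  by (rule cut_L2[OF one_L2], rule tail_L2[OF one_L2])
 have "ip g (%_. 1) = ip g (%s. cut 0 t (%_. 1) s + tail t (%_. 1) s)"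
  unfolding L2_inner_def by (rule Bochner_Integration.integral_cong) (auto simp: cut_def tail_def Ivl_def)
 then show ?thesis
  unfolding prim_inner range_orthogonal_one[OF fg] L2_inner_add_right[OF w g] by (simp add: eq_neg_iff_add_eq_0)
qed

text \<open>The hypothesis speaks of nodes only. Inside a cell \<open>P\<close> differs from its
  value at the left node by \<open>t - x n\<close>, and both this and \<open>B - t\<close> are at
  most \<open>B - x n\<close>; the additional error \<open>(B - x n)^2\<close> tends to
  zero.\<close>

lemma P_small:
 assumes lim: "(%n. (B - x n) * (\<Sum>j=1..n. (\<beta> j + gap x j))) \<longlonglongrightarrow> 0" and e: "\<epsilon> > 0"
 obtains r where "r \<in> I" "0 < r" "\<And>t. r \<le> t ==> t < B ==> \<bar>P t\<bar> \<le> \<epsilon> / (B - t)"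
proof -
 let ?S = "%n. \<Sum>j=1..n. (\<beta> j + gap x j)"
 have xB: "x \<longlonglongrightarrow> B" using x_lim bB by simp
 have "(%n. (B - x n)^2 + \<bar>(B - x n) * ?S n\<bar>) \<longlonglongrightarrow> (B - B)^2 + \<bar>0\<bar>"
  by (intro tendsto_intros xB lim)
 then have "\<forall>\<^sub>F n in sequentially. (B - x n)^2 + \<bar>(B - x n) * ?S n\<bar> < \<epsilon>" using e by (intro order_tendstoD(2)) auto
 then obtain N where N: "\<And>n. N \<le> n ==> (B - x n)^2 + \<bar>(B - x n) * ?S n\<bar> < \<epsilon>" by (auto simp: eventually_sequentially)
 show thesis
 proof (rule that)
  show "x (Suc N) \<in> I" "0 < x (Suc N)" by (simp_all add: x_in_I x_pos)
  fix t assume t: "x (Suc N) \<le> t" "t < B"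
  have tI: "t \<in> I" using t x_nonneg[of "Suc N"] unfolding Ivl_bounded by simp
  obtain n where n: "x n \<le> t" "t < x (Suc n)" using tI by (rule interval_obtain)
  have "N \<le> n" using le_less_trans[OF t(1) n(2)] by simp
  have "\<bar>P t\<bar> * (B - t) \<le> ((t - x n) + \<bar>?S n\<bar>) * (B - x n)"
   unfolding P_eq_partial_sum[OF n] using n t by (intro mult_mono) auto
  also have "... \<le> ((B - x n) + \<bar>?S n\<bar>) * (B - x n)" using n t by (intro mult_right_mono) auto
  also have "... = (B - x n)^2 + \<bar>(B - x n) * ?S n\<bar>"
  proof -
   have "\<bar>(B - x n) * ?S n\<bar> = (B - x n) * \<bar>?S n\<bar>" using n t by (simp only: abs_mult)
   then show ?thesis by (simp only: power2_eq_square distrib_left mult.commute)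
  qed
  also have "... \<le> \<epsilon>" using N[OF \<open>N \<le> n\<close>] by simp
  finally show "\<bar>P t\<bar> \<le> \<epsilon> / (B - t)" using t by (simp add: pos_le_divide_eq)
 qed
qed

text \<open>Beyond \<open>r\<close>, \<open>f\<close> minus a constant is \<open>P(t)\<close> times
  the integral of \<open>g\<close> over \<open>[t, B)\<close> plus the integral of
  \<open>P g\<close> over \<open>[r, t)\<close>: a Hardy operator and its dual with the same weight.
  The constant is square integrable on a bounded interval and is estimated by itself.\<close>

lemma bounded_tail:
 assumes r: "r \<in> I" and e: "\<epsilon> > 0" and P: "\<And>t. r \<le> t ==> t < B ==> \<bar>P t\<bar> \<le> \<epsilon> / (B - t)"
  and fg: "(f, g) \<in> Hmax" and c: "AE t in M. f t = c - volterra g t"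
 shows "nrm (tail r f) \<le> nrm (%_. 1) * (cmod c + cmod (prim b (weighted g) r)) + 4 * \<epsilon> * nrm g"
proof -
 have f: "f \<in> L2 M" and g: "g \<in> L2 M" using fg by (auto elim: HmaxE)
 \<comment> \<open>Moving the base point of the weighted primitive from \<open>0\<close> to
   \<open>r\<close> leaves its value at \<open>r\<close> in the constant.\<close>
 define \<kappa> where "\<kappa> = c + prim b (weighted g) r"
 define q where "q t = (if r \<le> t then P t else 0)" for t
 define F where "F = tail r (%t. f t - \<kappa>)"
 have r0: "0 \<le> r" using r by (rule Ivl_nonneg)
 have q: "q \<in> borel_measurable M"
 proof -
  have "(%t. Re (tail r (%t. of_real (P t)) t)) \<in> borel_measurable M"
   by (rule borel_measurable_continuous_on[where f=Re]) (intro continuous_intros, rule tail_measurable, rule borel_measurable_continuous_on[where f=of_real, OF _ P_measurable], intro continuous_intros)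
  then show ?thesis by (rule measurable_cong[THEN iffD1, rotated]) (simp add: q_def tail_def)
 qed
 have fk: "(%t. f t - \<kappa>) \<in> L2 M" using L2_diff[OF f L2_cmult[OF one_L2, of \<kappa>]] by simp
 have F: "F \<in> L2 M" unfolding F_def by (rule tail_L2[OF fk])
 \<comment> \<open>The weight \<open>sqrt (B - t)\<close> balances the two conditions: the integral
   of its reciprocal over \<open>[t, B)\<close> is twice the weight, and with
   \<open>\<bar>P t\<bar> \<le> \<epsilon> / (B - t)\<close> the integral of the weight times
   \<open>P^2\<close> up to \<open>s\<close> is at most \<open>2 * \<epsilon>^2\<close> divided by
   the weight at \<open>s\<close>.\<close>
 have main: "nrm F \<le> 2 * sqrt (2 * (2 * \<epsilon>^2)) * nrm g"
 proof (rule tail_Hardy(2)[where \<rho>="%s t. t \<le> s" and \<omega>="%t. sqrt (B - t)" and q=q])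
  show "(%t. sqrt (B - t)) \<in> borel_measurable M"
   by (rule borel_measurable_continuous_on[where f="%t. sqrt (B - t)", OF _ id_borel_measurable_Ivl]) (intro continuous_intros)
  show "AE t in M. 0 < sqrt (B - t)" by (rule AE_I2) (simp add: Ivl_bounded)
  show "AE t in M. (\<integral>\<^sup>+s. (if t \<le> s then ennreal (1 / sqrt (B - s)) else 0) \<partial>M) \<le> ennreal (2 * sqrt (B - t))"
  proof (rule AE_I2)
   fix t assume "t \<in> space M"
   then have t: "0 \<le> t" "t < B" by (simp_all add: Ivl_bounded)
   have "(\<integral>\<^sup>+s. (if t \<le> s then ennreal (1 / sqrt (B - s)) else 0) \<partial>M) = (\<integral>\<^sup>+s. (if t \<le> s \<and> s \<le> B then ennreal (1 / sqrt (B - s)) else 0) \<partial>M)"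
    by (rule nn_integral_cong) (simp add: Ivl_bounded)
   also have "... \<le> ennreal ((- 2 * sqrt (B - B)) - (- 2 * sqrt (B - t)))"
   proof (rule nn_integral_Ivl_FTC_le)
    show "((%s. - 2 * sqrt (B - s)) has_real_derivative 1 / sqrt (B - s)) (at s)" if "s < B" for s
     using that by (auto intro!: derivative_eq_intros simp: field_simps)
   qed (use t in "auto intro!: continuous_intros")
   finally show "(\<integral>\<^sup>+s. (if t \<le> s then ennreal (1 / sqrt (B - s)) else 0) \<partial>M) \<le> ennreal (2 * sqrt (B - t))" by simp
  qed
  show "AE s in M. (\<integral>\<^sup>+t. (if t \<le> s then ennreal (sqrt (B - t) * (q t)^2) else 0) \<partial>M) \<le> ennreal (2 * \<epsilon>^2 / sqrt (B - s))"
  proof (rule AE_I2)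
   fix s assume "s \<in> space M"
   then have s: "0 \<le> s" "s < B" by (simp_all add: Ivl_bounded)
   have "(\<integral>\<^sup>+t. (if t \<le> s then ennreal (sqrt (B - t) * (q t)^2) else 0) \<partial>M)
     \<le> (\<integral>\<^sup>+t. (if 0 \<le> t \<and> t \<le> s then ennreal (\<epsilon>^2 / ((B - t) * sqrt (B - t))) else 0) \<partial>M)"
   proof (rule nn_integral_mono)
    fix t assume "t \<in> space M"
    then have t: "0 \<le> t" "t < B" by (simp_all add: Ivl_bounded)
    have "\<bar>q t\<bar> \<le> \<epsilon> / (B - t)" using P[of t] t e by (simp add: q_def)
    then have "\<bar>q t\<bar>^2 \<le> (\<epsilon> / (B - t))^2" by (rule power_mono) simp
    then have "sqrt (B - t) * (q t)^2 \<le> sqrt (B - t) * (\<epsilon> / (B - t))^2" using t by (intro mult_left_mono) simp_all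
    also have "... = sqrt (B - t) * \<epsilon>^2 / ((B - t) * (sqrt (B - t) * sqrt (B - t)))"
     using t by (simp add: power_divide power2_eq_square)
    also have "... = \<epsilon>^2 / ((B - t) * sqrt (B - t))"
    proof -
     have "y * a / (w * (y * y)) = a / (w * y)" if "0 < y" for y a w :: real using that by simp
     from this[of "sqrt (B - t)" "\<epsilon>^2" "B - t"] show ?thesis using t by (simp only: real_sqrt_gt_0_iff diff_gt_0_iff_gt)
    qed
    finally show "(if t \<le> s then ennreal (sqrt (B - t) * (q t)^2) else 0)
      \<le> (if 0 \<le> t \<and> t \<le> s then ennreal (\<epsilon>^2 / ((B - t) * sqrt (B - t))) else 0)"
     using t by (simp add: ennreal_leI)
   qed
   also have "... \<le> ennreal (2 * \<epsilon>^2 / sqrt (B - s) - 2 * \<epsilon>^2 / sqrt (B - 0))"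
   proof (rule nn_integral_Ivl_FTC_le)
    show "((%t. 2 * \<epsilon>^2 / sqrt (B - t)) has_real_derivative \<epsilon>^2 / ((B - t) * sqrt (B - t))) (at t)" if "t < s" for t
    proof -
     have "((%t. sqrt (B - t)) has_real_derivative - (1 / (2 * sqrt (B - t)))) (at t)"
      using that s by (auto intro!: derivative_eq_intros simp: field_simps)
     then have "((%t. 2 * \<epsilon>^2 / sqrt (B - t)) has_real_derivative
       (0 * sqrt (B - t) - 2 * \<epsilon>^2 * - (1 / (2 * sqrt (B - t)))) / (sqrt (B - t) * sqrt (B - t))) (at t)"
      by (intro DERIV_divide DERIV_const) (use that s in simp_all)
     also have "(0 * sqrt (B - t) - 2 * \<epsilon>^2 * - (1 / (2 * sqrt (B - t)))) / (sqrt (B - t) * sqrt (B - t)) = \<epsilon>^2 / ((B - t) * sqrt (B - t))"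
      using that s by (simp add: field_simps)
     finally show ?thesis .
    qed
    show "continuous_on {0..s} (%t. 2 * \<epsilon>^2 / sqrt (B - t))" using s by (intro continuous_intros) auto
    show "0 \<le> \<epsilon>^2 / ((B - t) * sqrt (B - t))" if "t \<le> s" for t using that s by (intro divide_nonneg_nonneg mult_nonneg_nonneg) auto
   qed (use s in auto)
   also have "... \<le> ennreal (2 * \<epsilon>^2 / sqrt (B - s))" using B_pos by (intro ennreal_leI) simp
   finally show "(\<integral>\<^sup>+t. (if t \<le> s then ennreal (sqrt (B - t) * (q t)^2) else 0) \<partial>M) \<le> ennreal (2 * \<epsilon>^2 / sqrt (B - s))" .
  qed
  show "AE t in M. ennreal (cmod (F t)) \<le> ennreal \<bar>q t\<bar> * (\<integral>\<^sup>+s. (if t \<le> s then ennreal (cmod (g s)) else 0) \<partial>M)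
   + (\<integral>\<^sup>+s. (if s \<le> t then ennreal (\<bar>q s\<bar> * cmod (g s)) else 0) \<partial>M)"
   using c AE_space
  proof eventually_elim
   case (elim t)
   then have t: "t \<in> I" by simp
   show ?case
   proof (cases "r \<le> t")
    case False
    then show ?thesis by (simp add: F_def tail_def)
   next
    case True
    let ?w = "cut 0 t (weighted g)"
    have w: "?w \<in> L2 M" by (rule cut_weighted_L2[OF g t])
    have "prim b (weighted g) t - prim b (weighted g) r = (LINT s|M. cut r t ?w s)"
     using prim_diff[OF w r0 True t] prim_cut[of t t b "weighted g"] prim_cut[of r t b "weighted g"] True by simp
    moreover have "f t - \<kappa> = - of_real (P t) * prim b g t + (prim b (weighted g) t - prim b (weighted g) r)"
     using elim(1) by (simp add: \<kappa>_def volterra_def)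
    ultimately have "F t = of_real (q t) * ip g (tail t (%_. 1)) + (LINT s|M. cut r t ?w s)"
     using True prim_tail[OF fg t] by (simp add: F_def tail_def q_def)
    then have "cmod (F t) \<le> cmod (of_real (q t) * ip g (tail t (%_. 1))) + cmod (LINT s|M. cut r t ?w s)"
     by (simp only: norm_triangle_ineq)
    then have "cmod (F t) \<le> \<bar>q t\<bar> * cmod (ip g (tail t (%_. 1))) + cmod (LINT s|M. cut r t ?w s)"
     by (simp only: norm_mult norm_of_real)
    then have "ennreal (cmod (F t)) \<le> ennreal (\<bar>q t\<bar> * cmod (ip g (tail t (%_. 1))) + cmod (LINT s|M. cut r t ?w s))"
     by (rule ennreal_leI)
    also have "... = ennreal \<bar>q t\<bar> * ennreal (cmod (ip g (tail t (%_. 1)))) + ennreal (cmod (LINT s|M. cut r t ?w s))"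
     by (simp add: ennreal_mult)
    also have "... \<le> ennreal \<bar>q t\<bar> * (\<integral>\<^sup>+s. (if t \<le> s then ennreal (cmod (g s)) else 0) \<partial>M)
      + (\<integral>\<^sup>+s. (if s \<le> t then ennreal (\<bar>q s\<bar> * cmod (g s)) else 0) \<partial>M)"
    proof (intro add_mono mult_left_mono)
     have "ennreal (cmod (ip g (tail t (%_. 1)))) \<le> (\<integral>\<^sup>+s. ennreal (cmod (g s * cnj (tail t (%_. 1) s))) \<partial>M)"
      unfolding L2_inner_def by (rule integral_norm_bound_ennreal[OF L2_mult_integrable[OF g tail_L2[OF one_L2]]])
     also have "... = (\<integral>\<^sup>+s. (if t \<le> s then ennreal (cmod (g s)) else 0) \<partial>M)"
      by (rule nn_integral_cong) (simp add: tail_def)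
     finally show "ennreal (cmod (ip g (tail t (%_. 1)))) \<le> ..." .
     have "ennreal (cmod (LINT s|M. cut r t ?w s)) \<le> (\<integral>\<^sup>+s. ennreal (cmod (cut r t ?w s)) \<partial>M)"
      by (rule integral_norm_bound_ennreal[OF cut_integrable[OF w r0 True t]])
     also have "... \<le> (\<integral>\<^sup>+s. (if s \<le> t then ennreal (\<bar>q s\<bar> * cmod (g s)) else 0) \<partial>M)"
      by (rule nn_integral_mono) (use r0 in "auto simp: cut_def q_def weighted_def norm_mult")
     finally show "ennreal (cmod (LINT s|M. cut r t ?w s)) \<le> ..." .
    qed simp
    finally show ?thesis .
   qed
  qed
 qed (use pred_le_Ivl(2) q g L2_measurable[OF F] in simp_all)
 have "nrm (tail r f) = nrm (%t. F t + tail r (%_. \<kappa>) t)"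
  unfolding L2_norm_def F_def tail_def by (rule arg_cong[where f=sqrt], rule Bochner_Integration.integral_cong) auto
 also have "... \<le> nrm F + nrm (tail r (%_. \<kappa>))"
  by (rule L2_norm_triangle[OF F tail_L2]) (use L2_cmult[OF one_L2, of \<kappa>] in simp)
 also have "nrm (tail r (%_. \<kappa>)) \<le> nrm (%t. \<kappa> * 1)"
  by (rule L2_norm_mono_AE[OF tail_L2 L2_cmult[OF one_L2] AE_I2]) (use L2_cmult[OF one_L2, of \<kappa>] in "simp_all add: tail_def")
 also have "... = cmod \<kappa> * nrm (%_. 1)" by (rule L2_norm_cmult)
 also have "... \<le> (cmod c + cmod (prim b (weighted g) r)) * nrm (%_. 1)"
  unfolding \<kappa>_def by (rule mult_right_mono[OF norm_triangle_ineq]) simp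
 finally have "nrm (tail r f) \<le> nrm F + (cmod c + cmod (prim b (weighted g) r)) * nrm (%_. 1)" by simp
 moreover have "2 * sqrt (2 * (2 * \<epsilon>^2)) = 4 * \<epsilon>" using e real_sqrt_mult[of 4 "\<epsilon>^2"] by simp
 ultimately show ?thesis using main by (simp add: mult.commute)
qed

theorem discrete_spectrum_bounded:
 assumes lim: "(%n. (B - x n) * (\<Sum>j=1..n. (\<beta> j + gap x j))) \<longlonglongrightarrow> 0"
 shows "has_discrete_spectrum M Hmax"
proof (rule discrete_spectrum_of_tails[OF sa])
 fix \<epsilon> :: real assume e: "\<epsilon> > 0"
 define W where "W = nrm (%_. 1 :: complex)"
 have W: "0 \<le> W" by (simp add: W_def)
 \<comment> \<open>The Hardy part costs \<open>4 * (\<epsilon> / 8)\<close> and the constant of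
   integration at most \<open>W * (\<epsilon> / (2 * (W + 1)))\<close>; together these stay below
   \<open>\<epsilon>\<close>. Adding 1 to \<open>W\<close> avoids a division by zero.\<close>
 have e8: "\<epsilon> / 8 > 0" and eW: "\<epsilon> / (2 * (W + 1)) > 0" using e W by simp_all
 obtain r where r: "r \<in> I" "0 < r" and P: "\<And>t. r \<le> t ==> t < B ==> \<bar>P t\<bar> \<le> \<epsilon> / 8 / (B - t)"
  by (rule P_small[OF lim e8]) blast
 obtain \<theta> where \<theta>: "form_compact \<theta>" "\<And>f g c. (f, g) \<in> Hmax ==> (AE t in M. f t = c - volterra g t) ==> cmod c \<le> \<epsilon> / (2 * (W + 1)) * nrm g + \<theta> f g"
  by (rule constant_form_compact[OF eW]) blast
 show "\<exists>r\<in>I. 0 < r \<and> (\<exists>\<psi>. form_compact \<psi> \<and> (\<forall>f g. (f, g) \<in> Hmax --> nrm (tail r f) \<le> \<epsilon> * nrm g + \<psi> f g))"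
 proof (intro bexI[of _ r] conjI exI allI impI r)
  show "form_compact (%f g. W * (\<theta> f g + cmod (prim b (weighted g) r)))"
   unfolding prim_weighted_inner by (intro form_compact_cmult form_compact_add \<theta>(1) form_compact_inner weighted_window_L2 r W)
  fix f g assume fg: "(f, g) \<in> Hmax"
  obtain c where c: "AE t in M. f t = c - volterra g t" using fg by (rule HmaxE)
  have "nrm (tail r f) \<le> W * (cmod c + cmod (prim b (weighted g) r)) + 4 * (\<epsilon> / 8) * nrm g"
   unfolding W_def by (rule bounded_tail[OF r(1) e8 P fg c])
  also have "... \<le> W * ((\<epsilon> / (2 * (W + 1)) * nrm g + \<theta> f g) + cmod (prim b (weighted g) r)) + 4 * (\<epsilon> / 8) * nrm g"
   by (intro add_right_mono mult_left_mono \<theta>(2)[OF fg c] W)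
  also have "... = (W * (\<epsilon> / (2 * (W + 1)))) * nrm g + \<epsilon> / 2 * nrm g + W * (\<theta> f g + cmod (prim b (weighted g) r))"
   by (simp add: distrib_left mult.assoc)
  also have "(W * (\<epsilon> / (2 * (W + 1)))) * nrm g \<le> \<epsilon> / 2 * nrm g"
   using W e by (intro mult_right_mono) (simp_all add: field_simps)
  finally show "nrm (tail r f) \<le> \<epsilon> * nrm g + W * (\<theta> f g + cmod (prim b (weighted g) r))" by simp
 qed
qed

end

end

lemma nn_integral_Ivl_eq:
 assumes "\<And>t. t \<notin> Ivl b ==> h t = 0"
 shows "(\<integral>\<^sup>+t. h t \<partial>Ivl_measure b) = (\<integral>\<^sup>+t. h t \<partial>lborel)"
proof -
 have "(\<integral>\<^sup>+t. h t \<partial>Ivl_measure b) = (\<integral>\<^sup>+t. h t * indicator (Ivl b) t \<partial>lebesgue)"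
  by (rule nn_integral_restrict_space) simp
 also have "... = (\<integral>\<^sup>+t. h t \<partial>lebesgue)" by (rule nn_integral_cong) (auto simp: indicator_def assms)
 also have "... = (\<integral>\<^sup>+t. h t \<partial>lborel)" by (rule nn_integral_completion)
 finally show ?thesis .
qed

context delta_chain
begin

section \<open>The half-line: sufficiency\<close>

context
 assumes inf: "b = \<infinity>"
begin

lemma Ivl_half_line: "I = {0..}"
 using inf by (auto simp: Ivl_def)

lemma half_line_integral_inv_sqrt:
 assumes "0 \<le> u" "u \<le> v"
 shows "(\<integral>\<^sup>+t. (if u \<le> t \<and> t \<le> v then ennreal (1 / sqrt (1 + t)) else 0) \<partial>M) = ennreal (2 * sqrt (1 + v) - 2 * sqrt (1 + u))"
proof -
 have "(\<integral>\<^sup>+t. (if u \<le> t \<and> t \<le> v then ennreal (1 / sqrt (1 + t)) else 0) \<partial>M) = (\<integral>\<^sup>+t. (if u \<le> t \<and> t \<le> v then ennreal (1 / sqrt (1 + t)) else 0) \<partial>lborel)"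
  by (rule nn_integral_Ivl_eq) (use assms in "auto simp: Ivl_half_line")
 also have "... = (\<integral>\<^sup>+t. ennreal (1 / sqrt (1 + t)) * indicator {u..v} t \<partial>lborel)"
  by (rule nn_integral_cong) (simp add: indicator_def)
 also have "... = ennreal (2 * sqrt (1 + v) - 2 * sqrt (1 + u))"
 proof (rule nn_integral_FTC_Icc)
  fix t assume "t \<in> {u..v}"
  then have t: "0 < 1 + t" using assms(1) by simp
  have "((%t. 2 * sqrt (1 + t)) has_real_derivative 1 / sqrt (1 + t)) (at t)"
   using t by (auto intro!: derivative_eq_intros simp: field_simps)
  then show "((%t. 2 * sqrt (1 + t)) has_real_derivative 1 / sqrt (1 + t)) (at t)" .
  show "0 \<le> 1 / sqrt (1 + t)" using t by simp
 qed (use assms in auto)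
 finally show ?thesis .
qed

lemma constant_tail_zero:
 assumes "tail r (%_. \<kappa>) \<in> L2 M" "0 \<le> r"
 shows "\<kappa> = 0"
proof (rule ccontr)
 assume k: "\<kappa> \<noteq> 0"
 let ?C = "nrm (tail r (%_. \<kappa>))"
 obtain n :: nat where n: "(?C / cmod \<kappa>)^2 < real n" using reals_Archimedean2 by blast
 have rn: "r + real n \<in> I" using assms(2) by (simp add: Ivl_half_line)
 have "cut r (r + real n) (tail r (%_. \<kappa>)) = (%t. \<kappa> * cut r (r + real n) (%_. 1) t)"
  by (rule ext) (simp add: cut_def tail_def)
 then have "nrm (cut r (r + real n) (tail r (%_. \<kappa>))) = cmod \<kappa> * sqrt (real n)"
  using window_L2(2)[OF assms(2) _ rn] by (simp add: L2_norm_cmult)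
 then have "cmod \<kappa> * sqrt (real n) \<le> ?C" using L2_norm_cut_le[OF assms(1), of r "r + real n"] by simp
 then have "sqrt (real n) \<le> ?C / cmod \<kappa>" using k by (simp add: field_simps)
 then have "(sqrt (real n))^2 \<le> (?C / cmod \<kappa>)^2" by (rule power_mono) simp
 then show False using n by simp
qed

context
 assumes summable3: "summable (%j. gap x j ^ 3)" and lim3: "(%n. x n * (\<Sum>j. gap x (n + j) ^ 3)) \<longlonglongrightarrow> 0"
  and summable1: "summable (%j. \<beta> j + gap x j)" and lim1: "(%n. x n * (\<Sum>j. (\<beta> (n + j) + gap x (n + j)))) \<longlonglongrightarrow> 0"
  and nonneg: "\<And>n. 1 \<le> n ==> 0 \<le> \<beta> n + gap x n"
begin

text \<open>The series is the limit of \<open>P\<close> along the nodes. It starts at index 1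
  because the sum in \<open>P\<close> does; the value \<open>\<beta> 0\<close> carries no
  meaning.\<close>

definition Q :: "real \<Rightarrow> real" where
 "Q t = (\<Sum>j. \<beta> (Suc j) + gap x (Suc j)) - P t"

definition R :: "nat \<Rightarrow> real" where
 "R n = (\<Sum>j. \<beta> (Suc n + j) + gap x (Suc n + j))"

lemma R_nonneg: "0 \<le> R n"
proof -
 have "summable (%j. \<beta> (j + Suc n) + gap x (j + Suc n))" using summable1 by (rule summable_iff_shift[of "%j. \<beta> j + gap x j", THEN iffD2])
 then have "summable (%j. \<beta> (Suc n + j) + gap x (Suc n + j))" by (simp only: add.commute)
 then show ?thesis unfolding R_def by (rule suminf_nonneg) (rule nonneg, simp)
qed

lemma Q_eq:
 assumes "x n \<le> t" "t < x (Suc n)"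
 shows "Q t = R n - (t - x n)"
proof -
 let ?a = "%j. \<beta> (Suc j) + gap x (Suc j)"
 have s: "summable ?a" using summable1 by (rule summable_Suc_iff[of "%j. \<beta> j + gap x j", THEN iffD2])
 have "(\<Sum>j=1..n. \<beta> j + gap x j) = sum ?a {..<n}"
  by (induction n) simp_all
 moreover have "R n = (\<Sum>j. ?a (j + n))" unfolding R_def by (simp only: add_Suc add.commute[of n])
 ultimately show ?thesis
  unfolding Q_def P_eq_partial_sum[OF assms] suminf_split_initial_segment[OF s, of n] by simp
qed

lemma Q_measurable: "Q \<in> borel_measurable M"
 unfolding Q_def using P_measurable by simp

text \<open>On cell \<open>m\<close>, \<open>Q\<close> is the remainder \<open>R m\<close> minus the
  linear part \<open>s - x m\<close>. The remainder is at most \<open>\<delta> / s\<close>, whose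
  square integrates to \<open>\<delta>^2 / t\<close> over \<open>[t, \<infinity>)\<close>; the
  linear part is at most the length of its cell, and the squares integrate to the series of cubes,
  which is below \<open>\<delta> / t\<close>.\<close>

lemma Q_tail_integral:
 assumes e: "\<epsilon> > 0"
 obtains r where "1 \<le> r" "\<And>t. r \<le> t ==> (\<integral>\<^sup>+s. (if t \<le> s then ennreal ((Q s)^2) else 0) \<partial>M) \<le> ennreal (\<epsilon> / t)"
proof -
 \<comment> \<open>With \<open>\<delta> \<le> 1\<close> the two contributions
   \<open>2 * \<delta>^2\<close> and \<open>2 * \<delta>\<close> sum to at most
   \<open>4 * \<delta>\<close>, hence to at most \<open>\<epsilon>\<close>.\<close>
 define \<delta> where "\<delta> = min 1 (\<epsilon> / 4)"
 have d: "0 < \<delta>" "2 * \<delta>^2 + 2 * \<delta> \<le> \<epsilon>"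
 proof -
  show "0 < \<delta>" using e by (simp add: \<delta>_def)
  moreover have "\<delta> \<le> 1" "4 * \<delta> \<le> \<epsilon>" by (auto simp: \<delta>_def)
  ultimately have "\<delta> * \<delta> \<le> \<delta>" "4 * \<delta> \<le> \<epsilon>" using mult_left_mono[of \<delta> 1 \<delta>] by simp_all
  then show "2 * \<delta>^2 + 2 * \<delta> \<le> \<epsilon>" unfolding power2_eq_square by linarith
 qed
 let ?d = "%n. \<Sum>j. gap x (Suc n + j) ^ 3"
 have "\<forall>\<^sub>F n in sequentially. x (Suc n) * R n < \<delta>"
  unfolding R_def by (rule order_tendstoD(2)[OF LIMSEQ_Suc[OF lim1] d(1)])
 moreover have "\<forall>\<^sub>F n in sequentially. x (Suc n) * ?d n < \<delta>"
  by (rule order_tendstoD(2)[OF LIMSEQ_Suc[OF lim3] d(1)])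
 moreover have "\<forall>\<^sub>F n in sequentially. 1 < x n" by (rule eventually_lt_x) (simp add: Ivl_half_line)
 ultimately have "\<forall>\<^sub>F n in sequentially. x (Suc n) * R n < \<delta> \<and> x (Suc n) * ?d n < \<delta> \<and> 1 < x n" by eventually_elim simp
 then obtain N where N: "\<And>n. N \<le> n ==> x (Suc n) * R n < \<delta>" "\<And>n. N \<le> n ==> x (Suc n) * ?d n < \<delta>" "1 < x N"
  by (auto simp: eventually_sequentially)
 show thesis
 proof (rule that)
  show "1 \<le> x N" using N(3) by simp
  fix t assume t: "x N \<le> t"
  have t1: "1 < t" using t N(3) by simp
  have tI: "t \<in> I" using t1 by (simp add: Ivl_half_line)
  obtain n where n: "x n \<le> t" "t < x (Suc n)" using tI by (rule interval_obtain)
  have Nn: "N \<le> n" using le_less_trans[OF t n(2)] by simp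
  have gp: "0 \<le> gap x (Suc m)" for m by (simp add: gap_def)
  define u where "u j s = ennreal (2 * (gap x (Suc n + j))^2) * indicator {x (n + j)..<x (Suc n + j)} s" for j s
  define v where "v s = ennreal (2 * \<delta>^2 / s^2) * indicator {t..} s" for s
  have mu: "u j \<in> borel_measurable lborel" for j unfolding u_def by measurable
  have mv: "v \<in> borel_measurable lborel" unfolding v_def by (intro borel_measurable_times_ennreal measurable_compose[OF _ measurable_ennreal] borel_measurable_indicator borel_measurable_divide borel_measurable_power borel_measurable_const) simp_all
  have "(\<integral>\<^sup>+s. (if t \<le> s then ennreal ((Q s)^2) else 0) \<partial>M) \<le> (\<integral>\<^sup>+s. v s + (\<Sum>j. u j s) \<partial>M)"
  proof (rule nn_integral_mono)
   fix s assume "s \<in> space M"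
   then have sI: "s \<in> I" by simp
   show "(if t \<le> s then ennreal ((Q s)^2) else 0) \<le> v s + (\<Sum>j. u j s)"
   proof (cases "t \<le> s")
    case True
    obtain m where m: "x m \<le> s" "s < x (Suc m)" using sI by (rule interval_obtain)
    have "x n < x (Suc m)" using n(1) True m(2) by linarith
    then have nm: "n \<le> m" by (simp only: x_less_iff less_Suc_eq_le)
    have "s * R m \<le> x (Suc m) * R m" using m(2) R_nonneg by (intro mult_right_mono) auto
    also have "... < \<delta>" using N(1)[of m] Nn nm by simp
    finally have Rm: "R m \<le> \<delta> / s" using True t1 by (simp add: pos_le_divide_eq mult.commute)
    have sm: "0 \<le> s - x m" "s - x m \<le> gap x (Suc m)" using m by (simp_all add: gap_def)
    have "(Q s)^2 \<le> 2 * (R m)^2 + 2 * (s - x m)^2"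
     using zero_le_power2[of "R m + (s - x m)"] unfolding Q_eq[OF m] by (simp add: power2_eq_square algebra_simps)
    also have "... \<le> 2 * (\<delta> / s)^2 + 2 * (gap x (Suc m))^2"
     by (intro add_mono mult_left_mono power_mono Rm R_nonneg sm) simp_all
    finally have "ennreal ((Q s)^2) \<le> ennreal (2 * \<delta>^2 / s^2 + 2 * (gap x (Suc m))^2)"
     by (intro ennreal_leI) (simp add: power_divide)
    also have "... = v s + u (m - n) s" using True m nm by (simp add: v_def u_def)
    also have "u (m - n) s \<le> (\<Sum>j. u j s)" using sum_le_suminf[OF summableI, of "{m - n}" "%j. u j s"] by simp
    finally show ?thesis using True by (simp add: add_left_mono)
   qed simp
  qed
  also have "... \<le> (\<integral>\<^sup>+s. v s + (\<Sum>j. u j s) \<partial>lborel)" by (rule nn_integral_Ivl_le)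
  also have "... = (\<integral>\<^sup>+s. v s \<partial>lborel) + (\<Sum>j. \<integral>\<^sup>+s. u j s \<partial>lborel)"
   using mu mv by (simp add: nn_integral_add nn_integral_suminf)
  also have "(\<integral>\<^sup>+s. v s \<partial>lborel) = ennreal (0 - (- (2 * \<delta>^2 / t)))"
   unfolding v_def
  proof (rule nn_integral_FTC_atLeast)
   show "((%s. - (2 * \<delta>^2 / s)) has_real_derivative 2 * \<delta>^2 / s^2) (at s)" if "t \<le> s" for s
    using that t1 by (auto intro!: derivative_eq_intros simp: power2_eq_square)
   show "((%s. - (2 * \<delta>^2 / s)) \<longlongrightarrow> 0) at_top"
    using tendsto_minus[OF tendsto_divide_0[OF tendsto_const[of "2 * \<delta>^2"] filterlim_at_top_imp_at_infinity[OF filterlim_ident]]] by simp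
  qed auto
  also have "(\<Sum>j. \<integral>\<^sup>+s. u j s \<partial>lborel) = (\<Sum>j. ennreal (2 * gap x (Suc n + j) ^ 3))"
  proof (rule suminf_cong)
   fix j
   have "(\<integral>\<^sup>+s. u j s \<partial>lborel) = ennreal (2 * (gap x (Suc n + j))^2) * ennreal (gap x (Suc n + j))"
    unfolding u_def by (subst nn_integral_cmult_indicator) (simp_all add: gap_def)
   also have "... = ennreal (2 * gap x (Suc n + j) ^ 3)"
    using gp[of "n + j"] by (simp add: power2_eq_square power3_eq_cube mult.assoc flip: ennreal_mult)
   finally show "(\<integral>\<^sup>+s. u j s \<partial>lborel) = ennreal (2 * gap x (Suc n + j) ^ 3)" .
  qed
  also have "... = ennreal (\<Sum>j. 2 * gap x (Suc n + j) ^ 3)"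
  proof (rule suminf_ennreal2)
   have "summable (%j. gap x (j + Suc n) ^ 3)" using summable3 by (simp only: summable_iff_shift[of "%j. gap x j ^ 3"])
   then show "summable (%j. 2 * gap x (Suc n + j) ^ 3)" by (intro summable_mult) (simp only: add.commute)
  qed (use gp in simp)
  also have "(\<Sum>j. 2 * gap x (Suc n + j) ^ 3) = 2 * ?d n"
  proof (rule suminf_mult)
   show "summable (%j. gap x (Suc n + j) ^ 3)" using summable3 summable_iff_shift[of "%j. gap x j ^ 3" "Suc n"] by (simp only: add.commute)
  qed
  also have "ennreal (0 - (- (2 * \<delta>^2 / t))) + ennreal (2 * ?d n) \<le> ennreal (2 * \<delta>^2 / t) + ennreal (2 * \<delta> / t)"
  proof (rule add_mono)
   have "0 \<le> ?d n"
    by (rule suminf_nonneg) (use summable3 summable_iff_shift[of "%j. gap x j ^ 3" "Suc n"] gp in "simp_all add: add.commute")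
   then have "t * ?d n \<le> x (Suc n) * ?d n" using n(2) by (intro mult_right_mono) auto
   also have "... < \<delta>" by (rule N(2)[OF Nn])
   finally have "?d n \<le> \<delta> / t" using t1 by (simp add: pos_le_divide_eq mult.commute)
   then show "ennreal (2 * ?d n) \<le> ennreal (2 * \<delta> / t)" by (intro ennreal_leI) simp
  qed simp
  also have "... = ennreal ((2 * \<delta>^2 + 2 * \<delta>) / t)" using t1 d(1) by (simp add: add_divide_distrib flip: ennreal_plus)
  also have "... \<le> ennreal (\<epsilon> / t)" using d(2) t1 by (intro ennreal_leI divide_right_mono) auto
  finally show "(\<integral>\<^sup>+s. (if t \<le> s then ennreal ((Q s)^2) else 0) \<partial>M) \<le> ennreal (\<epsilon> / t)" .
 qed
qed

lemma Q_complex_L2: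
 assumes r: "1 \<le> r" and T: "(\<integral>\<^sup>+s. (if r \<le> s then ennreal ((Q s)^2) else 0) \<partial>M) \<le> ennreal (\<epsilon> / r)"
 shows "(%t. complex_of_real (Q t)) \<in> L2 M"
proof -
 let ?Q = "%t. complex_of_real (Q t)"
 have mQ: "?Q \<in> borel_measurable M"
  by (rule borel_measurable_continuous_on[where f=of_real, OF _ Q_measurable]) (intro continuous_intros)
 have rI: "r \<in> I" using r by (simp add: Ivl_half_line)
 have "tail r ?Q \<in> L2 M"
 proof (rule L2_nnI(1)[OF tail_measurable[OF mQ]])
  have "(\<integral>\<^sup>+t. ennreal ((cmod (tail r ?Q t))^2) \<partial>M) = (\<integral>\<^sup>+s. (if r \<le> s then ennreal ((Q s)^2) else 0) \<partial>M)"
   by (rule nn_integral_cong) (simp add: tail_def)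
  then show "(\<integral>\<^sup>+t. ennreal ((cmod (tail r ?Q t))^2) \<partial>M) \<le> ennreal (\<epsilon> / r)" using T by simp
 qed
 moreover have "cut 0 r ?Q \<in> L2 M"
 proof -
  define p where "p = (\<Sum>j. \<beta> (Suc j) + gap x (Suc j))"
  have "(%t. of_real p * cut 0 r (%_. 1) t - cut 0 r (%t. of_real (P t)) t) \<in> L2 M"
   by (intro L2_diff L2_cmult weighted_window_L2 window_L2 rI) (use r in auto)
  moreover have "(%t. of_real p * cut 0 r (%_. 1) t - cut 0 r (%t. of_real (P t)) t) = cut 0 r ?Q"
   by (rule ext) (simp add: cut_def Q_def p_def)
  ultimately show ?thesis by simp
 qed
 ultimately have "(%t. cut 0 r ?Q t + tail r ?Q t) \<in> L2 M" by (rule L2_add[rotated])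
 then show ?thesis by (rule L2_cong_AE[OF _ mQ AE_I2]) (auto simp: cut_def tail_def Ivl_half_line)
qed

text \<open>The constant vanishes because \<open>f\<close> and the two Hardy operators applied to \<open>g\<close> are square integrable at infinity.\<close>

lemma half_line_tail:
 assumes r: "1 \<le> r" and e: "\<epsilon> > 0" and T: "\<And>t. r \<le> t ==> (\<integral>\<^sup>+s. (if t \<le> s then ennreal ((Q s)^2) else 0) \<partial>M) \<le> ennreal (\<epsilon> / t)"
  and fg: "(f, g) \<in> Hmax"
 shows "nrm (tail r f) \<le> 2 * sqrt (2 * (4 * \<epsilon>)) * nrm g"
proof -
 obtain c where f: "f \<in> L2 M" and g: "g \<in> L2 M" and c: "AE t in M. f t = c - volterra g t" using fg by (rule HmaxE)
 let ?Q = "%t. complex_of_real (Q t)"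
 have Q: "?Q \<in> L2 M" by (rule Q_complex_L2[OF r T[OF order_refl]])
 define p where "p = (\<Sum>j. \<beta> (Suc j) + gap x (Suc j))"
 have PQ: "P t = p - Q t" for t by (simp add: Q_def p_def)
 \<comment> \<open>When \<open>P\<close> is replaced by \<open>p - Q\<close>, the terms with
   \<open>p\<close> cancel, and completing the integral of \<open>Q g\<close> over
   \<open>[0, t)\<close> to the whole half-line leaves this constant and an integral over
   \<open>[t, \<infinity>)\<close>.\<close>
 define \<kappa> where "\<kappa> = c - ip g ?Q"
 have repr: "f t - \<kappa> = of_real (Q t) * prim b g t + ip g (tail t ?Q)" if t: "t \<in> I" and ft: "f t = c - volterra g t" for t
 proof -
  have w: "cut 0 t (%_. 1) \<in> L2 M" by (rule window_L2(1)[OF order_refl Ivl_nonneg[OF t] t])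
  have "cut 0 t (%s. complex_of_real (P s)) = (%s. of_real p * cut 0 t (%_. 1) s - cut 0 t ?Q s)"
   by (rule ext) (simp add: cut_def PQ)
  then have "prim b (weighted g) t = of_real p * prim b g t - ip g (cut 0 t ?Q)"
   unfolding prim_weighted_inner unfolding prim_inner
   using L2_inner_diff_right[OF L2_cmult[OF w, of "of_real p"] cut_L2[OF Q, of 0 t] g] by (simp add: L2_inner_cmult_right)
  moreover have "ip g ?Q = ip g (%s. cut 0 t ?Q s + tail t ?Q s)"
   unfolding L2_inner_def by (rule Bochner_Integration.integral_cong) (auto simp: cut_def tail_def Ivl_half_line)
  then have "ip g ?Q = ip g (cut 0 t ?Q) + ip g (tail t ?Q)"
   by (simp only: L2_inner_add_right[OF cut_L2[OF Q] tail_L2[OF Q] g])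
  ultimately show ?thesis unfolding ft \<kappa>_def volterra_def PQ by (simp add: algebra_simps)
 qed
 define q where "q t = (if r \<le> t then Q t else 0)" for t
 define F where "F = tail r (%t. f t - \<kappa>)"
 have q: "q \<in> borel_measurable M"
 proof -
  have "(%t. Re (tail r ?Q t)) \<in> borel_measurable M"
   by (rule borel_measurable_continuous_on[where f=Re, OF _ tail_measurable[OF L2_measurable[OF Q]]]) (intro continuous_intros)
  then show ?thesis by (rule measurable_cong[THEN iffD1, rotated]) (simp add: q_def tail_def)
 qed
 have F: "F \<in> borel_measurable M" unfolding F_def by (rule tail_measurable) (use L2_measurable[OF f] in simp)
 have q2: "(%t. ennreal ((q t)^2)) \<in> borel_measurable M" using q by simp
 have half: "(%t. ennreal (1 / sqrt (1 + t) / 2)) \<in> borel_measurable M"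
  by (rule measurable_compose[OF id_borel_measurable_Ivl]) measurable
 interpret sigma_finite_measure M by (rule sigma_finite_lebesgue_on) simp
 interpret triangle M "%s t. s \<le> t" by unfold_locales (rule pred_le_Ivl(1))
 \<comment> \<open>\<open>q\<close> vanishes before \<open>r\<close>, and \<open>r \<ge> 1\<close>
   gives \<open>1 + s \<le> 2 * max r s\<close>. The shift by 1 keeps the bound finite and the
   weight \<open>sqrt (1 + t)\<close> positive down to \<open>0\<close>.\<close>
 have Tq: "(\<integral>\<^sup>+t. (if s \<le> t then ennreal ((q t)^2) else 0) \<partial>M) \<le> ennreal (2 * \<epsilon> / (1 + s))" if s: "0 \<le> s" for s
 proof -
  have "(\<integral>\<^sup>+t. (if s \<le> t then ennreal ((q t)^2) else 0) \<partial>M) = (\<integral>\<^sup>+t. (if max r s \<le> t then ennreal ((Q t)^2) else 0) \<partial>M)"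
   by (rule nn_integral_cong) (simp add: q_def)
  also have "... \<le> ennreal (\<epsilon> / max r s)" by (rule T) simp
  also have "... \<le> ennreal (2 * \<epsilon> / (1 + s))"
   using r s e mult_left_mono[of "1 + s" "2 * max r s" \<epsilon>] by (intro ennreal_leI) (simp add: field_simps)
  finally show ?thesis .
 qed
 have main: "F \<in> L2 M" "nrm F \<le> 2 * sqrt (2 * (4 * \<epsilon>)) * nrm g"
 proof (rule_tac [!] tail_Hardy[where \<rho>="%s t. s \<le> t" and \<omega>="%t. sqrt (1 + t)" and q=q and g=g])
  show mw: "(%t. sqrt (1 + t)) \<in> borel_measurable M" "(%t. sqrt (1 + t)) \<in> borel_measurable M"
   by (rule borel_measurable_continuous_on[where f="%t. sqrt (1 + t)", OF _ id_borel_measurable_Ivl], intro continuous_intros)+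
  show "AE t in M. 0 < sqrt (1 + t)" "AE t in M. 0 < sqrt (1 + t)" by (rule AE_I2, simp add: Ivl_half_line)+
  have "(\<integral>\<^sup>+s. (if s \<le> t then ennreal (1 / sqrt (1 + s)) else 0) \<partial>M) \<le> ennreal (2 * sqrt (1 + t))" if t: "t \<in> space M" for t
  proof -
   have t0: "0 \<le> t" using t by (simp add: Ivl_half_line)
   have "(\<integral>\<^sup>+s. (if s \<le> t then ennreal (1 / sqrt (1 + s)) else 0) \<partial>M) = (\<integral>\<^sup>+s. (if 0 \<le> s \<and> s \<le> t then ennreal (1 / sqrt (1 + s)) else 0) \<partial>M)"
    by (rule nn_integral_cong) (simp add: Ivl_half_line)
   also have "... \<le> ennreal (2 * sqrt (1 + t))" unfolding half_line_integral_inv_sqrt[OF order_refl t0] by (intro ennreal_leI) simp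
   finally show ?thesis .
  qed
  then show "AE t in M. (\<integral>\<^sup>+s. (if s \<le> t then ennreal (1 / sqrt (1 + s)) else 0) \<partial>M) \<le> ennreal (2 * sqrt (1 + t))"
   "AE t in M. (\<integral>\<^sup>+s. (if s \<le> t then ennreal (1 / sqrt (1 + s)) else 0) \<partial>M) \<le> ennreal (2 * sqrt (1 + t))" by (rule AE_I2, blast)+
  have "(\<integral>\<^sup>+t. (if s \<le> t then ennreal (sqrt (1 + t) * (q t)^2) else 0) \<partial>M) \<le> ennreal (4 * \<epsilon> / sqrt (1 + s))" if "s \<in> space M" for s
  proof -
   have s: "0 \<le> s" using that by (simp add: Ivl_half_line)
   \<comment> \<open>Integration by parts in the form of Tonelli's theorem:
     \<open>sqrt (1 + t)\<close> is \<open>sqrt (1 + s)\<close> plus the integral of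
     \<open>1 / (2 * sqrt (1 + \<tau>))\<close> over \<open>[s, t]\<close>. This reduces the
     weighted integral of \<open>q^2\<close> to unweighted tails, bounded by \<open>Tq\<close>; each
     of the two terms is at most \<open>2 * \<epsilon> / sqrt (1 + s)\<close>.\<close>
   let ?G = "%\<tau>. if s \<le> \<tau> then ennreal (1 / sqrt (1 + \<tau>) / 2) else 0"
   let ?V = "%t. \<integral>\<^sup>+\<tau>. (if \<tau> \<le> t then ?G \<tau> else 0) \<partial>M"
   have mG: "?G \<in> borel_measurable M" by (rule measurable_If[OF half _ section_sets(2)[OF that]]) simp
   have V: "?V \<in> borel_measurable M" by (rule tonelli(2)[OF q2 mG])
   have "(\<integral>\<^sup>+t. (if s \<le> t then ennreal (sqrt (1 + t) * (q t)^2) else 0) \<partial>M)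
     \<le> (\<integral>\<^sup>+t. ennreal (sqrt (1 + s)) * (if s \<le> t then ennreal ((q t)^2) else 0) + ennreal ((q t)^2) * ?V t \<partial>M)"
   proof (rule nn_integral_mono)
    fix t assume "t \<in> space M"
    then have t: "0 \<le> t" by (simp add: Ivl_half_line)
    show "(if s \<le> t then ennreal (sqrt (1 + t) * (q t)^2) else 0) \<le> ennreal (sqrt (1 + s)) * (if s \<le> t then ennreal ((q t)^2) else 0) + ennreal ((q t)^2) * ?V t"
    proof (cases "s \<le> t")
     case True
     have hh: "ennreal (1 / 2) * ennreal y = ennreal (y / 2)" for y
      by (subst ennreal_mult'[symmetric]) simp_all
     have "?V t = (\<integral>\<^sup>+\<tau>. ennreal (1 / 2) * (if s \<le> \<tau> \<and> \<tau> \<le> t then ennreal (1 / sqrt (1 + \<tau>)) else 0) \<partial>M)"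
      by (rule nn_integral_cong, cases "s \<le> t") (simp_all only: hh if_distrib[of "(*) (ennreal (1 / 2))"] mult_zero_right, auto)
     also have "... = ennreal (1 / 2) * (\<integral>\<^sup>+\<tau>. (if s \<le> \<tau> \<and> \<tau> \<le> t then ennreal (1 / sqrt (1 + \<tau>)) else 0) \<partial>M)"
     proof (rule nn_integral_cmult)
      show "(%\<tau>. if s \<le> \<tau> \<and> \<tau> \<le> t then ennreal (1 / sqrt (1 + \<tau>)) else 0) \<in> borel_measurable M"
       by (rule measurable_compose[OF id_borel_measurable_Ivl]) measurable
     qed
     also have "... = ennreal (sqrt (1 + t) - sqrt (1 + s))"
      unfolding half_line_integral_inv_sqrt[OF s True] hh by (simp add: diff_divide_distrib)
     finally have Vt: "?V t = ennreal (sqrt (1 + t) - sqrt (1 + s))" .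
     have "ennreal (sqrt (1 + t) * (q t)^2) = ennreal (sqrt (1 + s) * (q t)^2 + (q t)^2 * (sqrt (1 + t) - sqrt (1 + s)))"
      by (simp add: algebra_simps)
     also have "... = ennreal (sqrt (1 + s)) * ennreal ((q t)^2) + ennreal ((q t)^2) * ?V t"
      unfolding Vt using True s by (simp add: ennreal_mult)
     finally show ?thesis using True by simp
    qed simp
   qed
   also have "... = ennreal (sqrt (1 + s)) * (\<integral>\<^sup>+t. (if s \<le> t then ennreal ((q t)^2) else 0) \<partial>M) + (\<integral>\<^sup>+t. ennreal ((q t)^2) * ?V t \<partial>M)"
   proof -
    have m: "(%t. if s \<le> t then ennreal ((q t)^2) else 0) \<in> borel_measurable M"
     by (rule measurable_If[OF q2 _ section_sets(2)[OF that]]) simp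
    show ?thesis
     by (subst nn_integral_add) (use m V q2 in "auto intro!: borel_measurable_times_ennreal simp: nn_integral_cmult")
   qed
   also have "(\<integral>\<^sup>+t. ennreal ((q t)^2) * ?V t \<partial>M) = (\<integral>\<^sup>+\<tau>. ?G \<tau> * (\<integral>\<^sup>+t. (if \<tau> \<le> t then ennreal ((q t)^2) else 0) \<partial>M) \<partial>M)"
    by (rule tonelli(1)[OF q2 mG])
   also have "... \<le> (\<integral>\<^sup>+\<tau>. ennreal (\<epsilon> / ((1 + \<tau>) * sqrt (1 + \<tau>))) * indicator {s..} \<tau> \<partial>M)"
   proof (rule nn_integral_mono)
    fix \<tau> assume "\<tau> \<in> space M"
    then have \<tau>: "0 \<le> \<tau>" by (simp add: Ivl_half_line)
    have "?G \<tau> * (\<integral>\<^sup>+t. (if \<tau> \<le> t then ennreal ((q t)^2) else 0) \<partial>M) \<le> ?G \<tau> * ennreal (2 * \<epsilon> / (1 + \<tau>))"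
     by (rule mult_left_mono[OF Tq[OF \<tau>]]) simp
    also have "... = ennreal (\<epsilon> / ((1 + \<tau>) * sqrt (1 + \<tau>))) * indicator {s..} \<tau>"
    proof (cases "s \<le> \<tau>")
     case True
     have "1 / sqrt (1 + \<tau>) / 2 * (2 * \<epsilon> / (1 + \<tau>)) = \<epsilon> / ((1 + \<tau>) * sqrt (1 + \<tau>))" by (simp add: mult.commute)
     then have "ennreal (1 / sqrt (1 + \<tau>) / 2) * ennreal (2 * \<epsilon> / (1 + \<tau>)) = ennreal (\<epsilon> / ((1 + \<tau>) * sqrt (1 + \<tau>)))"
      by (subst ennreal_mult[symmetric]) (use \<tau> e in simp_all)
     then show ?thesis using True by (simp only: if_True) simp
    qed simp
    finally show "?G \<tau> * (\<integral>\<^sup>+t. (if \<tau> \<le> t then ennreal ((q t)^2) else 0) \<partial>M) \<le> ennreal (\<epsilon> / ((1 + \<tau>) * sqrt (1 + \<tau>))) * indicator {s..} \<tau>" .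
   qed
   also have "... \<le> (\<integral>\<^sup>+\<tau>. ennreal (\<epsilon> / ((1 + \<tau>) * sqrt (1 + \<tau>))) * indicator {s..} \<tau> \<partial>lborel)" by (rule nn_integral_Ivl_le)
   also have "... = ennreal (0 - (- (2 * \<epsilon> / sqrt (1 + s))))"
   proof (rule nn_integral_FTC_atLeast)
    fix \<tau> assume \<tau>: "s \<le> \<tau>"
    have "((%t. sqrt (1 + t)) has_real_derivative 1 / (2 * sqrt (1 + \<tau>))) (at \<tau>)"
     using \<tau> s by (auto intro!: derivative_eq_intros simp: field_simps)
    then have "((%t. - 2 * \<epsilon> / sqrt (1 + t)) has_real_derivative
      (0 * sqrt (1 + \<tau>) - - 2 * \<epsilon> * (1 / (2 * sqrt (1 + \<tau>)))) / (sqrt (1 + \<tau>) * sqrt (1 + \<tau>))) (at \<tau>)"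
     by (intro DERIV_divide DERIV_const) (use \<tau> s in simp_all)
    also have "(0 * sqrt (1 + \<tau>) - - 2 * \<epsilon> * (1 / (2 * sqrt (1 + \<tau>)))) / (sqrt (1 + \<tau>) * sqrt (1 + \<tau>)) = \<epsilon> / ((1 + \<tau>) * sqrt (1 + \<tau>))"
     using \<tau> s by (simp add: field_simps)
    finally show "((%t. - (2 * \<epsilon> / sqrt (1 + t))) has_real_derivative \<epsilon> / ((1 + \<tau>) * sqrt (1 + \<tau>))) (at \<tau>)" by simp
    show "0 \<le> \<epsilon> / ((1 + \<tau>) * sqrt (1 + \<tau>))" using \<tau> s e by simp
   next
    have "filterlim (%t::real. sqrt (1 + t)) at_top at_top"
     by (rule filterlim_compose[OF sqrt_at_top filterlim_tendsto_add_at_top[OF tendsto_const filterlim_ident]])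
    then show "((%t. - (2 * \<epsilon> / sqrt (1 + t))) \<longlongrightarrow> 0) at_top"
     using tendsto_minus[OF tendsto_divide_0[OF tendsto_const[of "2 * \<epsilon>"] filterlim_at_top_imp_at_infinity]] by fastforce
   qed simp
   finally have "(\<integral>\<^sup>+t. (if s \<le> t then ennreal (sqrt (1 + t) * (q t)^2) else 0) \<partial>M)
     \<le> ennreal (sqrt (1 + s)) * (\<integral>\<^sup>+t. (if s \<le> t then ennreal ((q t)^2) else 0) \<partial>M) + ennreal (2 * \<epsilon> / sqrt (1 + s))"
    by (simp add: add_left_mono)
   also have "... \<le> ennreal (sqrt (1 + s)) * ennreal (2 * \<epsilon> / (1 + s)) + ennreal (2 * \<epsilon> / sqrt (1 + s))"
    by (intro add_right_mono mult_left_mono Tq s) simp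
   also have "... = ennreal (sqrt (1 + s) * (2 * \<epsilon> / (1 + s)) + 2 * \<epsilon> / sqrt (1 + s))"
    using s e by (simp flip: ennreal_mult ennreal_plus)
   also have "sqrt (1 + s) * (2 * \<epsilon> / (1 + s)) = 2 * \<epsilon> / sqrt (1 + s)"
    using s real_sqrt_mult_self[of "1 + s"] by (simp add: field_simps)
   finally show ?thesis by simp
  qed
  then show "AE s in M. (\<integral>\<^sup>+t. (if s \<le> t then ennreal (sqrt (1 + t) * (q t)^2) else 0) \<partial>M) \<le> ennreal (4 * \<epsilon> / sqrt (1 + s))"
   "AE s in M. (\<integral>\<^sup>+t. (if s \<le> t then ennreal (sqrt (1 + t) * (q t)^2) else 0) \<partial>M) \<le> ennreal (4 * \<epsilon> / sqrt (1 + s))" by (rule AE_I2, blast)+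
  show "AE t in M. ennreal (cmod (F t)) \<le> ennreal \<bar>q t\<bar> * (\<integral>\<^sup>+s. (if s \<le> t then ennreal (cmod (g s)) else 0) \<partial>M)
   + (\<integral>\<^sup>+s. (if t \<le> s then ennreal (\<bar>q s\<bar> * cmod (g s)) else 0) \<partial>M)"
   using c AE_space
  proof eventually_elim
   case (elim t)
   then have t: "t \<in> I" by simp
   show ?case
   proof (cases "r \<le> t")
    case False
    then show ?thesis by (simp add: F_def tail_def)
   next
    case True
    have w: "cut 0 t (%_. 1) \<in> L2 M" by (rule window_L2(1)[OF order_refl Ivl_nonneg[OF t] t])
    have "F t = of_real (q t) * prim b g t + ip g (tail t ?Q)"
     using repr[OF t elim(1)] True by (simp only: F_def tail_def q_def if_True)
    then have "cmod (F t) \<le> cmod (of_real (q t) * prim b g t) + cmod (ip g (tail t ?Q))" by (simp only: norm_triangle_ineq)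
    then have "cmod (F t) \<le> \<bar>q t\<bar> * cmod (prim b g t) + cmod (ip g (tail t ?Q))" by (simp only: norm_mult norm_of_real)
    then have "ennreal (cmod (F t)) \<le> ennreal (\<bar>q t\<bar> * cmod (prim b g t) + cmod (ip g (tail t ?Q)))" by (rule ennreal_leI)
    also have "... = ennreal \<bar>q t\<bar> * ennreal (cmod (prim b g t)) + ennreal (cmod (ip g (tail t ?Q)))" by (simp add: ennreal_mult)
    also have "... \<le> ennreal \<bar>q t\<bar> * (\<integral>\<^sup>+s. (if s \<le> t then ennreal (cmod (g s)) else 0) \<partial>M)
      + (\<integral>\<^sup>+s. (if t \<le> s then ennreal (\<bar>q s\<bar> * cmod (g s)) else 0) \<partial>M)"
    proof (intro add_mono mult_left_mono)
     have "ennreal (cmod (prim b g t)) \<le> (\<integral>\<^sup>+s. ennreal (cmod (cut 0 t g s)) \<partial>M)"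
      unfolding prim_def by (rule integral_norm_bound_ennreal[OF cut_integrable[OF g order_refl Ivl_nonneg[OF t] t]])
     also have "... \<le> (\<integral>\<^sup>+s. (if s \<le> t then ennreal (cmod (g s)) else 0) \<partial>M)"
      by (rule nn_integral_mono) (auto simp: cut_def)
     finally show "ennreal (cmod (prim b g t)) \<le> ..." .
     have "ennreal (cmod (ip g (tail t ?Q))) \<le> (\<integral>\<^sup>+s. ennreal (cmod (g s * cnj (tail t ?Q s))) \<partial>M)"
      unfolding L2_inner_def by (rule integral_norm_bound_ennreal[OF L2_mult_integrable[OF g tail_L2[OF Q]]])
     also have "... = (\<integral>\<^sup>+s. (if t \<le> s then ennreal (\<bar>q s\<bar> * cmod (g s)) else 0) \<partial>M)"
      by (rule nn_integral_cong) (use True in "auto simp: tail_def q_def norm_mult mult.commute")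
     finally show "ennreal (cmod (ip g (tail t ?Q))) \<le> ..." .
    qed simp
    finally show ?thesis .
   qed
  qed
  then show "AE t in M. ennreal (cmod (F t)) \<le> ennreal \<bar>q t\<bar> * (\<integral>\<^sup>+s. (if s \<le> t then ennreal (cmod (g s)) else 0) \<partial>M)
   + (\<integral>\<^sup>+s. (if t \<le> s then ennreal (\<bar>q s\<bar> * cmod (g s)) else 0) \<partial>M)" .
 qed (use pred_le_Ivl(1) q g F e in simp_all)
 have "tail r (%_. \<kappa>) = (%t. tail r f t - F t)" by (rule ext) (simp add: tail_def F_def)
 then have "tail r (%_. \<kappa>) \<in> L2 M" using L2_diff[OF tail_L2[OF f] main(1)] by simp
 then have "\<kappa> = 0" by (rule constant_tail_zero) (use r in simp)
 then have "F = tail r f" by (simp add: F_def)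
 then show ?thesis using main(2) by simp
qed

theorem discrete_spectrum_half_line: "has_discrete_spectrum M Hmax"
proof (rule discrete_spectrum_of_tails[OF Hamiltonian_selfadjoint(1)[OF inf]])
 fix \<epsilon> :: real assume e: "\<epsilon> > 0"
 \<comment> \<open>The value for which the Hardy constant
   \<open>2 * sqrt (2 * (4 * (\<epsilon>^2 / 32)))\<close> equals \<open>\<epsilon>\<close>.\<close>
 then have e': "\<epsilon>^2 / 32 > 0" by simp
 obtain r where r: "1 \<le> r" and T: "\<And>t. r \<le> t ==> (\<integral>\<^sup>+s. (if t \<le> s then ennreal ((Q s)^2) else 0) \<partial>M) \<le> ennreal (\<epsilon>^2 / 32 / t)"
  by (rule Q_tail_integral[OF e']) blast
 have s: "2 * sqrt (2 * (4 * (\<epsilon>^2 / 32))) = \<epsilon>" using e by (simp add: real_sqrt_divide)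
 show "\<exists>r\<in>I. 0 < r \<and> (\<exists>\<psi>. form_compact \<psi> \<and> (\<forall>f g. (f, g) \<in> Hmax --> nrm (tail r f) \<le> \<epsilon> * nrm g + \<psi> f g))"
 proof (intro bexI[of _ r] conjI exI allI impI)
  show "form_compact (%f g. cmod (ip f (%_. 0)))" by (rule form_compact_inner(1)[OF L2_zero])
  fix f g assume "(f, g) \<in> Hmax"
  then show "nrm (tail r f) \<le> \<epsilon> * nrm g + cmod (ip f (%_. 0))"
   using half_line_tail[OF r e' T, of f g] unfolding s by simp
 qed (use r in "auto simp: Ivl_half_line")
qed

end

end

end

lemma L2_dominated:
 assumes F: "F \<in> L2 M" and G: "G \<in> borel_measurable M" and le: "AE t in M. cmod (G t) \<le> cmod (F t)"
 shows "G \<in> L2 M" "L2_norm M G \<le> L2_norm M F"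
proof -
 have "(\<integral>\<^sup>+t. ennreal ((cmod (G t))^2) \<partial>M) \<le> (\<integral>\<^sup>+t. ennreal ((cmod (F t))^2) \<partial>M)"
 proof (rule nn_integral_mono_AE)
  show "AE t in M. ennreal ((cmod (G t))^2) \<le> ennreal ((cmod (F t))^2)"
   using le by eventually_elim (intro ennreal_leI power_mono, simp_all)
 qed
 then have "(\<integral>\<^sup>+t. ennreal ((cmod (G t))^2) \<partial>M) \<le> ennreal ((L2_norm M F)^2)" unfolding nn_integral_L2_norm[OF F] .
 from L2_nnI(1)[OF G this] show "G \<in> L2 M" .
 then show "L2_norm M G \<le> L2_norm M F" by (rule L2_norm_mono_AE[OF _ F le])
qed

context delta_chain
begin

section \<open>Necessity\<close>

lemma tail_x_tendsto:
 assumes e: "e \<in> L2 M"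
 shows "(%n. nrm (tail (x n) e)) \<longlonglongrightarrow> 0"
proof -
 have "(%n. LINT t|M. (cmod (tail (x n) e t))^2) \<longlonglongrightarrow> (LINT t|M. 0)"
 proof (rule integral_dominated_convergence[where w="%t. (cmod (e t))^2"])
  show "AE t in M. (%n. (cmod (tail (x n) e t))^2) \<longlonglongrightarrow> 0"
  proof (rule AE_I2)
   fix t assume "t \<in> space M"
   then have "t \<in> I" by simp
   from eventually_lt_x[OF this] show "(%n. (cmod (tail (x n) e t))^2) \<longlonglongrightarrow> 0"
    by (intro tendsto_eventually) (elim eventually_mono, simp add: tail_def)
  qed
  show "(%t. (cmod (tail (x n) e t))^2) \<in> borel_measurable M" for n
   using tail_measurable[OF L2_measurable[OF e], of "x n"] by simp
  show "AE t in M. norm ((cmod (tail (x n) e t))^2) \<le> (cmod (e t))^2" for n by (rule AE_I2) (simp add: tail_def)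
 qed (use L2_integrable_sq[OF e] in simp_all)
 then have "(%n. (nrm (tail (x n) e))^2) \<longlonglongrightarrow> 0" unfolding L2_norm_sq by simp
 then have "(%n. sqrt ((nrm (tail (x n) e))^2)) \<longlonglongrightarrow> sqrt 0" by (rule tendsto_real_sqrt)
 then show ?thesis by simp
qed

lemma prim_const:
 assumes "t \<in> I" shows "prim b (%_. a) t = of_real t * a"
 using lint_window(2)[OF order_refl Ivl_nonneg[OF assms] assms, of a] by (simp add: prim_def cut_def scaleR_conv_of_real)

lemma weighted_cut: "weighted (cut s t g) = cut s t (weighted g)"
 by (rule ext) (simp add: weighted_def cut_def)

section \<open>Necessity on the half-line: square integrals of \<open>k - P\<close>\<close>

context
 assumes inf: "b = \<infinity>"
begin

lemma half_line_kernel: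
 assumes "(e, %_. 0) \<in> Hmax"
 shows "AE t in M. e t = 0"
proof -
 obtain c where e: "e \<in> L2 M" and c: "AE t in M. e t = c - volterra (%_. 0) t" using assms by (rule HmaxE)
 have v: "volterra (%_. 0) t = 0" for t by (simp add: volterra_def weighted_def prim_inner)
 have "tail 0 (%_. c) \<in> L2 M"
 proof (rule L2_cong_AE[OF e tail_measurable])
  show "AE t in M. e t = tail 0 (%_. c) t"
   using c AE_space by eventually_elim (simp add: v tail_def Ivl_half_line[OF inf])
 qed simp
 then have c0: "c = 0" by (rule constant_tail_zero[OF inf]) simp
 from c show ?thesis by eventually_elim (simp add: v c0)
qed

text \<open>The kernel is trivial, so 0 is not an eigenvalue; in a discrete spectrum every point is
  one. Hence 0 is in the resolvent set and any right-hand side may be prescribed.\<close>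

lemma half_line_solvable:
 assumes disc: "has_discrete_spectrum M Hmax" and h: "h \<in> L2 M"
 obtains f where "(f, h) \<in> Hmax"
proof -
 interpret selfadjoint_graph M Hmax by (rule selfadjoint_graph_Hmax[OF Hamiltonian_selfadjoint(1)[OF inf]])
 have "\<not> is_eigenvalue M Hmax 0"
 proof
  assume "is_eigenvalue M Hmax 0"
  then obtain f where f: "(f, %t. 0 * f t) \<in> Hmax" "nrm f = 1" by (rule eigenvalue_obtain)
  have "(f, %_. 0) \<in> Hmax" using f(1) by simp
  then have "AE t in M. f t = 0" by (rule half_line_kernel)
  then have "L2_eq M f (%_. 0)" by (simp only: L2_eq_def)
  moreover have "f \<in> L2 M" using f(1) by (rule HmaxE)
  ultimately show False using L2_norm_eq_0_iff[of f M] f(2) by simp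
 qed
 then have "0 \<in> resolvent_set M Hmax" using discrete_spectrum_eigenvalue(1)[OF disc, of 0] unfolding op_spectrum_def by blast
 from resolvent_solve[OF this h] show thesis using that by auto
qed

text \<open>Splitting at a node \<open>x m\<close>, the part of the window before it has norm of
  order \<open>1 / sqrt r\<close>, and the part after it meets only the tail of \<open>e\<close>,
  which is small for large \<open>m\<close>.\<close>

lemma spread_window_weakly_null:
 assumes e: "e \<in> L2 M"
 shows "((%r. ip (cut 0 r (%_. of_real (1 / sqrt r))) e) \<longlongrightarrow> 0) at_top"
proof (rule tendstoI)
 fix \<delta> :: real assume d: "0 < \<delta>"
 have "\<forall>\<^sub>F m in sequentially. nrm (tail (x m) e) < \<delta> / 2"
  using order_tendstoD(2)[OF tail_x_tendsto[OF e], of "\<delta> / 2"] d by simp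
 then obtain m where m: "nrm (tail (x m) e) < \<delta> / 2" by (auto simp: eventually_sequentially)
 have "((%r. sqrt (x m) * nrm e / sqrt r) \<longlongrightarrow> 0) at_top"
  by (rule tendsto_divide_0[OF tendsto_const filterlim_at_top_imp_at_infinity[OF sqrt_at_top]])
 then have "\<forall>\<^sub>F r in at_top. sqrt (x m) * nrm e / sqrt r < \<delta> / 2" using d by (intro order_tendstoD(2)) auto
 moreover have "\<forall>\<^sub>F r in at_top. x m \<le> r" by (rule eventually_ge_at_top)
 moreover have "\<forall>\<^sub>F r::real in at_top. 0 < r" by (rule eventually_gt_at_top)
 ultimately show "\<forall>\<^sub>F r in at_top. dist (ip (cut 0 r (%_. of_real (1 / sqrt r))) e) 0 < \<delta>"
 proof eventually_elim
  case (elim r)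
  have I: "x m \<in> I" "r \<in> I" using elim x_nonneg[of m] by (simp_all add: Ivl_half_line[OF inf])
  let ?u = "cut 0 (x m) (%_. 1) :: real \<Rightarrow> complex" and ?v = "cut (x m) r (%_. 1) :: real \<Rightarrow> complex"
  note u = window_L2[OF order_refl x_nonneg I(1)] and v = window_L2[OF x_nonneg elim(2) I(2)]
  have "cut 0 r (%_. of_real (1 / sqrt r)) = (%t. of_real (1 / sqrt r) * (?u t + ?v t))"
   using elim x_nonneg[of m] by (intro ext) (auto simp: cut_def)
  then have "ip (cut 0 r (%_. of_real (1 / sqrt r))) e = of_real (1 / sqrt r) * (ip ?u e + ip ?v e)"
   by (simp only: L2_inner_cmult_left L2_inner_add_left[OF u(1) v(1) e])
  also have "ip ?v e = ip ?v (tail (x m) e)"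
   unfolding L2_inner_def by (rule Bochner_Integration.integral_cong) (auto simp: cut_def tail_def)
  finally have "cmod (ip (cut 0 r (%_. of_real (1 / sqrt r))) e) = (1 / sqrt r) * cmod (ip ?u e + ip ?v (tail (x m) e))"
   using elim by (simp add: norm_mult norm_divide)
  also have "... \<le> (1 / sqrt r) * (sqrt (x m) * nrm e + sqrt r * nrm (tail (x m) e))"
  proof (intro mult_left_mono order_trans[OF norm_triangle_ineq add_mono])
   show "cmod (ip ?u e) \<le> sqrt (x m) * nrm e" using L2_Cauchy_Schwarz[OF u(1) e] u(2) by simp
   have "cmod (ip ?v (tail (x m) e)) \<le> sqrt (r - x m) * nrm (tail (x m) e)"
    using L2_Cauchy_Schwarz[OF v(1) tail_L2[OF e]] v(2) by simp
   also have "... \<le> sqrt r * nrm (tail (x m) e)" using x_nonneg[of m] by (intro mult_right_mono) simp_all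
   finally show "cmod (ip ?v (tail (x m) e)) \<le> sqrt r * nrm (tail (x m) e)" .
  qed (use elim in simp)
  also have "... = sqrt (x m) * nrm e / sqrt r + nrm (tail (x m) e)" using elim by (simp add: field_simps)
  also have "... < \<delta> / 2 + \<delta> / 2" by (rule add_strict_mono[OF elim(1) m])
  finally show ?case by simp
 qed
qed

text \<open>Let \<open>f\<close> solve the equation for the unit window \<open>h r\<close>. Beyond
  \<open>r\<close> the primitive of \<open>h r\<close> is \<open>sqrt r\<close> and its weighted
  primitive is constant, so \<open>f / sqrt r\<close> is a constant minus \<open>P\<close> there.
  The windows are weakly null, so the compactness estimate makes the norm of \<open>f\<close> at
  most \<open>sqrt \<epsilon>\<close> for all large \<open>r\<close>. At this stage \<open>k\<close>
  still depends on \<open>r\<close>.\<close>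

lemma half_line_necessary:
 assumes disc: "has_discrete_spectrum M Hmax" and e: "\<epsilon> > 0"
 obtains r0 where "0 < r0" "\<And>r. r0 \<le> r ==> \<exists>k::real. tail r (%t. of_real (k - P t)) \<in> L2 M \<and> r * (nrm (tail r (%t. of_real (k - P t))))^2 \<le> \<epsilon>"
proof -
 interpret selfadjoint_graph M Hmax by (rule selfadjoint_graph_Hmax[OF Hamiltonian_selfadjoint(1)[OF inf]])
 define h where "h r = cut 0 r (%_. of_real (1 / sqrt r) :: complex)" for r
 define \<delta> where "\<delta> = sqrt \<epsilon> / 2"
 have d: "\<delta> > 0" using e by (simp add: \<delta>_def)
 from discrete_spectrum_bound[OF disc d] obtain E K where E: "finite E" "E \<subseteq> L2 M"
  and bound: "\<forall>f g. (f, g) \<in> Hmax --> (\<forall>e. (e, %_. 0) \<in> Hmax --> ip f e = 0) -->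
    nrm f \<le> \<delta> * nrm g + K * (\<Sum>e\<in>E. cmod (ip g e))"
  by (elim exE conjE)
 have "((%r. K * (\<Sum>e\<in>E. cmod (ip (h r) e))) \<longlongrightarrow> K * (\<Sum>e\<in>E. 0)) at_top"
  unfolding h_def by (intro tendsto_mult tendsto_const tendsto_sum tendsto_norm_zero spread_window_weakly_null) (use E in blast)
 then have "\<forall>\<^sub>F r in at_top. K * (\<Sum>e\<in>E. cmod (ip (h r) e)) < \<delta>" using d by (intro order_tendstoD(2)) auto
 then obtain r1 where r1: "\<And>r. r1 \<le> r ==> K * (\<Sum>e\<in>E. cmod (ip (h r) e)) < \<delta>" by (auto simp: eventually_at_top_linorder)
 show thesis
 proof (rule that)
  show "0 < max r1 1" by simp
  fix r assume "max r1 1 \<le> r"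
  then have r: "r1 \<le> r" "0 < r" by auto
  have rI: "r \<in> I" using r by (simp add: Ivl_half_line[OF inf])
  let ?a = "of_real (1 / sqrt r) :: complex"
  have h: "h r \<in> L2 M" "nrm (h r) = 1"
  proof -
   have eq: "h r = (%t. ?a * cut 0 r (%_. 1) t)" by (rule ext) (simp add: h_def cut_def)
   note w = window_L2[OF order_refl less_imp_le[OF r(2)] rI]
   show "h r \<in> L2 M" unfolding eq by (rule L2_cmult[OF w(1)])
   show "nrm (h r) = 1" unfolding eq L2_norm_cmult w(2) using r by (simp add: norm_divide)
  qed
  obtain f where fh: "(f, h r) \<in> Hmax" by (rule half_line_solvable[OF disc h(1)])
  obtain c where f: "f \<in> L2 M" and c: "AE t in M. f t = c - volterra (h r) t" using fh by (rule HmaxE)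
  have "ip f e = 0" if "(e, %_. 0) \<in> Hmax" for e
  proof -
   have "e \<in> L2 M" using that by (rule HmaxE)
   then have "ip f e = ip f (%_. 0)"
    by (intro L2_inner_cong_AE(2)) (use half_line_kernel[OF that] L2_measurable f in auto)
   then show ?thesis by simp
  qed
  with bound fh have "nrm f \<le> \<delta> * nrm (h r) + K * (\<Sum>e\<in>E. cmod (ip (h r) e))" by blast
  then have fn: "nrm f \<le> sqrt \<epsilon>" using r1[OF r(1)] h(2) by (simp add: \<delta>_def)
  define m where "m = prim b (weighted (%_. ?a)) r"
  \<comment> \<open>The constant may be complex while \<open>P\<close> is real; its real part gives
    a function that is pointwise no larger.\<close>
  define k where "k = Re ((c + m) / of_real (sqrt r))"
  have ft: "cmod (of_real (k - P t)) \<le> cmod (of_real (1 / sqrt r) * f t)" if t: "r \<le> t" and ft: "f t = c - volterra (h r) t" for t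
  proof -
   have "prim b (h r) t = of_real (sqrt r)"
    unfolding h_def prim_cut_ge[OF t] prim_const[OF rI] of_real_mult[symmetric] using r by (simp add: real_div_sqrt)
   moreover have "prim b (weighted (h r)) t = m" unfolding h_def weighted_cut prim_cut_ge[OF t] m_def ..
   ultimately have "f t = c + m - of_real (P t) * of_real (sqrt r)" unfolding ft volterra_def by simp
   then have "of_real (1 / sqrt r) * f t = (c + m) / of_real (sqrt r) - of_real (P t)" using r by (simp add: field_simps)
   then have "k - P t = Re (of_real (1 / sqrt r) * f t)" by (simp add: k_def)
   then show ?thesis using abs_Re_le_cmod by (simp only: norm_of_real)
  qed
  let ?G = "tail r (%t. of_real (k - P t)) :: real \<Rightarrow> complex"
  have F: "(%t. of_real (1 / sqrt r) * f t) \<in> L2 M" by (rule L2_cmult[OF f])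
  have mG: "?G \<in> borel_measurable M"
   by (rule tail_measurable, rule borel_measurable_continuous_on[where f="%p. of_real (k - p)", OF _ P_measurable]) (intro continuous_intros)
  have le: "AE t in M. cmod (?G t) \<le> cmod (of_real (1 / sqrt r) * f t)"
   using c
  proof eventually_elim
   case (elim t)
   show ?case
   proof (cases "r \<le> t")
    case True
    then show ?thesis using ft[OF True elim] by (simp only: tail_def if_True)
   qed (simp add: tail_def)
  qed
  have "nrm ?G \<le> nrm (%t. of_real (1 / sqrt r) * f t)" by (rule L2_dominated(2)[OF F mG le])
  also have "... = nrm f / sqrt r" unfolding L2_norm_cmult using r by (simp add: norm_divide)
  also have "... \<le> sqrt \<epsilon> / sqrt r" using fn r by (simp add: divide_right_mono)
  finally have "(nrm ?G)^2 \<le> (sqrt \<epsilon> / sqrt r)^2" by (rule power_mono) simp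
  then have "r * (nrm ?G)^2 \<le> \<epsilon>" using r e by (simp add: power_divide field_simps)
  then show "\<exists>k::real. tail r (%t. of_real (k - P t)) \<in> L2 M \<and> r * (nrm (tail r (%t. of_real (k - P t))))^2 \<le> \<epsilon>"
   using L2_dominated(1)[OF F mG le] by blast
 qed
qed

text \<open>Mean and variance: \<open>s - u\<close> has mean \<open>(v - u) / 2\<close> on the
  interval, and its variance contributes \<open>(v - u) ^ 3 / 12\<close> for every
  \<open>\<kappa>\<close>.\<close>

lemma interval_square_integral:
 assumes uv: "0 \<le> u" "u \<le> v"
 shows "(\<integral>\<^sup>+s. (if u \<le> s \<and> s < v then ennreal ((\<kappa> - (s - u))^2) else 0) \<partial>M)
  = ennreal ((v - u) * (\<kappa> - (v - u) / 2)^2 + (v - u) ^ 3 / 12)"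
proof -
 have "(\<integral>\<^sup>+s. (if u \<le> s \<and> s < v then ennreal ((\<kappa> - (s - u))^2) else 0) \<partial>M) = (\<integral>\<^sup>+s. (if u \<le> s \<and> s < v then ennreal ((\<kappa> - (s - u))^2) else 0) \<partial>lborel)"
  by (rule nn_integral_Ivl_eq) (use uv in "auto simp: Ivl_half_line[OF inf]")
 also have "... = (\<integral>\<^sup>+s. ennreal ((\<kappa> - (s - u))^2) * indicator {u..v} s \<partial>lborel)"
  by (rule nn_integral_cong_AE, rule AE_mp[OF AE_lborel_singleton[of v]], rule AE_I2) (auto simp: indicator_def)
 also have "... = ennreal ((- ((\<kappa> - (v - u)) ^ 3 / 3)) - (- ((\<kappa> - (u - u)) ^ 3 / 3)))"
 proof (rule nn_integral_FTC_Icc)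
  fix s
  show "((%s. - ((\<kappa> - (s - u)) ^ 3 / 3)) has_real_derivative (\<kappa> - (s - u))^2) (at s)"
   by (auto intro!: derivative_eq_intros)
 qed (use uv in auto)
 also have "(- ((\<kappa> - (v - u)) ^ 3 / 3)) - (- ((\<kappa> - (u - u)) ^ 3 / 3)) = (v - u) * (\<kappa> - (v - u) / 2)^2 + (v - u) ^ 3 / 12"
 proof -
  have "(- ((\<kappa> - d) ^ 3 / 3)) - (- (\<kappa> ^ 3 / 3)) = d * (\<kappa> - d / 2)^2 + d ^ 3 / 12" for d :: real
   by (simp add: power2_eq_square power3_eq_cube field_simps)
  from this[of "v - u"] show ?thesis by simp
 qed
 finally show ?thesis .
qed

abbreviation partial_sum :: "nat \<Rightarrow> real" where "partial_sum n \<equiv> \<Sum>j=1..n. \<beta> j + gap x j"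

text \<open>The cells from \<open>i\<close> on are disjoint and lie beyond \<open>r\<close>, and on
  cell \<open>j\<close> the function \<open>P\<close> is \<open>partial_sum j + (s - x j)\<close>.
  Finite sums are used so that no convergence is presupposed.\<close>

lemma interval_sum_le:
 assumes G: "tail r (%t. of_real (k - P t)) \<in> L2 M" and r: "r \<le> x i"
 shows "(\<Sum>j\<in>{i..<m}. gap x (Suc j) * (k - partial_sum j - gap x (Suc j) / 2)^2 + gap x (Suc j) ^ 3 / 12)
  \<le> (nrm (tail r (%t. of_real (k - P t))))^2"
proof -
 let ?J = "%j. gap x (Suc j) * (k - partial_sum j - gap x (Suc j) / 2)^2 + gap x (Suc j) ^ 3 / 12"
 have gp: "0 \<le> gap x (Suc j)" for j by (simp add: gap_def)
 define w where "w j s = (if x j \<le> s \<and> s < x (Suc j) then ennreal ((k - partial_sum j - (s - x j))^2) else 0)" for j s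
 have mw: "w j \<in> borel_measurable M" for j
  unfolding w_def by (rule measurable_compose[OF id_borel_measurable_Ivl]) measurable
 have "ennreal (\<Sum>j\<in>{i..<m}. ?J j) = (\<Sum>j\<in>{i..<m}. ennreal (?J j))"
 proof (rule sum_ennreal[symmetric])
  fix j
  show "0 \<le> ?J j" by (rule add_nonneg_nonneg[OF mult_nonneg_nonneg[OF gp zero_le_power2]]) (simp add: gp)
 qed
 also have "... = (\<Sum>j\<in>{i..<m}. \<integral>\<^sup>+s. w j s \<partial>M)"
 proof (rule sum.cong[OF refl])
  fix j
  show "ennreal (?J j) = (\<integral>\<^sup>+s. w j s \<partial>M)"
   unfolding w_def using interval_square_integral[OF x_nonneg, of j "x (Suc j)" "k - partial_sum j"] by (simp add: gap_def)
 qed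
 also have "... = (\<integral>\<^sup>+s. (\<Sum>j\<in>{i..<m}. w j s) \<partial>M)" by (rule nn_integral_sum[symmetric]) (rule mw)
 also have "... \<le> (\<integral>\<^sup>+s. ennreal ((cmod (tail r (%t. of_real (k - P t)) s))^2) \<partial>M)"
 proof (rule nn_integral_mono)
  fix s assume "s \<in> space M"
  then have "s \<in> I" by simp
  then obtain n where n: "x n \<le> s" "s < x (Suc n)" by (rule interval_obtain)
  have "w j s = (if j = n then w n s else 0)" for j
  proof (cases "x j \<le> s \<and> s < x (Suc j)")
   case True
   then have "x j < x (Suc n)" "x n < x (Suc j)" using n by linarith+
   then have "j = n" by (simp only: x_less_iff)
   then show ?thesis by simp
  next
   case False
   then have "j \<noteq> n" using n by blast
   moreover have "w j s = 0" unfolding w_def if_not_P[OF False] ..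
   ultimately show ?thesis by simp
  qed
  then have "(\<Sum>j\<in>{i..<m}. w j s) = (\<Sum>j\<in>{i..<m}. if j = n then w n s else 0)" by (intro sum.cong refl)
  also have "... = (if n \<in> {i..<m} then w n s else 0)" by (rule sum.delta[OF finite_atLeastLessThan, of n "%_. w n s"])
  also have "... \<le> ennreal ((cmod (tail r (%t. of_real (k - P t)) s))^2)"
  proof (cases "n \<in> {i..<m}")
   case True
   then have "x i \<le> x n" by simp
   then have "r \<le> s" using r n(1) by linarith
   moreover have "w n s = ennreal ((k - P s)^2)" unfolding w_def P_eq_partial_sum[OF n] using n by (simp add: algebra_simps)
   ultimately show ?thesis unfolding if_P[OF True] by (simp only: tail_def if_True norm_of_real power2_abs order_refl)
  next
   case False
   show ?thesis unfolding if_not_P[OF False] by (rule zero_le)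
  qed
  finally show "(\<Sum>j\<in>{i..<m}. w j s) \<le> ennreal ((cmod (tail r (%t. of_real (k - P t)) s))^2)" .
 qed
 also have "... = ennreal ((nrm (tail r (%t. of_real (k - P t))))^2)" by (rule nn_integral_L2_norm[OF G])
 finally show ?thesis by simp
qed

lemma half_line_necessary_sums:
 assumes disc: "has_discrete_spectrum M Hmax" and e: "\<epsilon> > 0"
 obtains r0 where "0 < r0" "\<And>r. r0 \<le> r ==> \<exists>k::real. \<forall>i m. r \<le> x i -->
   r * (\<Sum>j\<in>{i..<m}. gap x (Suc j) * (k - partial_sum j - gap x (Suc j) / 2)^2 + gap x (Suc j) ^ 3 / 12) \<le> \<epsilon>"
proof -
 obtain r0 where r0: "0 < r0" "\<And>r. r0 \<le> r ==> \<exists>k::real. tail r (%t. of_real (k - P t)) \<in> L2 M \<and> r * (nrm (tail r (%t. of_real (k - P t))))^2 \<le> \<epsilon>"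
  by (rule half_line_necessary[OF disc e]) blast
 show thesis
 proof (rule that[OF r0(1)])
  fix r assume r: "r0 \<le> r"
  from r0(2)[OF r] obtain k :: real where k: "tail r (%t. of_real (k - P t)) \<in> L2 M" "r * (nrm (tail r (%t. of_real (k - P t))))^2 \<le> \<epsilon>"
   by (elim exE conjE)
  show "\<exists>k::real. \<forall>i m. r \<le> x i -->
   r * (\<Sum>j\<in>{i..<m}. gap x (Suc j) * (k - partial_sum j - gap x (Suc j) / 2)^2 + gap x (Suc j) ^ 3 / 12) \<le> \<epsilon>"
  proof (intro exI allI impI)
   fix i m assume i: "r \<le> x i"
   show "r * (\<Sum>j\<in>{i..<m}. gap x (Suc j) * (k - partial_sum j - gap x (Suc j) / 2)^2 + gap x (Suc j) ^ 3 / 12) \<le> \<epsilon>"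
    by (rule order_trans[OF mult_left_mono[OF interval_sum_le[OF k(1) i]] k(2)]) (use r0(1) r in simp)
  qed
 qed
qed

end

section \<open>Necessity on the half-line: the two limits\<close>

context
 assumes inf: "b = \<infinity>" and disc: "has_discrete_spectrum M Hmax"
  and nonneg: "\<And>n. 1 \<le> n ==> 0 \<le> \<beta> n + gap x n"
  and bdd: "bdd_above (gap x ` {1..})"
begin

abbreviation cell :: "real \<Rightarrow> nat \<Rightarrow> real" where
 "cell k j \<equiv> gap x (Suc j) * (k - partial_sum j - gap x (Suc j) / 2)^2 + gap x (Suc j) ^ 3 / 12"

lemma gap_nonneg: "0 \<le> gap x (Suc j)"
 by (simp add: gap_def)

lemma gap_bound_obtain:
 obtains D where "0 < D" "\<And>j. gap x (Suc j) \<le> D"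
proof -
 obtain D where D: "\<And>y. y \<in> gap x ` {1..} ==> y \<le> D" using bdd unfolding bdd_above_def by blast
 show thesis
 proof (rule that[of "max D 1"])
  show "gap x (Suc j) \<le> max D 1" for j using D[of "gap x (Suc j)"] by force
 qed simp
qed

lemma cell_ge_cube: "gap x (Suc j) ^ 3 / 12 \<le> cell k j"
 using gap_nonneg by simp

text \<open>Completing the square in the gap, for fixed \<open>k - partial_sum j\<close>;
  \<open>1/4\<close> is the largest factor for which the difference remains a square with a
  nonnegative factor.\<close>

lemma cell_ge_square: "gap x (Suc j) * (k - partial_sum j)^2 / 4 \<le> cell k j"
proof -
 have "cell k j - gap x (Suc j) * (k - partial_sum j)^2 / 4 = gap x (Suc j) * (3 * (k - partial_sum j) / 2 - gap x (Suc j))^2 / 3"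
  by (simp add: power2_eq_square power3_eq_cube field_simps)
 also have "... \<ge> 0" using gap_nonneg by simp
 finally show ?thesis by simp
qed

lemma sum_gap: "i \<le> m ==> (\<Sum>j\<in>{i..<m}. gap x (Suc j)) = x m - x i"
 using sum_Suc_diff'[of i m x] by (simp add: gap_def)

lemma partial_sum_mono: "m \<le> n ==> partial_sum m \<le> partial_sum n"
 by (rule sum_mono2) (use nonneg in auto)

lemma x_unbounded: "\<exists>n. r \<le> x n"
proof -
 have "max r 0 \<in> I" by (simp add: Ivl_half_line[OF inf])
 then obtain n where "max r 0 < x n" using ex_x_gt by blast
 then show ?thesis by (intro exI[of _ n]) simp
qed

lemma eventually_x_ge: "\<exists>N. \<forall>n\<ge>N. r \<le> x n"
proof -
 obtain N where N: "r \<le> x N" using x_unbounded by blast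
 have "r \<le> x n" if "N \<le> n" for n using N that x_le_iff[of N n] by linarith
 then show ?thesis by blast
qed

text \<open>With \<open>r = x n\<close> the estimate bounds the cubes of the gaps following
  \<open>x n\<close> by \<open>12 * \<epsilon> / x n\<close>. In the limit this series is multiplied
  by \<open>x (Suc n)\<close>, not by \<open>x n\<close>; the quotient of the two is at most 2 once
  \<open>x n\<close> exceeds the bound \<open>D\<close> of the gaps, hence the constant 24.\<close>

lemma cubes_tendsto:
 "summable (%j. gap x j ^ 3)" "(%n. x n * (\<Sum>j. gap x (n + j) ^ 3)) \<longlonglongrightarrow> 0"
proof -
 obtain D where D: "0 < D" "\<And>j. gap x (Suc j) \<le> D" by (rule gap_bound_obtain) blast
 have key: "\<exists>N. \<forall>n\<ge>N. summable (%j. gap x (Suc n + j) ^ 3) \<and> x (Suc n) * (\<Sum>j. gap x (Suc n + j) ^ 3) \<le> 24 * \<epsilon>" if e: "\<epsilon> > 0" for \<epsilon>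
 proof -
  obtain r0 where r0: "0 < r0" "\<And>r. r0 \<le> r ==> \<exists>k::real. \<forall>i m. r \<le> x i --> r * (\<Sum>j\<in>{i..<m}. cell k j) \<le> \<epsilon>"
   by (rule half_line_necessary_sums[OF inf disc e]) blast
  obtain N where N: "\<forall>n\<ge>N. max r0 D \<le> x n" using eventually_x_ge by blast
  have "summable (%j. gap x (Suc n + j) ^ 3) \<and> x (Suc n) * (\<Sum>j. gap x (Suc n + j) ^ 3) \<le> 24 * \<epsilon>" if n: "N \<le> n" for n
  proof -
   have xn: "r0 \<le> x n" "D \<le> x n" "0 < x n" using N n r0(1) by (auto simp: max_def split: if_splits intro: less_le_trans)
   from r0(2)[OF xn(1)] obtain k where k: "\<forall>i m. x n \<le> x i --> x n * (\<Sum>j\<in>{i..<m}. cell k j) \<le> \<epsilon>" by blast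
   have part: "(\<Sum>j<m. gap x (Suc n + j) ^ 3) \<le> 12 * \<epsilon> / x n" for m
   proof -
    have "(\<Sum>j<m. gap x (Suc n + j) ^ 3) / 12 = (\<Sum>j\<in>{n..<n + m}. gap x (Suc j) ^ 3 / 12)"
     by (simp add: sum_divide_distrib sum.shift_bounds_nat_ivl[of _ 0 n m, simplified] atLeast0LessThan[symmetric] add.commute)
    also have "... \<le> (\<Sum>j\<in>{n..<n + m}. cell k j)" by (rule sum_mono) (rule cell_ge_cube)
    also have "... \<le> \<epsilon> / x n" using k[rule_format, of n "n + m"] xn(3) by (simp add: pos_le_divide_eq mult.commute)
    finally have "(\<Sum>j<m. gap x (Suc n + j) ^ 3) \<le> 12 * (\<epsilon> / x n)" by linarith
    then show ?thesis by (simp only: times_divide_eq_right)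
   qed
   have s: "summable (%j. gap x (Suc n + j) ^ 3)"
    by (rule bounded_imp_summable[where B="12 * \<epsilon> / x n"])
     (use part[of "Suc _"] gap_nonneg in "simp_all add: lessThan_Suc_atMost")
   have "(\<Sum>j. gap x (Suc n + j) ^ 3) \<le> 12 * \<epsilon> / x n" by (rule suminf_le_const[OF s part])
   moreover have "0 \<le> (\<Sum>j. gap x (Suc n + j) ^ 3)" by (rule suminf_nonneg[OF s]) (use gap_nonneg in simp)
   moreover have "x (Suc n) \<le> 2 * x n" using D(2)[of n] xn(2) by (simp add: gap_def)
   ultimately have "x (Suc n) * (\<Sum>j. gap x (Suc n + j) ^ 3) \<le> (2 * x n) * (12 * \<epsilon> / x n)"
    using xn(3) by (intro mult_mono) auto
   then show ?thesis using s xn(3) by simp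
  qed
  then show ?thesis by blast
 qed
 obtain N where "summable (%j. gap x (Suc N + j) ^ 3)" using key[of 1] by auto
 then have "summable (%j. gap x (j + Suc N) ^ 3)" by (simp only: add.commute)
 then show s: "summable (%j. gap x j ^ 3)" by (rule summable_iff_shift[of "%j. gap x j ^ 3", THEN iffD1])
 have "(%n. x (Suc n) * (\<Sum>j. gap x (Suc n + j) ^ 3)) \<longlonglongrightarrow> 0"
 proof (rule LIMSEQ_I)
  fix r :: real assume "0 < r"
  then obtain N where N: "\<forall>n\<ge>N. summable (%j. gap x (Suc n + j) ^ 3) \<and> x (Suc n) * (\<Sum>j. gap x (Suc n + j) ^ 3) \<le> 24 * (r / 48)"
   using key[of "r / 48"] by auto
  have "norm (x (Suc n) * (\<Sum>j. gap x (Suc n + j) ^ 3) - 0) < r" if n: "N \<le> n" for n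
  proof -
   have "0 \<le> (\<Sum>j. gap x (Suc n + j) ^ 3)" by (rule suminf_nonneg) (use N n gap_nonneg in auto)
   then have "0 \<le> x (Suc n) * (\<Sum>j. gap x (Suc n + j) ^ 3)" using x_nonneg by simp
   moreover have "x (Suc n) * (\<Sum>j. gap x (Suc n + j) ^ 3) \<le> 24 * (r / 48)" using N n by blast
   ultimately show ?thesis using \<open>0 < r\<close> by (simp only: real_norm_def)
  qed
  then show "\<exists>N. \<forall>n\<ge>N. norm (x (Suc n) * (\<Sum>j. gap x (Suc n + j) ^ 3) - 0) < r" by blast
 qed
 then show "(%n. x n * (\<Sum>j. gap x (n + j) ^ 3)) \<longlonglongrightarrow> 0" by (rule LIMSEQ_imp_Suc)
qed

text \<open>If the partial sums stayed at a distance \<open>\<delta>\<close> from \<open>k\<close>,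
  the cells would add up to infinity along with the gaps. So they come arbitrarily close to
  \<open>k\<close> arbitrarily late, and being monotone they converge. In particular the
  \<open>k\<close> found for different \<open>r\<close> coincide.\<close>

lemma partial_sum_tendsto_of_cells:
 assumes r: "0 < r" and k: "\<forall>i m. r \<le> x i --> r * (\<Sum>j\<in>{i..<m}. cell k j) \<le> \<epsilon>"
 shows "partial_sum \<longlonglongrightarrow> k"
proof -
 have near: "\<exists>j\<ge>J. \<bar>k - partial_sum j\<bar> < \<delta>" if d: "\<delta> > 0" for \<delta> J
 proof (rule ccontr)
  assume "\<not> (\<exists>j\<ge>J. \<bar>k - partial_sum j\<bar> < \<delta>)"
  then have far: "\<delta> \<le> \<bar>k - partial_sum j\<bar>" if "J \<le> j" for j using that by (meson not_less)
  obtain N where N: "\<forall>n\<ge>N. r \<le> x n" using eventually_x_ge by blast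
  define i where "i = max J N"
  have xi: "r \<le> x i" using N by (simp add: i_def)
  \<comment> \<open>Each cell is at least its gap times \<open>\<delta>^2 / 4\<close>, so gaps of
    this total length push the sum up to \<open>\<epsilon> / r + 1\<close>, past its bound.\<close>
  obtain m where m: "x i + 4 * (\<epsilon> / r + 1) / \<delta>^2 \<le> x m" using x_unbounded by blast
  have "\<epsilon> \<ge> 0" using k[rule_format, OF xi, of i] by simp
  then have "x i < x m" using m r d by (smt (verit) divide_nonneg_pos divide_pos_pos zero_less_power)
  then have im: "i \<le> m" by simp
  have "(\<epsilon> / r + 1) \<le> (x m - x i) * \<delta>^2 / 4" using m d by (simp add: field_simps)
  also have "... = (\<Sum>j\<in>{i..<m}. gap x (Suc j) * \<delta>^2 / 4)" by (simp add: sum_gap[OF im, symmetric] sum_divide_distrib sum_distrib_right)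
  also have "... \<le> (\<Sum>j\<in>{i..<m}. cell k j)"
  proof (rule sum_mono)
   fix j assume "j \<in> {i..<m}"
   then have "\<delta> \<le> \<bar>k - partial_sum j\<bar>" by (intro far) (simp add: i_def)
   then have "\<delta>^2 \<le> \<bar>k - partial_sum j\<bar>^2" by (rule power_mono) (use d in simp)
   then have "\<delta>^2 \<le> (k - partial_sum j)^2" by (simp only: power2_abs)
   then have "gap x (Suc j) * \<delta>^2 / 4 \<le> gap x (Suc j) * (k - partial_sum j)^2 / 4"
    by (intro divide_right_mono mult_left_mono gap_nonneg) simp_all
   then show "gap x (Suc j) * \<delta>^2 / 4 \<le> cell k j" by (rule order_trans[OF _ cell_ge_square])
  qed
  also have "... \<le> \<epsilon> / r" using k[rule_format, OF xi, of m] r by (simp add: pos_le_divide_eq mult.commute)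
  finally show False by simp
 qed
 show ?thesis
 proof (rule LIMSEQ_I)
  fix \<delta> :: real assume d: "0 < \<delta>"
  obtain i where i: "\<bar>k - partial_sum i\<bar> < \<delta>" using near[OF d, of 0] by blast
  have "norm (partial_sum n - k) < \<delta>" if n: "i \<le> n" for n
  proof -
   obtain j where "n \<le> j" "\<bar>k - partial_sum j\<bar> < \<delta>" using near[OF d, of n] by blast
   then show ?thesis using i partial_sum_mono[OF n] partial_sum_mono[of n j] unfolding real_norm_def by linarith
  qed
  then show "\<exists>N. \<forall>n\<ge>N. norm (partial_sum n - k) < \<delta>" by blast
 qed
qed

text \<open>By monotonicity the remainder \<open>p - partial_sum n\<close> is the smallest among the
  indices up to \<open>n\<close>. On the cells between \<open>y / 2\<close> and
  \<open>y = x (Suc n)\<close>, of total length at least \<open>y / 4\<close>, its square therefore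
  bounds the cells from below, and the estimate with \<open>r = y / 2\<close> controls the square of
  \<open>y\<close> times the remainder.\<close>

lemma remainders_tendsto:
 "summable (%j. \<beta> j + gap x j)" "(%n. x n * (\<Sum>j. (\<beta> (n + j) + gap x (n + j)))) \<longlonglongrightarrow> 0"
proof -
 obtain D where D: "0 < D" "\<And>j. gap x (Suc j) \<le> D" by (rule gap_bound_obtain) blast
 obtain r0 where r0: "0 < r0" "\<And>r. r0 \<le> r ==> \<exists>k::real. \<forall>i m. r \<le> x i --> r * (\<Sum>j\<in>{i..<m}. cell k j) \<le> 1"
  by (rule half_line_necessary_sums[OF inf disc zero_less_one]) blast
 from r0(2)[OF order_refl] obtain p where p: "\<forall>i m. r0 \<le> x i --> r0 * (\<Sum>j\<in>{i..<m}. cell p j) \<le> 1" by blast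
 have lim: "partial_sum \<longlonglongrightarrow> p" by (rule partial_sum_tendsto_of_cells[OF r0(1) p])
 let ?a = "%j. \<beta> (Suc j) + gap x (Suc j)"
 have ps: "partial_sum n = sum ?a {..<n}" for n by (induction n) simp_all
 have sums: "?a sums p" unfolding sums_def ps[symmetric] by (rule lim)
 then show "summable (%j. \<beta> j + gap x j)" by (intro summable_Suc_iff[of "%j. \<beta> j + gap x j", THEN iffD1] sums_summable)
 have rem: "(\<Sum>j. \<beta> (Suc n + j) + gap x (Suc n + j)) = p - partial_sum n" for n
 proof -
  have "suminf ?a = (\<Sum>j. ?a (j + n)) + sum ?a {..<n}" by (rule suminf_split_initial_segment[OF sums_summable[OF sums]])
  moreover have "(\<Sum>j. ?a (j + n)) = (\<Sum>j. \<beta> (Suc n + j) + gap x (Suc n + j))" by (simp only: add_Suc add.commute[of n])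
  ultimately show ?thesis using sums_unique[OF sums] ps[of n] by simp
 qed
 have le_p: "partial_sum n \<le> p" for n by (rule LIMSEQ_le_const[OF lim]) (use partial_sum_mono in blast)
 have "(%n. x (Suc n) * (p - partial_sum n)) \<longlonglongrightarrow> 0"
 proof (rule LIMSEQ_I)
  fix \<delta> :: real assume d: "0 < \<delta>"
  \<comment> \<open>The factors \<open>1/2\<close> from \<open>r\<close>, \<open>1/4\<close> from
    the length of the cells and \<open>1/4\<close> from \<open>cell_ge_square\<close> combine to
    \<open>1/32\<close>, which leaves the square of the wanted quantity at most
    \<open>\<delta>^2 / 2\<close>.\<close>
  then have e: "\<delta>^2 / 64 > 0" by simp
  obtain r1 where r1: "0 < r1" "\<And>r. r1 \<le> r ==> \<exists>k::real. \<forall>i m. r \<le> x i --> r * (\<Sum>j\<in>{i..<m}. cell k j) \<le> \<delta>^2 / 64"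
   by (rule half_line_necessary_sums[OF inf disc e]) blast
  obtain N where N: "\<forall>n\<ge>N. 2 * r1 + 4 * D \<le> x n" using eventually_x_ge by blast
  have "norm (x (Suc n) * (p - partial_sum n) - 0) < \<delta>" if n: "N \<le> n" for n
  proof -
   define y where "y = x (Suc n)"
   have y: "2 * r1 + 4 * D \<le> y" using N n unfolding y_def by (meson le_SucI)
   have y0: "0 < y" "r1 \<le> y / 2" "D \<le> y / 4" using y r1(1) D(1) by auto
   from r1(2)[OF y0(2)] obtain k where k: "\<forall>i m. y / 2 \<le> x i --> y / 2 * (\<Sum>j\<in>{i..<m}. cell k j) \<le> \<delta>^2 / 64" by blast
   have kp: "k = p" by (rule LIMSEQ_unique[OF partial_sum_tendsto_of_cells[OF _ k] lim]) (use y0 in simp)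
   define i where "i = (LEAST i. y / 2 \<le> x i)"
   have i: "y / 2 \<le> x i" unfolding i_def by (rule LeastI_ex) (rule x_unbounded)
   have "i \<noteq> 0" using i y0(1) x0 by (cases "i = 0") auto
   then obtain l where l: "i = Suc l" by (cases i) auto
   have "x l < y / 2" using not_less_Least[of l "%i. y / 2 \<le> x i"] l unfolding i_def[symmetric] by simp
   then have xi: "x i \<le> y / 2 + D" using D(2)[of l] l by (simp add: gap_def)
   have "x i < x (Suc n)" using xi y0 D(1) y r1(1) unfolding y_def by linarith
   then have im: "i \<le> Suc n" by simp
   let ?R = "p - partial_sum n"
   have "y / 4 * (?R^2 / 4) \<le> (x (Suc n) - x i) * (?R^2 / 4)"
    using xi y0(3) unfolding y_def[symmetric] by (intro mult_right_mono) auto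
   also have "... = (\<Sum>j\<in>{i..<Suc n}. gap x (Suc j) * ?R^2 / 4)" unfolding sum_gap[OF im, symmetric] sum_distrib_right by (simp only: times_divide_eq_right)
   also have "... \<le> (\<Sum>j\<in>{i..<Suc n}. cell k j)"
   proof (rule sum_mono)
    fix j assume j: "j \<in> {i..<Suc n}"
    have "?R^2 \<le> (k - partial_sum j)^2"
     by (rule power_mono) (use j partial_sum_mono[of j n] le_p[of n] kp in auto)
    then have "gap x (Suc j) * ?R^2 / 4 \<le> gap x (Suc j) * (k - partial_sum j)^2 / 4"
     by (intro divide_right_mono mult_left_mono gap_nonneg) simp_all
    then show "gap x (Suc j) * ?R^2 / 4 \<le> cell k j" by (rule order_trans[OF _ cell_ge_square])
   qed
   finally have "y / 2 * (y / 4 * (?R^2 / 4)) \<le> y / 2 * (\<Sum>j\<in>{i..<Suc n}. cell k j)" using y0(1) by (intro mult_left_mono) auto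
   also have "... \<le> \<delta>^2 / 64" using k i by blast
   finally have "(y * ?R)^2 \<le> \<delta>^2 / 2" by (simp add: power2_eq_square field_simps)
   also have "... < \<delta>^2" using d by simp
   finally have "y * ?R < \<delta>" by (rule power2_less_imp_less) (use d in simp)
   moreover have "0 \<le> y * ?R" using y0(1) le_p[of n] by simp
   ultimately show ?thesis unfolding y_def by simp
  qed
  then show "\<exists>N. \<forall>n\<ge>N. norm (x (Suc n) * (p - partial_sum n) - 0) < \<delta>" by blast
 qed
 then have "(%n. x (Suc n) * (\<Sum>j. (\<beta> (Suc n + j) + gap x (Suc n + j)))) \<longlonglongrightarrow> 0" by (simp only: rem)
 then show "(%n. x n * (\<Sum>j. (\<beta> (n + j) + gap x (n + j)))) \<longlonglongrightarrow> 0" by (rule LIMSEQ_imp_Suc)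
qed

end

section \<open>Necessity on bounded intervals\<close>

context
 fixes B :: real
 assumes bB: "b = ereal B" and sa: "Hamiltonian b x \<beta> = Hmax"
  and disc: "has_discrete_spectrum M Hmax"
  and nonneg: "\<And>n. 1 \<le> n ==> 0 \<le> \<beta> n + gap x n"
begin

text \<open>The test function \<open>g n\<close> has mean zero, since the range is orthogonal to the constants: a normalised bump
 near \<open>b\<close> is compensated on the first interval, and between the two \<open>volterra (g n)\<close> is affine in \<open>P\<close>.\<close>

theorem bounded_necessary:
 "(%n. (B - x n) * (\<Sum>j=1..n. (\<beta> j + gap x j))) \<longlonglongrightarrow> 0"
proof -
 interpret selfadjoint_graph M Hmax by (rule selfadjoint_graph_Hmax[OF sa])
 note I = Ivl_bounded[OF bB sa] and one = one_L2[OF bB sa]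
 have xB: "x n < B" for n using x_in_I[of n] by (simp add: I)
 define y where "y = x 1"
 have y: "0 < y" "y < B" "y \<in> I" using x_pos[of 1] xB[of 1] x_in_I[of 1] by (simp_all add: y_def)
 \<comment> \<open>\<open>[x n, B)\<close> is divided at its middle \<open>r n\<close> and at its
   three-quarter point \<open>r' n\<close>. The bump occupies \<open>[r n, r' n)\<close>;
   \<open>[x n, r n)\<close>, of length \<open>2 * \<rho> n\<close>, is kept free for the lower
   bound, and beyond \<open>r' n\<close> the function \<open>volterra (g n)\<close> is
   constant.\<close>
 define \<rho> where "\<rho> n = (B - x n) / 4" for n
 define r where "r n = (x n + B) / 2" for n
 define r' where "r' n = r n + \<rho> n" for n
 have \<rho>: "0 < \<rho> n" for n using xB by (simp add: \<rho>_def)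
 have rr: "x n < r n" "r n < r' n" "r' n < B" for n using xB[of n] by (simp_all add: r_def r'_def \<rho>_def field_simps)
 have r0: "0 < r n" for n using rr(1)[of n] x_nonneg[of n] by linarith
 have rI: "r n \<in> I" "r' n \<in> I" for n using rr[of n] r0[of n] by (simp_all add: I)
 define u where "u n = cut (r n) (r' n) (%_. 1 :: complex)" for n
 define w where "w = cut 0 y (%_. 1 :: complex)"
 have u: "u n \<in> L2 M" "nrm (u n) = sqrt (\<rho> n)" for n
  using window_L2[OF less_imp_le[OF r0] less_imp_le[OF rr(2)] rI(2), of n] by (simp_all add: u_def r'_def)
 have w: "w \<in> L2 M" "nrm w = sqrt y" using window_L2[OF order_refl less_imp_le[OF y(1)] y(3)] by (simp_all add: w_def)
 define p where "p n = complex_of_real (1 / sqrt (\<rho> n))" for n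
 \<comment> \<open>Determined by \<open>p n * \<rho> n + q n * y = 0\<close>. It tends to zero, so
   the compensation is negligible in the limit.\<close>
 define q where "q n = complex_of_real (- (sqrt (\<rho> n) / y))" for n
 define g where "g n = (%t. p n * u n t + q n * w t)" for n
 have g: "g n \<in> L2 M" for n unfolding g_def by (intro L2_add L2_cmult u w)
 have cq: "cmod (q n) = sqrt (\<rho> n) / y" for n using \<rho>[of n] y(1) by (simp only: q_def norm_of_real) simp
 have pu: "prim b (u n) t = 0" if "t \<le> r n" for n t
 proof -
  have "cut 0 t (u n) = (%_. 0)" by (rule ext) (use that in "auto simp: cut_def u_def")
  then show ?thesis by (simp add: prim_def)
 qed
 have vu: "volterra (u n) t = 0" if "t \<le> r n" for n t
 proof -
  have "cut 0 t (weighted (u n)) = (%_. 0)" by (rule ext) (use that in "auto simp: cut_def u_def weighted_def")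
  then show ?thesis using pu[OF that] by (simp add: prim_def volterra_def)
 qed
 have pu': "prim b (u n) (r' n) = of_real (\<rho> n)" for n
 proof -
  have "prim b (u n) (r' n) - prim b (u n) (r n) = (LINT s|M. cut (r n) (r' n) (u n) s)"
   by (rule prim_diff[OF u(1) less_imp_le[OF r0] less_imp_le[OF rr(2)] rI(2)])
  also have "... = ip (u n) (u n)" unfolding u_def inner_window ..
  also have "... = of_real (\<rho> n)" using \<rho>[of n] by (simp add: L2_inner_self u)
  finally show ?thesis using pu[of "r n" n] by simp
 qed
 have pw: "prim b w t = of_real y" if "y \<le> t" for t
  unfolding w_def prim_cut_ge[OF that] prim_const[OF y(3)] by simp
 define m where "m = prim b (weighted (%_. 1)) y"
 have vw: "volterra w t = of_real (P t) * of_real y - m" if "y \<le> t" for t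
  unfolding volterra_def pw[OF that] by (simp add: w_def weighted_cut prim_cut_ge[OF that] m_def)
 define v where "v = nrm (cut 0 y (volterra w))"
 have yr: "y \<le> r n" if "1 \<le> n" for n
 proof -
  have "y \<le> x n" unfolding y_def using that by (simp only: x_le_iff)
  then show ?thesis using rr(1)[of n] by linarith
 qed
 have vg: "volterra (g n) t = p n * volterra (u n) t + q n * volterra w t" if "t \<in> I" for n t
  unfolding g_def by (rule volterra_lincomb[OF u(1) w(1) that])
 have gz: "prim b (g n) (r' n) = 0" if "1 \<le> n" for n
 proof -
  have yr': "y \<le> r' n" using yr[OF that] rr(2)[of n] by linarith
  have "p n * of_real (\<rho> n) = of_real (sqrt (\<rho> n))" unfolding p_def of_real_mult[symmetric] using \<rho>[of n] by (simp add: real_div_sqrt)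
  moreover have "q n * of_real y = - of_real (sqrt (\<rho> n))" unfolding q_def of_real_mult[symmetric] using y(1) by simp
  ultimately show ?thesis unfolding g_def prim_lincomb[OF u(1) w(1) rI(2)] pu' pw[OF yr'] by simp
 qed
 have gcut: "g n = cut 0 (r' n) (g n)" if "1 \<le> n" for n
 proof
  fix t
  have "y \<le> r' n" using yr[OF that] rr(2)[of n] by linarith
  then show "g n t = cut 0 (r' n) (g n) t" using r0[of n] by (auto simp: g_def cut_def u_def w_def)
 qed
 have VL: "volterra (g n) \<in> L2 M" if n: "1 \<le> n" for n
 proof -
  define z where "z = volterra (g n) (r' n)"
  have "(%t. cut 0 (r' n) (volterra (g n)) t + z * tail (r' n) (%_. 1) t) \<in> L2 M"
   by (intro L2_add L2_cmult volterra_cut_L2 g rI tail_L2 one)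
  then show ?thesis
  proof (rule L2_cong_AE[OF _ volterra_measurable[OF g] AE_I2])
   fix t assume "t \<in> space M"
   then have t: "0 \<le> t" by (simp add: I)
   show "cut 0 (r' n) (volterra (g n)) t + z * tail (r' n) (%_. 1) t = volterra (g n) t"
   proof (cases "r' n \<le> t")
    case True
    from volterra_beyond(2)[OF gcut[OF n] gz[OF n] True] show ?thesis using True by (simp add: cut_def tail_def z_def)
   next
    case False
    then show ?thesis using t by (simp add: cut_def tail_def)
   qed
  qed
 qed
 define N1 where "N1 = ip (%_. 1) (%_. 1)"
 have N1: "N1 \<noteq> 0"
 proof
  assume "N1 = 0"
  then have "nrm (%_. 1) = 0" unfolding N1_def L2_inner_self by simp
  moreover have "sqrt y \<le> nrm (%_. 1)" using L2_norm_cut_le[OF one, of 0 y] w(2) by (simp add: w_def)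
  ultimately show False using y(1) by simp
 qed
 \<comment> \<open>The mean of \<open>volterra (g n)\<close>; this choice makes \<open>f n\<close>
   orthogonal to the constants, that is to the kernel, as the compactness estimate requires.\<close>
 define c where "c n = ip (volterra (g n)) (%_. 1) / N1" for n
 define f where "f n = (%t. c n * 1 - volterra (g n) t)" for n
 have f: "f n \<in> L2 M" if "1 \<le> n" for n unfolding f_def by (intro L2_diff L2_cmult one VL that)
 have fg: "(f n, g n) \<in> Hmax" if "1 \<le> n" for n
  by (rule HmaxI[where c="c n", OF f[OF that] g]) (simp add: f_def)
 have orth: "ip (f n) e = 0" if n: "1 \<le> n" and e: "(e, %_. 0) \<in> Hmax" for n e
 proof -
  obtain a where eL: "e \<in> L2 M" and "AE t in M. e t = a - volterra (%_. 0) t" using e by (rule HmaxE)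
  then have "AE t in M. e t = a * 1" by (simp add: volterra_zero[OF bB sa])
  then have "ip (f n) e = ip (f n) (%t. a * 1)"
   by (intro L2_inner_cong_AE(2)) (use L2_measurable[OF eL] L2_measurable[OF f[OF n]] in auto)
  also have "... = cnj a * ip (f n) (%_. 1)" by (rule L2_inner_cmult_right)
  also have "ip (f n) (%_. 1) = c n * N1 - ip (volterra (g n)) (%_. 1)"
   unfolding f_def N1_def by (simp only: L2_inner_diff_left[OF L2_cmult[OF one] VL[OF n] one] L2_inner_cmult_left)
  also have "... = 0" using N1 by (simp add: c_def)
  finally show ?thesis by simp
 qed
 have \<rho>0: "(%n. sqrt (\<rho> n)) \<longlonglongrightarrow> 0"
 proof -
  have "x \<longlonglongrightarrow> B" using x_lim bB by simp
  then have "(%n. sqrt ((B - x n) / 4)) \<longlonglongrightarrow> sqrt ((B - B) / 4)" by (intro tendsto_intros) simp_all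
  then show ?thesis by (simp add: \<rho>_def)
 qed
 have weak: "(%n. cmod (ip (g n) e)) \<longlonglongrightarrow> 0" if e: "e \<in> L2 M" for e
 proof (rule tendsto_sandwich[OF always_eventually always_eventually tendsto_const])
  show "\<forall>n. 0 \<le> cmod (ip (g n) e)" by simp
  show "\<forall>n. cmod (ip (g n) e) \<le> nrm (tail (x n) e) + (sqrt (\<rho> n) / y) * (sqrt y * nrm e)"
  proof
   fix n
   have "ip (u n) e = ip (u n) (tail (x n) e)"
    unfolding L2_inner_def using rr(1)[of n] by (intro Bochner_Integration.integral_cong) (auto simp: u_def cut_def tail_def)
   then have "cmod (ip (u n) e) \<le> sqrt (\<rho> n) * nrm (tail (x n) e)"
    using L2_Cauchy_Schwarz[OF u(1) tail_L2[OF e], of n "x n"] u(2)[of n] by simp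
   then have "cmod (p n) * cmod (ip (u n) e) \<le> (1 / sqrt (\<rho> n)) * (sqrt (\<rho> n) * nrm (tail (x n) e))"
    using \<rho>[of n] by (intro mult_mono) (simp_all add: p_def norm_divide)
   then have 1: "cmod (p n) * cmod (ip (u n) e) \<le> nrm (tail (x n) e)" using \<rho>[of n] by simp
   have 2: "cmod (q n) * cmod (ip w e) \<le> (sqrt (\<rho> n) / y) * (sqrt y * nrm e)"
    unfolding cq using L2_Cauchy_Schwarz[OF w(1) e] w(2) \<rho>[of n] y(1) by (intro mult_left_mono) auto
   have "ip (g n) e = p n * ip (u n) e + q n * ip w e"
    unfolding g_def L2_inner_add_left[OF L2_cmult[OF u(1)] L2_cmult[OF w(1)] e] L2_inner_cmult_left ..
   then have "cmod (ip (g n) e) \<le> cmod (p n) * cmod (ip (u n) e) + cmod (q n) * cmod (ip w e)"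
    by (simp only: norm_mult[symmetric] norm_triangle_ineq)
   then show "cmod (ip (g n) e) \<le> nrm (tail (x n) e) + (sqrt (\<rho> n) / y) * (sqrt y * nrm e)" using 1 2 by linarith
  qed
  have "(%n. nrm (tail (x n) e) + (sqrt (\<rho> n) / y) * (sqrt y * nrm e)) \<longlonglongrightarrow> 0 + (0 / y) * (sqrt y * nrm e)"
   by (intro tendsto_intros tail_x_tendsto[OF e] \<rho>0) (use y in simp)
  then show "(%n. nrm (tail (x n) e) + (sqrt (\<rho> n) / y) * (sqrt y * nrm e)) \<longlonglongrightarrow> 0" by simp
 qed
 have gnorm: "nrm (g n) \<le> 1 + sqrt (\<rho> n) / y * sqrt y" for n
 proof -
  have "nrm (g n) \<le> nrm (%t. p n * u n t) + nrm (%t. q n * w t)"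
   unfolding g_def by (rule L2_norm_triangle[OF L2_cmult[OF u(1)] L2_cmult[OF w(1)]])
  also have "... = 1 + sqrt (\<rho> n) / y * sqrt y"
   unfolding L2_norm_cmult u(2) w(2) cq using \<rho>[of n] by (simp add: p_def norm_divide)
  finally show ?thesis .
 qed
 have f0: "(%n. nrm (f n)) \<longlonglongrightarrow> 0"
 proof (rule LIMSEQ_I)
  fix \<epsilon> :: real assume e: "0 < \<epsilon>"
  then have e3: "\<epsilon> / 4 > 0" by simp
  from discrete_spectrum_bound[OF disc e3] obtain E K where E: "finite E" "E \<subseteq> L2 M"
   and bound: "\<forall>f g. (f, g) \<in> Hmax --> (\<forall>e. (e, %_. 0) \<in> Hmax --> ip f e = 0) -->
    nrm f \<le> \<epsilon> / 4 * nrm g + K * (\<Sum>e\<in>E. cmod (ip g e))"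
   by (elim exE conjE)
  have "(%n. \<epsilon> / 4 * (1 + sqrt (\<rho> n) / y * sqrt y) + K * (\<Sum>e\<in>E. cmod (ip (g n) e))) \<longlonglongrightarrow> \<epsilon> / 4 * (1 + 0 / y * sqrt y) + K * (\<Sum>e\<in>E. 0)"
   by (intro tendsto_add tendsto_mult tendsto_const tendsto_sum weak \<rho>0 tendsto_divide) (use E y in auto)
  then have "\<forall>\<^sub>F n in sequentially. \<epsilon> / 4 * (1 + sqrt (\<rho> n) / y * sqrt y) + K * (\<Sum>e\<in>E. cmod (ip (g n) e)) < \<epsilon>"
   by (rule order_tendstoD(2)) (use e in simp)
  then obtain N where N: "\<And>n. N \<le> n ==> \<epsilon> / 4 * (1 + sqrt (\<rho> n) / y * sqrt y) + K * (\<Sum>e\<in>E. cmod (ip (g n) e)) < \<epsilon>"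
   by (auto simp: eventually_sequentially)
  have "norm (nrm (f n) - 0) < \<epsilon>" if n: "max N 1 \<le> n" for n
  proof -
   have n': "N \<le> n" "1 \<le> n" using n by auto
   have "nrm (f n) \<le> \<epsilon> / 4 * nrm (g n) + K * (\<Sum>e\<in>E. cmod (ip (g n) e))"
    using bound fg[OF n'(2)] orth[OF n'(2)] by blast
   also have "\<epsilon> / 4 * nrm (g n) \<le> \<epsilon> / 4 * (1 + sqrt (\<rho> n) / y * sqrt y)" using e by (intro mult_left_mono gnorm) simp
   finally show ?thesis using N[OF n'(1)] by simp
  qed
  then show "\<exists>N. \<forall>n\<ge>N. norm (nrm (f n) - 0) < \<epsilon>" by blast
 qed
 \<comment> \<open>On \<open>[0, y)\<close> the bump is not yet seen, so \<open>c n\<close> is there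
   the sum of \<open>f n\<close> and \<open>q n\<close> times a fixed function. Both tend to zero in
   norm, and with them \<open>c n\<close>.\<close>
 have cle: "cmod (c n) * sqrt y \<le> nrm (f n) + sqrt (\<rho> n) / y * v" if n: "1 \<le> n" for n
 proof -
  have "nrm (%t. c n * w t) = nrm (%t. cut 0 y (f n) t + q n * cut 0 y (volterra w) t)"
   unfolding L2_norm_def
  proof (rule arg_cong[where f=sqrt], rule Bochner_Integration.integral_cong[OF refl])
   fix t assume "t \<in> space M"
   then have t: "t \<in> I" by simp
   have "f n t = c n - q n * volterra w t" if "t < y"
    unfolding f_def vg[OF t] using vu[of t n] yr[OF n] that by simp
   then have "c n * w t = cut 0 y (f n) t + q n * cut 0 y (volterra w) t" by (simp add: w_def cut_def)
   then show "(cmod (c n * w t))^2 = (cmod (cut 0 y (f n) t + q n * cut 0 y (volterra w) t))^2" by (rule arg_cong)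
  qed
  also have "... \<le> nrm (cut 0 y (f n)) + nrm (%t. q n * cut 0 y (volterra w) t)"
   by (rule L2_norm_triangle[OF cut_L2[OF f[OF n]] L2_cmult[OF volterra_cut_L2[OF w(1) y(3)]]])
  also have "... \<le> nrm (f n) + sqrt (\<rho> n) / y * v"
   unfolding L2_norm_cmult cq v_def by (intro add_right_mono L2_norm_cut_le f n)
  finally show ?thesis unfolding L2_norm_cmult w(2) .
 qed
 let ?W = "nrm (%_. 1 :: complex)"
 define bnd where "bnd n = nrm (f n) + ((nrm (f n) + sqrt (\<rho> n) / y * v) / sqrt y + sqrt (\<rho> n) / y * cmod m) * ?W" for n
 \<comment> \<open>On \<open>[x n, r n)\<close> the compensation is complete and the bump has not
   begun, so \<open>f n\<close> minus a constant is \<open>sqrt (\<rho> n)\<close> times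
   \<open>P\<close>. Further nodes may lie in this window, but there \<open>P\<close> is still at
   least \<open>partial_sum n\<close>. The norm over the window yields
   \<open>\<rho> n * partial_sum n\<close>, a quarter of the wanted quantity.\<close>
 have main: "(B - x n) * partial_sum n \<le> 4 * bnd n" if n: "1 \<le> n" for n
 proof -
  have S: "0 \<le> partial_sum n" by (rule sum_nonneg) (use nonneg in auto)
  let ?k = "c n + q n * m"
  let ?z = "cut (x n) (r n) (%_. 1) :: real \<Rightarrow> complex"
  have z: "?z \<in> L2 M" "nrm ?z = sqrt (r n - x n)"
   using window_L2[OF x_nonneg less_imp_le[OF rr(1)] rI(1)] by simp_all
  have yx: "y \<le> x n" unfolding y_def using n by (simp only: x_le_iff)
  have "nrm (%t. of_real (sqrt (\<rho> n) * partial_sum n) * ?z t) \<le> nrm (%t. f n t - ?k * 1)"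
  proof (rule L2_norm_mono_AE[OF L2_cmult[OF z(1)] L2_diff[OF f[OF n] L2_cmult[OF one]] AE_I2])
   fix t assume "t \<in> space M"
   then have t: "t \<in> I" by simp
   show "cmod (of_real (sqrt (\<rho> n) * partial_sum n) * ?z t) \<le> cmod (f n t - ?k * 1)"
   proof (cases "x n \<le> t \<and> t < r n")
    case True
    then have "y \<le> t" using yx by linarith
    have "f n t - ?k * 1 = - q n * of_real y * of_real (P t)"
     unfolding f_def vg[OF t] vw[OF \<open>y \<le> t\<close>] using vu[of t n] True by (simp add: algebra_simps)
    also have "- q n * of_real y = of_real (sqrt (\<rho> n))" unfolding q_def using y(1) by simp
    finally have 1: "cmod (f n t - ?k * 1) = sqrt (\<rho> n) * \<bar>P t\<bar>" using \<rho>[of n] by (simp add: norm_mult)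
    obtain l where l: "x l \<le> t" "t < x (Suc l)" using t by (rule interval_obtain)
    have "x n < x (Suc l)" using True l(2) by linarith
    then have nl: "n \<le> l" by (simp only: x_less_iff less_Suc_eq_le)
    have "partial_sum n \<le> partial_sum l" by (rule sum_mono2) (use nl nonneg in auto)
    then have "partial_sum n \<le> \<bar>P t\<bar>" unfolding P_eq_partial_sum[OF l] using l(1) by linarith
    then have "sqrt (\<rho> n) * partial_sum n \<le> sqrt (\<rho> n) * \<bar>P t\<bar>" using \<rho>[of n] by (intro mult_left_mono) auto
    moreover have "cmod (of_real (sqrt (\<rho> n) * partial_sum n) * ?z t) = sqrt (\<rho> n) * partial_sum n"
    proof -
     have "?z t = 1" using True by (simp add: cut_def)
     moreover have "0 \<le> sqrt (\<rho> n) * partial_sum n" using S \<rho>[of n] by (intro mult_nonneg_nonneg) auto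
     ultimately show ?thesis by (simp only: mult_1_right norm_of_real abs_of_nonneg)
    qed
    ultimately show ?thesis unfolding 1 by linarith
   next
    case False
    then have "?z t = 0" by (auto simp: cut_def)
    then show ?thesis by (simp only: mult_zero_right norm_zero norm_ge_zero)
   qed
  qed
  also have "... \<le> nrm (f n) + nrm (%t. ?k * 1)" by (rule L2_norm_triangle_diff[OF f[OF n] L2_cmult[OF one]])
  also have "nrm (%t. ?k * 1) = cmod ?k * ?W" by (rule L2_norm_cmult)
  also have "nrm (f n) + cmod ?k * ?W \<le> bnd n"
  proof -
   have "cmod (c n) \<le> (nrm (f n) + sqrt (\<rho> n) / y * v) / sqrt y" using cle[OF n] y(1) by (simp only: pos_le_divide_eq real_sqrt_gt_0_iff)
   then have "cmod ?k \<le> (nrm (f n) + sqrt (\<rho> n) / y * v) / sqrt y + sqrt (\<rho> n) / y * cmod m"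
    using norm_triangle_ineq[of "c n" "q n * m"] by (simp only: norm_mult cq)
   then show ?thesis unfolding bnd_def by (intro add_left_mono mult_right_mono) simp_all
  qed
  finally have "sqrt (\<rho> n) * partial_sum n * sqrt (r n - x n) \<le> bnd n"
   unfolding L2_norm_cmult z(2) norm_of_real by (simp only: abs_of_nonneg[OF mult_nonneg_nonneg[OF real_sqrt_ge_zero[OF less_imp_le[OF \<rho>[of n]]] S]])
  moreover have "sqrt (\<rho> n) * partial_sum n * sqrt (\<rho> n) \<le> sqrt (\<rho> n) * partial_sum n * sqrt (r n - x n)"
   using S \<rho>[of n] xB[of n] by (intro mult_left_mono mult_nonneg_nonneg) (auto simp: r_def \<rho>_def field_simps)
  moreover have "sqrt (\<rho> n) * partial_sum n * sqrt (\<rho> n) = \<rho> n * partial_sum n" using \<rho>[of n] by (simp add: mult.commute mult.left_commute)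
  ultimately have "\<rho> n * partial_sum n \<le> bnd n" by linarith
  moreover have "(B - x n) * partial_sum n = 4 * (\<rho> n * partial_sum n)" unfolding \<rho>_def by simp
  ultimately show ?thesis by linarith
 qed
 have "(%n. 4 * bnd n) \<longlonglongrightarrow> 4 * (0 + ((0 + 0 / y * v) / sqrt y + 0 / y * cmod m) * ?W)"
  unfolding bnd_def by (intro tendsto_intros f0 \<rho>0) (use y in auto)
 then have lim0: "(%n. 4 * bnd n) \<longlonglongrightarrow> 0" by simp
 show ?thesis
 proof (rule tendsto_sandwich[OF _ _ tendsto_const lim0])
  show "\<forall>\<^sub>F n in sequentially. 0 \<le> (B - x n) * partial_sum n"
   by (rule always_eventually, intro allI mult_nonneg_nonneg sum_nonneg) (use xB nonneg in "auto simp: less_imp_le")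
  show "\<forall>\<^sub>F n in sequentially. (B - x n) * partial_sum n \<le> 4 * bnd n"
   by (rule eventually_sequentiallyI[of 1]) (rule main)
 qed
qed

end

end

text \<open>Summability is required separately because \<open>suminf\<close> has a value for
  divergent series too. Index 0 is harmless: \<open>gap x 0 = 0\<close>, and
  \<open>\<beta> 0\<close> enters only the term with \<open>n = 0\<close>, which carries the factor
  \<open>x 0 = 0\<close>, and does not affect summability.\<close>

theorem proposition6p11:
  fixes b :: ereal and x \<beta> :: "nat \<Rightarrow> real"
  assumes "0 < b"
    and "x 0 = 0"
    and "strict_mono x"
    and "\<forall>n. ereal (x n) < b"
    and "(\<lambda>n. ereal (x n)) \<longlonglongrightarrow> b"
    and "bdd_above (gap x ` {1..})"
    and "\<forall>n\<ge>1. \<beta> n \<noteq> 0"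
    and "\<forall>n\<ge>1. \<beta> n + gap x n \<ge> 0"
  shows "(b < \<infinity> \<and> self_adjoint (Ivl_measure b) (Hamiltonian b x \<beta>) \<longrightarrow>
            (has_discrete_spectrum (Ivl_measure b) (Hamiltonian b x \<beta>) \<longleftrightarrow>
              (\<lambda>n. (real_of_ereal b - x n) * (\<Sum>j=1..n. (\<beta> j + gap x j))) \<longlonglongrightarrow> 0)) \<and>
         (b = \<infinity> \<longrightarrow>
            self_adjoint (Ivl_measure b) (Hamiltonian b x \<beta>) \<and>
            (has_discrete_spectrum (Ivl_measure b) (Hamiltonian b x \<beta>) \<longleftrightarrow>
              (summable (\<lambda>j. gap x j ^ 3) \<and>
               (\<lambda>n. x n * (\<Sum>j. gap x (n + j) ^ 3)) \<longlonglongrightarrow> 0) \<and>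
              (summable (\<lambda>j. \<beta> j + gap x j) \<and>
               (\<lambda>n. x n * (\<Sum>j. (\<beta> (n + j) + gap x (n + j)))) \<longlonglongrightarrow> 0)))"
proof -
 interpret delta_chain b x \<beta> by unfold_locales (use assms in auto)
 have nonneg: "0 \<le> \<beta> n + gap x n" if "1 \<le> n" for n using assms(8) that by blast
 show ?thesis
 proof (intro conjI impI)
  assume *: "b < \<infinity> \<and> self_adjoint M (Hamiltonian b x \<beta>)"
  obtain B where bB: "b = ereal B" using * assms(1) by (cases b) auto
  \<comment> \<open>The adjoint of the Hamiltonian is always \<open>Hmax\<close>, so
    self-adjointness is this equality of graphs.\<close>
  have sa: "Hamiltonian b x \<beta> = Hmax" using * adjoint_Hamiltonian unfolding self_adjoint_def by blast
  have B: "real_of_ereal b = B" using bB by simp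
  show "has_discrete_spectrum M (Hamiltonian b x \<beta>) \<longleftrightarrow>
   (%n. (real_of_ereal b - x n) * (\<Sum>j=1..n. (\<beta> j + gap x j))) \<longlonglongrightarrow> 0"
   unfolding sa B
  proof
   assume "has_discrete_spectrum M Hmax"
   then show "(%n. (B - x n) * (\<Sum>j=1..n. (\<beta> j + gap x j))) \<longlonglongrightarrow> 0"
    by (rule bounded_necessary[OF bB sa _ nonneg])
  next
   assume "(%n. (B - x n) * (\<Sum>j=1..n. (\<beta> j + gap x j))) \<longlonglongrightarrow> 0"
   then show "has_discrete_spectrum M Hmax" by (rule discrete_spectrum_bounded[OF bB sa])
  qed
 next
  assume inf: "b = \<infinity>"
  show "self_adjoint M (Hamiltonian b x \<beta>)" by (rule Hamiltonian_selfadjoint(2)[OF inf])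
  show "has_discrete_spectrum M (Hamiltonian b x \<beta>) \<longleftrightarrow>
   (summable (%j. gap x j ^ 3) \<and> (%n. x n * (\<Sum>j. gap x (n + j) ^ 3)) \<longlonglongrightarrow> 0) \<and>
   (summable (%j. \<beta> j + gap x j) \<and> (%n. x n * (\<Sum>j. (\<beta> (n + j) + gap x (n + j)))) \<longlonglongrightarrow> 0)"
   unfolding Hamiltonian_selfadjoint(1)[OF inf]
  proof (intro iffI conjI)
   assume disc: "has_discrete_spectrum M Hmax"
   note cubes = cubes_tendsto[OF inf disc nonneg assms(6)] and rems = remainders_tendsto[OF inf disc nonneg assms(6)]
   show "summable (%j. gap x j ^ 3)" by (rule cubes(1))
   show "(%n. x n * (\<Sum>j. gap x (n + j) ^ 3)) \<longlonglongrightarrow> 0" by (rule cubes(2))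
   show "summable (%j. \<beta> j + gap x j)" by (rule rems(1))
   show "(%n. x n * (\<Sum>j. (\<beta> (n + j) + gap x (n + j)))) \<longlonglongrightarrow> 0" by (rule rems(2))
  next
   assume "(summable (%j. gap x j ^ 3) \<and> (%n. x n * (\<Sum>j. gap x (n + j) ^ 3)) \<longlonglongrightarrow> 0) \<and>
    (summable (%j. \<beta> j + gap x j) \<and> (%n. x n * (\<Sum>j. (\<beta> (n + j) + gap x (n + j)))) \<longlonglongrightarrow> 0)"
   then show "has_discrete_spectrum M Hmax"
    by (elim conjE) (rule discrete_spectrum_half_line[OF inf _ _ _ _ nonneg])
  qed
 qed
qed

end
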